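(* There exists a finitely generated torsion lacunary hyperbolic group $G$ such that one of the asymptotic cones of $G$ does not have cut points.
   Context: For a finitely generated group $G$ with the word metric of a finite generating set, a non-principal ultrafilter $\omega$ on $\mathbb N$ and an unbounded non-decreasing sequence $d=(d_n)$ of positive reals, the asymptotic cone $\mathrm{Con}^\omega(G,d)$ is the set of sequences $(g_n)$ in $G$ with $\mathrm{dist}(1,g_n)/d_n$ bounded, modulo $\lim^\omega \mathrm{dist}(g_n,h_n)/d_n=0$, with metric $\lim^\omega \mathrm{dist}(g_n,h_n)/d_n$. $G$ is lacunary hyperbolic if at least one of its asymptotic cones is an $\mathbb R$-tree. A cut point is a point whose removal disconnects the space. *)

theory Defs
  imports "HOL-Analysis.Analysis" "HOL-Algebra.Generated_Groups"
begin

section \<open>Word metrics\<close>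

definition generating_set :: "('a, 'b) monoid_scheme \<Rightarrow> 'a set \<Rightarrow> bool" where
  "generating_set G S \<longleftrightarrow> S \<subseteq> carrier G \<and> generate G S = carrier G"

definition torsion_group :: "('a, 'b) monoid_scheme \<Rightarrow> bool" where
  "torsion_group G \<longleftrightarrow> group G \<and> (\<forall>x\<in>carrier G. \<exists>n::nat. n > 0 \<and> x [^]\<^bsub>G\<^esub> n = \<one>\<^bsub>G\<^esub>)"

definition represents :: "('a, 'b) monoid_scheme \<Rightarrow> 'a set \<Rightarrow> 'a list \<Rightarrow> 'a \<Rightarrow> bool" where
  "represents G S w g \<longleftrightarrow>
     set w \<subseteq> S \<union> (\<lambda>s. inv\<^bsub>G\<^esub> s) ` S \<and> foldr (\<lambda>x y. x \<otimes>\<^bsub>G\<^esub> y) w \<one>\<^bsub>G\<^esub> = g"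

definition word_length :: "('a, 'b) monoid_scheme \<Rightarrow> 'a set \<Rightarrow> 'a \<Rightarrow> nat" where
  "word_length G S g = (LEAST n. \<exists>w. length w = n \<and> represents G S w g)"

definition word_dist :: "('a, 'b) monoid_scheme \<Rightarrow> 'a set \<Rightarrow> 'a \<Rightarrow> 'a \<Rightarrow> real" where
  "word_dist G S g h = real (word_length G S (inv\<^bsub>G\<^esub> g \<otimes>\<^bsub>G\<^esub> h))"


section \<open>Asymptotic cones\<close>

text \<open>An ultrafilter on the natural numbers is a value of type \<^typ>\<open>nat filter\<close>: its members are
  the sets \<open>{n. P n}\<close> with \<open>eventually P \<omega>\<close>, so that \<open>(f \<longlongrightarrow> l) \<omega>\<close> is the limit along it.\<close>

definition nonprincipal_ultrafilter :: "nat filter \<Rightarrow> bool" where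
  "nonprincipal_ultrafilter \<omega> \<longleftrightarrow>
     \<omega> \<noteq> bot \<and>
     (\<forall>P. eventually P \<omega> \<or> eventually (\<lambda>n. \<not> P n) \<omega>) \<and>
     (\<forall>k. \<not> eventually (\<lambda>n. n = k) \<omega>)"

definition scaling_sequence :: "(nat \<Rightarrow> real) \<Rightarrow> bool" where
  "scaling_sequence d \<longleftrightarrow> (\<forall>n. 0 < d n) \<and> mono d \<and> \<not> bdd_above (range d)"

definition cone_sequences ::
    "('a, 'b) monoid_scheme \<Rightarrow> 'a set \<Rightarrow> (nat \<Rightarrow> real) \<Rightarrow> (nat \<Rightarrow> 'a) set" where
  "cone_sequences G S d =
     {g. (\<forall>n. g n \<in> carrier G) \<and> bdd_above (range (\<lambda>n. word_dist G S \<one>\<^bsub>G\<^esub> (g n) / d n))}"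

definition cone_rel ::
    "nat filter \<Rightarrow> ('a, 'b) monoid_scheme \<Rightarrow> 'a set \<Rightarrow> (nat \<Rightarrow> real) \<Rightarrow>
       ((nat \<Rightarrow> 'a) \<times> (nat \<Rightarrow> 'a)) set" where
  "cone_rel \<omega> G S d =
     {(g, h). g \<in> cone_sequences G S d \<and> h \<in> cone_sequences G S d \<and>
              ((\<lambda>n. word_dist G S (g n) (h n) / d n) \<longlongrightarrow> 0) \<omega>}"

definition cone_points ::
    "nat filter \<Rightarrow> ('a, 'b) monoid_scheme \<Rightarrow> 'a set \<Rightarrow> (nat \<Rightarrow> real) \<Rightarrow> (nat \<Rightarrow> 'a) set set" where
  "cone_points \<omega> G S d = cone_sequences G S d // cone_rel \<omega> G S d"

text \<open>The limit does not depend on the representatives (lemma \<open>cone_dist_class\<close>).  The value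
  outside the set of points is irrelevant, but \<^locale>\<open>Metric_space\<close> wants it to be
  nonnegative and symmetric.\<close>

definition cone_dist ::
    "nat filter \<Rightarrow> ('a, 'b) monoid_scheme \<Rightarrow> 'a set \<Rightarrow> (nat \<Rightarrow> real) \<Rightarrow>
       (nat \<Rightarrow> 'a) set \<Rightarrow> (nat \<Rightarrow> 'a) set \<Rightarrow> real" where
  "cone_dist \<omega> G S d A B =
     (if A \<in> cone_points \<omega> G S d \<and> B \<in> cone_points \<omega> G S d
      then Lim \<omega> (\<lambda>n. word_dist G S ((SOME g. g \<in> A) n) ((SOME h. h \<in> B) n) / d n)
      else 0)"

definition asymptotic_cone ::
    "nat filter \<Rightarrow> ('a, 'b) monoid_scheme \<Rightarrow> 'a set \<Rightarrow> (nat \<Rightarrow> real) \<Rightarrow> (nat \<Rightarrow> 'a) set metric" where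
  "asymptotic_cone \<omega> G S d = metric (cone_points \<omega> G S d, cone_dist \<omega> G S d)"

definition is_asymptotic_cone_of ::
    "(nat \<Rightarrow> 'a) set metric \<Rightarrow> ('a, 'b) monoid_scheme \<Rightarrow> 'a set \<Rightarrow> bool" where
  "is_asymptotic_cone_of X G S \<longleftrightarrow>
     (\<exists>\<omega> d. nonprincipal_ultrafilter \<omega> \<and> scaling_sequence d \<and> X = asymptotic_cone \<omega> G S d)"


section \<open>Real trees and cut points\<close>

definition geodesic_space :: "'a metric \<Rightarrow> bool" where
  "geodesic_space X \<longleftrightarrow>
     (\<forall>x\<in>mspace X. \<forall>y\<in>mspace X. \<exists>c.
        c \<in> {0..mdist X x y} \<rightarrow> mspace X \<and> c 0 = x \<and> c (mdist X x y) = y \<and>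
        (\<forall>s\<in>{0..mdist X x y}. \<forall>t\<in>{0..mdist X x y}. mdist X (c s) (c t) = \<bar>s - t\<bar>))"

definition arc_between :: "'a topology \<Rightarrow> 'a \<Rightarrow> 'a \<Rightarrow> 'a set \<Rightarrow> bool" where
  "arc_between T x y A \<longleftrightarrow>
     (\<exists>g. embedding_map (top_of_set {0..1::real}) T g \<and> g 0 = x \<and> g 1 = y \<and> A = g ` {0..1})"

definition real_tree :: "'a metric \<Rightarrow> bool" where
  "real_tree X \<longleftrightarrow>
     geodesic_space X \<and>
     (\<forall>x\<in>mspace X. \<forall>y\<in>mspace X. x \<noteq> y \<longrightarrow> (\<exists>!A. arc_between (mtopology_of X) x y A))"

text \<open>Here \<^const>\<open>connected_space\<close> counts the empty space as connected, so a one-point space has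
  no cut point.\<close>

definition cut_point :: "'a topology \<Rightarrow> 'a \<Rightarrow> bool" where
  "cut_point T p \<longleftrightarrow> p \<in> topspace T \<and> \<not> connected_space (subtopology T (topspace T - {p}))"

definition lacunary_hyperbolic :: "('a, 'b) monoid_scheme \<Rightarrow> 'a set \<Rightarrow> bool" where
  "lacunary_hyperbolic G S \<longleftrightarrow>
     group G \<and> finite S \<and> generating_set G S \<and> (\<exists>X. is_asymptotic_cone_of X G S \<and> real_tree X)"


section \<open>The asymptotic cone is a metric space\<close>

lemma foldr_mult_append:
  assumes "group G" "set u \<subseteq> carrier G" "set v \<subseteq> carrier G"
  shows "foldr (\<lambda>x y. x \<otimes>\<^bsub>G\<^esub> y) u \<one>\<^bsub>G\<^esub> \<in> carrier G \<and>
         foldr (\<lambda>x y. x \<otimes>\<^bsub>G\<^esub> y) (u @ v) \<one>\<^bsub>G\<^esub> =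
         foldr (\<lambda>x y. x \<otimes>\<^bsub>G\<^esub> y) u \<one>\<^bsub>G\<^esub> \<otimes>\<^bsub>G\<^esub> foldr (\<lambda>x y. x \<otimes>\<^bsub>G\<^esub> y) v \<one>\<^bsub>G\<^esub>"
proof -
  interpret group G by fact
  have cl: "foldr (\<lambda>x y. x \<otimes>\<^bsub>G\<^esub> y) w \<one>\<^bsub>G\<^esub> \<in> carrier G" if "set w \<subseteq> carrier G" for w
    using that by (induction w) auto
  show ?thesis using assms(2)
    by (induction u) (auto simp: cl assms(3) m_assoc)
qed

locale fg_group = group G for G (structure) +
  fixes S
  assumes gen: "generating_set G S"
begin

lemma letters: "S \<union> (\<lambda>s. inv s) ` S \<subseteq> carrier G"
  using gen by (auto simp: generating_set_def)

lemma represents_append: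
  assumes "represents G S u g" "represents G S v h"
  shows "represents G S (u @ v) (g \<otimes> h)"
proof -
  have "set u \<subseteq> carrier G" "set v \<subseteq> carrier G"
    using assms letters unfolding represents_def by blast+
  with assms show ?thesis
    unfolding represents_def using foldr_mult_append[OF is_group, of u v]
    by (metis Un_least set_append)
qed

lemma represents_single: "s \<in> S \<union> (\<lambda>s. inv s) ` S \<Longrightarrow> represents G S [s] s"
  using letters by (auto simp: represents_def)

lemma represents_rev:
  assumes "represents G S w g" shows "represents G S (rev (map (\<lambda>s. inv s) w)) (inv g)"
  using assms
proof (induction w arbitrary: g)
  case Nil then show ?case by (auto simp: represents_def)
next
  case (Cons a w)
  let ?h = "foldr (\<otimes>) w \<one>"
  have a: "a \<in> S \<union> (\<lambda>s. inv s) ` S" and w: "represents G S w ?h" and g: "g = a \<otimes> ?h"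
    using Cons.prems by (auto simp: represents_def)
  have "inv a \<in> S \<union> (\<lambda>s. inv s) ` S" using a letters by auto
  then have "represents G S (rev (map (\<lambda>s. inv s) w) @ [inv a]) (inv ?h \<otimes> inv a)"
    by (intro represents_append Cons.IH w represents_single)
  moreover have "?h \<in> carrier G"
    using foldr_mult_append[OF is_group, of w "[]", THEN conjunct1] w letters
    unfolding represents_def by (metis empty_set empty_subsetI order_trans)
  ultimately show ?case using a letters g by (auto simp: inv_mult_group)
qed

lemma represents_exists:
  assumes "g \<in> carrier G" shows "\<exists>w. represents G S w g"
proof -
  have "g \<in> generate G S" using assms gen by (simp add: generating_set_def)
  then show ?thesis
  proof induction
    case one then show ?case by (auto simp: represents_def intro!: exI[of _ "[]"])
  next
    case (incl h) then show ?case using represents_single by blast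
  next
    case (inv h) then show ?case using represents_single by blast
  next
    case (eng h1 h2) then show ?case using represents_append by blast
  qed
qed

lemma word_length_le: "represents G S w g \<Longrightarrow> word_length G S g \<le> length w"
  unfolding word_length_def by (rule Least_le) auto

lemma word_length_attained:
  assumes "g \<in> carrier G"
  obtains w where "length w = word_length G S g" "represents G S w g"
proof -
  have "\<exists>n w. length w = n \<and> represents G S w g" using represents_exists[OF assms] by auto
  then have "\<exists>w. length w = word_length G S g \<and> represents G S w g"
    unfolding word_length_def by (rule LeastI_ex)
  then show thesis using that by blast
qed

lemma word_length_mult:
  assumes "g \<in> carrier G" "h \<in> carrier G"
  shows "word_length G S (g \<otimes> h) \<le> word_length G S g + word_length G S h"
proof -
  obtain u v where "length u = word_length G S g" "represents G S u g"
     "length v = word_length G S h" "represents G S v h"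
    using word_length_attained assms by metis
  then show ?thesis using word_length_le[OF represents_append, of u g v h] by simp
qed

lemma word_length_inv:
  assumes "g \<in> carrier G" shows "word_length G S (inv g) = word_length G S g"
proof -
  have le: "word_length G S (inv g) \<le> word_length G S g" if "g \<in> carrier G" for g
  proof -
    obtain w where "length w = word_length G S g" "represents G S w g"
      using word_length_attained \<open>g \<in> carrier G\<close> by metis
    then show ?thesis using word_length_le[OF represents_rev, of w g] by simp
  qed
  from le[of g] le[of "inv g"] assms show ?thesis by simp
qed

lemma word_length_zero:
  assumes "g \<in> carrier G" shows "word_length G S g = 0 \<longleftrightarrow> g = \<one>"
proof
  assume "word_length G S g = 0"
  then show "g = \<one>"
    using word_length_attained[OF assms] by (metis foldr_Nil id_apply length_0_conv represents_def)
next
  assume "g = \<one>"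
  then show "word_length G S g = 0"
    using word_length_le[of "[]" g] by (simp add: represents_def)
qed

lemma word_dist_nonneg: "0 \<le> word_dist G S g h"
  by (simp add: word_dist_def)

lemma word_dist_commute:
  assumes "g \<in> carrier G" "h \<in> carrier G"
  shows "word_dist G S g h = word_dist G S h g"
  using word_length_inv[of "inv g \<otimes> h"] assms by (simp add: word_dist_def inv_mult_group)

lemma word_dist_zero:
  assumes "g \<in> carrier G" "h \<in> carrier G"
  shows "word_dist G S g h = 0 \<longleftrightarrow> g = h"
  using word_length_zero[of "inv g \<otimes> h"] assms
  by (metis inv_closed inv_equality inv_inv l_inv m_closed of_nat_eq_0_iff word_dist_def)

lemma word_dist_triangle:
  assumes "g \<in> carrier G" "h \<in> carrier G" "k \<in> carrier G"
  shows "word_dist G S g k \<le> word_dist G S g h + word_dist G S h k"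
proof -
  have "(inv g \<otimes> h) \<otimes> (inv h \<otimes> k) = inv g \<otimes> k"
    using assms by (metis inv_closed inv_solve_left m_assoc m_closed)
  then show ?thesis
    using word_length_mult[of "inv g \<otimes> h" "inv h \<otimes> k"] assms
    by (simp add: word_dist_def flip: of_nat_add)
qed

end

lemma ultrafilter_limit:
  fixes f :: "nat \<Rightarrow> real"
  assumes \<omega>: "nonprincipal_ultrafilter \<omega>" and f: "\<And>n. f n \<in> {a..b}"
  shows "\<exists>l\<in>{a..b}. (f \<longlongrightarrow> l) \<omega>"
proof -
  let ?F = "filtermap f \<omega>"
  have "?F \<noteq> bot" using \<omega> by (simp add: nonprincipal_ultrafilter_def filtermap_bot_iff)
  moreover have "eventually (\<lambda>x. x \<in> {a..b}) ?F" using f by (simp add: eventually_filtermap)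
  moreover have "compact {a..b}" by simp
  ultimately obtain l where l: "l \<in> {a..b}" and nb: "inf (nhds l) ?F \<noteq> bot"
    unfolding compact_filter by blast
  have "(f \<longlongrightarrow> l) \<omega>"
  proof (rule topological_tendstoI)
    fix U assume U: "open U" "l \<in> U"
    show "eventually (\<lambda>n. f n \<in> U) \<omega>"
    proof (rule ccontr)
      assume "\<not> eventually (\<lambda>n. f n \<in> U) \<omega>"
      then have "eventually (\<lambda>n. \<not> f n \<in> U) \<omega>"
        using \<omega> unfolding nonprincipal_ultrafilter_def by blast
      then have "eventually (\<lambda>x. x \<notin> U) ?F" by (simp add: eventually_filtermap)
      moreover have "eventually (\<lambda>x. x \<in> U) (nhds l)" using U by (simp add: eventually_nhds_in_open)
      ultimately have "eventually (\<lambda>x. False) (inf (nhds l) ?F)"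
        unfolding eventually_inf by blast
      then show False using nb by (simp add: trivial_limit_def)
    qed
  qed
  then show ?thesis using l by blast
qed

locale cone_data = fg_group G S for G (structure) and S +
  fixes \<omega> :: "nat filter" and d :: "nat \<Rightarrow> real"
  assumes \<omega>: "nonprincipal_ultrafilter \<omega>" and d: "scaling_sequence d"
begin

abbreviation sdist where "sdist g h n \<equiv> word_dist G S (g n) (h n) / d n"

lemma nontriv: "\<omega> \<noteq> bot"
  using \<omega> by (simp add: nonprincipal_ultrafilter_def)

lemma dpos: "0 < d n"
  using d by (simp add: scaling_sequence_def)

lemma seq_carrier: "g \<in> cone_sequences G S d \<Longrightarrow> g n \<in> carrier G"
  by (simp add: cone_sequences_def)

lemma sdist_nonneg: "0 \<le> sdist g h n"
  using dpos[of n] by (simp add: word_dist_nonneg)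

lemma sdist_commute:
  "g \<in> cone_sequences G S d \<Longrightarrow> h \<in> cone_sequences G S d \<Longrightarrow> sdist g h n = sdist h g n"
  by (simp add: word_dist_commute seq_carrier)

lemma sdist_triangle:
  assumes "g \<in> cone_sequences G S d" "h \<in> cone_sequences G S d" "k \<in> cone_sequences G S d"
  shows "sdist g k n \<le> sdist g h n + sdist h k n"
  using word_dist_triangle[of "g n" "h n" "k n"] assms dpos[of n]
  by (simp add: seq_carrier divide_right_mono flip: add_divide_distrib)

lemma sdist_limit:
  assumes g: "g \<in> cone_sequences G S d" and h: "h \<in> cone_sequences G S d"
  obtains l where "0 \<le> l" "(sdist g h \<longlongrightarrow> l) \<omega>"
proof -
  obtain a b where a: "\<And>n. word_dist G S \<one> (g n) / d n \<le> a"
    and b: "\<And>n. word_dist G S \<one> (h n) / d n \<le> b"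
    using g h unfolding cone_sequences_def bdd_above_def by blast
  have "sdist g h n \<in> {0..a + b}" for n
  proof -
    have "word_dist G S (g n) (h n) \<le> word_dist G S \<one> (g n) + word_dist G S \<one> (h n)"
      using word_dist_triangle[of "g n" \<one> "h n"] word_dist_commute[of "g n" \<one>] g h
      by (simp add: seq_carrier)
    then have "sdist g h n \<le> word_dist G S \<one> (g n) / d n + word_dist G S \<one> (h n) / d n"
      using dpos[of n] by (simp add: divide_right_mono flip: add_divide_distrib)
    then show ?thesis using a[of n] b[of n] sdist_nonneg[where g = g and h = h and n = n] by simp
  qed
  then have "\<exists>l\<in>{0..a + b}. (sdist g h \<longlongrightarrow> l) \<omega>" by (rule ultrafilter_limit[OF \<omega>])
  then show thesis using that by auto
qed

lemma equiv_cone_rel: "equiv (cone_sequences G S d) (cone_rel \<omega> G S d)"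
proof (rule equivI)
  show "cone_rel \<omega> G S d \<subseteq> cone_sequences G S d \<times> cone_sequences G S d"
    by (auto simp: cone_rel_def)
  show "refl_on (cone_sequences G S d) (cone_rel \<omega> G S d)"
    by (auto simp: refl_on_def cone_rel_def word_dist_zero[THEN iffD2] seq_carrier)
  show "sym (cone_rel \<omega> G S d)"
  proof (rule symI)
    fix g h assume *: "(g, h) \<in> cone_rel \<omega> G S d"
    then have "sdist g h = sdist h g"
      by (intro ext sdist_commute) (simp_all add: cone_rel_def)
    then show "(h, g) \<in> cone_rel \<omega> G S d" using * by (auto simp: cone_rel_def)
  qed
  show "trans (cone_rel \<omega> G S d)"
  proof (rule transI)
    fix g h k assume *: "(g, h) \<in> cone_rel \<omega> G S d" "(h, k) \<in> cone_rel \<omega> G S d"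
    have "((\<lambda>n. sdist g h n + sdist h k n) \<longlongrightarrow> 0 + 0) \<omega>"
      using * by (intro tendsto_add) (auto simp: cone_rel_def)
    then have lim: "((\<lambda>n. sdist g h n + sdist h k n) \<longlongrightarrow> 0) \<omega>" by simp
    have m: "g \<in> cone_sequences G S d" "h \<in> cone_sequences G S d" "k \<in> cone_sequences G S d"
      using * by (simp_all add: cone_rel_def)
    have "(sdist g k \<longlongrightarrow> 0) \<omega>"
    proof (rule tendsto_sandwich[OF _ _ tendsto_const lim])
      show "eventually (\<lambda>n. 0 \<le> sdist g k n) \<omega>"
        by (intro always_eventually allI sdist_nonneg)
      show "eventually (\<lambda>n. sdist g k n \<le> sdist g h n + sdist h k n) \<omega>"
        by (intro always_eventually allI sdist_triangle m)
    qed
    then show "(g, k) \<in> cone_rel \<omega> G S d" using * by (auto simp: cone_rel_def)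
  qed
qed

lemma cone_rel_same_limit:
  assumes "(g, g') \<in> cone_rel \<omega> G S d" "(h, h') \<in> cone_rel \<omega> G S d"
    and "(sdist g h \<longlongrightarrow> l) \<omega>"
  shows "(sdist g' h' \<longlongrightarrow> l) \<omega>"
proof -
  have m: "g \<in> cone_sequences G S d" "g' \<in> cone_sequences G S d"
          "h \<in> cone_sequences G S d" "h' \<in> cone_sequences G S d"
    using assms by (auto simp: cone_rel_def)
  have z: "((\<lambda>n. sdist g g' n + sdist h h' n) \<longlongrightarrow> 0 + 0) \<omega>"
    using assms by (intro tendsto_add) (auto simp: cone_rel_def)
  have bound: "\<bar>sdist g' h' n - sdist g h n\<bar> \<le> sdist g g' n + sdist h h' n" for n
  proof -
    have abs_diff: "\<bar>p - q\<bar> \<le> e + f"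
      if "p \<le> e + r" "r \<le> q + f" "q \<le> e + t" "t \<le> p + f" for p q r t e f :: real
      using that by linarith
    show ?thesis
    proof (rule abs_diff)
      show "sdist g' h' n \<le> sdist g g' n + sdist g h' n"
        unfolding sdist_commute[OF m(1,2), of n] by (rule sdist_triangle[OF m(2,1,4)])
      show "sdist g h' n \<le> sdist g h n + sdist h h' n" by (rule sdist_triangle[OF m(1,3,4)])
      show "sdist g h n \<le> sdist g g' n + sdist g' h n" by (rule sdist_triangle[OF m(1,2,3)])
      show "sdist g' h n \<le> sdist g' h' n + sdist h h' n"
        unfolding sdist_commute[OF m(3,4), of n] by (rule sdist_triangle[OF m(2,4,3)])
    qed
  qed
  have "((\<lambda>n. sdist g' h' n - sdist g h n) \<longlongrightarrow> 0) \<omega>"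
  proof (rule Lim_null_comparison)
    show "eventually (\<lambda>n. norm (sdist g' h' n - sdist g h n) \<le> sdist g g' n + sdist h h' n) \<omega>"
      unfolding real_norm_def by (intro always_eventually allI bound)
    show "((\<lambda>n. sdist g g' n + sdist h h' n) \<longlongrightarrow> 0) \<omega>" using z by simp
  qed
  from tendsto_add[OF this assms(3)] show ?thesis by simp
qed

lemma class_in_cone_points:
  "g \<in> cone_sequences G S d \<Longrightarrow> cone_rel \<omega> G S d `` {g} \<in> cone_points \<omega> G S d"
  by (simp add: cone_points_def quotientI)

lemma cone_dist_class:
  assumes g: "g \<in> cone_sequences G S d" and h: "h \<in> cone_sequences G S d"
  shows "(sdist g h \<longlongrightarrow>
     cone_dist \<omega> G S d (cone_rel \<omega> G S d `` {g}) (cone_rel \<omega> G S d `` {h})) \<omega>"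
proof -
  let ?g = "SOME x. x \<in> cone_rel \<omega> G S d `` {g}" and ?h = "SOME x. x \<in> cone_rel \<omega> G S d `` {h}"
  obtain l where l: "(sdist g h \<longlongrightarrow> l) \<omega>" using sdist_limit[OF g h] by blast
  have "?g \<in> cone_rel \<omega> G S d `` {g}"
    using equiv_class_self[OF equiv_cone_rel g]
    by (rule someI[where P = "\<lambda>x. x \<in> cone_rel \<omega> G S d `` {g}"])
  moreover have "?h \<in> cone_rel \<omega> G S d `` {h}"
    using equiv_class_self[OF equiv_cone_rel h]
    by (rule someI[where P = "\<lambda>x. x \<in> cone_rel \<omega> G S d `` {h}"])
  ultimately have "(g, ?g) \<in> cone_rel \<omega> G S d" "(h, ?h) \<in> cone_rel \<omega> G S d"
    unfolding Image_singleton_iff .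
  then have "(sdist ?g ?h \<longlongrightarrow> l) \<omega>" using l by (rule cone_rel_same_limit)
  then have "Lim \<omega> (sdist ?g ?h) = l" by (rule tendsto_Lim[OF nontriv])
  then have "cone_dist \<omega> G S d (cone_rel \<omega> G S d `` {g}) (cone_rel \<omega> G S d `` {h}) = l"
    unfolding cone_dist_def by (simp only: class_in_cone_points g h simp_thms if_True)
  then show ?thesis using l by (simp only:)
qed

lemma cone_points_cases:
  assumes "A \<in> cone_points \<omega> G S d"
  obtains g where "g \<in> cone_sequences G S d" "A = cone_rel \<omega> G S d `` {g}"
  using assms by (auto simp: cone_points_def elim: quotientE)

lemma Metric_space_cone: "Metric_space (cone_points \<omega> G S d) (cone_dist \<omega> G S d)"
proof
  let ?D = "cone_dist \<omega> G S d" and ?P = "cone_points \<omega> G S d"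
  show "0 \<le> ?D A B" for A B
  proof (cases "A \<in> ?P \<and> B \<in> ?P")
    case True
    then obtain g h where gh: "g \<in> cone_sequences G S d" "A = cone_rel \<omega> G S d `` {g}"
      "h \<in> cone_sequences G S d" "B = cone_rel \<omega> G S d `` {h}"
      by (metis cone_points_cases)
    show ?thesis
      using tendsto_lowerbound[OF cone_dist_class _ nontriv, of g h 0] gh sdist_nonneg by simp
  qed (auto simp: cone_dist_def)
  show "?D A B = ?D B A" for A B
  proof (cases "A \<in> ?P \<and> B \<in> ?P")
    case True
    then obtain g h where gh: "g \<in> cone_sequences G S d" "A = cone_rel \<omega> G S d `` {g}"
      "h \<in> cone_sequences G S d" "B = cone_rel \<omega> G S d `` {h}"
      by (metis cone_points_cases)
    have "sdist g h = sdist h g" using sdist_commute gh by blast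
    then show ?thesis
      using tendsto_unique[OF nontriv cone_dist_class[of g h]] cone_dist_class[of h g] gh by simp
  qed (auto simp: cone_dist_def)
  fix A B assume "A \<in> ?P" "B \<in> ?P"
  then obtain g h where gh: "g \<in> cone_sequences G S d" "A = cone_rel \<omega> G S d `` {g}"
      "h \<in> cone_sequences G S d" "B = cone_rel \<omega> G S d `` {h}"
    by (metis cone_points_cases)
  have lim: "(sdist g h \<longlongrightarrow> ?D A B) \<omega>" using cone_dist_class gh by simp
  have "?D A B = 0 \<longleftrightarrow> (g, h) \<in> cone_rel \<omega> G S d"
  proof
    assume "?D A B = 0"
    with lim have "(sdist g h \<longlongrightarrow> 0) \<omega>" by (rule subst[rotated])
    with gh show "(g, h) \<in> cone_rel \<omega> G S d" by (simp add: cone_rel_def)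
  next
    assume "(g, h) \<in> cone_rel \<omega> G S d"
    then have "(sdist g h \<longlongrightarrow> 0) \<omega>" by (simp add: cone_rel_def)
    then show "?D A B = 0" using tendsto_unique[OF nontriv lim] by blast
  qed
  also have "\<dots> \<longleftrightarrow> A = B"
    using eq_equiv_class_iff[OF equiv_cone_rel] gh by simp
  finally show "?D A B = 0 \<longleftrightarrow> A = B" .
  fix C assume "C \<in> ?P"
  then obtain k where k: "k \<in> cone_sequences G S d" "C = cone_rel \<omega> G S d `` {k}"
    by (metis cone_points_cases)
  have "((\<lambda>n. sdist g h n + sdist h k n) \<longlongrightarrow> ?D A B + ?D B C) \<omega>"
    using cone_dist_class gh k by (intro tendsto_add) auto
  moreover have "(sdist g k \<longlongrightarrow> ?D A C) \<omega>" using cone_dist_class gh k by simp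
  ultimately show "?D A C \<le> ?D A B + ?D B C"
    by (rule tendsto_le[OF nontriv]) (intro always_eventually allI sdist_triangle gh k)
qed

lemma mspace_cone: "mspace (asymptotic_cone \<omega> G S d) = cone_points \<omega> G S d"
  unfolding asymptotic_cone_def by (rule Metric_space.mspace_metric[OF Metric_space_cone])

lemma mdist_cone: "mdist (asymptotic_cone \<omega> G S d) = cone_dist \<omega> G S d"
  unfolding asymptotic_cone_def by (rule Metric_space.mdist_metric[OF Metric_space_cone])

end

end

theory Submission
  imports Defs
begin

text \<open>The group is a limit of quotients of the free group of rank two. Adding a large power of an element of
  infinite order to a hyperbolic group keeps it hyperbolic and changes no short relation (rotating families on
  the coned-off group), so all elements can be killed to finite order one after another. If each such power is
  followed by a much larger unchanged ball, the limit looks hyperbolic at infinitely many scales, and the cone at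
  these scales is a tree.

  For the other cone, finite-index subgroups are cut off as well: the relators \<open>R\<close> are replaced by
  \<open>R \<inter> M\<close> with \<open>M\<close> normal of finite index. A derivation \<open>D\<close> of the free group into a permutation module of
  a finite quotient that kills the relators so far, but not some \<open>y\<close>, makes the powers of \<open>y ^ m\<close>, which lie in
  \<open>R\<close>, move linearly modulo \<open>R \<inter> M \<inter> {D = 0}\<close>, and a finite-index subgroup centralises them there.
  Replacing \<open>D = 0\<close> by \<open>D = 0\<close> modulo a huge integer makes the index finite and changes nothing on a long range of
  scales. In a cone at such scales the powers act as a one-parameter group of translations with uniform
  displacement, and a geodesic space with such an action whose orbits are proper subsets has no cut point.
  Derivations of this kind keep existing because the orders of the relators in finite quotients can be chosen so
  large that the sum of their inverses stays below one.\<close>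

section \<open>Groups as types and word lengths modulo a normal subgroup\<close>

text \<open>The obstacle is to have both kinds of cones in one torsion group. Power relators alone
  give no control over the cones at other scales, and a central element of infinite order, which
  would provide the translations at once, is excluded by torsion. The way out is a finite but
  enormous cyclic group: replacing \<open>R\<close> by \<open>R \<inter> M\<close> adds only a
  finite normal subgroup to the quotient, so lengths change by a bounded amount and hyperbolicity
  persists, yet a cyclic subgroup of huge order looks like a line at scales far below its length. In
  the limit, \<open>A\<close> is the union of the \<open>R \<inter> M\<close> and \<open>P\<close>
  the union of the \<open>R\<close>. The group \<open>P / A\<close> is locally finite; the
  translations come from elements of \<open>P\<close>, and the points off their orbits come from the
  infinite quotient by \<open>P\<close>.

  Rank two enters through the bound one on the sum of inverse orders: over a finite quotient of
  order \<open>q\<close> a derivation has \<open>2 * q\<close> free coefficients, \<open>q\<close>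
  conditions are spent on excluding derivations that vanish on the finite-index subgroup, and a
  relator of order \<open>k\<close> costs \<open>q / k\<close> more.\<close>

class grp = monoid_mult + inverse +
  assumes left_inv: "inverse x * x = 1"
begin

lemma inv_cancel_left: "inverse x * (x * y) = y"
  by (metis left_inv mult.assoc mult_1_left)

lemma right_inv: "x * inverse x = 1"
  by (metis inv_cancel_left left_inv mult_1_right)

lemma cancel_inv_left: "x * (inverse x * y) = y"
  by (metis right_inv mult.assoc mult_1_left)

lemma inv_inv: "inverse (inverse x) = x"
  by (metis inv_cancel_left left_inv mult_1_right)

lemma inv_one: "inverse 1 = 1"
  by (metis left_inv mult_1_right)

lemma inv_unique: "x * y = 1 \<Longrightarrow> inverse x = y"
  by (metis inv_cancel_left mult_1_right)

lemma inv_mult: "inverse (x * y) = inverse y * inverse x"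
  by (rule inv_unique) (simp only: mult.assoc cancel_inv_left right_inv)

lemmas gsimps = mult.assoc inv_mult inv_one inv_inv left_inv right_inv inv_cancel_left cancel_inv_left

lemma right_cancel: "a * x = b * x \<Longrightarrow> a = b"
proof -
  assume "a * x = b * x"
  then have "a * x * inverse x = b * x * inverse x" by simp
  then show "a = b" by (simp only: mult.assoc right_inv mult_1_right)
qed

lemma inverse_power: "inverse x ^ n = inverse (x ^ n)"
proof (induction n)
  case (Suc n)
  have "inverse x ^ Suc n = inverse x * inverse x ^ n" by (rule power_Suc)
  also have "\<dots> = inverse (x ^ n * x)" by (simp only: Suc inv_mult)
  finally show ?case by (simp only: power_Suc2)
qed (simp add: inv_one)

end

lemma conj_power: "(g * x * inverse g) ^ n = g * x ^ n * inverse (g::'a::grp)"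
  by (induction n) (simp_all add: gsimps)

lemma powi_nat: "x powi int n = (x::'a::grp) ^ n"
  by (simp add: power_int_def)

lemma powi_neg: "x powi (- i) = inverse (x powi i :: 'a::grp)"
  by (cases "i = 0") (auto simp: power_int_def inverse_power gsimps)

lemma powi_Suc: "x powi (i + 1) = x powi i * (x::'a::grp)"
proof (cases "i \<ge> 0")
  case True
  then have "nat (i + 1) = Suc (nat i)" by simp
  with True show ?thesis by (simp add: power_int_def power_commutes)
next
  case False
  then have "i = - int (Suc (nat (- i - 1)))" by simp
  then obtain n where n: "i = - int (Suc n)" by blast
  have "x powi i = inverse (x ^ Suc n)"
    unfolding n powi_neg powi_nat ..
  moreover have "x powi (i + 1) = inverse (x ^ n)"
    using n powi_neg[of x "int n"] by (simp add: powi_nat)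
  ultimately show ?thesis by (simp add: gsimps power_commutes)
qed

lemma powi_add: "x powi (i + j) = x powi i * (x::'a::grp) powi j"
proof (induction j rule: int_induct[where k=0])
  case base show ?case by simp
next
  case (step1 j)
  then show ?case using powi_Suc[of x "i + j"] powi_Suc[of x j] by (simp add: gsimps add.assoc)
next
  case (step2 j)
  have "x powi (i + (j - 1)) * x = x powi i * x powi (j - 1) * x"
    using step2 powi_Suc[of x "i + (j - 1)"] powi_Suc[of x "j - 1"] by (simp add: gsimps add.assoc)
  then show ?case by (rule right_cancel)
qed

lemma powi_power: "(x ^ n) powi i = (x::'a::grp) powi (int n * i)"
proof (cases "i \<ge> 0")
  case True
  then obtain m where "i = int m" by (metis nonneg_int_cases)
  then show ?thesis by (metis of_nat_mult powi_nat power_mult)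
next
  case False
  then have "i = - int (nat (- i))" by simp
  then obtain m where i: "i = - int m" by blast
  have "x powi (int n * int m) = (x ^ n) ^ m" by (metis of_nat_mult powi_nat power_mult)
  then show ?thesis unfolding i by (simp add: powi_neg powi_nat)
qed

lemma powi_conj: "(g * x * inverse g) powi i = g * x powi i * inverse (g::'a::grp)"
  unfolding power_int_def inverse_power conj_power by (simp add: gsimps)

section \<open>Subgroups, normal subgroups and normal closures\<close>

definition subgr :: "'a::grp set \<Rightarrow> bool" where
  "subgr H \<longleftrightarrow> 1 \<in> H \<and> (\<forall>x\<in>H. \<forall>y\<in>H. x * y \<in> H) \<and> (\<forall>x\<in>H. inverse x \<in> H)"

definition nsub :: "'a::grp set \<Rightarrow> bool" where
  "nsub R \<longleftrightarrow> subgr R \<and> (\<forall>g. \<forall>x\<in>R. g * x * inverse g \<in> R)"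

lemma subgrD: "subgr H \<Longrightarrow> 1 \<in> H" "subgr H \<Longrightarrow> x \<in> H \<Longrightarrow> y \<in> H \<Longrightarrow> x * y \<in> H"
  "subgr H \<Longrightarrow> x \<in> H \<Longrightarrow> inverse x \<in> H"
  by (auto simp: subgr_def)

lemma subgr_power: "subgr H \<Longrightarrow> x \<in> H \<Longrightarrow> x ^ n \<in> H"
  by (induction n) (auto simp: subgrD)

lemma subgr_powi: "subgr H \<Longrightarrow> x \<in> H \<Longrightarrow> x powi i \<in> H"
  by (auto simp: power_int_def inverse_power subgrD subgr_power)

lemma nsub_subgr: "nsub R \<Longrightarrow> subgr R" by (simp add: nsub_def)

lemma nsubD: "nsub R \<Longrightarrow> 1 \<in> R" "nsub R \<Longrightarrow> x \<in> R \<Longrightarrow> y \<in> R \<Longrightarrow> x * y \<in> R"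
  "nsub R \<Longrightarrow> x \<in> R \<Longrightarrow> inverse x \<in> R" "nsub R \<Longrightarrow> x \<in> R \<Longrightarrow> g * x * inverse g \<in> R"
  "nsub R \<Longrightarrow> x \<in> R \<Longrightarrow> inverse g * x * g \<in> R"
proof -
  show "inverse g * x * g \<in> R" if "nsub R" "x \<in> R"
    using that unfolding nsub_def by (metis inv_inv)
qed (auto simp: subgr_def nsub_def)

lemma subgr_inv_iff: "subgr H \<Longrightarrow> inverse x \<in> H \<longleftrightarrow> x \<in> H"
  by (metis inv_inv subgrD(3))

lemma subgr_mult_left: "subgr H \<Longrightarrow> x \<in> H \<Longrightarrow> x * y \<in> H \<longleftrightarrow> y \<in> H"
  by (metis inv_cancel_left subgrD(2,3))

definition nclos :: "'a::grp set \<Rightarrow> 'a set" where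
  "nclos X = \<Inter>{R. nsub R \<and> X \<subseteq> R}"

lemma nsub_Inter: "(\<And>R. R \<in> \<C> \<Longrightarrow> nsub R) \<Longrightarrow> nsub (\<Inter>\<C>)"
  unfolding nsub_def subgr_def by blast

lemma nsub_Int: "nsub A \<Longrightarrow> nsub B \<Longrightarrow> nsub (A \<inter> B)"
  unfolding nsub_def subgr_def by blast

lemma nsub_nclos: "nsub (nclos X)"
  unfolding nclos_def by (rule nsub_Inter) auto

lemma nclos_incl: "X \<subseteq> nclos X" by (auto simp: nclos_def)

lemma nclos_least: "nsub R \<Longrightarrow> X \<subseteq> R \<Longrightarrow> nclos X \<subseteq> R" by (auto simp: nclos_def)

section \<open>Products of letters and pseudo-lengths of cosets\<close>

definition prods :: "'a::monoid_mult set \<Rightarrow> nat \<Rightarrow> 'a set" where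
  "prods T n = {prod_list ts | ts. set ts \<subseteq> T \<and> length ts = n}"

lemma prods_0: "prods T 0 = {1}" by (auto simp: prods_def)

lemma prods_1: "t \<in> T \<Longrightarrow> t \<in> prods T 1"
  unfolding prods_def by (intro CollectI exI[of _ "[t]"]) auto

lemma prods_add: "x \<in> prods T m \<Longrightarrow> y \<in> prods T n \<Longrightarrow> x * y \<in> prods T (m + n)"
  unfolding prods_def by clarsimp (metis Un_least length_append prod_list.append set_append)

lemma prods_split: "x \<in> prods T (m + n) \<Longrightarrow> \<exists>y\<in>prods T m. \<exists>z\<in>prods T n. x = y * z"
proof -
  assume "x \<in> prods T (m + n)"
  then obtain ts where ts: "set ts \<subseteq> T" "length ts = m + n" "x = prod_list ts" by (auto simp: prods_def)
  have "x = prod_list (take m ts) * prod_list (drop m ts)"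
    unfolding ts prod_list.append[symmetric] by simp
  moreover have "prod_list (take m ts) \<in> prods T m" "prod_list (drop m ts) \<in> prods T n"
    using ts set_take_subset[of m ts] set_drop_subset[of m ts] unfolding prods_def by force+
  ultimately show ?thesis by blast
qed

lemma prods_mono: "T \<subseteq> T' \<Longrightarrow> prods T n \<subseteq> prods T' n" by (auto simp: prods_def)

lemma prods_inverse:
  assumes "\<And>t. t \<in> T \<Longrightarrow> inverse t \<in> T" shows "x \<in> prods T n \<Longrightarrow> inverse (x::'a::grp) \<in> prods T n"
proof (induction n arbitrary: x)
  case 0 then show ?case by (simp add: prods_0 inv_one)
next
  case (Suc n)
  then obtain y z where yz: "y \<in> prods T 1" "z \<in> prods T n" "x = y * z"
    using prods_split[of x T 1 n] by auto
  then have "y \<in> T" by (auto simp: prods_def length_Suc_conv)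
  then have "inverse y \<in> prods T 1" using assms prods_1 by blast
  then show ?case using prods_add[OF Suc.IH[OF yz(2)], of "inverse y" 1] yz(3) by (simp add: inv_mult)
qed

lemma finite_prods: "finite T \<Longrightarrow> finite (prods T n)"
proof -
  assume "finite T"
  then have "finite {ts. set ts \<subseteq> T \<and> length ts = n}" by (rule finite_lists_length_eq)
  moreover have "prods T n = prod_list ` {ts. set ts \<subseteq> T \<and> length ts = n}" by (auto simp: prods_def)
  ultimately show ?thesis by simp
qed

text \<open>Quotient groups are never formed: the word length of the coset \<open>x R\<close> is a pseudo-length on the group.\<close>

definition wl :: "'a::grp set \<Rightarrow> 'a set \<Rightarrow> 'a \<Rightarrow> nat" where
  "wl T R x = (LEAST n. \<exists>y\<in>prods T n. inverse x * y \<in> R)"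

definition genset :: "'a::grp set \<Rightarrow> bool" where
  "genset T \<longleftrightarrow> (\<forall>t\<in>T. inverse t \<in> T) \<and> (\<forall>x. \<exists>n. x \<in> prods T n)"

text \<open>Only these properties of a word length enter the geometry; \<open>len_geo\<close> says
  that the discrete metric is geodesic. The locale is instantiated on one and the same group with
  different letters and modulo different normal subgroups.\<close>

locale lenspace =
  fixes len :: "'a::grp \<Rightarrow> nat"
  assumes len_one [simp]: "len 1 = 0"
    and len_inv [simp]: "len (inverse x) = len x"
    and len_mult: "len (x * y) \<le> len x + len y"
    and len_geo: "n \<le> len x \<Longrightarrow> \<exists>y. len y = n \<and> len (inverse y * x) = len x - n"

lemma wl_le: "y \<in> prods T n \<Longrightarrow> inverse x * y \<in> R \<Longrightarrow> wl T R x \<le> n"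
  unfolding wl_def by (rule Least_le) blast

lemma wl_attained:
  assumes "genset T" "nsub R"
  obtains y where "y \<in> prods T (wl T R x)" "inverse x * y \<in> R"
proof -
  obtain n where "x \<in> prods T n" using assms by (auto simp: genset_def)
  then have "\<exists>n. \<exists>y\<in>prods T n. inverse x * y \<in> R"
    using nsubD(1)[OF assms(2)] by (metis left_inv)
  then have "\<exists>y\<in>prods T (wl T R x). inverse x * y \<in> R" unfolding wl_def by (rule LeastI_ex)
  then show thesis using that by blast
qed

lemma wl_cong:
  assumes "nsub R" "inverse x * y \<in> R" shows "wl T R x = wl T R y"
proof -
  have "inverse x * z \<in> R \<longleftrightarrow> inverse y * z \<in> R" for z
  proof -
    have "inverse x * z = (inverse x * y) * (inverse y * z)" by (simp add: gsimps)
    then show ?thesis using subgr_mult_left[OF nsub_subgr[OF assms(1)] assms(2)] by metis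
  qed
  then show ?thesis by (simp add: wl_def)
qed

lemma wl_zero_iff:
  assumes "genset T" "nsub R" shows "wl T R x = 0 \<longleftrightarrow> x \<in> R"
proof
  assume "wl T R x = 0"
  then show "x \<in> R" using wl_attained[OF assms, of x]
    by (metis (no_types, lifting) prods_0 singletonD mult_1_right subgr_inv_iff nsub_subgr[OF assms(2)])
next
  assume "x \<in> R"
  then show "wl T R x = 0"
    using wl_le[of 1 T 0 x R] by (simp add: prods_0 nsubD(3)[OF assms(2)])
qed

lemma wl_mono: assumes "genset T" "nsub R" "R \<subseteq> R'" shows "wl T R' x \<le> wl T R x"
  using wl_attained[OF assms(1,2)] assms(3) wl_le by (metis subsetD)

lemma wl_mono_gen: assumes "genset T" "nsub R" "T \<subseteq> T'" shows "wl T' R x \<le> wl T R x"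
  using wl_attained[OF assms(1,2)] prods_mono[OF assms(3)] wl_le by (metis subsetD)

lemma genset_mono: "genset T \<Longrightarrow> T \<subseteq> T' \<Longrightarrow> (\<And>t. t \<in> T' \<Longrightarrow> inverse t \<in> T') \<Longrightarrow> genset T'"
  unfolding genset_def using prods_mono by blast

lemma wl_mult_le:
  assumes "genset T" "nsub R" shows "wl T R (x * y) \<le> wl T R x + wl T R y"
proof -
  obtain u v where u: "u \<in> prods T (wl T R x)" "inverse x * u \<in> R"
    and v: "v \<in> prods T (wl T R y)" "inverse y * v \<in> R"
    using wl_attained[OF assms] by metis
  have "inverse (x * y) * (u * v) = (inverse y * (inverse x * u) * y) * (inverse y * v)"
    by (simp add: gsimps)
  then have "inverse (x * y) * (u * v) \<in> R" using nsubD(2,5)[OF assms(2)] u v by metis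
  then show ?thesis using wl_le prods_add[OF u(1) v(1)] by metis
qed

lemma wl_inverse_le:
  assumes "genset T" "nsub R" shows "wl T R (inverse x) \<le> wl T R x"
proof -
  obtain u where u: "u \<in> prods T (wl T R x)" "inverse x * u \<in> R"
    using wl_attained[OF assms] by metis
  have "x * inverse u = x * inverse (inverse x * u) * inverse x" by (simp add: gsimps)
  then have "inverse (inverse x) * inverse u \<in> R" using nsubD(3,4)[OF assms(2)] u by (metis inv_inv)
  moreover have "inverse u \<in> prods T (wl T R x)" using prods_inverse u assms(1) by (metis genset_def)
  ultimately show ?thesis using wl_le by metis
qed

lemma wl_lenspace:
  assumes "genset T" "nsub R" shows "lenspace (wl T R)"
proof
  show "wl T R 1 = 0" using wl_zero_iff[OF assms] nsubD(1)[OF assms(2)] by blast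
  show "wl T R (inverse x) = wl T R x" for x
    using wl_inverse_le[OF assms, of x] wl_inverse_le[OF assms, of "inverse x"] by (simp add: inv_inv)
  show "wl T R (x * y) \<le> wl T R x + wl T R y" for x y by (rule wl_mult_le[OF assms])
  fix n x assume n: "n \<le> wl T R x"
  obtain u where u: "u \<in> prods T (n + (wl T R x - n))" "inverse x * u \<in> R"
    using wl_attained[OF assms, of x] n by (metis le_add_diff_inverse)
  obtain y z where yz: "y \<in> prods T n" "z \<in> prods T (wl T R x - n)" "u = y * z"
    using prods_split[OF u(1)] by blast
  have a: "wl T R y \<le> n" using wl_le[OF yz(1)] nsubD(1)[OF assms(2)] by (metis left_inv)
  have "inverse (inverse y * x) * z \<in> R" using u(2) yz(3) by (simp add: gsimps)
  then have b: "wl T R (inverse y * x) \<le> wl T R x - n" using wl_le[OF yz(2)] by metis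
  have "wl T R x \<le> wl T R y + wl T R (inverse y * x)"
    using wl_mult_le[OF assms, of y "inverse y * x"] by (simp add: gsimps)
  with a b n show "\<exists>y. wl T R y = n \<and> wl T R (inverse y * x) = wl T R x - n"
    by (intro exI[of _ y]) linarith
qed

lemma wl_ball_finite:
  assumes "genset T" "nsub R" "finite T"
  shows "\<exists>A. finite A \<and> (\<forall>x. wl T R x \<le> n \<longrightarrow> (\<exists>a\<in>A. inverse x * a \<in> R))"
proof (intro exI conjI allI impI)
  show "finite (\<Union>i\<le>n. prods T i)" using finite_prods[OF assms(3)] by blast
  fix x assume n: "wl T R x \<le> n"
  obtain y where "y \<in> prods T (wl T R x)" "inverse x * y \<in> R" using wl_attained[OF assms(1,2)] .
  with n show "\<exists>a\<in>(\<Union>i\<le>n. prods T i). inverse x * a \<in> R" by (intro bexI[of _ y] UN_I) auto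
qed

section \<open>Hyperbolicity\<close>

lemma linear_less_exp: "\<exists>K. \<forall>k\<ge>K. c * (k + 4) < (2::nat) ^ k"
proof (intro exI allI impI)
  fix k assume k: "max 5 (2 * c + 1) \<le> k"
  have sq: "k * k \<le> 2 ^ k" if "k \<ge> 4" for k :: nat
    using that
  proof (induction k rule: dec_induct)
    case (step n)
    have "4 * n \<le> n * n" using step by (intro mult_right_mono) auto
    then have "Suc n * Suc n \<le> 2 * (n * n)" using step(1) unfolding mult_Suc mult_Suc_right by linarith
    also have "\<dots> \<le> 2 ^ Suc n" using step by simp
    finally show ?case .
  qed simp
  have "c * (k + 4) \<le> c * (2 * k)" using k by (intro mult_left_mono) auto
  also have "\<dots> = (2 * c) * k" by simp
  also have "\<dots> < k * k" using k by (intro mult_strict_right_mono) auto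
  also have "\<dots> \<le> 2 ^ k" using sq k by simp
  finally show "c * (k + 4) < 2 ^ k" .
qed

text \<open>In Bowditch's argument the deviation \<open>D\<close> is bounded by the logarithm of its
  own size. Comparing \<open>6 * D\<close> with the least power of two above it bounds
  \<open>D\<close> in terms of \<open>h\<close> alone.\<close>

lemma log_bound: "\<exists>H. \<forall>D. (\<forall>k. 6 * D \<le> 2 ^ k \<longrightarrow> D \<le> h * (k + 3)) \<longrightarrow> D \<le> (H::nat)"
proof -
  obtain K where K: "\<forall>k\<ge>K. 6 * h * (k + 4) < (2::nat) ^ k" using linear_less_exp by blast
  show ?thesis
  proof (intro exI allI impI, rule ccontr)
    fix D assume D: "\<forall>k. 6 * D \<le> 2 ^ k \<longrightarrow> D \<le> h * (k + 3)" "\<not> D \<le> h * (K + 3)"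
    have ex: "\<exists>k. 6 * D \<le> 2 ^ k" using less_exp[of "6 * D"] less_imp_le by blast
    define k where "k = (LEAST k. 6 * D \<le> 2 ^ k)"
    have k: "6 * D \<le> 2 ^ k" unfolding k_def using ex by (rule LeastI_ex)
    have "k > K"
    proof (rule ccontr)
      assume "\<not> k > K"
      then have "h * (k + 3) \<le> h * (K + 3)" by (intro mult_left_mono) auto
      then show False using D(1) k D(2) by (meson le_trans)
    qed
    then have "\<not> 6 * D \<le> 2 ^ (k - 1)" unfolding k_def by (intro not_less_Least) auto
    moreover have "6 * D \<le> 6 * (h * (k + 3))" using D(1) k by (intro mult_left_mono) auto
    moreover have "6 * h * (k - 1 + 4) < 2 ^ (k - 1)" using K[rule_format, of "k - 1"] \<open>k > K\<close> by linarith
    moreover have "6 * h * (k - 1 + 4) = 6 * (h * (k + 3))" using \<open>k > K\<close> by simp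
    ultimately show False by linarith
  qed
qed

context lenspace begin

section \<open>Left-invariant distances, Gromov products and slim triangles\<close>

definition dd :: "'a \<Rightarrow> 'a \<Rightarrow> int" where "dd x y = int (len (inverse x * y))"

lemma dd_self [simp]: "dd x x = 0" by (simp add: dd_def left_inv)

lemma dd_nonneg [simp]: "0 \<le> dd x y" by (simp add: dd_def)

lemma dd_sym: "dd x y = dd y x"
  using len_inv[of "inverse x * y"] by (simp add: dd_def gsimps)

lemma dd_tri: "dd x z \<le> dd x y + dd y z"
  using len_mult[of "inverse x * y" "inverse y * z"] by (simp add: dd_def gsimps flip: of_nat_add)

lemma dd_left [simp]: "dd (g * x) (g * y) = dd x y"
  by (simp add: dd_def gsimps)

lemma dd_one: "dd 1 x = int (len x)" by (simp add: dd_def inv_one)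

lemma dd_shift: "dd (g * x) y = dd x (inverse g * y)"
  using dd_left[of g x "inverse g * y"] by (simp add: gsimps)

lemma dd_point:
  assumes "0 \<le> a" "a \<le> dd x y" obtains z where "dd x z = a" "dd z y = dd x y - a"
proof -
  have "nat a \<le> len (inverse x * y)" using assms by (simp add: dd_def)
  then obtain u where u: "len u = nat a" "len (inverse u * (inverse x * y)) = len (inverse x * y) - nat a"
    using len_geo by blast
  have "dd x (x * u) = a" "dd (x * u) y = dd x y - a"
    using u assms by (auto simp: dd_def gsimps)
  then show thesis using that by blast
qed

text \<open>Twice the Gromov product, so that all quantities are integers.\<close>

definition gp :: "'a \<Rightarrow> 'a \<Rightarrow> 'a \<Rightarrow> int" where "gp p x y = dd p x + dd p y - dd x y"

lemma gp_nonneg: "0 \<le> gp p x y" using dd_tri[of x y p] dd_sym[of x p] by (simp add: gp_def)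

lemma gp_sym: "gp p x y = gp p y x" by (simp add: gp_def dd_sym)

lemma gp_swap: "gp p x y + gp x p y = 2 * dd p x" by (simp add: gp_def dd_sym)

lemma gp_left [simp]: "gp (g * p) (g * x) (g * y) = gp p x y" by (simp add: gp_def)

definition betw :: "'a \<Rightarrow> 'a \<Rightarrow> 'a \<Rightarrow> bool" where "betw x z y \<longleftrightarrow> dd x z + dd z y = dd x y"

definition hyp4 :: "int \<Rightarrow> bool" where
  "hyp4 \<delta> \<longleftrightarrow> (\<forall>p x y z. min (gp p x y) (gp p y z) - \<delta> \<le> gp p x z)"

text \<open>Formulated with \<open>betw\<close>, the condition speaks of all points on all
  geodesics, so that no geodesics have to be chosen.\<close>

definition slim :: "int \<Rightarrow> bool" where
  "slim h \<longleftrightarrow> (\<forall>x y z p. betw x p y \<longrightarrow> (\<exists>q. (betw x q z \<or> betw z q y) \<and> dd p q \<le> h))"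

lemma hyp4D: "hyp4 \<delta> \<Longrightarrow> gp p x y - \<delta> \<le> gp p x z \<or> gp p y z - \<delta> \<le> gp p x z"
  unfolding hyp4_def by (metis min_def)

lemma hyp4_nonneg: "hyp4 \<delta> \<Longrightarrow> 0 \<le> \<delta>"
  using hyp4D[of \<delta> 1 1 1 1] by (auto simp: gp_def)

text \<open>A point \<open>p\<close> that is no further from \<open>x\<close> than the Gromov
  product of \<open>y\<close> and \<open>z\<close> is matched with the point \<open>q\<close> of the
  side from \<open>x\<close> to \<open>z\<close> at the same distance from \<open>x\<close>; two
  applications of the four-point condition bound \<open>dd p q\<close>. Other points are treated
  from the end \<open>y\<close>.\<close>

lemma slim_of_hyp4:
  assumes "hyp4 \<delta>" shows "slim (2 * \<delta>)"
proof -
  have main: "\<exists>q. betw x q z \<and> dd p q \<le> 2 * \<delta>"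
    if p: "betw x p y" and le: "2 * dd x p \<le> gp x y z" for x y z p
  proof -
    have "gp x y z \<le> 2 * dd x z" using dd_tri[of x y z] dd_sym[of z y] by (simp add: gp_def)
    then obtain q where q: "dd x q = dd x p" "dd q z = dd x z - dd x p"
      using dd_point[of "dd x p" x z] le by auto
    have "gp x p y = 2 * dd x p" using p by (simp add: betw_def gp_def)
    moreover have "gp x z q = 2 * dd x p" using q by (simp add: gp_def dd_sym)
    moreover have "gp x p q = 2 * dd x p - dd p q" using q by (simp add: gp_def)
    ultimately have "dd p q \<le> 2 * \<delta>"
      using hyp4D[OF assms, of x p y q] hyp4D[OF assms, of x y z q] le hyp4_nonneg[OF assms] by linarith
    then show ?thesis using q by (intro exI[of _ q]) (simp add: betw_def)
  qed
  show ?thesis unfolding slim_def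
  proof (intro allI impI)
    fix x y z p assume p: "betw x p y"
    show "\<exists>q. (betw x q z \<or> betw z q y) \<and> dd p q \<le> 2 * \<delta>"
    proof (cases "2 * dd x p \<le> gp x y z")
      case True then show ?thesis using main[OF p] by blast
    next
      case False
      have "betw y p x" using p by (simp add: betw_def dd_sym)
      moreover have "2 * dd y p \<le> gp y x z"
        using False p gp_swap[of x y z] dd_sym[of y p] by (simp add: betw_def)
      ultimately obtain q where "betw y q z" "dd p q \<le> 2 * \<delta>" using main by blast
      moreover from this have "betw z q y" using dd_sym[of z q] dd_sym[of q y] dd_sym[of z y] by (simp add: betw_def)
      ultimately show ?thesis by blast
    qed
  qed
qed

section \<open>Discrete geodesics\<close>

definition isgeo :: "(nat \<Rightarrow> 'a) \<Rightarrow> nat \<Rightarrow> bool" where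
  "isgeo \<gamma> n \<longleftrightarrow> (\<forall>i\<le>n. \<forall>j\<le>n. dd (\<gamma> i) (\<gamma> j) = \<bar>int i - int j\<bar>)"

lemma isgeoD: "isgeo \<gamma> n \<Longrightarrow> i \<le> j \<Longrightarrow> j \<le> n \<Longrightarrow> dd (\<gamma> i) (\<gamma> j) = int j - int i"
  by (auto simp: isgeo_def)

lemma isgeo_sub: "isgeo \<gamma> n \<Longrightarrow> i + m \<le> n \<Longrightarrow> isgeo (\<lambda>t. \<gamma> (i + t)) m"
  by (auto simp: isgeo_def)

lemma isgeo_betw: "isgeo \<gamma> n \<Longrightarrow> l \<le> n \<Longrightarrow> betw (\<gamma> 0) (\<gamma> l) (\<gamma> n)"
  using isgeoD[of \<gamma> n 0 l] isgeoD[of \<gamma> n l n] isgeoD[of \<gamma> n 0 n] by (simp add: betw_def)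

lemma isgeoI:
  assumes "\<And>i j. i \<le> j \<Longrightarrow> j \<le> n \<Longrightarrow> dd (\<gamma> i) (\<gamma> j) = int j - int i"
  shows "isgeo \<gamma> n"
  unfolding isgeo_def
proof (intro allI impI)
  fix i j assume "i \<le> n" "j \<le> n"
  then show "dd (\<gamma> i) (\<gamma> j) = \<bar>int i - int j\<bar>"
    using assms[of i j] assms[of j i] dd_sym[of "\<gamma> i" "\<gamma> j"] by (cases "i \<le> j") auto
qed

text \<open>The path ends at pseudo-distance 0 from \<open>y\<close> instead of at \<open>y\<close>:
  if \<open>x\<close> and \<open>y\<close> are different but at distance 0, the path of length 0 at
  \<open>x\<close> has to do.\<close>

lemma ex_geo: "\<exists>\<gamma> n. int n = dd x y \<and> \<gamma> 0 = x \<and> dd (\<gamma> n) y = 0 \<and> isgeo \<gamma> n"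
proof -
  have "\<exists>\<gamma>. \<gamma> 0 = x \<and> dd (\<gamma> n) y = 0 \<and> isgeo \<gamma> n" if "dd x y = int n" for n
    using that
  proof (induction n arbitrary: y)
    case 0
    then show ?case by (intro exI[of _ "\<lambda>_. x"]) (auto simp: isgeo_def)
  next
    case (Suc n)
    obtain z where z: "dd x z = int n" "dd z y = 1"
      using dd_point[of "int n" x y] Suc.prems by auto
    obtain \<gamma> where \<gamma>: "\<gamma> 0 = x" "dd (\<gamma> n) z = 0" "isgeo \<gamma> n" using Suc.IH[OF z(1)] by blast
    have yy: "dd (\<gamma> i) y = int (Suc n) - int i" if "i \<le> n" for i
    proof -
      have "dd (\<gamma> i) y \<le> int n - int i + 0 + 1"
        using dd_tri[of "\<gamma> i" y "\<gamma> n"] dd_tri[of "\<gamma> n" y z] z \<gamma>(2) isgeoD[OF \<gamma>(3) that] by simp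
      moreover have "dd x (\<gamma> i) = int i" using isgeoD[OF \<gamma>(3), of 0 i] that \<gamma>(1) by simp
      ultimately show ?thesis using dd_tri[of x y "\<gamma> i"] Suc.prems by simp
    qed
    have "isgeo (\<gamma>(Suc n := y)) (Suc n)"
      by (rule isgeoI) (auto simp: yy isgeoD[OF \<gamma>(3)] le_Suc_eq)
    then show ?case using \<gamma>(1) by (intro exI[of _ "\<gamma>(Suc n := y)"]) (simp del: fun_upd_apply, simp)
  qed
  moreover have "dd x y = int (nat (dd x y))" by simp
  ultimately show ?thesis by metis
qed

lemma geo_through:
  assumes "betw x p y"
  shows "\<exists>\<gamma> n l. \<gamma> 0 = x \<and> dd (\<gamma> n) y = 0 \<and> isgeo \<gamma> n \<and> l \<le> n \<and> dd (\<gamma> l) p = 0"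
proof -
  obtain \<gamma>1 l where 1: "int l = dd x p" "\<gamma>1 0 = x" "dd (\<gamma>1 l) p = 0" "isgeo \<gamma>1 l" using ex_geo by blast
  obtain \<gamma>2 m where 2: "int m = dd p y" "\<gamma>2 0 = p" "dd (\<gamma>2 m) y = 0" "isgeo \<gamma>2 m" using ex_geo by blast
  define \<gamma> where "\<gamma> i = (if i \<le> l then \<gamma>1 i else \<gamma>2 (i - l))" for i
  have x1: "dd x (\<gamma>1 i) = int i" if "i \<le> l" for i using isgeoD[OF 1(4), of 0 i] that 1(2) by simp
  have y2: "dd (\<gamma>2 j) y = int m - int j" if "j \<le> m" for j
    using isgeoD[OF 2(4) that] dd_tri[of "\<gamma>2 j" y "\<gamma>2 m"] dd_tri[of "\<gamma>2 j" "\<gamma>2 m" y] 2(3) dd_sym[of y "\<gamma>2 m"]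
    by simp
  have cross: "dd (\<gamma>1 i) (\<gamma>2 j) = int l - int i + int j" if "i \<le> l" "j \<le> m" for i j
  proof -
    have "dd (\<gamma>1 i) (\<gamma>2 j) \<le> (int l - int i) + 0 + int j"
      using dd_tri[of "\<gamma>1 i" "\<gamma>2 j" "\<gamma>1 l"] dd_tri[of "\<gamma>1 l" "\<gamma>2 j" p] isgeoD[OF 1(4) that(1)]
        isgeoD[OF 2(4), of 0 j] that 1 2 by simp
    moreover have "dd x y \<le> int i + dd (\<gamma>1 i) (\<gamma>2 j) + (int m - int j)"
      using dd_tri[of x y "\<gamma>1 i"] dd_tri[of "\<gamma>1 i" y "\<gamma>2 j"] x1[OF that(1)] y2[OF that(2)] by linarith
    ultimately show ?thesis using assms 1(1) 2(1) by (simp add: betw_def)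
  qed
  have "isgeo \<gamma> (l + m)"
  proof (rule isgeoI)
    fix i j assume "i \<le> j" "j \<le> l + m"
    then consider "j \<le> l" | "i \<le> l" "l < j" | "l < i" by linarith
    then show "dd (\<gamma> i) (\<gamma> j) = int j - int i"
    proof cases
      case 1 then show ?thesis using isgeoD[OF \<open>isgeo \<gamma>1 l\<close>] \<open>i \<le> j\<close> by (simp add: \<gamma>_def)
    next
      case 2 then show ?thesis using cross[of i "j - l"] \<open>j \<le> l + m\<close> by (simp add: \<gamma>_def)
    next
      case 3 then show ?thesis using isgeoD[OF \<open>isgeo \<gamma>2 m\<close>, of "i - l" "j - l"] \<open>i \<le> j\<close> \<open>j \<le> l + m\<close>
        by (simp add: \<gamma>_def)
    qed
  qed
  moreover have "dd (\<gamma> (l + m)) y = 0"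
  proof (cases "m = 0")
    case True
    then have "dd p y = 0" using 2 by simp
    then show ?thesis using True 1(3) dd_tri[of "\<gamma>1 l" y p] dd_nonneg[of "\<gamma>1 l" y] by (simp add: \<gamma>_def)
  next
    case False then show ?thesis using 2(3) by (simp add: \<gamma>_def)
  qed
  ultimately show ?thesis using 1 by (intro exI[of _ \<gamma>] exI[of _ "l + m"] exI[of _ l]) (auto simp: \<gamma>_def)
qed

text \<open>On a geodesic from \<open>x\<close> to \<open>y\<close>, the last vertex within
  \<open>h\<close> of the side from \<open>x\<close> to \<open>c\<close> is within
  \<open>h + 1\<close> of the side from \<open>c\<close> to \<open>y\<close>. Hence its distance
  from \<open>c\<close> is the Gromov product up to a constant, and slimness compares such
  distances.\<close>

lemma hyp4_of_slim:
  assumes "slim h" shows "hyp4 (6 * h + 2)"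
proof -
  have near: "\<exists>p. betw x p y \<and> 2 * dd c p \<le> gp c x y + 4 * h + 2" for c x y
  proof -
    obtain \<gamma> n where \<gamma>: "\<gamma> 0 = x" "dd (\<gamma> n) y = 0" "isgeo \<gamma> n" "int n = dd x y" using ex_geo by blast
    obtain q0 where "dd 1 q0 \<le> h"
      using assms[unfolded slim_def, rule_format, of 1 1 1 1] by (auto simp: betw_def)
    then have h0: "0 \<le> h" using dd_nonneg[of 1 q0] by linarith
    have bt: "betw x (\<gamma> k) y" if "k \<le> n" for k
      using isgeoD[OF \<gamma>(3), of 0 k] isgeoD[OF \<gamma>(3) that] that \<gamma> dd_tri[of "\<gamma> k" y "\<gamma> n"]
        dd_tri[of x y "\<gamma> k"] by (simp add: betw_def)
    define A where "A = {k. k \<le> n \<and> (\<exists>q. betw x q c \<and> dd (\<gamma> k) q \<le> h)}"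
    have "0 \<in> A" using \<gamma>(1) h0 by (auto simp: A_def betw_def intro!: exI[of _ x])
    moreover have fin: "finite A" by (simp add: A_def)
    ultimately have "Max A \<in> A" by (intro Max_in) auto
    define k where "k = Max A"
    obtain q where k: "k \<le> n" and q: "betw x q c" "dd (\<gamma> k) q \<le> h"
      using \<open>Max A \<in> A\<close> by (auto simp: A_def k_def)
    have "\<exists>q'. betw c q' y \<and> dd (\<gamma> k) q' \<le> h + 1"
    proof (cases "k = n")
      case True
      then show ?thesis using \<gamma>(2) h0 by (intro exI[of _ y]) (auto simp: betw_def)
    next
      case False
      then have k1: "Suc k \<le> n" using k by simp
      have "Suc k \<notin> A" using Max_ge[OF fin, of "Suc k"] unfolding k_def by linarith
      then have "\<nexists>q. betw x q c \<and> dd (\<gamma> (Suc k)) q \<le> h" using k1 by (simp add: A_def)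
      then obtain q' where q': "betw c q' y" "dd (\<gamma> (Suc k)) q' \<le> h"
        using assms[unfolded slim_def, rule_format, OF bt[OF k1], of c] by blast
      moreover have "dd (\<gamma> k) q' \<le> h + 1"
        using dd_tri[of "\<gamma> k" q' "\<gamma> (Suc k)"] isgeoD[OF \<gamma>(3), of k "Suc k"] k1 q'(2) by simp
      ultimately show ?thesis by blast
    qed
    then obtain q' where q': "betw c q' y" "dd (\<gamma> k) q' \<le> h + 1" by blast
    have "dd x (\<gamma> k) \<le> dd x q + h" "dd (\<gamma> k) y \<le> dd q' y + h + 1"
      using dd_tri[of x "\<gamma> k" q] dd_tri[of "\<gamma> k" y q'] dd_sym[of q "\<gamma> k"] q(2) q'(2) by linarith+
    moreover have "dd c (\<gamma> k) \<le> dd q c + h" "dd c (\<gamma> k) \<le> dd c q' + h + 1"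
      using dd_tri[of c "\<gamma> k" q] dd_tri[of c "\<gamma> k" q'] dd_sym[of q "\<gamma> k"] dd_sym[of q' "\<gamma> k"]
        dd_sym[of c q] q(2) q'(2) by linarith+
    moreover have "gp c x y = dd x q + dd q c + (dd c q' + dd q' y) - (dd x (\<gamma> k) + dd (\<gamma> k) y)"
      using q(1) q'(1) bt[OF k] dd_sym[of c x] unfolding betw_def gp_def by linarith
    ultimately have "2 * dd c (\<gamma> k) \<le> gp c x y + 4 * h + 2" by linarith
    then show ?thesis using bt[OF k] by blast
  qed
  have gp_le: "gp c x y \<le> 2 * dd c q" if "betw x q y" for c x y q
    using dd_tri[of c x q] dd_tri[of c y q] that dd_sym[of q x] by (simp add: gp_def betw_def)
  show ?thesis unfolding hyp4_def
  proof (intro allI)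
    fix c x y z
    obtain p where p: "betw x p z" "2 * dd c p \<le> gp c x z + 4 * h + 2" using near by blast
    obtain q where q: "betw x q y \<or> betw y q z" "dd p q \<le> h"
      using assms[unfolded slim_def, rule_format, OF p(1), of y] by blast
    show "min (gp c x y) (gp c y z) - (6 * h + 2) \<le> gp c x z"
      using q(1)
    proof
      assume "betw x q y"
      then show ?thesis using gp_le[of x q y c] dd_tri[of c q p] q(2) p(2) by linarith
    next
      assume "betw y q z"
      then show ?thesis using gp_le[of y q z c] dd_tri[of c q p] q(2) p(2) by linarith
    qed
  qed
qed

end

subsection \<open>Guessing geodesics\<close>

text \<open>Bowditch's criterion: a family of connected sets with slim triangles determines the geodesics up to a bounded error.\<close>

context lenspace begin

context
  fixes \<eta> :: "'a \<Rightarrow> 'a \<Rightarrow> 'a set" and h :: nat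
  assumes path: "\<And>x y. \<exists>e n. e 0 = x \<and> e n = y \<and> (\<forall>i\<le>n. e i \<in> \<eta> x y) \<and>
                  (\<forall>i<n. dd (e i) (e (Suc i)) \<le> int h)"
    and short: "\<And>x y p. dd x y \<le> 1 \<Longrightarrow> p \<in> \<eta> x y \<Longrightarrow> dd x p \<le> int h"
    and thin: "\<And>x y z p. p \<in> \<eta> x y \<Longrightarrow> \<exists>q\<in>\<eta> x z \<union> \<eta> z y. dd p q \<le> int h"
begin

text \<open>Each halving of the parameter interval costs \<open>h\<close>, and after
  \<open>k\<close> halvings the ends are at distance at most 1.\<close>

lemma guess_log:
  assumes g: "isgeo \<gamma> n" and ij: "i \<le> j" "j \<le> n" "j - i \<le> 2 ^ k" and p: "p \<in> \<eta> (\<gamma> i) (\<gamma> j)"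
  shows "\<exists>l. i \<le> l \<and> l \<le> j \<and> dd p (\<gamma> l) \<le> int (h * (k + 1))"
  using ij p
proof (induction k arbitrary: i j p)
  case 0
  then have "dd (\<gamma> i) (\<gamma> j) \<le> 1" using isgeoD[OF g] by simp
  then show ?case using short[of "\<gamma> i" "\<gamma> j" p] 0 dd_sym by (intro exI[of _ i]) auto
next
  case (Suc k)
  define m where "m = i + (j - i) div 2"
  have m: "i \<le> m" "m \<le> j" "m - i \<le> 2 ^ k" "j - m \<le> 2 ^ k" using Suc.prems by (auto simp: m_def)
  obtain q where q: "q \<in> \<eta> (\<gamma> i) (\<gamma> m) \<union> \<eta> (\<gamma> m) (\<gamma> j)" "dd p q \<le> int h" using thin[OF Suc.prems(4)] by blast
  have "\<exists>l. i \<le> l \<and> l \<le> j \<and> dd q (\<gamma> l) \<le> int (h * (k + 1))"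
    using q(1)
  proof
    assume "q \<in> \<eta> (\<gamma> i) (\<gamma> m)"
    then show ?thesis using Suc.IH[of i m q] m Suc.prems by (meson le_trans)
  next
    assume "q \<in> \<eta> (\<gamma> m) (\<gamma> j)"
    then show ?thesis using Suc.IH[of m j q] m Suc.prems by (meson le_trans)
  qed
  then obtain l where "i \<le> l" "l \<le> j" "dd q (\<gamma> l) \<le> int (h * (k + 1))" by blast
  moreover from this have "dd p (\<gamma> l) \<le> int (h * (Suc k + 1))"
    using dd_tri[of p "\<gamma> l" q] q(2) by (simp add: algebra_simps)
  ultimately show ?case by blast
qed

text \<open>Cut the geodesic at distance \<open>3 * D\<close> on both sides of a point within
  \<open>D\<close> of \<open>p\<close>. The guessed sets of the outer parts stay within
  \<open>D\<close> of points that are too far away, unless \<open>D\<close> is small. So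
  \<open>p\<close> is close to the guessed set of the middle part, whose length is at most
  \<open>6 * D\<close>, and there the logarithmic bound applies.\<close>

lemma guess_near_bound:
  assumes least: "\<And>\<gamma> m p. isgeo \<gamma> m \<Longrightarrow> m \<le> n \<Longrightarrow> p \<in> \<eta> (\<gamma> 0) (\<gamma> m) \<Longrightarrow> \<exists>l\<le>m. dd p (\<gamma> l) \<le> int D"
    and g: "isgeo \<gamma> m" "m \<le> n" and p: "p \<in> \<eta> (\<gamma> 0) (\<gamma> m)" and far: "\<And>l. l \<le> m \<Longrightarrow> int D \<le> dd p (\<gamma> l)"
    and k: "6 * D \<le> 2 ^ k"
  shows "D \<le> h * (k + 3)"
proof -
  obtain l where l: "l \<le> m" "dd p (\<gamma> l) \<le> int D" using least[OF g p] by blast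
  define i where "i = l - 3 * D"
  define j where "j = min m (l + 3 * D)"
  have ij: "i \<le> l" "l \<le> j" "j \<le> m" "j - i \<le> 6 * D" by (auto simp: i_def j_def l)
  have h3: "h \<le> h * (k + 3)" "2 * h \<le> h * (k + 3)" "3 * h \<le> h * (k + 3)" by (auto simp: algebra_simps)
  obtain q1 where q1: "q1 \<in> \<eta> (\<gamma> 0) (\<gamma> i) \<union> \<eta> (\<gamma> i) (\<gamma> m)" "dd p q1 \<le> int h" using thin[OF p] by blast
  show ?thesis
  proof (cases "q1 \<in> \<eta> (\<gamma> 0) (\<gamma> i)")
    case True
    show ?thesis
    proof (cases "i = 0")
      case i0: True
      then have "dd (\<gamma> 0) q1 \<le> int h" using short[of "\<gamma> 0" "\<gamma> 0" q1] True by simp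
      then have "dd p (\<gamma> 0) \<le> 2 * int h" using dd_tri[of p "\<gamma> 0" q1] q1(2) dd_sym[of "\<gamma> 0" q1] by linarith
      then show ?thesis using far[of 0] h3 by linarith
    next
      case i0: False
      have "isgeo \<gamma> i" using isgeo_sub[OF g(1), of 0 i] ij by simp
      then obtain l' where l': "l' \<le> i" "dd q1 (\<gamma> l') \<le> int D" using least[of \<gamma> i q1] True ij g(2) by auto
      have "dd (\<gamma> l) (\<gamma> l') \<ge> 3 * int D"
        using isgeoD[OF g(1), of l' l] dd_sym[of "\<gamma> l'" "\<gamma> l"] l' ij l i0 by (simp add: i_def)
      moreover have "dd (\<gamma> l) (\<gamma> l') \<le> int D + int h + int D"
        using dd_tri[of "\<gamma> l" "\<gamma> l'" p] dd_tri[of p "\<gamma> l'" q1] dd_sym[of "\<gamma> l" p] l l' q1 by linarith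
      ultimately show ?thesis using h3 by linarith
    qed
  next
    case False
    then obtain q2 where q2: "q2 \<in> \<eta> (\<gamma> i) (\<gamma> j) \<union> \<eta> (\<gamma> j) (\<gamma> m)" "dd q1 q2 \<le> int h" using q1 thin by blast
    have pq2: "dd p q2 \<le> 2 * int h" using dd_tri[of p q2 q1] q1 q2 by linarith
    show ?thesis
    proof (cases "q2 \<in> \<eta> (\<gamma> i) (\<gamma> j)")
      case True
      then obtain t where t: "i \<le> t" "t \<le> j" "dd q2 (\<gamma> t) \<le> int (h * (k + 1))"
        using guess_log[OF g(1), of i j k q2] ij k by (meson le_trans)
      then have "int D \<le> 2 * int h + int (h * (k + 1))"
        using far[of t] dd_tri[of p "\<gamma> t" q2] pq2 ij by linarith
      then show ?thesis by (simp add: algebra_simps flip: of_nat_add of_nat_mult)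
    next
      case False
      then have q2m: "q2 \<in> \<eta> (\<gamma> j) (\<gamma> m)" using q2 by blast
      show ?thesis
      proof (cases "j = m")
        case True
        then have "dd (\<gamma> m) q2 \<le> int h" using short[of "\<gamma> m" "\<gamma> m" q2] q2m by simp
        then have "dd p (\<gamma> m) \<le> 3 * int h" using dd_tri[of p "\<gamma> m" q2] pq2 dd_sym[of "\<gamma> m" q2] by linarith
        then show ?thesis using far[of m] h3 by linarith
      next
        case jm: False
        have "isgeo (\<lambda>t. \<gamma> (j + t)) (m - j)" using isgeo_sub[OF g(1), of j "m - j"] ij by simp
        moreover have "m - j \<le> n" "j + (m - j) = m" using g(2) ij by auto
        ultimately obtain l' where l': "l' \<le> m - j" "dd q2 (\<gamma> (j + l')) \<le> int D"
          using least[of "\<lambda>t. \<gamma> (j + t)" "m - j" q2] q2m by auto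
        have "dd (\<gamma> l) (\<gamma> (j + l')) \<ge> 3 * int D"
          using isgeoD[OF g(1), of l "j + l'"] l' ij jm by (simp add: j_def min_def split: if_splits)
        moreover have "dd (\<gamma> l) (\<gamma> (j + l')) \<le> int D + 2 * int h + int D"
          using dd_tri[of "\<gamma> l" "\<gamma> (j + l')" p] dd_tri[of p "\<gamma> (j + l')" q2] dd_sym[of "\<gamma> l" p] l l' pq2 by linarith
        ultimately show ?thesis using h3 by linarith
      qed
    qed
  qed
qed

text \<open>For geodesics of length at most \<open>m\<close> some bound exists by
  \<open>guess_log\<close>. The least one, \<open>D\<close>, is attained by some geodesic and some
  point, to which \<open>guess_near_bound\<close> applies; the resulting \<open>H\<close> does not
  depend on \<open>m\<close>.\<close>

lemma guess_near:
  "\<exists>H. \<forall>\<gamma> m p. isgeo \<gamma> m \<longrightarrow> p \<in> \<eta> (\<gamma> 0) (\<gamma> m) \<longrightarrow> (\<exists>l\<le>m. dd p (\<gamma> l) \<le> int H)"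
proof -
  obtain H where H: "\<And>D. (\<And>k. 6 * D \<le> 2 ^ k \<Longrightarrow> D \<le> h * (k + 3)) \<Longrightarrow> D \<le> H"
    using log_bound[of h] by blast
  have "\<exists>l\<le>m. dd p (\<gamma> l) \<le> int H" if g: "isgeo \<gamma> m" and p: "p \<in> \<eta> (\<gamma> 0) (\<gamma> m)" for \<gamma> m p
  proof -
    define Q where "Q D \<longleftrightarrow> (\<forall>\<gamma>' m' p'. isgeo \<gamma>' m' \<longrightarrow> m' \<le> m \<longrightarrow> p' \<in> \<eta> (\<gamma>' 0) (\<gamma>' m') \<longrightarrow>
                        (\<exists>l\<le>m'. dd p' (\<gamma>' l) \<le> int D))" for D
    have "Q (h * (m + 1))" unfolding Q_def
    proof (intro allI impI)
      fix \<gamma>' m' p' assume a: "isgeo \<gamma>' m'" "m' \<le> m" "p' \<in> \<eta> (\<gamma>' 0) (\<gamma>' m')"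
      have "m < 2 ^ m" by simp
      then have "m' - 0 \<le> 2 ^ m" using a(2) by linarith
      then show "\<exists>l\<le>m'. dd p' (\<gamma>' l) \<le> int (h * (m + 1))" using guess_log[OF a(1) le0 le_refl _ a(3)] by blast
    qed
    define D where "D = (LEAST D. Q D)"
    have QD: "Q D" unfolding D_def by (rule LeastI) fact
    have "D \<le> H"
    proof (cases "D = 0")
      case False
      then have "\<not> Q (D - 1)" unfolding D_def by (intro not_less_Least) auto
      then obtain \<gamma>' m' p' where c: "isgeo \<gamma>' m'" "m' \<le> m" "p' \<in> \<eta> (\<gamma>' 0) (\<gamma>' m')"
        and f: "\<And>l. l \<le> m' \<Longrightarrow> \<not> dd p' (\<gamma>' l) \<le> int (D - 1)"
        unfolding Q_def by blast
      have far: "int D \<le> dd p' (\<gamma>' l)" if "l \<le> m'" for l using f[OF that] False by linarith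
      show ?thesis
      proof (rule H)
        fix k assume k: "6 * D \<le> 2 ^ k"
        show "D \<le> h * (k + 3)"
        proof (rule guess_near_bound[OF _ c _ k])
          show "\<exists>l\<le>k. dd p (\<gamma> l) \<le> int D" if "isgeo \<gamma> k" "k \<le> m" "p \<in> \<eta> (\<gamma> 0) (\<gamma> k)" for \<gamma> k p
            using QD that unfolding Q_def by blast
        qed (rule far)
      qed
    qed simp
    then show ?thesis using QD g p unfolding Q_def by (meson le_refl of_nat_mono order_trans)
  qed
  then show ?thesis by blast
qed

text \<open>Conversely, geodesics stay close to \<open>\<eta>\<close>: along a path in
  \<open>\<eta>\<close> from end to end, the positions of nearby points of the geodesic run from its
  start to its end without large forward jumps, so every position is nearly met. Slimness of the
  guessed triangles then passes to geodesics.\<close>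

lemma guess_slim: "\<exists>H. slim (int H)"
proof -
  obtain H where H: "\<And>\<gamma> m p. isgeo \<gamma> m \<Longrightarrow> p \<in> \<eta> (\<gamma> 0) (\<gamma> m) \<Longrightarrow> \<exists>l\<le>m. dd p (\<gamma> l) \<le> int H"
    using guess_near by blast
  define H1 where "H1 = H + 2 * h"
  have near: "\<exists>l\<le>m. dd p (\<gamma> l) \<le> int H1"
    if g: "isgeo \<gamma> m" and y: "dd (\<gamma> m) y = 0" and p: "p \<in> \<eta> (\<gamma> 0) y" for \<gamma> m p y
  proof -
    obtain q where q: "q \<in> \<eta> (\<gamma> 0) (\<gamma> m) \<union> \<eta> (\<gamma> m) y" "dd p q \<le> int h" using thin[OF p] by blast
    show ?thesis
    proof (cases "q \<in> \<eta> (\<gamma> 0) (\<gamma> m)")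
      case True
      then obtain l where l: "l \<le> m" "dd q (\<gamma> l) \<le> int H" using H[OF g] by blast
      then have "dd p (\<gamma> l) \<le> int H1" using dd_tri[of p "\<gamma> l" q] q(2) by (simp add: H1_def)
      then show ?thesis using l by blast
    next
      case False
      then have "dd (\<gamma> m) q \<le> int h" using q short[of "\<gamma> m" y q] y by simp
      then have "dd p (\<gamma> m) \<le> int H1" using dd_tri[of p "\<gamma> m" q] q(2) dd_sym[of q "\<gamma> m"] by (simp add: H1_def)
      then show ?thesis by blast
    qed
  qed
  have close: "\<exists>e\<in>\<eta> (\<gamma> 0) y. dd (\<gamma> l) e \<le> 3 * int H1 + int h"
    if g: "isgeo \<gamma> n" and y: "dd (\<gamma> n) y = 0" and l: "l \<le> n" for \<gamma> n l y
  proof -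
    obtain e N where e: "e 0 = \<gamma> 0" "e N = y" "\<And>i. i \<le> N \<Longrightarrow> e i \<in> \<eta> (\<gamma> 0) y"
      "\<And>i. i < N \<Longrightarrow> dd (e i) (e (Suc i)) \<le> int h" using path[of "\<gamma> 0" y] by blast
    have "\<exists>t. t \<le> n \<and> dd (e i) (\<gamma> t) \<le> int H1 \<and> (i = 0 \<longrightarrow> t = 0)" if "i \<le> N" for i
      using near[OF g y e(3)[OF that]] e(1) by (cases "i = 0") auto
    then obtain t where t: "\<And>i. i \<le> N \<Longrightarrow> t i \<le> n" "\<And>i. i \<le> N \<Longrightarrow> dd (e i) (\<gamma> (t i)) \<le> int H1" "t 0 = 0"
      by (metis le0)
    define A where "A = {i. i \<le> N \<and> t i \<le> l}"
    have fin: "finite A" and "0 \<in> A" using t(3) by (auto simp: A_def)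
    then have MA: "Max A \<in> A" by (intro Max_in) auto
    define i where "i = Max A"
    have i: "i \<le> N" "t i \<le> l" using MA by (auto simp: A_def i_def)
    have tl: "dd (\<gamma> (t i)) (\<gamma> l) = int l - int (t i)" using isgeoD[OF g i(2) l] .
    have gap: "int l - int (t i) \<le> 2 * int H1 + int h"
    proof (cases "i = N")
      case True
      have "int n - int (t i) \<le> int H1"
        using isgeoD[OF g t(1)[OF i(1)] le_refl] t(2)[OF i(1)] True e(2) y
          dd_tri[of "\<gamma> (t i)" "\<gamma> n" y] dd_sym[of y "\<gamma> n"] dd_sym[of y "\<gamma> (t i)"] by simp
      then show ?thesis using l by linarith
    next
      case False
      then have N: "Suc i \<le> N" using i by simp
      then have "Suc i \<notin> A" using Max_ge[OF fin, of "Suc i"] unfolding i_def by linarith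
      then have "l < t (Suc i)" using N by (simp add: A_def)
      moreover have "dd (\<gamma> (t i)) (\<gamma> (t (Suc i))) = int (t (Suc i)) - int (t i)"
        using isgeoD[OF g _ t(1)[OF N], of "t i"] i \<open>l < t (Suc i)\<close> by simp
      moreover have "dd (\<gamma> (t i)) (\<gamma> (t (Suc i))) \<le> int H1 + int h + int H1"
        using dd_tri[of "\<gamma> (t i)" "\<gamma> (t (Suc i))" "e i"] dd_tri[of "e i" "\<gamma> (t (Suc i))" "e (Suc i)"]
          dd_sym[of "\<gamma> (t i)" "e i"] t(2)[OF i(1)] t(2)[OF N] e(4)[of i] N by linarith
      ultimately show ?thesis by linarith
    qed
    have "dd (\<gamma> l) (e i) \<le> 3 * int H1 + int h"
      using dd_tri[of "\<gamma> l" "e i" "\<gamma> (t i)"] dd_sym[of "\<gamma> l" "\<gamma> (t i)"] dd_sym[of "e i" "\<gamma> (t i)"] tl gap t(2)[OF i(1)]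
      by linarith
    then show ?thesis using e(3)[OF i(1)] by blast
  qed
  have side: "\<exists>b. betw x b y \<and> dd q b \<le> int H1" if q: "q \<in> \<eta> x y" for x y q
  proof -
    obtain \<gamma> n where \<gamma>: "\<gamma> 0 = x" "dd (\<gamma> n) y = 0" "isgeo \<gamma> n" using ex_geo by blast
    obtain l where l: "l \<le> n" "dd q (\<gamma> l) \<le> int H1" using near[OF \<gamma>(3,2)] q \<gamma>(1) by blast
    have e: "dd a y = dd a (\<gamma> n)" for a
      using dd_tri[of a y "\<gamma> n"] dd_tri[of a "\<gamma> n" y] dd_sym[of y "\<gamma> n"] \<gamma>(2) by linarith
    have "betw x (\<gamma> l) y" using isgeo_betw[OF \<gamma>(3) l(1)] \<gamma>(1) e by (simp add: betw_def)
    then show ?thesis using l by blast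
  qed
  have "slim (int (4 * H1 + 2 * h))"
    unfolding slim_def
  proof (intro allI impI)
    fix x y z p assume "betw x p y"
    then obtain \<gamma> n l where \<gamma>: "\<gamma> 0 = x" "dd (\<gamma> n) y = 0" "isgeo \<gamma> n" "l \<le> n" "dd (\<gamma> l) p = 0"
      using geo_through by blast
    obtain e where e: "e \<in> \<eta> x y" "dd (\<gamma> l) e \<le> 3 * int H1 + int h" using close[OF \<gamma>(3,2,4)] \<gamma>(1) by blast
    obtain e' where e': "e' \<in> \<eta> x z \<union> \<eta> z y" "dd e e' \<le> int h" using thin[OF e(1)] by blast
    have bd: "dd p b \<le> int (4 * H1 + 2 * h)" if "dd e' b \<le> int H1" for b
      using dd_tri[of p b "\<gamma> l"] dd_tri[of "\<gamma> l" b e] dd_tri[of e b e'] that \<gamma>(5) e(2) e'(2) dd_sym[of p "\<gamma> l"] by simp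
    show "\<exists>q. (betw x q z \<or> betw z q y) \<and> dd p q \<le> int (4 * H1 + 2 * h)"
      using e'(1) side bd by blast
  qed
  then show ?thesis by blast
qed

end

end

subsection \<open>Elements of infinite order\<close>

text \<open>\<open>R\<close> is the kernel of the pseudo-length and balls are finite up to
  \<open>R\<close>: the quotient by \<open>R\<close> is a hyperbolic group with a proper word
  metric.\<close>

locale hypgrp = lenspace len for len :: "'a::grp \<Rightarrow> nat" +
  fixes R :: "'a set" and \<delta> :: int
  assumes nR: "nsub R" and len0: "len x = 0 \<longleftrightarrow> x \<in> R"
    and hyp: "hyp4 \<delta>"
    and proper: "\<exists>A. finite A \<and> (\<forall>x. len x \<le> n \<longrightarrow> (\<exists>a\<in>A. inverse x * a \<in> R))"
begin

definition cg :: "'a \<Rightarrow> 'a \<Rightarrow> bool" where "cg x y \<longleftrightarrow> inverse x * y \<in> R"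

lemma cg_refl [simp]: "cg x x" by (simp add: cg_def left_inv nsubD[OF nR])

lemma cg_sym: "cg x y \<Longrightarrow> cg y x"
  using nsubD(3)[OF nR, of "inverse x * y"] by (simp add: cg_def gsimps)

lemma cg_trans: "cg x y \<Longrightarrow> cg y z \<Longrightarrow> cg x z"
  using nsubD(2)[OF nR, of "inverse x * y" "inverse y * z"] by (simp add: cg_def gsimps)

lemma cg_mult: "cg x y \<Longrightarrow> cg x' y' \<Longrightarrow> cg (x * x') (y * y')"
proof -
  assume a: "cg x y" "cg x' y'"
  have "inverse (x * x') * (y * y') = (inverse x' * (inverse x * y) * x') * (inverse x' * y')"
    by (simp add: gsimps)
  then show ?thesis using a nsubD(2,5)[OF nR] unfolding cg_def by metis
qed

lemma cg_inverse: "cg x y \<Longrightarrow> cg (inverse x) (inverse y)"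
proof -
  assume "cg x y"
  then have "x * inverse (inverse x * y) * inverse x \<in> R" unfolding cg_def by (intro nsubD(4)[OF nR] nsubD(3)[OF nR])
  then show ?thesis by (simp add: cg_def gsimps)
qed

lemma cg_powi: "cg x y \<Longrightarrow> cg (x powi i) (y powi i)"
proof -
  have p: "cg x y \<Longrightarrow> cg (x ^ n) (y ^ n)" for n x y by (induction n) (auto intro: cg_mult)
  assume "cg x y"
  then show ?thesis unfolding power_int_def by (auto intro: p cg_inverse)
qed

lemma cg_dd: "cg x y \<longleftrightarrow> dd x y = 0" by (simp add: cg_def dd_def len0)

lemma cg_dd_eq: "cg x y \<Longrightarrow> dd x z = dd y z"
  using dd_tri[of x z y] dd_tri[of y z x] dd_sym[of x y] by (simp add: cg_dd)

lemma cg_len: "cg x y \<Longrightarrow> len x = len y"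
  using cg_dd_eq[of x y 1] dd_one dd_sym by (metis of_nat_eq_iff)

lemma dnn: "0 \<le> \<delta>" using hyp4_nonneg[OF hyp] .

lemma pigeon: "\<exists>M. \<forall>f::nat \<Rightarrow> 'a. (\<forall>i\<le>M. int (len (f i)) \<le> C) \<longrightarrow> (\<exists>i j. i < j \<and> j \<le> M \<and> cg (f i) (f j))"
proof -
  obtain A where A: "finite A" "\<And>x. len x \<le> nat C \<Longrightarrow> \<exists>a\<in>A. cg x a"
    using proper[of "nat C"] unfolding cg_def by blast
  show ?thesis
  proof (rule exI[of _ "card A"], intro allI impI)
    fix f :: "nat \<Rightarrow> 'a" assume f: "\<forall>i\<le>card A. int (len (f i)) \<le> C"
    have "\<exists>a\<in>A. cg (f i) a" if "i \<le> card A" for i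
      using A(2)[of "f i"] f that by (metis nat_int nat_mono)
    then obtain a where a: "\<And>i. i \<le> card A \<Longrightarrow> a i \<in> A \<and> cg (f i) (a i)" by metis
    have "\<not> inj_on a {..card A}"
    proof
      assume "inj_on a {..card A}"
      then have "card {..card A} \<le> card A" using a by (intro card_inj_on_le[OF _ _ A(1)]) auto
      then show False by simp
    qed
    then obtain i j where ij: "i \<le> card A" "j \<le> card A" "i \<noteq> j" "a i = a j" by (auto simp: inj_on_def)
    then have "cg (f i) (f j)" using a cg_trans cg_sym by metis
    then show "\<exists>i j. i < j \<and> j \<le> card A \<and> cg (f i) (f j)"
      using ij cg_sym by (metis linorder_neqE_nat)
  qed
qed

lemma powi_diff_mod: "cg (x powi i) (x powi j) \<Longrightarrow> x powi (j - i) \<in> R"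
  using powi_add[of x "- i" j] by (simp add: cg_def powi_neg)

lemma unbounded_powers:
  assumes "\<And>n. n > 0 \<Longrightarrow> w ^ n \<notin> R" shows "\<exists>k. int (len (w ^ k)) > C"
proof (rule ccontr)
  assume "\<not> ?thesis"
  then have b: "\<And>k. int (len (w ^ k)) \<le> C" by (meson not_le)
  obtain i j where ij: "i < j" "cg (w ^ i) (w ^ j)" using pigeon[of C] b by blast
  have "w powi (int j - int i) \<in> R" using powi_diff_mod[of w "int i" "int j"] ij(2) by (simp add: powi_nat)
  moreover have "int j - int i = int (j - i)" using ij by simp
  ultimately show False using assms[of "j - i"] ij powi_nat by (metis zero_less_diff)
qed

lemma len_power_le: "len (w ^ n) \<le> n * len w"
proof (induction n)
  case (Suc n)
  then show ?case using len_mult[of w "w ^ n"] by simp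
qed simp

text \<open>Points with small Gromov product lie near a geodesic from \<open>X\<close> to
  \<open>Y\<close>, on which the distance from \<open>X\<close> is a coordinate.\<close>

lemma near_points:
  assumes "gp c X Y \<le> \<epsilon>" "gp d X Y \<le> \<epsilon>"
  shows "dd c d \<le> \<bar>dd X c - dd X d\<bar> + \<epsilon> + \<delta>"
proof -
  have "gp X c Y \<ge> 2 * dd X c - \<epsilon>" "gp X Y d \<ge> 2 * dd X d - \<epsilon>"
    using assms gp_swap[of X c Y] gp_swap[of X d Y] gp_sym[of X Y d] by linarith+
  moreover have "gp X c Y - \<delta> \<le> gp X c d \<or> gp X Y d - \<delta> \<le> gp X c d" using hyp4D[OF hyp] .
  moreover have "dd c d = dd X c + dd X d - gp X c d" by (simp add: gp_def)
  ultimately show ?thesis by linarith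
qed

lemma gp_middle:
  assumes "gp q X Y \<le> 2 * \<delta>" "gp q X p > 3 * \<delta>" "gp q r Y > 4 * \<delta>" shows "gp q p r \<le> 4 * \<delta>"
proof -
  have "gp q p Y \<le> 3 * \<delta>" using hyp4D[OF hyp, of q X p Y] assms(1,2) by linarith
  then show ?thesis using hyp4D[OF hyp, of q p r Y] assms(3) by linarith
qed

lemma gp_big: "gp q x y \<ge> 2 * dd q x - 2 * dd x y"
  using dd_tri[of q x y] dd_sym[of x y] by (simp add: gp_def)

text \<open>Small powers of \<open>w\<close> commute with \<open>w ^ k\<close> and so move both ends
  of a long geodesic from 1 to \<open>w ^ k\<close> only a little; they shift its midpoint
  \<open>p\<close> along it. One of the shifts exceeds \<open>C\<close>, since otherwise two
  conjugates of powers would agree modulo \<open>R\<close> by pigeonhole. Then \<open>p\<close>,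
  \<open>w ^ j * p\<close> and \<open>w ^ j * (w ^ j * p)\<close> advance in one direction, which
  bounds the length of the square from below.\<close>

lemma loxodromic:
  assumes w: "\<And>n. n > 0 \<Longrightarrow> w ^ n \<notin> R" and C: "C \<ge> 4 * \<delta>"
  shows "\<exists>p j. j > 0 \<and> int (len (inverse p * w ^ j * p)) > C \<and>
     2 * int (len (inverse p * w ^ j * p)) - int (len ((inverse p * w ^ j * p) ^ 2)) \<le> 4 * \<delta>"
proof -
  obtain M where M: "\<And>f::nat \<Rightarrow> 'a. (\<And>i. i \<le> M \<Longrightarrow> int (len (f i)) \<le> C + 3 * \<delta>) \<Longrightarrow> \<exists>i j. i < j \<and> j \<le> M \<and> cg (f i) (f j)"
    using pigeon[of "C + 3 * \<delta>"] by blast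
  define e where "e = int (M * len w)"
  \<comment> \<open>\<open>M\<close> and \<open>e\<close> are fixed first: powers up to
    \<open>M\<close> move the ends by at most \<open>e\<close>, however long the geodesic
    is.\<close>
  obtain k where k: "int (len (w ^ k)) > 2 * e + 10 * \<delta> + 2 * C + 10" using unbounded_powers[OF w] by blast
  define Y where "Y = w ^ k"
  define n where "n = dd 1 Y"
  have n: "n > 2 * e + 10 * \<delta> + 2 * C + 10" using k by (simp add: n_def Y_def dd_one)
  have e0: "e \<ge> 0" by (simp add: e_def)
  have "2 * (n div 2) \<ge> n - 1" "2 * (n div 2) \<le> n" by linarith+
  then obtain h where half: "2 * h \<ge> n - 1" "2 * h \<le> n" by blast
  have "0 \<le> h" "h \<le> n" using half n e0 dnn C by linarith+
  then obtain p where p: "dd 1 p = h" "dd p Y = n - h"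
    unfolding n_def using dd_point by metis
  have we: "dd z (w ^ j * z') \<le> e" if "j \<le> M" "z = z'" "w ^ j * z = z * w ^ j" for j z z'
  proof -
    have "inverse z * (w ^ j * z) = w ^ j" using that(3) by (simp add: gsimps)
    then have "dd z (w ^ j * z') = int (len (w ^ j))" using that(2) by (simp add: dd_def)
    also have "\<dots> \<le> int (j * len w)" using len_power_le by (simp only: of_nat_le_iff)
    also have "\<dots> \<le> e" unfolding e_def using that(1) by (simp add: mult_right_mono)
    finally show ?thesis .
  qed
  have com: "w ^ j * Y = Y * w ^ j" for j unfolding Y_def by (metis add.commute power_add)
  have we1: "dd 1 (w ^ j) \<le> e" if "j \<le> M" for j using we[OF that, of 1 1] by simp
  have weY: "dd Y (w ^ j * Y) \<le> e" if "j \<le> M" for j using we[OF that _ com] by simp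
  define q where "q j = w ^ j * p" for j
  define s where "s j = dd 1 (q j) - dd 1 p" for j
  have gq: "gp (q j) 1 Y \<le> 2 * \<delta>" if j: "j \<le> M" for j
  proof -
    have z: "gp (q j) (w ^ j) (w ^ j * Y) = 0"
      using gp_left[of "w ^ j" p 1 Y] p dd_sym[of 1 p] by (simp add: q_def gp_def n_def)
    have "dd (q j) (w ^ j) = h" "dd (q j) (w ^ j * Y) = n - h"
      using dd_left[of "w ^ j" p 1] p dd_sym[of 1 p] by (simp_all add: q_def)
    then have "gp (q j) (w ^ j) 1 > 2 * \<delta>" "gp (q j) Y (w ^ j * Y) > 2 * \<delta>"
      using gp_big[of "q j" "w ^ j" 1] gp_big[of "q j" "w ^ j * Y" Y] gp_sym[of "q j" Y "w ^ j * Y"] n half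
        we1[OF j] weY[OF j] dd_sym[of "w ^ j" 1] dd_sym[of "w ^ j * Y" Y] dnn C by linarith+
    then show ?thesis
      using hyp4D[OF hyp, of "q j" "w ^ j" 1 "w ^ j * Y"] hyp4D[OF hyp, of "q j" 1 Y "w ^ j * Y"] z dnn by linarith
  qed
  have pq: "dd p (q j) \<le> \<bar>s j\<bar> + 3 * \<delta>" if "j \<le> M" for j
  proof -
    have "gp p 1 Y \<le> 2 * \<delta>" using p dd_sym[of 1 p] dnn by (simp add: gp_def n_def)
    then show ?thesis using near_points[OF _ gq[OF that], of p] by (simp add: s_def)
  qed
  have "\<exists>j\<le>M. \<bar>s j\<bar> > C"
  proof (rule ccontr)
    assume "\<not> ?thesis"
    then have "\<And>j. j \<le> M \<Longrightarrow> \<bar>s j\<bar> \<le> C" by (meson not_le)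
    then have "int (len (inverse p * q j)) \<le> C + 3 * \<delta>" if "j \<le> M" for j using pq[OF that] that by (force simp: dd_def)
    then obtain i j where ij: "i < j" "cg (inverse p * q i) (inverse p * q j)" using M[of "\<lambda>j. inverse p * q j"] by blast
    have "cg (p * (inverse p * q i) * inverse p) (p * (inverse p * q j) * inverse p)"
      by (rule cg_mult[OF cg_mult[OF cg_refl ij(2)] cg_refl])
    moreover have "p * (inverse p * q i) * inverse p = w ^ i" for i unfolding q_def by (simp add: gsimps)
    ultimately have "cg (w ^ i) (w ^ j)" by simp
    then have "w powi (int j - int i) \<in> R" using powi_diff_mod[of w "int i" "int j"] by (simp add: powi_nat)
    moreover have "int j - int i = int (j - i)" using ij by simp
    ultimately show False using w[of "j - i"] ij powi_nat by (metis zero_less_diff)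
  qed
  then obtain j where j: "j \<le> M" "\<bar>s j\<bar> > C" by blast
  define v where "v = inverse p * w ^ j * p"
  have j0: "j > 0" using j(2) C dnn by (cases j) (auto simp: s_def q_def)
  define r where "r = w ^ j * q j"
  have lv: "int (len v) = dd p (q j)" by (simp add: v_def q_def dd_def mult.assoc)
  have v2: "int (len (v ^ 2)) = dd p r" by (simp add: v_def q_def r_def dd_def power2_eq_square gsimps)
  have qr: "dd (q j) r = dd p (q j)"
    using dd_left[of "w ^ j" p "q j"] by (simp add: r_def q_def)
  have big: "dd p (q j) \<ge> \<bar>s j\<bar>"
    using dd_tri[of 1 "q j" p] dd_tri[of 1 p "q j"] dd_sym[of p "q j"] unfolding s_def by linarith
  have sh: "gp (q j) r z = gp p (q j) (inverse (w ^ j) * z)" for z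
    using gp_left[of "w ^ j" p "q j" "inverse (w ^ j) * z"] by (simp add: r_def q_def gsimps)
  have wY: "dd Y (inverse (w ^ j) * Y) \<le> e"
    using weY[OF j(1)] dd_shift[of "w ^ j" Y Y] dd_sym[of Y "inverse (w ^ j) * Y"] dd_sym[of Y "w ^ j * Y"] by simp
  have w1: "dd 1 (inverse (w ^ j)) \<le> e" using we1[OF j(1)] by (simp add: dd_one)
  have gq': "dd (q j) 1 + dd (q j) Y - n \<le> 2 * \<delta>" "n \<le> dd (q j) 1 + dd (q j) Y"
    using gq[OF j(1)] dd_tri[of 1 Y "q j"] dd_sym[of 1 "q j"] by (simp_all add: gp_def n_def)
  have sd: "s j = dd 1 (q j) - dd 1 p" by (simp add: s_def)
  \<comment> \<open>The sign of \<open>s j\<close> decides whether, seen from \<open>q j\<close>,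
    the point \<open>p\<close> lies towards 1 or towards \<open>Y\<close>; \<open>r\<close> lies on
    the other side.\<close>
  have "gp (q j) p r \<le> 4 * \<delta>"
  proof (cases "s j > 0")
    case True
    then have as: "\<bar>s j\<bar> = s j" by simp
    have a: "gp (q j) 1 p > 3 * \<delta>"
      using sd big[unfolded as] j(2)[unfolded as] C dnn dd_sym[of 1 "q j"] dd_sym[of p "q j"] unfolding gp_def by linarith
    have "gp p (q j) Y \<ge> 2 * s j - 2 * \<delta>"
      using sd big[unfolded as] gq' p dd_sym[of 1 "q j"] unfolding gp_def by linarith
    moreover define Y' where "Y' = inverse (w ^ j) * Y"
    moreover have "gp p Y Y' \<ge> 2 * n - 2 * h - 2 * e"
      using gp_big[of p Y Y'] p(2) wY[folded Y'_def] by linarith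
    ultimately have "gp (q j) r Y > 4 * \<delta>"
      unfolding sh[of Y, folded Y'_def] using hyp4D[OF hyp, of p "q j" Y Y'] j(2)[unfolded as] C n half dnn by linarith
    then show ?thesis using gp_middle[OF gq[OF j(1)] a] by blast
  next
    case False
    then have as: "\<bar>s j\<bar> = - s j" by simp
    have a: "gp (q j) Y p > 3 * \<delta>"
      using sd big[unfolded as] j(2)[unfolded as] C dnn gq' p dd_sym[of 1 "q j"] dd_sym[of p "q j"] dd_sym[of Y p]
      unfolding gp_def by linarith
    have "gp p (q j) 1 \<ge> 2 * (- s j)"
      using sd big[unfolded as] dd_sym[of 1 "q j"] dd_sym[of 1 p] unfolding gp_def by linarith
    moreover have "gp p 1 (inverse (w ^ j)) \<ge> 2 * (h) - 2 * e"
      using gp_big[of p 1 "inverse (w ^ j)"] p w1 dd_sym[of 1 p] by linarith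
    ultimately have "gp p (q j) (inverse (w ^ j)) > 4 * \<delta>"
      using hyp4D[OF hyp, of p "q j" 1 "inverse (w ^ j)"] j(2)[unfolded as] C n half dnn by linarith
    then have "gp (q j) r 1 > 4 * \<delta>" using sh[of 1] by simp
    then show ?thesis using gp_middle[of "q j" Y 1 p r] gq[OF j(1)] gp_sym[of "q j" Y 1] a by simp
  qed
  then have "2 * int (len v) - int (len (v ^ 2)) \<le> 4 * \<delta>"
    using qr lv v2 dd_sym[of p "q j"] by (simp add: gp_def)
  moreover have "int (len v) > C" using lv big j(2) by simp
  ultimately show ?thesis using j0 unfolding v_def by blast
qed

end

subsection \<open>The elementary subgroup of a loxodromic element\<close>

lemma powi_powi: "(x powi i) powi j = (x::'a::grp) powi (i * j)"
proof (induction j rule: int_induct[where k=0])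
  case base show ?case by simp
next
  case (step1 j)
  have "(x powi i) powi (j + 1) = (x powi i) powi j * x powi i" by (rule powi_Suc)
  then show ?case using step1 powi_add[of x "i * j" i] by (simp add: distrib_left)
next
  case (step2 j)
  have "(x powi i) powi (j - 1) * x powi i = (x powi i) powi j" using powi_Suc[of "x powi i" "j - 1"] by simp
  moreover have "x powi (i * (j - 1)) * x powi i = x powi (i * j)"
    using powi_add[of x "i * (j - 1)" i] by (simp add: algebra_simps)
  ultimately show ?case using step2 right_cancel by metis
qed

context hypgrp begin

lemma gp_perturb: "gp c x' y' \<le> gp c x y + 2 * dd x x' + 2 * dd y y'"
  using dd_tri[of c x' x] dd_tri[of c y' y] dd_tri[of x y x'] dd_tri[of x' y y'] dd_sym[of y y']
  unfolding gp_def by linarith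

text \<open>Local to global: each step is much longer than the backtracking at its start, so the
  backtracking does not accumulate.\<close>

lemma chain_gp:
  assumes "int (len u) \<ge> 100 * \<delta> + 100" "2 * int (len u) - int (len (u ^ 2)) \<le> 4 * \<delta>"
  shows "gp 1 (inverse u) (u ^ n) \<le> 5 * \<delta>"
proof (induction n)
  case 0
  then show ?case using dnn dd_sym[of 1 "inverse u"] by (simp add: gp_def)
next
  case (Suc n)
  have "gp 1 (inverse u) u = 2 * int (len u) - int (len (u ^ 2))"
    by (simp add: gp_def dd_one) (simp add: dd_def gsimps power2_eq_square)
  then have 1: "gp 1 (inverse u) u \<le> 4 * \<delta>" using assms(2) by simp
  have "gp u 1 (u ^ Suc n) = gp 1 (inverse u) (u ^ n)"
    using gp_left[of u 1 "inverse u" "u ^ n"] by (simp add: gsimps)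
  then have "gp 1 (u ^ Suc n) u > 5 * \<delta>"
    using gp_swap[of 1 u "u ^ Suc n"] gp_sym[of 1 u "u ^ Suc n"] Suc assms(1) dnn dd_one[of u] by linarith
  then show ?case using hyp4D[OF hyp, of 1 "inverse u" "u ^ Suc n" u] 1 by linarith
qed

end

text \<open>The left side of \<open>v2\<close> is the Gromov product of \<open>inverse v\<close> and
  \<open>v\<close> at 1, that is, the backtracking between consecutive powers of
  \<open>v\<close>.\<close>

locale qaxis = hypgrp len R \<delta> for len :: "'a::grp \<Rightarrow> nat" and R :: "'a set" and \<delta> :: int +
  fixes v :: 'a
  assumes vl: "int (len v) \<ge> 100 * \<delta> + 100"
    and v2: "2 * int (len v) - int (len (v ^ 2)) \<le> 4 * \<delta>"
begin

section \<open>The powers of a loxodromic element as a quasi-geodesic\<close>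

abbreviation P :: "int \<Rightarrow> 'a" where "P i \<equiv> v powi i"

definition lam :: int where "lam = int (len v) - 6 * \<delta>"

lemma lam_pos: "lam \<ge> 1" using vl dnn by (simp add: lam_def)

lemma P_shift: "gp (P i) (P a) (P b) = gp 1 (P (a - i)) (P (b - i))"
  using gp_left[of "P i" 1 "P (a - i)" "P (b - i)"] by (simp flip: powi_add)

lemma dd_P: "dd (P a) (P b) = int (len (P (b - a)))"
proof -
  have "inverse (P a) * P b = P (b - a)" using powi_add[of v "- a" b] by (simp add: powi_neg)
  then show ?thesis by (simp add: dd_def)
qed

lemma len_P: "len (P i) = len (v ^ nat \<bar>i\<bar>)"
  by (cases "i \<ge> 0") (auto simp: power_int_def inverse_power)

lemma gp_P_nat: "gp 1 (P (- int m)) (P (int n)) \<le> 6 * \<delta>"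
proof (cases m)
  case 0
  then show ?thesis using dnn by (simp add: gp_def dd_sym)
next
  case (Suc m')
  have 1: "gp 1 (P (-1)) (P (int n)) \<le> 5 * \<delta>"
    using chain_gp[OF vl v2, of n] by (simp add: powi_nat powi_neg)
  have "gp 1 (inverse (inverse v)) (inverse v ^ m') \<le> 5 * \<delta>"
    using vl v2 by (intro chain_gp) (simp_all add: inverse_power)
  then have "gp 1 (P 1) (P (- int m')) \<le> 5 * \<delta>" by (simp add: powi_neg powi_nat inverse_power gsimps)
  moreover have "gp (P (-1)) 1 (P (- int m)) = gp 1 (P 1) (P (- int m'))"
    using P_shift[of "-1" 0 "- int m"] Suc by simp
  moreover have "dd 1 (P (-1)) = int (len v)" by (simp add: dd_one powi_neg)
  ultimately have "gp 1 (P (-1)) (P (- int m)) > 6 * \<delta>"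
    using gp_swap[of 1 "P (-1)" "P (- int m)"] vl dnn by linarith
  then show ?thesis using hyp4D[OF hyp, of 1 "P (-1)" "P (- int m)" "P (int n)"] 1 by linarith
qed

lemma gp_P: "a \<le> i \<Longrightarrow> i \<le> b \<Longrightarrow> gp (P i) (P a) (P b) \<le> 6 * \<delta>"
  using gp_P_nat[of "nat (i - a)" "nat (b - i)"] by (simp add: P_shift)

lemma len_super: "int (len (v ^ m)) + int (len (v ^ n)) - 6 * \<delta> \<le> int (len (v ^ (m + n)))"
proof -
  have "gp 1 (P (- int m)) (P (int n)) = int (len (v ^ m)) + int (len (v ^ n)) - int (len (v ^ (m + n)))"
    using dd_P[of "- int m" "int n"] by (simp add: gp_def dd_one powi_neg powi_nat add.commute nat_add_distrib len_P)
  then show ?thesis using gp_P_nat[of m n] by linarith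
qed

lemma len_lower: "int n * lam \<le> int (len (v ^ n))"
proof (induction n)
  case (Suc n)
  then show ?case using len_super[of n 1] by (simp add: lam_def algebra_simps)
qed simp

lemma len_mono: "m \<le> n \<Longrightarrow> int (len (v ^ m)) + int (n - m) * lam - 6 * \<delta> \<le> int (len (v ^ n))"
  using len_super[of m "n - m"] len_lower[of "n - m"] by simp

lemma len_mono': "m \<le> n \<Longrightarrow> len (v ^ m) \<le> len (v ^ n)"
proof (cases "m = n")
  case False
  assume "m \<le> n"
  then have "lam \<le> int (n - m) * lam" using lam_pos False by simp
  moreover have "6 * \<delta> \<le> lam" using vl dnn by (simp add: lam_def)
  ultimately show ?thesis using len_mono[OF \<open>m \<le> n\<close>] by linarith
qed simp

lemma near_axis:
  assumes ab: "a \<le> b" and c: "gp c (P a) (P b) \<le> \<epsilon>" and e: "6 * \<delta> \<le> \<epsilon>"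
  shows "\<exists>i. a \<le> i \<and> i \<le> b \<and> dd c (P i) \<le> int (len v) + \<epsilon> + \<delta>"
proof -
  define A where "A = {i. a \<le> i \<and> i \<le> b \<and> dd (P a) (P i) \<le> dd (P a) c}"
  have "A \<subseteq> {a..b}" by (auto simp: A_def)
  then have fin: "finite A" by (rule finite_subset) simp
  have "a \<in> A" using ab by (simp add: A_def)
  then have MA: "Max A \<in> A" using fin by (intro Max_in) auto
  \<comment> \<open>The last power that is not further from \<open>P a\<close> than \<open>c\<close>
    is; one step of the axis bounds the difference of the two distances.\<close>
  define i where "i = Max A"
  have i: "a \<le> i" "i \<le> b" "dd (P a) (P i) \<le> dd (P a) c" using MA by (auto simp: A_def i_def)
  show ?thesis
  proof (cases "i = b")
    case True
    have "dd (P a) (P b) \<le> dd (P a) c" using i(3) True by simp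
    then have "dd c (P b) \<le> \<epsilon>" using c dd_sym[of c "P a"] unfolding gp_def by linarith
    then show ?thesis using i True dnn by (intro exI[of _ i]) auto
  next
    case False
    then have "i + 1 \<notin> A" using Max_ge[OF fin, of "i + 1"] unfolding i_def by linarith
    then have "dd (P a) c < dd (P a) (P (i + 1))" using i False by (simp add: A_def)
    also have "\<dots> \<le> dd (P a) (P i) + int (len v)"
      using dd_tri[of "P a" "P (i + 1)" "P i"] dd_P[of i "i + 1"] by simp
    finally have "\<bar>dd (P a) c - dd (P a) (P i)\<bar> \<le> int (len v)" using i(3) by linarith
    moreover have "gp (P i) (P a) (P b) \<le> \<epsilon>" using gp_P[OF i(1,2)] e by linarith
    ultimately show ?thesis using near_points[OF c] i by (intro exI[of _ i]) force
  qed
qed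

lemma near_axis':
  assumes c: "gp c (g * P a) (g * P b) \<le> \<epsilon>" and e: "6 * \<delta> \<le> \<epsilon>"
  shows "\<exists>i. dd c (g * P i) \<le> int (len v) + \<epsilon> + \<delta>"
proof -
  define c' where "c' = inverse g * c"
  have gc: "g * c' = c" by (simp add: c'_def gsimps)
  have "gp c' (P a) (P b) \<le> \<epsilon>" using gp_left[of g c' "P a" "P b"] c gc by simp
  moreover from this have "gp c' (P b) (P a) \<le> \<epsilon>" using gp_sym by metis
  ultimately obtain i where "dd c' (P i) \<le> int (len v) + \<epsilon> + \<delta>"
    using near_axis[of a b c' \<epsilon>] near_axis[of b a c' \<epsilon>] e by (meson nle_le)
  then show ?thesis using dd_left[of g c' "P i"] gc by auto
qed

text \<open>Conjugation by \<open>g\<close> changes the length of every power by at most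
  \<open>2 * len g\<close>, whereas different absolute exponents make the lengths of high powers
  drift apart.\<close>

lemma conj_exponent:
  assumes c: "cg (g * P a * inverse g) (P b)" and a: "a > 0" shows "\<bar>b\<bar> = a"
proof -
  define n where "n = nat (2 * int (len g) + 6 * \<delta> + 1)"
  have n: "int n = 2 * int (len g) + 6 * \<delta> + 1" using dnn by (simp add: n_def)
  have "cg ((g * P a * inverse g) powi int n) (P b powi int n)" by (rule cg_powi[OF c])
  then have "cg (g * P (a * int n) * inverse g) (P (b * int n))" by (simp only: powi_conj powi_powi)
  then have eq: "len (g * P (a * int n) * inverse g) = len (P (b * int n))" by (rule cg_len)
  have "P (a * int n) = inverse g * (g * P (a * int n) * inverse g) * g" by (simp add: gsimps)
  then have 1: "len (P (a * int n)) \<le> len (P (b * int n)) + 2 * len g"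
    using len_mult[of "inverse g * (g * P (a * int n) * inverse g)" g]
      len_mult[of "inverse g" "g * P (a * int n) * inverse g"] eq by simp
  have 2: "len (P (b * int n)) \<le> len (P (a * int n)) + 2 * len g"
    using len_mult[of "g * P (a * int n)" "inverse g"] len_mult[of g "P (a * int n)"] eq by simp
  have key: "j = i" if le: "i \<le> j" and l: "len (v ^ (j * n)) \<le> len (v ^ (i * n)) + 2 * len g" for i j
  proof (rule ccontr)
    assume "j \<noteq> i"
    then have "1 * n \<le> (j - i) * n" using le by (intro mult_right_mono) auto
    then have "n \<le> j * n - i * n" by (simp add: diff_mult_distrib)
    then have "int n * 1 \<le> int (j * n - i * n) * lam" using lam_pos by (intro mult_mono) auto
    moreover have "i * n \<le> j * n" using le by simp
    ultimately show False using len_mono[of "i * n" "j * n"] l n by linarith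
  qed
  have la: "len (P (a * int n)) = len (v ^ (nat a * n))"
    using a by (simp add: len_P nat_mult_distrib abs_mult)
  have lb: "len (P (b * int n)) = len (v ^ (nat \<bar>b\<bar> * n))"
    by (simp add: len_P nat_mult_distrib abs_mult)
  have "nat a = nat \<bar>b\<bar>" using key[of "nat a" "nat \<bar>b\<bar>"] key[of "nat \<bar>b\<bar>" "nat a"] 1 2 la lb by (metis nle_le)
  then show ?thesis using a by simp
qed

section \<open>Elements that normalise a power of \<open>v\<close>\<close>

definition nrm :: "'a \<Rightarrow> nat \<Rightarrow> bool" where
  "nrm g m \<longleftrightarrow> (\<exists>s\<in>{1,-1}. cg (g * P (int m) * inverse g) (P (s * int m)))"

lemma nrm_gen:
  assumes "cg (g * P m * inverse g) (P (s * m))"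
  shows "cg (g * P (m * n) * inverse g) (P (s * (m * n)))"
proof -
  have "cg ((g * P m * inverse g) powi n) (P (s * m) powi n)" by (rule cg_powi[OF assms])
  moreover have "s * m * n = s * (m * n)" by simp
  ultimately show ?thesis by (simp only: powi_conj powi_powi)
qed

lemma nrm_mult: assumes "nrm g m" shows "nrm g (m * k)"
proof -
  obtain s where s: "s \<in> {1,-1}" "cg (g * P (int m) * inverse g) (P (s * int m))"
    using assms unfolding nrm_def by blast
  have "cg (g * P (int m * int k) * inverse g) (P (s * (int m * int k)))" by (rule nrm_gen[OF s(2)])
  then show ?thesis using s(1) unfolding nrm_def of_nat_mult by blast
qed

lemma cg_conj_swap: "cg (inverse g * x * g) y \<Longrightarrow> cg x (g * y * inverse g)"
proof -
  assume "cg (inverse g * x * g) y"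
  then have "cg (g * (inverse g * x * g) * inverse g) (g * y * inverse g)" by (intro cg_mult cg_refl)
  then show ?thesis by (simp add: gsimps)
qed

lemma nrm_inverse: assumes "nrm (inverse g) m" shows "nrm g m"
proof -
  obtain s where s: "s \<in> {1, -1}" "cg (inverse g * P (int m) * g) (P (s * int m))"
    using assms unfolding nrm_def inv_inv by blast
  then have c: "cg (P (int m)) (g * P (s * int m) * inverse g)" by (intro cg_conj_swap)
  from s(1) consider "s = 1" | "s = -1" by blast
  then show ?thesis
  proof cases
    case 1
    then show ?thesis using cg_sym[OF c] unfolding nrm_def by (intro bexI[of _ 1]) auto
  next
    case 2
    have "cg (inverse (g * P (s * int m) * inverse g)) (inverse (P (int m)))" using cg_inverse[OF cg_sym[OF c]] .
    then show ?thesis using 2 unfolding nrm_def by (intro bexI[of _ "-1"]) (auto simp: gsimps powi_neg)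
  qed
qed

text \<open>Along the common part, the elements leading from \<open>P (i + int t)\<close> to a
  nearby point of the translated axis have bounded length, so two of them agree modulo
  \<open>R\<close>, and \<open>g\<close> relates a power of \<open>v\<close> to a power of
  \<open>v\<close>. The exponents agree up to sign by \<open>conj_exponent\<close>. The factorial is
  a common multiple of all exponents that the pigeonhole can produce, so it does not depend on
  \<open>g\<close>.\<close>

lemma fellow:
  assumes "B \<ge> 0"
  shows "\<exists>M0>0. \<exists>T. \<forall>g i j k l. dd (P i) (g * P k) \<le> B \<longrightarrow> dd (P j) (g * P l) \<le> B \<longrightarrow> T \<le> j - i \<longrightarrow> nrm g M0"
proof -
  define B2 where "B2 = int (len v) + (6 * \<delta> + 4 * B) + \<delta>"
  obtain M where M: "\<And>f::nat \<Rightarrow> 'a. (\<And>t. t \<le> M \<Longrightarrow> int (len (f t)) \<le> B2) \<Longrightarrow> \<exists>i j. i < j \<and> j \<le> M \<and> cg (f i) (f j)"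
    using pigeon[of B2] by blast
  have "nrm g (fact M)" if a: "dd (P i) (g * P k) \<le> B" "dd (P j) (g * P l) \<le> B" "int M \<le> j - i" for g i j k l
  proof -
    have "\<exists>m'. dd (P (i + int t)) (g * P m') \<le> B2" if "t \<le> M" for t
    proof -
      have "gp (P (i + int t)) (P i) (P j) \<le> 6 * \<delta>" using gp_P[of i "i + int t" j] a(3) that by simp
      then have "gp (P (i + int t)) (g * P k) (g * P l) \<le> 6 * \<delta> + 4 * B"
        using gp_perturb[of "P (i + int t)" "g * P k" "g * P l" "P i" "P j"] a by linarith
      then obtain m' where "dd (P (i + int t)) (g * P m') \<le> int (len v) + (6 * \<delta> + 4 * B) + \<delta>"
        using near_axis'[of _ g k l "6 * \<delta> + 4 * B"] assms by auto
      then show ?thesis unfolding B2_def by blast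
    qed
    then obtain m' where m': "\<And>t. t \<le> M \<Longrightarrow> dd (P (i + int t)) (g * P (m' t)) \<le> B2" by metis
    define f where "f t = inverse (P (i + int t)) * (g * P (m' t))" for t
    obtain t1 t2 where t: "t1 < t2" "t2 \<le> M" "cg (f t1) (f t2)"
      using M[of f] m' by (auto simp: f_def dd_def)
    define \<alpha> where "\<alpha> = int t2 - int t1"
    define \<beta> where "\<beta> = m' t2 - m' t1"
    have "cg (inverse g * (P (i + int t2) * f t1 * P (- m' t1))) (inverse g * (P (i + int t2) * f t2 * P (- m' t1)))"
      using t(3) by (intro cg_mult cg_refl)
    moreover have "P (i + int t2) * f t1 * P (- m' t1) = P (i + int t2) * P (- (i + int t1)) * g * (P (m' t1) * P (- m' t1))"
      unfolding f_def powi_neg[of v "i + int t1"] by (simp add: mult.assoc)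
    then have "P (i + int t2) * f t1 * P (- m' t1) = P \<alpha> * g"
      unfolding powi_add[symmetric] by (simp add: \<alpha>_def)
    moreover have "P (i + int t2) * f t2 * P (- m' t1) = P (i + int t2) * P (- (i + int t2)) * g * (P (m' t2) * P (- m' t1))"
      unfolding f_def powi_neg[of v "i + int t2"] by (simp add: mult.assoc)
    then have "P (i + int t2) * f t2 * P (- m' t1) = g * P \<beta>"
      unfolding powi_add[symmetric] by (simp add: \<beta>_def)
    ultimately have c: "cg (inverse g * P \<alpha> * inverse (inverse g)) (P \<beta>)" by (simp add: gsimps)
    have \<alpha>: "\<alpha> > 0" using t(1) by (simp add: \<alpha>_def)
    have "\<bar>\<beta>\<bar> = \<alpha>" using conj_exponent[OF c \<alpha>] .
    then have "\<exists>s\<in>{1,-1}. \<beta> = s * \<alpha>" by auto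
    then have "nrm (inverse g) (nat \<alpha>)" using c \<alpha> unfolding nrm_def by auto
    then have "nrm g (nat \<alpha>)" by (rule nrm_inverse)
    moreover have "nat \<alpha> dvd fact M" using \<alpha> t by (intro dvd_fact) (auto simp: \<alpha>_def)
    ultimately show ?thesis using nrm_mult by (metis dvd_def)
  qed
  then show ?thesis by (intro exI[of _ "fact M"] conjI exI[of _ "int M"]) auto
qed

text \<open>The maximal elementary subgroup of the loxodromic element \<open>v\<close> in the
  quotient by \<open>R\<close>, pulled back to the group.\<close>

definition E :: "'a set" where "E = {g. \<exists>m>0. nrm g m}"

lemma nrm_prod: assumes "nrm g m" "nrm h k" shows "nrm (g * h) (m * k)"
proof -
  obtain s where s: "s \<in> {1,-1}" "cg (g * P (int m) * inverse g) (P (s * int m))"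
    using assms unfolding nrm_def by blast
  obtain t where t: "t \<in> {1,-1}" "cg (h * P (int k) * inverse h) (P (t * int k))"
    using assms unfolding nrm_def by blast
  have 1: "cg (h * P (int (m * k)) * inverse h) (P (int m * (t * int k)))"
  proof -
    have "int (m * k) = int k * int m" "int m * (t * int k) = t * (int k * int m)" by simp_all
    then show ?thesis using nrm_gen[OF t(2), of "int m"] by (simp only:)
  qed
  have "cg (g * (h * P (int (m * k)) * inverse h) * inverse g) (g * P (int m * (t * int k)) * inverse g)"
    by (rule cg_mult[OF cg_mult[OF cg_refl 1] cg_refl])
  moreover have "cg (g * P (int m * (t * int k)) * inverse g) (P (s * (int m * (t * int k))))" by (rule nrm_gen[OF s(2)])
  ultimately have "cg (g * (h * P (int (m * k)) * inverse h) * inverse g) (P (s * (int m * (t * int k))))"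
    by (rule cg_trans)
  moreover have "g * (h * P (int (m * k)) * inverse h) * inverse g = (g * h) * P (int (m * k)) * inverse (g * h)"
    by (simp only: inv_mult mult.assoc)
  moreover have "s * (int m * (t * int k)) = (s * t) * int (m * k)" by simp
  ultimately have "cg ((g * h) * P (int (m * k)) * inverse (g * h)) (P ((s * t) * int (m * k)))" by simp
  moreover have "s * t \<in> {1,-1}" using s t by auto
  ultimately show ?thesis unfolding nrm_def by blast
qed

lemma subgr_E: "subgr E"
proof -
  have "nrm 1 1" unfolding nrm_def by (intro bexI[of _ 1]) (auto simp: gsimps)
  then have "1 \<in> E" unfolding E_def using zero_less_one by blast
  moreover have "g * h \<in> E" if gh: "g \<in> E" "h \<in> E" for g h
  proof -
    obtain m k where "m > 0" "nrm g m" "k > 0" "nrm h k" using gh unfolding E_def by blast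
    then have "m * k > 0" "nrm (g * h) (m * k)" using nrm_prod by auto
    then show ?thesis unfolding E_def by blast
  qed
  moreover have "inverse g \<in> E" if "g \<in> E" for g
    using that nrm_inverse[of "inverse g"] unfolding E_def by (auto simp: inv_inv)
  ultimately show ?thesis by (auto simp: subgr_def)
qed

lemma P_in_E: "P i \<in> E"
proof -
  have "P i * P 1 * inverse (P i) = P (i + 1 + - i)" unfolding powi_add powi_neg by simp
  then have "nrm (P i) 1" unfolding nrm_def by (intro bexI[of _ 1]) auto
  then show ?thesis unfolding E_def using zero_less_one by blast
qed

lemma R_sub_E: "R \<subseteq> E"
proof
  fix r assume r: "r \<in> R"
  then have "cg r 1" unfolding cg_def using nsubD(3)[OF nR] by simp
  then have "cg (r * P 1 * inverse r) (1 * P 1 * inverse 1)" by (intro cg_mult cg_refl cg_inverse)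
  then have "nrm r 1" unfolding nrm_def by (intro bexI[of _ 1]) (auto simp: gsimps)
  then show "r \<in> E" unfolding E_def using zero_less_one by blast
qed

definition kap :: int where "kap = int (len v) + 9 * \<delta>"

lemma kap_nonneg: "0 \<le> kap" using dnn by (simp add: kap_def)

text \<open>An element \<open>e\<close> of \<open>E\<close> sends far points of the axis to within
  \<open>len e\<close> of points of the axis. Far enough out this error disappears from the Gromov
  products at \<open>e\<close>, so \<open>e\<close> is near the axis with a constant that is the
  same for all \<open>e\<close>.\<close>

lemma E_near: assumes "e \<in> E" shows "\<exists>i. dd e (P i) \<le> kap"
proof -
  obtain m s where m: "m > 0" "s \<in> {1,-1}" "cg (e * P (int m) * inverse e) (P (s * int m))"
    using assms unfolding E_def nrm_def by blast
  define n where "n = nat (int (len e) + 10 * \<delta> + 1)"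
  have n: "int n = int (len e) + 10 * \<delta> + 1" using dnn by (simp add: n_def)
  have near: "dd (e * P (int m * j)) (P (s * (int m * j))) \<le> int (len e)" for j
  proof -
    have "cg (e * P (int m * j) * inverse e) (P (s * (int m * j)))" by (rule nrm_gen[OF m(3)])
    then have "cg (e * P (int m * j) * inverse e * e) (P (s * (int m * j)) * e)" by (intro cg_mult cg_refl)
    then have "dd (e * P (int m * j)) (P (s * (int m * j)) * e) = 0" by (simp add: gsimps cg_dd)
    moreover have "dd (P (s * (int m * j)) * e) (P (s * (int m * j))) = int (len e)"
      using dd_left[of "P (s * (int m * j))" e 1] dd_one[of e] dd_sym[of 1 e] by simp
    ultimately show ?thesis using dd_tri[of "e * P (int m * j)" "P (s * (int m * j))" "P (s * (int m * j)) * e"] by linarith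
  qed
  define x where "x = e * P (int m * - int n)"
  define y where "y = e * P (int m * int n)"
  define x' where "x' = P (s * (int m * - int n))"
  define y' where "y' = P (s * (int m * int n))"
  have "gp e x y = gp (P 0) (P (int m * - int n)) (P (int m * int n))"
    using gp_left[of e 1] unfolding x_def y_def by simp
  also have "\<dots> \<le> 6 * \<delta>" by (rule gp_P) auto
  finally have g1: "gp e x y \<le> 6 * \<delta>" .
  have far: "int n \<le> dd e (e * P j)" if "\<bar>j\<bar> = int (m * n)" for j
  proof -
    have "dd e (e * P j) = int (len (P j))" using dd_left[of e 1 "P j"] by (simp add: dd_one)
    also have "nat \<bar>j\<bar> = m * n" using that by (simp only: nat_int)
    then have "int (len (P j)) = int (len (v ^ (m * n)))" by (simp add: len_P)
    also have "\<dots> \<ge> int (m * n) * lam" using len_lower .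
    finally have "int (m * n) * lam \<le> dd e (e * P j)" .
    moreover have "1 * n \<le> m * n" using m(1) by (intro mult_right_mono) auto
    moreover have "int (m * n) * 1 \<le> int (m * n) * lam" using lam_pos by (intro mult_left_mono) auto
    ultimately show ?thesis by linarith
  qed
  have "gp e x x' > 7 * \<delta>" "gp e y y' > 8 * \<delta>"
    using gp_big[of e x x'] gp_big[of e y y'] near[of "- int n"] near[of "int n"] far[of "int m * - int n"] far[of "int m * int n"] n dnn
    unfolding x_def[symmetric] y_def[symmetric] x'_def[symmetric] y'_def[symmetric] by (auto simp: abs_mult)
  then have g2: "gp e x' y' \<le> 8 * \<delta>"
    using hyp4D[OF hyp, of e x x' y] hyp4D[OF hyp, of e x' y' y] g1 gp_sym[of e y' y] by linarith
  have "\<exists>i. dd e (1 * P i) \<le> int (len v) + 8 * \<delta> + \<delta>"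
    by (rule near_axis'[of e 1 "s * (int m * - int n)" "s * (int m * int n)"]) (use g2 dnn in \<open>auto simp: x'_def y'_def\<close>)
  then show ?thesis unfolding kap_def by (simp add: algebra_simps)
qed

lemma len_P_le: "int (len (P i)) \<le> \<bar>i\<bar> * int (len v)"
proof -
  have "int (len (P i)) \<le> int (nat \<bar>i\<bar> * len v)" unfolding len_P using len_power_le by (simp only: of_nat_le_iff)
  then show ?thesis by simp
qed

text \<open>The points \<open>e * P k\<close> lie in \<open>E\<close>, hence within
  \<open>kap\<close> of the axis, for all \<open>k\<close>; \<open>fellow\<close> with this constant
  yields a single exponent.\<close>

lemma E_uniform: "\<exists>M0>0. \<forall>e\<in>E. nrm e M0"
proof -
  obtain M0 T where M0: "M0 > 0" and T: "\<And>g i j k l. dd (P i) (g * P k) \<le> kap \<Longrightarrow> dd (P j) (g * P l) \<le> kap \<Longrightarrow> T \<le> j - i \<Longrightarrow> nrm g M0"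
    using fellow[OF kap_nonneg] by blast
  have "nrm e M0" if e: "e \<in> E" for e
  proof -
    obtain i0 where i0: "dd (e * P 0) (P i0) \<le> kap" using E_near[OF e] by auto
    define k where "k = nat (\<bar>T\<bar> * int (len v) + 2 * kap)"
    have "0 \<le> \<bar>T\<bar> * int (len v)" by simp
    then have k: "int k = \<bar>T\<bar> * int (len v) + 2 * kap" unfolding k_def using kap_nonneg by (intro nat_0_le) linarith
    obtain i1 where i1: "dd (e * P (int k)) (P i1) \<le> kap"
      using E_near[of "e * P (int k)"] subgrD(2)[OF subgr_E e P_in_E] by blast
    have "dd (e * P 0) (e * P (int k)) = int (len (v ^ k))" 
      using dd_left[of e 1 "P (int k)"] by (simp add: dd_one powi_nat) 
    moreover have "int k * 1 \<le> int k * lam" using lam_pos by (intro mult_left_mono) auto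
    ultimately have "int k \<le> dd (e * P 0) (e * P (int k))" using len_lower[of k] by linarith
    then have "int k - 2 * kap \<le> dd (P i0) (P i1)"
      using dd_tri[of "e * P 0" "e * P (int k)" "P i0"] dd_tri[of "P i0" "e * P (int k)" "P i1"] i0 i1
        dd_sym[of "P i1" "e * P (int k)"] by linarith
    also have "\<dots> \<le> \<bar>i1 - i0\<bar> * int (len v)" using dd_P len_P_le by simp
    finally have "\<bar>T\<bar> * int (len v) \<le> \<bar>i1 - i0\<bar> * int (len v)" using k by simp
    then have "\<bar>T\<bar> \<le> \<bar>i1 - i0\<bar>" using vl dnn by simp
    then have "T \<le> i1 - i0 \<or> T \<le> i0 - i1" by linarith
    then show ?thesis
      using T[of i0 e 0 i1 "int k"] T[of i1 e "int k" i0 0] i0 i1 dd_sym by metis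
  qed
  then show ?thesis using M0 by blast
qed

text \<open>Long fellow travelling of two cosets is long fellow travelling of two axes, and
  \<open>fellow\<close> turns it into membership in \<open>E\<close>. This is the separation on
  which all projection estimates rest.\<close>

lemma E_separated:
  assumes "B \<ge> 0"
  shows "\<exists>\<theta>\<ge>0. \<forall>g. \<forall>e1\<in>E. \<forall>e2\<in>E. \<forall>f1\<in>E. \<forall>f2\<in>E. dd e1 (g * f1) \<le> B \<longrightarrow> dd e2 (g * f2) \<le> B \<longrightarrow> \<theta> < dd e1 e2 \<longrightarrow> g \<in> E"
proof -
  obtain M0 T where M0: "M0 > 0" and T: "\<And>g i j k l. dd (P i) (g * P k) \<le> B + 2 * kap \<Longrightarrow> dd (P j) (g * P l) \<le> B + 2 * kap \<Longrightarrow> T \<le> j - i \<Longrightarrow> nrm g M0"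
    using fellow[of "B + 2 * kap"] kap_nonneg assms by (auto 0 0) blast
  define \<theta> where "\<theta> = \<bar>T\<bar> * int (len v) + 2 * kap"
  have near: "\<exists>i k. dd e (P i) \<le> kap \<and> dd (P i) (g * P k) \<le> B + 2 * kap"
    if ef: "e \<in> E" "f \<in> E" "dd e (g * f) \<le> B" for e f g
  proof -
    obtain i where i: "dd e (P i) \<le> kap" using E_near[OF ef(1)] by blast
    obtain k where k: "dd f (P k) \<le> kap" using E_near[OF ef(2)] by blast
    note ik = i k
    then have "dd (P i) (g * P k) \<le> B + 2 * kap"
      using dd_tri[of "P i" "g * P k" e] dd_tri[of e "g * P k" "g * f"] dd_sym[of e "P i"] ef(3) by simp
    then show ?thesis using ik by blast
  qed
  have "g \<in> E" if a: "e1 \<in> E" "e2 \<in> E" "f1 \<in> E" "f2 \<in> E" "dd e1 (g * f1) \<le> B" "dd e2 (g * f2) \<le> B" "\<theta> < dd e1 e2"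
    for g e1 e2 f1 f2
  proof -
    obtain i k where 1: "dd e1 (P i) \<le> kap" "dd (P i) (g * P k) \<le> B + 2 * kap" using near[OF a(1,3,5)] by blast
    obtain j l where 2: "dd e2 (P j) \<le> kap" "dd (P j) (g * P l) \<le> B + 2 * kap" using near[OF a(2,4,6)] by blast
    have "dd e1 e2 - 2 * kap \<le> dd (P i) (P j)"
      using dd_tri[of e1 e2 "P i"] dd_tri[of "P i" e2 "P j"] 1 2 dd_sym[of e2 "P j"] by linarith
    also have "\<dots> \<le> \<bar>j - i\<bar> * int (len v)" using dd_P len_P_le by simp
    finally have "\<bar>T\<bar> * int (len v) < \<bar>j - i\<bar> * int (len v)" using a(7) by (simp add: \<theta>_def)
    then have "\<bar>T\<bar> < \<bar>j - i\<bar>" using mult_right_less_imp_less by fastforce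
    then have "T \<le> j - i \<or> T \<le> i - j" by linarith
    then have "nrm g M0" using T 1(2) 2(2) by blast
    then show ?thesis using M0 by (auto simp: E_def)
  qed
  moreover have "\<theta> \<ge> 0" using kap_nonneg by (simp add: \<theta>_def)
  ultimately show ?thesis by blast
qed

lemma E_quasiconvex:
  assumes "e1 \<in> E" "e2 \<in> E" "gp c e1 e2 \<le> \<epsilon>" "0 \<le> \<epsilon>"
  shows "\<exists>e\<in>E. dd c e \<le> int (len v) + \<epsilon> + 4 * kap + 7 * \<delta>"
proof -
  obtain i where i: "dd e1 (P i) \<le> kap" using E_near[OF assms(1)] by blast
  obtain j where j: "dd e2 (P j) \<le> kap" using E_near[OF assms(2)] by blast
  note ij = i j
  have "gp c (P i) (P j) \<le> \<epsilon> + 4 * kap"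
    using gp_perturb[of c "P i" "P j" e1 e2] ij assms(3) by linarith
  then have "gp c (1 * P i) (1 * P j) \<le> \<epsilon> + 4 * kap + 6 * \<delta>" using dnn by simp
  then have "\<exists>k. dd c (1 * P k) \<le> int (len v) + (\<epsilon> + 4 * kap + 6 * \<delta>) + \<delta>"
    using kap_nonneg assms(4) by (intro near_axis') auto
  then show ?thesis using P_in_E by (auto simp: add.assoc)
qed

end

section \<open>Rotating families\<close>

text \<open>\<open>pd g a b\<close> is the distance between the projections of \<open>a\<close> and \<open>b\<close> to the axis \<open>g E\<close>, \<open>Kc g\<close> consists of
  the rotations about this axis, and \<open>rho g\<close> is its distance from 1.\<close>

locale windmill =
  fixes E R :: "'a::grp set" and pd :: "'a \<Rightarrow> 'a \<Rightarrow> 'a \<Rightarrow> int" and rho :: "'a \<Rightarrow> nat"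
    and Kc :: "'a \<Rightarrow> 'a set" and L \<theta> :: int
  assumes sE: "subgr E" and nR: "nsub R"
    and pd_sym: "pd g a b = pd g b a" and pd_tri: "pd g a c \<le> pd g a b + pd g b c"
    and pd_left: "pd (k * g) (k * a) (k * b) = pd g a b"
    and pd_coset: "e \<in> E \<Longrightarrow> pd (g * e) a b = pd g a b"
    and pd_R: "r \<in> R \<Longrightarrow> pd g 1 r \<le> \<theta>"
    and behrstock: "inverse g * h \<notin> E \<Longrightarrow> pd g a h \<le> \<theta> \<or> pd h a g \<le> \<theta>"
    and rot: "k \<in> Kc g \<Longrightarrow> k \<notin> R \<Longrightarrow> L \<le> pd g a (k * a)"
    and Kc_subgr: "subgr (Kc g)" and R_Kc: "R \<subseteq> Kc g"
    and Kc_conj: "x \<in> Kc g \<Longrightarrow> k * x * inverse k \<in> Kc (k * g)"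
    and Kc_coset: "e \<in> E \<Longrightarrow> Kc (g * e) = Kc g"
    and Kc_fix: "k \<in> Kc g \<Longrightarrow> inverse g * (k * g) \<in> E"
    and rho_coset: "e \<in> E \<Longrightarrow> rho (g * e) = rho g"
    and rho_less: "inverse g * h \<notin> E \<Longrightarrow> \<theta> < pd g 1 h \<Longrightarrow> rho g < rho h"
    and rho_reduce: "inverse g * h \<notin> E \<Longrightarrow> 3 * L \<le> 5 * pd g 1 h \<Longrightarrow> \<exists>k\<in>Kc g. rho (k * h) < rho h"
    and th: "0 \<le> \<theta>" and LL: "1000 * \<theta> + 1000 \<le> L"
begin

abbreviation eqv :: "'a \<Rightarrow> 'a \<Rightarrow> bool" where "eqv g h \<equiv> inverse g * h \<in> E"

lemma eqv_sym: "eqv g h \<Longrightarrow> eqv h g"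
  using subgrD(3)[OF sE, of "inverse g * h"] by (simp add: gsimps)

lemma eqv_left [simp]: "eqv (k * g) (k * h) \<longleftrightarrow> eqv g h" by (simp add: gsimps)

lemma eqvE: assumes "eqv g h" obtains e where "e \<in> E" "h = g * e"
  using that[OF assms] by (simp add: gsimps)

lemma pd_eqv: "eqv g h \<Longrightarrow> pd h a b = pd g a b" by (metis eqvE pd_coset)
lemma Kc_eqv: "eqv g h \<Longrightarrow> Kc h = Kc g" by (metis eqvE Kc_coset)
lemma rho_eqv: "eqv g h \<Longrightarrow> rho h = rho g" by (metis eqvE rho_coset)

lemma pd_shift: "pd g (k * a) (k * b) = pd (inverse k * g) a b"
  using pd_left[of k "inverse k * g" a b] by (simp add: gsimps)

lemma pd_fix: "k \<in> Kc g \<Longrightarrow> pd g (k * a) (k * b) = pd g a b"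
  using pd_left[of k g a b] pd_eqv[OF Kc_fix] by simp

text \<open>The windmill: \<open>Kr r\<close> is generated by the rotations about the axes closer than \<open>r\<close> to 1, and \<open>Per r\<close> contains the
  axes that it meets next.\<close>

inductive_set Kr :: "nat \<Rightarrow> 'a set" for r where
  KrR: "x \<in> R \<Longrightarrow> x \<in> Kr r"
| KrK: "rho g < r \<Longrightarrow> x \<in> Kc g \<Longrightarrow> x \<in> Kr r"
| KrM: "x \<in> Kr r \<Longrightarrow> y \<in> Kr r \<Longrightarrow> x * y \<in> Kr r"

lemma Kr_one: "1 \<in> Kr r" by (intro KrR nsubD[OF nR])

lemma Kr_inv: "x \<in> Kr r \<Longrightarrow> inverse x \<in> Kr r"
  by (induction rule: Kr.induct)
     (auto simp: inv_mult intro: KrR KrK KrM nsubD(3)[OF nR] subgrD(3)[OF Kc_subgr])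

lemma Kr_mono: "r \<le> s \<Longrightarrow> x \<in> Kr r \<Longrightarrow> x \<in> Kr s"
proof -
  assume "r \<le> s" "x \<in> Kr r"
  from this(2) show ?thesis
  proof (induction rule: Kr.induct)
    case (KrK g x) then show ?case using Kr.KrK[of g s x] \<open>r \<le> s\<close> by linarith
  qed (auto intro: KrR KrM)
qed

lemma Kr_0: "x \<in> Kr 0 \<Longrightarrow> x \<in> R"
  by (induction rule: Kr.induct) (auto intro: nsubD[OF nR])

definition Out :: "nat \<Rightarrow> 'a set" where "Out r = {g. \<forall>b\<in>Kr r. r \<le> rho (b * g)}"

definition Per :: "nat \<Rightarrow> 'a set" where "Per r = {b * g | b g. b \<in> Kr r \<and> g \<in> Out r \<and> rho g = r}"

text \<open>\<open>n\<close> counts the rotations about perimeter axes. Elements of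
  \<open>Kr r\<close> between them can be moved to the right end because \<open>Per r\<close> is
  invariant under \<open>Kr r\<close>, so a single factor from \<open>Kr r\<close> is kept
  there.\<close>

inductive Wd :: "nat \<Rightarrow> nat \<Rightarrow> 'a \<Rightarrow> bool" for r where
  Wd0: "x \<in> Kr r \<Longrightarrow> Wd r 0 x"
| WdS: "y \<in> Per r \<Longrightarrow> h \<in> Kc y \<Longrightarrow> Wd r n k \<Longrightarrow> Wd r (Suc n) (h * k)"

lemma Out_translate: "g \<in> Out r \<Longrightarrow> b \<in> Kr r \<Longrightarrow> b * g \<in> Out r"
  unfolding Out_def using KrM[of _ r b] by (simp flip: mult.assoc)

lemma Out_rho: "g \<in> Out r \<Longrightarrow> r \<le> rho g"
  unfolding Out_def using Kr_one by force

lemma Out_anti: "g \<in> Out s \<Longrightarrow> r \<le> s \<Longrightarrow> g \<in> Out r"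
  unfolding Out_def using Kr_mono[of r s] by fastforce

lemma Per_translate: "y \<in> Per r \<Longrightarrow> b \<in> Kr r \<Longrightarrow> b * y \<in> Per r"
proof -
  assume "y \<in> Per r" "b \<in> Kr r"
  then obtain b' g where "b' \<in> Kr r" "g \<in> Out r" "rho g = r" "y = b' * g" by (auto simp: Per_def)
  then show ?thesis unfolding Per_def using KrM[OF \<open>b \<in> Kr r\<close>]
    by (intro CollectI exI[of _ "b * b'"] exI[of _ g]) (simp add: mult.assoc)
qed

lemma Per_Out: "y \<in> Per r \<Longrightarrow> y \<in> Out r"
  unfolding Per_def using Out_translate by auto

lemma not_Out: assumes "g \<notin> Out r" shows "Kc g \<subseteq> Kr r"
proof
  fix x assume x: "x \<in> Kc g"
  obtain b where b: "b \<in> Kr r" "rho (b * g) < r" using assms unfolding Out_def by force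
  have "b * x * inverse b \<in> Kr r" using KrK[OF b(2)] Kc_conj[OF x] by blast
  then have "inverse b * (b * x * inverse b) * b \<in> Kr r" using KrM[OF KrM[OF Kr_inv[OF b(1)]] b(1)] by blast
  then show "x \<in> Kr r" by (simp add: gsimps)
qed

lemma Wd_left: "Wd r n k \<Longrightarrow> b \<in> Kr r \<Longrightarrow> Wd r n (b * k)"
proof (induction arbitrary: b rule: Wd.induct)
  case (Wd0 x) then show ?case by (intro Wd.Wd0 KrM)
next
  case (WdS y h n k)
  have "Wd r (Suc n) ((b * h * inverse b) * (b * k))"
    using WdS by (intro Wd.WdS[of "b * y"] Per_translate Kc_conj) auto
  then show ?case by (simp add: gsimps)
qed

lemma Wd_right: "Wd r n k \<Longrightarrow> Wd r m l \<Longrightarrow> Wd r (n + m) (k * l)"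
proof (induction rule: Wd.induct)
  case (WdS y h n k)
  then show ?case using Wd.WdS[of y r h "n + m" "k * l"] by (simp add: mult.assoc)
qed (auto intro: Wd_left)

lemma Kr_Suc_Wd: "x \<in> Kr (Suc r) \<Longrightarrow> \<exists>n. Wd r n x"
proof (induction rule: Kr.induct)
  case (KrR x) then show ?case by (blast intro: Wd0 Kr.KrR)
next
  case (KrK g x)
  show ?case
  proof (cases "g \<in> Out r")
    case True
    then have "rho g = r" using Out_rho[of g r] KrK by simp
    then have "g \<in> Per r" unfolding Per_def using True Kr_one[of r]
      by (intro CollectI exI[of _ 1] exI[of _ g]) simp
    then have "Wd r (Suc 0) (x * 1)" using KrK(2) Kr_one by (intro WdS Wd0)
    then show ?thesis by auto
  next
    case False
    then show ?thesis using not_Out KrK(2) Wd0 by blast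
  qed
next
  case (KrM x y) then show ?case using Wd_right by blast
qed

lemma Per_Kc: "y \<in> Per r \<Longrightarrow> Kc y \<subseteq> Kr (Suc r)"
proof
  fix x assume "y \<in> Per r" "x \<in> Kc y"
  then obtain b g where b: "b \<in> Kr r" "rho g = r" "y = b * g" by (auto simp: Per_def)
  then have "inverse b * x * inverse (inverse b) \<in> Kc (inverse b * y)" using Kc_conj \<open>x \<in> Kc y\<close> by blast
  then have "inverse b * x * b \<in> Kr (Suc r)" using b by (intro KrK[of g]) (auto simp: gsimps)
  moreover have b': "b \<in> Kr (Suc r)" using b(1) Kr_mono[of r "Suc r"] by simp
  ultimately have "b * (inverse b * x * b) * inverse b \<in> Kr (Suc r)"
    using KrM[OF KrM[OF b'] Kr_inv[OF b']] by blast
  then show "x \<in> Kr (Suc r)" by (simp add: gsimps)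
qed

section \<open>Bounded projections of the windmill to the axes outside it\<close>

definition Cr :: "nat \<Rightarrow> bool" where "Cr r \<longleftrightarrow> (\<forall>c\<in>Kr r. \<forall>y\<in>Out r. pd y 1 c \<le> 6 * \<theta>)"

lemma small_proj: "\<not> eqv y V \<Longrightarrow> rho V \<le> rho y \<Longrightarrow> pd y 1 V \<le> \<theta>"
  using rho_less[of y V] by linarith

text \<open>\<open>y'\<close> is a translate by some \<open>b'\<close> of an axis no further from 1
  than the axes in \<open>Out r\<close>, so \<open>y\<close> sees it near \<open>b'\<close>; and
  \<open>y\<close> sees \<open>b'\<close> near \<open>b\<close> by \<open>Cr\<close>. The constants
  add up as 1 and 6.\<close>

lemma Per_proj:
  assumes C: "Cr r" and y: "y \<in> Per r" "y' \<in> Per r" "\<not> eqv y y'" and b: "b \<in> Kr r"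
  shows "pd y b y' \<le> 7 * \<theta>"
proof -
  obtain b' V where V: "b' \<in> Kr r" "rho V = r" "y' = b' * V" using y(2) by (auto simp: Per_def)
  have o: "inverse c * y \<in> Out r" if "c \<in> Kr r" for c using Out_translate[OF Per_Out[OF y(1)] Kr_inv[OF that]] .
  have "pd y (b' * 1) (b' * V) = pd (inverse b' * y) 1 V" by (rule pd_shift)
  also have "\<dots> \<le> \<theta>"
  proof (rule small_proj)
    show "\<not> eqv (inverse b' * y) V" using y(3) V(3) eqv_left[of b' "inverse b' * y" V] by (simp add: gsimps)
    show "rho V \<le> rho (inverse b' * y)" using Out_rho[OF o[OF V(1)]] V(2) by simp
  qed
  finally have 1: "pd y b' y' \<le> \<theta>" using V(3) by simp
  have "pd y (b * 1) (b * (inverse b * b')) = pd (inverse b * y) 1 (inverse b * b')" by (rule pd_shift)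
  also have "\<dots> \<le> 6 * \<theta>" using C o[OF b] KrM[OF Kr_inv[OF b] V(1)] by (simp add: Cr_def)
  finally have "pd y b b' \<le> 6 * \<theta>" by (simp add: gsimps)
  then show ?thesis using 1 pd_tri[of y b y' b'] by linarith
qed

text \<open>The projection of a reduced word to its first axis is almost as long as the rotation, since
  by induction the rest of the word starts at a different axis.\<close>

lemma Wd_first:
  assumes C: "Cr r"
  shows "y \<in> Per r \<Longrightarrow> h \<in> Kc y \<Longrightarrow> Wd r n k \<Longrightarrow> (\<And>m. m < Suc n \<Longrightarrow> \<not> Wd r m (h * k)) \<Longrightarrow> b \<in> Kr r \<Longrightarrow>
    L - 8 * \<theta> \<le> pd y b (h * k)"
proof (induction n arbitrary: y h k b)
  case (0 y h k)
  have "h \<notin> R" using 0(4)[of 0] Wd_left[OF 0(3) KrR, of h] by auto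
  then have L: "L \<le> pd y b (h * b)" using rot[OF 0(2)] by blast
  have k: "k \<in> Kr r" using 0(3) by (cases rule: Wd.cases) auto
  have "pd y (b * 1) (b * (inverse b * k)) = pd (inverse b * y) 1 (inverse b * k)" by (rule pd_shift)
  also have "\<dots> \<le> 6 * \<theta>"
    using C Out_translate[OF Per_Out[OF 0(1)] Kr_inv[OF 0(5)]] KrM[OF Kr_inv[OF 0(5)] k] by (simp add: Cr_def)
  finally have "pd y b k \<le> 6 * \<theta>" by (simp add: gsimps)
  then have "pd y (h * b) (h * k) \<le> 6 * \<theta>" using pd_fix[OF 0(2)] by simp
  then show ?case using pd_tri[of y b "h * b" "h * k"] pd_sym[of y "h * k" "h * b"] L th by linarith
next
  case (Suc n y h k)
  have "h \<notin> R" using Suc.prems(4)[of "Suc n"] Wd_left[OF Suc.prems(3) KrR, of h] by auto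
  then have L: "L \<le> pd y b (h * b)" using rot[OF Suc.prems(2)] by blast
  obtain y' h' k' where k: "k = h' * k'" "y' \<in> Per r" "h' \<in> Kc y'" "Wd r n k'"
    using Suc.prems(3) by (cases rule: Wd.cases) auto
  \<comment> \<open>Two consecutive rotations about one axis would merge and shorten the
    word.\<close>
  have ne: "\<not> eqv y y'"
  proof
    assume "eqv y y'"
    then have "h * h' \<in> Kc y" using Kc_eqv k(3) Suc.prems(2) subgrD(2)[OF Kc_subgr] by metis
    then have "Wd r (Suc n) ((h * h') * k')" using Suc.prems(1) k(4) by (intro WdS)
    then show False using Suc.prems(4)[of "Suc n"] k(1) by (simp add: mult.assoc)
  qed
  have "\<not> Wd r m (h' * k')" if "m < Suc n" for m
    using Suc.prems(4)[of "Suc m"] WdS[OF Suc.prems(1,2), of m "h' * k'"] that k(1) by auto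
  then have big: "L - 8 * \<theta> \<le> pd y' b k" using Suc.IH[OF k(2-4) _ Suc.prems(5)] k(1) by blast
  have "pd y' b y \<le> 7 * \<theta>" using Per_proj[OF C k(2) Suc.prems(1) _ Suc.prems(5)] ne eqv_sym by blast
  then have "\<theta> < pd y' k y"
    using big pd_tri[of y' b k y] pd_sym[of y' y k] LL th by linarith
  then have "pd y k y' \<le> \<theta>" using behrstock[OF ne, of k] by linarith
  moreover have "pd y b y' \<le> 7 * \<theta>" using Per_proj[OF C Suc.prems(1) k(2) ne Suc.prems(5)] .
  ultimately have "pd y b k \<le> 8 * \<theta>" using pd_tri[of y b k y'] pd_sym[of y y' k] by linarith
  then have "pd y (h * b) (h * k) \<le> 8 * \<theta>" using pd_fix[OF Suc.prems(2)] by simp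
  then show ?case using pd_tri[of y b "h * b" "h * k"] pd_sym[of y "h * k" "h * b"] L by linarith
qed

text \<open>A base point \<open>p\<close> that may replace 1 when looking from \<open>y\<close>: it
  has almost the same projection to \<open>y\<close>, and every axis that clearly separates 1 from
  \<open>y\<close> still separates \<open>p\<close> from \<open>y\<close>. The gap between
  \<open>9 / 10\<close> and \<open>1 / 5\<close> of \<open>L\<close> lets the property reproduce
  itself in \<open>LA_axis\<close>.\<close>

definition LA :: "'a \<Rightarrow> 'a \<Rightarrow> bool" where
  "LA p y \<longleftrightarrow> pd y p 1 \<le> 2 * \<theta> \<and> (\<forall>u. \<not> eqv u y \<longrightarrow> 9 * L \<le> 10 * pd u 1 y \<longrightarrow> L \<le> 5 * pd u p y)"

lemma LA_one: "LA 1 y"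
proof -
  have "pd y 1 1 \<le> 2 * \<theta>" using pd_R[OF nsubD(1)[OF nR], of y] th by linarith
  then show ?thesis using LL th by (auto simp: LA_def)
qed

text \<open>When \<open>V\<close> separates \<open>p\<close> from \<open>y\<close>, both
  \<open>y\<close> and any relevant axis \<open>u\<close> see \<open>p\<close> where they see
  \<open>V\<close>. Of the \<open>9 / 10\<close> of \<open>L\<close> between 1 and \<open>y\<close>
  at \<open>u\<close>, less than \<open>3 / 5\<close> lies before \<open>V\<close>; so
  \<open>3 / 10\<close> remains behind \<open>V\<close>, and \<open>1 / 5\<close> after subtracting
  errors.\<close>

lemma LA_axis:
  assumes V: "V \<in> Out (rho V)" "rho V < rho y" and far: "L \<le> 5 * pd V p y" shows "LA p y"
proof -
  have ne: "\<not> eqv V y" "\<not> eqv y V" using V(2) rho_eqv[of V y] rho_eqv[of y V] by auto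
  have "pd y p V \<le> \<theta>" using behrstock[OF ne(1), of p] far LL th by linarith
  moreover have "pd y 1 V \<le> \<theta>" using small_proj[OF ne(2)] V(2) by simp
  ultimately have 1: "pd y p 1 \<le> 2 * \<theta>" using pd_tri[of y p 1 V] pd_sym[of y V 1] by linarith
  have "L \<le> 5 * pd u p y" if u: "\<not> eqv u y" "9 * L \<le> 10 * pd u 1 y" for u
  proof (cases "eqv u V")
    case True
    then show ?thesis using pd_eqv[OF True, of p y] far by simp
  next
    case False
    \<comment> \<open>Otherwise a rotation about \<open>u\<close>, which is in
      \<open>Kr (rho V)\<close>, would bring \<open>V\<close> closer to 1 than its membership in
      \<open>Out (rho V)\<close> permits.\<close>
    have "5 * pd u 1 V < 3 * L"
    proof (cases "rho V \<le> rho u")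
      case True
      then show ?thesis using small_proj[OF False] LL th by linarith
    next
      case less: False
      show ?thesis
      proof (rule ccontr)
        assume "\<not> ?thesis"
        then obtain k where k: "k \<in> Kc u" "rho (k * V) < rho V" using rho_reduce[OF False] by auto
        then have "k \<in> Kr (rho V)" using KrK[of u] less by simp
        then show False using V(1) k(2) unfolding Out_def by force
      qed
    qed
    then have uV: "3 * L \<le> 10 * pd u V y" using u(2) pd_tri[of u 1 y V] by linarith
    then have "pd V y u \<le> \<theta>" using behrstock[OF False, of y] pd_sym[of u y V] LL th by linarith
    then have "\<theta> < pd V p u" using far pd_tri[of V p y u] pd_sym[of V u y] LL th by linarith
    then have "pd u p V \<le> \<theta>" using behrstock[OF False, of p] by linarith
    then show ?thesis using uV pd_tri[of u V y p] pd_sym[of u V p] LL th by linarith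
  qed
  with 1 show ?thesis by (simp add: LA_def)
qed

text \<open>\<open>Cr\<close> is the case \<open>p = 1\<close>, \<open>q = c\<close>. With free base
  points at both ends the statement is stable under rotations, so that the bound does not grow with
  the number of rotations in a word or with \<open>r\<close>.\<close>

definition Dr :: "nat \<Rightarrow> bool" where
  "Dr r \<longleftrightarrow> (\<forall>c\<in>Kr r. \<forall>y\<in>Out r. \<forall>p q. LA p y \<longrightarrow> LA (inverse c * q) (inverse c * y) \<longrightarrow> pd y p q \<le> 6 * \<theta>)"

lemma Cr_of_Dr: "Dr r \<Longrightarrow> Cr r"
  unfolding Dr_def Cr_def using LA_one by (metis left_inv)

text \<open>Induction on the number of rotations in a shortest word for \<open>c\<close>. Its first
  axis \<open>y1\<close> separates 1 from \<open>c\<close> by almost \<open>L\<close>. By the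
  Behrstock inequality, \<open>y\<close> is on the side of \<open>c\<close>, on the side of 1, or
  sees 1, \<open>y1\<close> and \<open>c\<close> in nearly one place.\<close>

lemma Dr_Suc: assumes D: "Dr r" shows "Dr (Suc r)"
proof -
  note C = Cr_of_Dr[OF D]
  have step: "pd y p q \<le> 6 * \<theta>"
    if "Wd r n c" "y \<in> Out (Suc r)" "LA p y" "LA (inverse c * q) (inverse c * y)" for n c y p q
    using that
  proof (induction n arbitrary: c y p q rule: less_induct)
    case (less n)
    note yr = Out_anti[OF less.prems(2), of r, simplified]
    show ?case
    proof (cases "\<exists>m<n. Wd r m c")
      case True then show ?thesis using less by blast
    next
      case False
      show ?thesis
      proof (cases n)
        case 0
        then have "c \<in> Kr r" using less.prems(1) by (auto elim: Wd.cases)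
        then show ?thesis using D yr less.prems(3,4) unfolding Dr_def by blast
      next
        case (Suc m)
        obtain y1 h c' where c: "c = h * c'" "y1 \<in> Per r" "h \<in> Kc y1" "Wd r m c'"
          using less.prems(1) Suc by (auto elim: Wd.cases)
        obtain b V where V: "b \<in> Kr r" "V \<in> Out r" "rho V = r" "y1 = b * V" using c(2) by (auto simp: Per_def)
        have big: "L - 8 * \<theta> \<le> pd y1 1 c"
          using Wd_first[OF C c(2-4) _ Kr_one] False Suc c(1) by auto
        have ne: "\<not> eqv y1 y"
        proof
          assume "eqv y1 y"
          then have "rho (inverse b * y) = rho (inverse b * y1)" by (intro rho_eqv) simp
          moreover have "Suc r \<le> rho (inverse b * y)"
            using less.prems(2) Kr_inv[OF Kr_mono[OF _ V(1), of "Suc r"]] by (simp add: Out_def)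
          ultimately show False using V by (simp add: gsimps)
        qed
        have hb: "inverse (h * b) \<in> Kr (Suc r)"
          using Per_Kc[OF c(2)] c(3) Kr_mono[OF _ V(1), of "Suc r"] by (intro Kr_inv KrM) auto
        have rho_big: "r < rho (k * y)" if "k \<in> Kr (Suc r)" for k
          using Out_rho[OF Out_translate[OF less.prems(2) that]] by simp
        have Vo: "V \<in> Out (rho V)" using V by simp
        have pd1: "pd y1 c y \<le> \<theta> \<or> pd y c y1 \<le> \<theta>" "pd y1 1 y \<le> \<theta> \<or> pd y 1 y1 \<le> \<theta>"
          using behrstock[OF ne] by blast+
        have l1: "pd y p 1 \<le> 2 * \<theta>" using less.prems(3) by (simp add: LA_def)
        have l2: "pd y q c \<le> 2 * \<theta>"
          using less.prems(4) pd_left[of c "inverse c * y" "inverse c * q" 1] by (simp add: LA_def gsimps)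
        consider (a) "pd y1 c y \<le> \<theta>" | (b) "pd y1 1 y \<le> \<theta>" | (c) "pd y c y1 \<le> \<theta>" "pd y 1 y1 \<le> \<theta>"
          using pd1 by blast
        then show ?thesis
        proof cases
          \<comment> \<open>\<open>y1\<close> separates \<open>y\<close> from 1 and therefore from
            \<open>p\<close>. Undoing the first rotation turns \<open>y1\<close> into
            \<open>V\<close>; \<open>LA_axis\<close> accepts the moved \<open>p\<close> as a base
            point, and the word has become shorter.\<close>
          case a
          have "9 * L \<le> 10 * pd y1 1 y" using big a pd_tri[of y1 1 c y] pd_sym[of y1 y c] LL th by linarith
          then have f: "L \<le> 5 * pd y1 p y" using less.prems(3) ne by (simp add: LA_def)
          define k where "k = inverse (h * b)"
          have e: "eqv y1 (h * y1)" using Kc_fix[OF c(3)] .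
          have "pd V (k * p) (k * y) = pd (inverse k * V) p y" by (rule pd_shift)
          also have "inverse k * V = h * y1" using V by (simp add: k_def gsimps)
          finally have "L \<le> 5 * pd V (k * p) (k * y)" using f pd_eqv[OF e] by simp
          then have "LA (k * p) (k * y)" using LA_axis[OF Vo] rho_big[OF hb] V(3) by (simp add: k_def)
          moreover have "Wd r m (inverse b * c')" using Wd_left[OF c(4) Kr_inv[OF V(1)]] .
          moreover have "inverse (inverse b * c') * (k * x) = inverse c * x" for x by (simp add: k_def c(1) gsimps)
          moreover have "k * y \<in> Out (Suc r)" using Out_translate[OF less.prems(2) hb] by (simp add: k_def)
          ultimately have "pd (k * y) (k * p) (k * q) \<le> 6 * \<theta>"
            using less.IH[of m "inverse b * c'" "k * y" "k * p" "k * q"] less.prems(4) Suc by simp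
          then show ?thesis by (simp add: pd_left)
        next
          \<comment> \<open>\<open>y1\<close> separates \<open>y\<close> from \<open>c\<close> and
            therefore from \<open>q\<close>. All rotations are dropped: \<open>b\<close> from
            \<open>Kr r\<close> takes the place of \<open>c\<close>, and \<open>Dr r\<close>
            applies.\<close>
          case b
          have "9 * L \<le> 10 * pd y1 c y" using big b pd_tri[of y1 1 c y] pd_sym[of y1 y c] LL th by linarith
          moreover have "pd (inverse c * y1) (inverse c * z) (inverse c * y) = pd y1 z y" for z by (rule pd_left)
          moreover have "\<not> eqv (inverse c * y1) (inverse c * y)" using ne eqv_left by blast
          ultimately have f: "L \<le> 5 * pd y1 q y"
            using less.prems(4)[unfolded LA_def] left_inv[of c] by metis
          have "pd V (inverse b * q) (inverse b * y) = pd (b * V) q y"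
            using pd_shift[of V "inverse b" q y] by (simp add: inv_inv)
          then have "LA (inverse b * q) (inverse b * y)"
            using LA_axis[OF Vo, of "inverse b * y"] rho_big[OF Kr_mono[OF _ Kr_inv[OF V(1)]]] V f by simp
          then show ?thesis using D V(1) yr less.prems(3) unfolding Dr_def by blast
        next
          \<comment> \<open>The constant 6 is \<open>2 + 1 + 1 + 2\<close>, along \<open>p\<close>,
            1, \<open>y1\<close>, \<open>c\<close> and \<open>q\<close>.\<close>
          case c
          then show ?thesis using l1 l2 pd_tri[of y p q 1] pd_tri[of y 1 q y1] pd_tri[of y y1 q c]
            pd_sym[of y c y1] pd_sym[of y q c] by linarith
        qed
      qed
    qed
  qed
  show ?thesis unfolding Dr_def using step Kr_Suc_Wd by blast
qed

lemma Dr_all: "Dr r"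
proof (induction r)
  case 0
  show ?case unfolding Dr_def
  proof (intro ballI allI impI)
    fix c y p q assume a: "c \<in> Kr 0" "LA p y" "LA (inverse c * q) (inverse c * y)"
    have "pd y 1 c \<le> \<theta>" using pd_R Kr_0[OF a(1)] by blast
    moreover have "pd y p 1 \<le> 2 * \<theta>" using a(2) by (simp add: LA_def)
    moreover have "pd y q c \<le> 2 * \<theta>"
      using a(3) pd_left[of c "inverse c * y" "inverse c * q" 1] by (simp add: LA_def gsimps)
    ultimately show "pd y p q \<le> 6 * \<theta>"
      using pd_tri[of y p q 1] pd_tri[of y 1 q c] pd_sym[of y q c] th by linarith
  qed
qed (rule Dr_Suc)

text \<open>The counterpart of Greendlinger's lemma: an element outside \<open>R\<close> is seen far
  from 1 by some axis, and a rotation about this axis removes its first factor. The rule is used to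
  lift triangles from the quotient and to show that new relations are long.\<close>

lemma Kr_reduce [consumes 1, case_names base step]:
  assumes "k \<in> Kr r"
    and base: "\<And>k. k \<in> R \<Longrightarrow> Q k"
    and step: "\<And>k y h. h \<in> Kc y \<Longrightarrow> L - 8 * \<theta> \<le> pd y 1 k \<Longrightarrow> Q (h * k) \<Longrightarrow> Q k"
  shows "Q k"
  using assms(1)
proof (induction r arbitrary: k)
  case 0 then show ?case using base Kr_0 by blast
next
  case (Suc r)
  note C = Cr_of_Dr[OF Dr_all, of r]
  obtain n where "Wd r n k" using Kr_Suc_Wd[OF Suc.prems] by blast
  then show ?case
  proof (induction n arbitrary: k rule: less_induct)
    case (less n)
    show ?case
    proof (cases "\<exists>m<n. Wd r m k")
      case True then show ?thesis using less by blast
    next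
      case False
      show ?thesis
      proof (cases n)
        case 0
        then have "k \<in> Kr r" using less.prems by (auto elim: Wd.cases)
        then show ?thesis by (rule Suc.IH)
      next
        case (Suc m)
        obtain y h k' where k: "k = h * k'" "y \<in> Per r" "h \<in> Kc y" "Wd r m k'"
          using less.prems Suc by (auto elim: Wd.cases)
        have "L - 8 * \<theta> \<le> pd y 1 k" using Wd_first[OF C k(2-4) _ Kr_one] False Suc k(1) by auto
        moreover have "Q k'" using less.IH[OF _ k(4)] Suc by simp
        ultimately show ?thesis
          using step[of "inverse h" y k] subgrD(3)[OF Kc_subgr k(3)] k(1) by (simp add: gsimps)
      qed
    qed
  qed
qed

section \<open>The normal subgroup generated by all rotations\<close>

definition KK :: "'a set" where "KK = (\<Union>r. Kr r)"

lemma Kc_KK: "Kc g \<subseteq> KK" unfolding KK_def using KrK[of g "Suc (rho g)"] by auto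

lemma nsub_KK: "nsub KK"
proof -
  have "x * y \<in> KK" if xy: "x \<in> KK" "y \<in> KK" for x y
  proof -
    obtain r s where "x \<in> Kr r" "y \<in> Kr s" using xy by (auto simp: KK_def)
    then have "x * y \<in> Kr (max r s)" using Kr_mono[of r "max r s" x] Kr_mono[of s "max r s" y] by (intro KrM) auto
    then show ?thesis by (auto simp: KK_def)
  qed
  moreover have "inverse x \<in> KK" if "x \<in> KK" for x using that Kr_inv by (auto simp: KK_def)
  moreover have "1 \<in> KK" using Kr_one by (auto simp: KK_def)
  ultimately have s: "subgr KK" by (auto simp: subgr_def)
  have "g * x * inverse g \<in> KK" if "x \<in> Kr r" for g x r
    using that
  proof (induction rule: Kr.induct)
    case (KrR x)
    then have "g * x * inverse g \<in> R" by (rule nsubD(4)[OF nR])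
    then show ?case unfolding KK_def using Kr.KrR by blast
  next
    case (KrK h x)
    then show ?case using Kc_conj Kc_KK by blast
  next
    case (KrM x y)
    have "g * (x * y) * inverse g = (g * x * inverse g) * (g * y * inverse g)" by (simp add: gsimps)
    then show ?case using KrM subgrD(2)[OF s] by metis
  qed
  then show ?thesis using s by (auto simp: nsub_def KK_def)
qed

lemma KK_least: assumes "nsub M" "R \<subseteq> M" "\<And>g. Kc g \<subseteq> M" shows "KK \<subseteq> M"
proof -
  have "x \<in> M" if "x \<in> Kr r" for x r
    using that by (induction rule: Kr.induct) (use assms in \<open>auto intro: nsubD\<close>)
  then show ?thesis by (auto simp: KK_def)
qed

end

subsection \<open>Projections to cosets of the elementary subgroup\<close>

context qaxis begin

definition cs :: "'a \<Rightarrow> 'a set" where "cs g = {y. inverse g * y \<in> E}"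

lemma cs_self: "g \<in> cs g" using subgrD(1)[OF subgr_E] by (simp add: cs_def left_inv)

lemma cs_left: "k * y \<in> cs (k * g) \<longleftrightarrow> y \<in> cs g" by (simp add: cs_def gsimps)

lemma cs_coset: "e \<in> E \<Longrightarrow> cs (g * e) = cs g"
  unfolding cs_def using subgr_mult_left[OF subgr_E subgrD(3)[OF subgr_E]] by (simp add: gsimps)

definition prj :: "'a \<Rightarrow> 'a \<Rightarrow> 'a \<Rightarrow> bool" where
  "prj g a p \<longleftrightarrow> p \<in> cs g \<and> (\<forall>y\<in>cs g. dd a p \<le> dd a y)"

lemma prj_ex: "\<exists>p. prj g a p"
proof -
  obtain p where "p \<in> cs g" "\<forall>y. y \<in> cs g \<longrightarrow> len (inverse a * p) \<le> len (inverse a * y)"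
    using ex_has_least_nat[of "\<lambda>y. y \<in> cs g" g "\<lambda>y. len (inverse a * y)"] cs_self by auto
  then show ?thesis by (auto simp: prj_def dd_def)
qed

lemma prj_left: "prj (k * g) (k * a) (k * p) \<longleftrightarrow> prj g a p"
proof -
  have "(\<forall>y\<in>cs (k * g). dd (k * a) (k * p) \<le> dd (k * a) y) \<longleftrightarrow> (\<forall>y\<in>cs g. dd a p \<le> dd a y)"
  proof safe
    fix y assume "\<forall>y\<in>cs (k * g). dd (k * a) (k * p) \<le> dd (k * a) y" "y \<in> cs g"
    then show "dd a p \<le> dd a y" using cs_left[of k y g] dd_left by metis
  next
    fix y assume a: "\<forall>y\<in>cs g. dd a p \<le> dd a y" "y \<in> cs (k * g)"
    then have "inverse k * y \<in> cs g" using cs_left[of k "inverse k * y" g] by (simp add: gsimps)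
    then show "dd (k * a) (k * p) \<le> dd (k * a) y"
      using a(1) dd_left[of k a "inverse k * y"] by (simp add: gsimps)
  qed
  then show ?thesis by (simp add: prj_def cs_left)
qed

lemma prj_coset: "e \<in> E \<Longrightarrow> prj (g * e) a p \<longleftrightarrow> prj g a p" by (simp add: prj_def cs_coset)

definition qc :: "int \<Rightarrow> int" where "qc \<epsilon> = int (len v) + \<epsilon> + 4 * kap + 7 * \<delta>"

lemma cs_quasiconvex:
  assumes "y1 \<in> cs g" "y2 \<in> cs g" "gp c y1 y2 \<le> \<epsilon>" "0 \<le> \<epsilon>" shows "\<exists>y\<in>cs g. dd c y \<le> qc \<epsilon>"
proof -
  have "gp (inverse g * c) (inverse g * y1) (inverse g * y2) \<le> \<epsilon>" using assms(3) by simp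
  then obtain e where e: "e \<in> E" "dd (inverse g * c) e \<le> qc \<epsilon>"
    using E_quasiconvex assms unfolding cs_def qc_def by blast
  have "dd c (g * e) = dd (inverse g * c) e" using dd_left[of g "inverse g * c" e] by (simp add: gsimps)
  then show ?thesis using e by (intro bexI[of _ "g * e"]) (auto simp: cs_def gsimps)
qed

definition C1 :: int where "C1 = 2 * qc 0 + 2 * \<delta> + 2"

lemma C1_pos: "2 \<le> C1" using kap_nonneg dnn by (simp add: C1_def qc_def)

text \<open>If the Gromov product were large, the point \<open>c\<close> at half its height on the
  way from \<open>p\<close> to \<open>y\<close> would be much closer to \<open>a\<close> than
  \<open>p\<close> is, and by quasiconvexity so would be a point of the coset near
  \<open>c\<close>.\<close>

lemma prj_gp: assumes "prj g a p" "y \<in> cs g" shows "gp p a y \<le> C1"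
proof -
  define t where "t = gp p a y"
  have t: "0 \<le> t" "t \<le> 2 * dd p y"
    using gp_nonneg dd_tri[of a p y] dd_tri[of p a y] dd_sym[of y p] dd_sym[of a p] unfolding t_def gp_def by auto
  have "2 * (t div 2) \<le> t" "t \<le> 2 * (t div 2) + 1" by linarith+
  then obtain h where h: "2 * h \<le> t" "t \<le> 2 * h + 1" by blast
  obtain c where c: "dd p c = h" "dd c y = dd p y - h" using dd_point[of h p y] h t by auto
  have "gp p y c = 2 * h" using c dd_sym[of c y] by (simp add: gp_def)
  then have "t - 1 - \<delta> \<le> gp p a c" using hyp4D[OF hyp, of p a y c] h dnn unfolding t_def by linarith
  then have ac: "dd a c \<le> dd a p + h - t + 1 + \<delta>" using c dd_sym[of a p] unfolding gp_def by linarith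
  have "gp c p y \<le> 0" using c dd_sym[of c p] by (simp add: gp_def)
  then obtain y' where y': "y' \<in> cs g" "dd c y' \<le> qc 0" using cs_quasiconvex[of p g y c 0] assms by (auto simp: prj_def)
  have "dd a p \<le> dd a c + dd c y'" using assms(1) y'(1) dd_tri[of a y' c] unfolding prj_def by fastforce
  then show ?thesis using ac y'(2) h unfolding t_def[symmetric] C1_def by linarith
qed

lemma prj_far:
  assumes "prj g a p" "prj g b p'" "C1 + \<delta> < dd p p'"
  shows "gp p a b \<le> C1 + \<delta>" "dd a p + dd p p' + dd p' b - (2 * C1 + \<delta>) \<le> dd a b"
proof -
  have 1: "gp p a p' \<le> C1" "gp p' b p \<le> C1" using prj_gp assms unfolding prj_def by blast+
  have "2 * dd p p' - C1 \<le> gp p b p'" using 1(2) gp_swap[of p p' b] gp_sym[of p b p'] gp_sym[of p' b p] by linarith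
  then show 2: "gp p a b \<le> C1 + \<delta>"
    using hyp4D[OF hyp, of p a b p'] 1(1) assms(3) C1_pos dnn by linarith
  show "dd a p + dd p p' + dd p' b - (2 * C1 + \<delta>) \<le> dd a b"
    using 2 1(2) dd_sym[of p a] dd_sym[of p p'] dd_sym[of b p] unfolding gp_def by linarith
qed

lemma prj_lip: "prj g a p \<Longrightarrow> prj g b p' \<Longrightarrow> dd p p' \<le> dd a b + 2 * C1 + \<delta>"
  using prj_far[of g a p b p'] C1_pos dnn dd_nonneg[of a p] dd_nonneg[of p' b] dd_nonneg[of a b] by linarith

text \<open>Nearest points are not unique. The supremum over all choices makes symmetry, triangle
  inequality and equivariance exact, as \<open>windmill\<close> demands.\<close>

definition pd :: "'a \<Rightarrow> 'a \<Rightarrow> 'a \<Rightarrow> int" where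
  "pd g a b = Sup {dd p p' | p p'. prj g a p \<and> prj g b p'}"

lemma pd_upper: "prj g a p \<Longrightarrow> prj g b p' \<Longrightarrow> dd p p' \<le> pd g a b"
  unfolding pd_def
  by (rule cSup_upper) (auto intro!: bdd_aboveI[of _ "dd a b + 2 * C1 + \<delta>"] intro: prj_lip)

lemma pd_least: "(\<And>p p'. prj g a p \<Longrightarrow> prj g b p' \<Longrightarrow> dd p p' \<le> n) \<Longrightarrow> pd g a b \<le> n"
  unfolding pd_def using prj_ex[of g a] prj_ex[of g b] by (intro cSup_least) auto

lemma pd_greater: assumes "n < pd g a b" obtains p p' where "prj g a p" "prj g b p'" "n < dd p p'"
  using assms pd_least[of g a b n] by (meson not_le)

lemma pd_sym: "pd g a b = pd g b a"
  by (rule antisym; rule pd_least) (metis dd_sym pd_upper)+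

lemma pd_tri: "pd g a c \<le> pd g a b + pd g b c"
proof (rule pd_least)
  fix p p' assume p: "prj g a p" "prj g c p'"
  obtain u where "prj g b u" using prj_ex by blast
  then show "dd p p' \<le> pd g a b + pd g b c" using pd_upper[OF p(1)] pd_upper[OF _ p(2)] dd_tri[of p p' u] by force
qed

lemma pd_lip: "pd g a b \<le> dd a b + 2 * C1 + \<delta>" by (rule pd_least) (rule prj_lip)

lemma pd_left: "pd (k * g) (k * a) (k * b) = pd g a b"
proof -
  have le: "pd g a b \<le> pd (k * g) (k * a) (k * b)" for k g a b
    by (rule pd_least) (metis dd_left pd_upper prj_left)
  have "pd (inverse k * (k * g)) (inverse k * (k * a)) (inverse k * (k * b)) \<ge> pd (k * g) (k * a) (k * b)" by (rule le)
  then show ?thesis using le[of g a b k] by (simp add: gsimps)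
qed

lemma pd_coset: "e \<in> E \<Longrightarrow> pd (g * e) a b = pd g a b" by (simp add: pd_def prj_coset)

text \<open>The length beyond which different cosets of \<open>E\<close> cannot run in parallel,
  from \<open>E_separated\<close>; it is at least \<open>C1 + \<delta>\<close> so that
  \<open>prj_far\<close> applies above it.\<close>

definition \<theta>3 :: int where
  "\<theta>3 = (SOME t. C1 + \<delta> \<le> t \<and> (\<forall>g. \<forall>e1\<in>E. \<forall>e2\<in>E. \<forall>f1\<in>E. \<forall>f2\<in>E.
     dd e1 (g * f1) \<le> qc (C1 + \<delta>) \<longrightarrow> dd e2 (g * f2) \<le> qc (C1 + \<delta>) \<longrightarrow> t < dd e1 e2 \<longrightarrow> g \<in> E))"

lemma \<theta>3: "C1 + \<delta> \<le> \<theta>3"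
  "e1 \<in> E \<Longrightarrow> e2 \<in> E \<Longrightarrow> f1 \<in> E \<Longrightarrow> f2 \<in> E \<Longrightarrow> dd e1 (g * f1) \<le> qc (C1 + \<delta>) \<Longrightarrow>
   dd e2 (g * f2) \<le> qc (C1 + \<delta>) \<Longrightarrow> \<theta>3 < dd e1 e2 \<Longrightarrow> g \<in> E"
proof -
  have "0 \<le> qc (C1 + \<delta>)" using C1_pos dnn kap_nonneg by (simp add: qc_def)
  then obtain t where t: "\<forall>g. \<forall>e1\<in>E. \<forall>e2\<in>E. \<forall>f1\<in>E. \<forall>f2\<in>E.
     dd e1 (g * f1) \<le> qc (C1 + \<delta>) \<longrightarrow> dd e2 (g * f2) \<le> qc (C1 + \<delta>) \<longrightarrow> t < dd e1 e2 \<longrightarrow> g \<in> E"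
    using E_separated by blast
  have "\<exists>t. C1 + \<delta> \<le> t \<and> (\<forall>g. \<forall>e1\<in>E. \<forall>e2\<in>E. \<forall>f1\<in>E. \<forall>f2\<in>E.
     dd e1 (g * f1) \<le> qc (C1 + \<delta>) \<longrightarrow> dd e2 (g * f2) \<le> qc (C1 + \<delta>) \<longrightarrow> t < dd e1 e2 \<longrightarrow> g \<in> E)"
  proof (intro exI[of _ "max t (C1 + \<delta>)"] conjI allI ballI impI)
    fix g e1 e2 f1 f2 assume a: "e1 \<in> E" "e2 \<in> E" "f1 \<in> E" "f2 \<in> E" "dd e1 (g * f1) \<le> qc (C1 + \<delta>)"
      "dd e2 (g * f2) \<le> qc (C1 + \<delta>)" and l: "max t (C1 + \<delta>) < dd e1 e2"
    from l have "t < dd e1 e2" by simp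
    with t a show "g \<in> E" by blast
  qed simp
  from someI_ex[OF this, folded \<theta>3_def]
  show "C1 + \<delta> \<le> \<theta>3"
    "e1 \<in> E \<Longrightarrow> e2 \<in> E \<Longrightarrow> f1 \<in> E \<Longrightarrow> f2 \<in> E \<Longrightarrow> dd e1 (g * f1) \<le> qc (C1 + \<delta>) \<Longrightarrow>
     dd e2 (g * f2) \<le> qc (C1 + \<delta>) \<Longrightarrow> \<theta>3 < dd e1 e2 \<Longrightarrow> g \<in> E" by blast+
qed

text \<open>If two points of the coset of \<open>h\<close> had projections to the coset of
  \<open>g\<close> further apart than \<open>\<theta>3\<close>, both projections would be close to
  the coset of \<open>h\<close> by quasiconvexity, and the cosets would run in parallel for too
  long.\<close>

lemma axes_proj:
  assumes ne: "inverse g * h \<notin> E" and z: "z \<in> cs h" "z' \<in> cs h" shows "pd g z z' \<le> \<theta>3"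
proof (rule pd_least, rule ccontr)
  fix p p' assume p: "prj g z p" "prj g z' p'" and n: "\<not> dd p p' \<le> \<theta>3"
  then have far: "C1 + \<delta> < dd p p'" "C1 + \<delta> < dd p' p" using \<theta>3(1) dd_sym[of p p'] by linarith+
  have nn: "0 \<le> C1 + \<delta>" using C1_pos dnn by linarith
  obtain y where y: "y \<in> cs h" "dd p y \<le> qc (C1 + \<delta>)"
    using cs_quasiconvex[OF z prj_far(1)[OF p far(1)] nn] by blast
  obtain y' where y': "y' \<in> cs h" "dd p' y' \<le> qc (C1 + \<delta>)"
    using cs_quasiconvex[OF z(2,1) prj_far(1)[OF p(2,1) far(2)] nn] by blast
  have "inverse g * h \<in> E"
  proof (rule \<theta>3(2))
    show "inverse g * p \<in> E" "inverse g * p' \<in> E" using p by (auto simp: prj_def cs_def)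
    show "inverse h * y \<in> E" "inverse h * y' \<in> E" using y y' by (auto simp: cs_def)
    show "dd (inverse g * p) (inverse g * h * (inverse h * y)) \<le> qc (C1 + \<delta>)"
      using y(2) by (simp add: mult.assoc cancel_inv_left)
    show "dd (inverse g * p') (inverse g * h * (inverse h * y')) \<le> qc (C1 + \<delta>)"
      using y'(2) by (simp add: mult.assoc cancel_inv_left)
    show "\<theta>3 < dd (inverse g * p) (inverse g * p')" using n by simp
  qed
  with ne show False ..
qed

text \<open>The first two terms collect the projection errors in
  \<open>behrstock_inequality\<close>, the last one is the size of one coset as seen from
  another.\<close>

definition \<theta> :: int where "\<theta> = 5 * C1 + 3 * \<delta> + \<theta>3"

lemma th_nonneg: "0 \<le> \<theta>" "\<theta>3 \<le> \<theta>" "2 * C1 + \<delta> + \<theta>3 \<le> \<theta>"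
  using C1_pos dnn \<theta>3(1) unfolding \<theta>_def by linarith+

text \<open>Let \<open>p\<close> be the projection of \<open>a\<close> to the coset of
  \<open>g\<close>. If the coset of \<open>h\<close> saw \<open>a\<close> and \<open>p\<close> far
  apart, its point \<open>u\<close> nearest to \<open>a\<close> would be near a geodesic from
  \<open>a\<close> to \<open>p\<close> and so project to \<open>g\<close> near \<open>p\<close>,
  against the assumption. Hence \<open>h\<close> sees \<open>a\<close> where it sees
  \<open>p\<close>, which lies on the coset of \<open>g\<close>.\<close>

lemma behrstock_inequality:
  assumes ne: "inverse g * h \<notin> E" shows "pd g a h \<le> \<theta> \<or> pd h a g \<le> \<theta>"
proof (cases "pd g a h \<le> \<theta>")
  case False
  have ne': "inverse h * g \<notin> E" using ne subgrD(3)[OF subgr_E, of "inverse h * g"] by (auto simp: gsimps)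
  obtain p where p: "prj g a p" using prj_ex by blast
  have "pd h a p \<le> C1 + \<delta>"
  proof (rule ccontr)
    assume "\<not> ?thesis"
    then have "C1 + \<delta> < pd h a p" by simp
    then obtain u u' where u: "prj h a u" "prj h p u'" "C1 + \<delta> < dd u u'" by (rule pd_greater)
    have g1: "gp u a p \<le> C1 + \<delta>" by (rule prj_far(1)[OF u])
    have "pd g a u \<le> 5 * C1 + 3 * \<delta>"
    proof (rule pd_least)
      fix q t assume q: "prj g a q" and t: "prj g u t"
      have "dd q p \<le> 2 * C1 + \<delta>" using prj_lip[OF q p] by simp
      moreover have "dd p t \<le> 3 * C1 + 2 * \<delta>"
      proof (cases "C1 + \<delta> < dd p t")
        case True
        then show ?thesis using prj_far(2)[OF p t] g1 dd_sym[of u a] dd_nonneg[of u p] dd_nonneg[of t u]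
          unfolding gp_def by linarith
      next
        case False then show ?thesis using C1_pos dnn by linarith
      qed
      ultimately show "dd q t \<le> 5 * C1 + 3 * \<delta>" using dd_tri[of q t p] by linarith
    qed
    moreover have "pd g u h \<le> \<theta>3" using axes_proj[OF ne, of u h] u(1) cs_self by (auto simp: prj_def)
    ultimately show False using False pd_tri[of g a h u] unfolding \<theta>_def by linarith
  qed
  moreover have "pd h p g \<le> \<theta>3" using axes_proj[OF ne', of p g] p cs_self by (auto simp: prj_def)
  ultimately show ?thesis using pd_tri[of h a g p] C1_pos dnn unfolding \<theta>_def by linarith
qed simp

section \<open>Distances of the axes from 1\<close>

definition rho :: "'a \<Rightarrow> nat" where "rho g = (LEAST n. \<exists>y\<in>cs g. len y = n)"

lemma rho_le: "y \<in> cs g \<Longrightarrow> rho g \<le> len y" unfolding rho_def by (rule Least_le) blast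

lemma rho_attained: "\<exists>y\<in>cs g. len y = rho g"
proof -
  have "\<exists>n. \<exists>y\<in>cs g. len y = n" using cs_self by auto
  then show ?thesis unfolding rho_def by (rule LeastI_ex)
qed

lemma rho_prj: "prj g 1 p \<Longrightarrow> len p = rho g"
proof -
  assume p: "prj g 1 p"
  obtain y where y: "y \<in> cs g" "len y = rho g" using rho_attained by blast
  then have "dd 1 p \<le> dd 1 y" using p unfolding prj_def by blast
  then have "len p \<le> len y" by (simp add: dd_one)
  moreover have "rho g \<le> len p" using p rho_le by (simp add: prj_def)
  ultimately show ?thesis using y by simp
qed

lemma rho_coset: "e \<in> E \<Longrightarrow> rho (g * e) = rho g" by (simp add: rho_def cs_coset)

text \<open>A far projection forces a shortest path from 1 to the coset of \<open>h\<close> to run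
  along the coset of \<open>g\<close>, so the distance splits into three legs up to a
  constant.\<close>

lemma proj_pair:
  assumes ne: "inverse g * h \<notin> E" and far: "n + \<theta>3 < pd g 1 h" and n: "C1 + \<delta> \<le> n"
  obtains p p' h' where "prj g 1 p" "p' \<in> cs g" "h' \<in> cs h" "len h' = rho h" "n < dd p p'"
    "int (rho g) + dd p p' + dd p' h' - (2 * C1 + \<delta>) \<le> int (rho h)"
proof -
  obtain h' where h': "h' \<in> cs h" "len h' = rho h" using rho_attained by blast
  have "pd g h' h \<le> \<theta>3" by (rule axes_proj[OF ne h'(1) cs_self])
  then have "n < pd g 1 h'" using far pd_tri[of g 1 h h'] by linarith
  then obtain p p' where p: "prj g 1 p" "prj g h' p'" "n < dd p p'" by (rule pd_greater)
  have "dd 1 p + dd p p' + dd p' h' - (2 * C1 + \<delta>) \<le> dd 1 h'" using prj_far(2)[OF p(1,2)] p(3) n by linarith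
  then show thesis using that[of p p' h'] p h' rho_prj[OF p(1)] by (auto simp: dd_one prj_def)
qed

lemma rho_less: assumes "inverse g * h \<notin> E" "\<theta> < pd g 1 h" shows "rho g < rho h"
proof -
  have "2 * C1 + \<delta> + \<theta>3 < pd g 1 h" using assms(2) th_nonneg by linarith
  moreover have "C1 + \<delta> \<le> 2 * C1 + \<delta>" using C1_pos by linarith
  ultimately obtain p p' h' where "2 * C1 + \<delta> < dd p p'"
    "int (rho g) + dd p p' + dd p' h' - (2 * C1 + \<delta>) \<le> int (rho h)" using proj_pair[OF assms(1)] by metis
  then show ?thesis using dd_nonneg[of p' h'] by linarith
qed

section \<open>Rotations about the axes\<close>

definition M0 :: nat where "M0 = (SOME m. m > 0 \<and> (\<forall>e\<in>E. nrm e m))"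

lemma M0: "M0 > 0" "e \<in> E \<Longrightarrow> nrm e M0"
  using someI_ex[OF E_uniform, folded M0_def] by auto

text \<open>Powers of \<open>v ^ N\<close>, conjugated by \<open>g\<close>, modulo \<open>R\<close>.
  When \<open>M0\<close> divides \<open>N\<close>, the set depends on the coset of \<open>g\<close>
  only.\<close>

definition rotset :: "nat \<Rightarrow> 'a \<Rightarrow> 'a set" where
  "rotset N g = {k. \<exists>j. cg k (g * P (int N * j) * inverse g)}"

lemma rotset_subgr: "subgr (rotset N g)"
proof -
  have "1 \<in> rotset N g" unfolding rotset_def by (intro CollectI exI[of _ 0]) (simp add: gsimps)
  moreover have "x * y \<in> rotset N g" if xy: "x \<in> rotset N g" "y \<in> rotset N g" for x y
  proof -
    obtain i j where "cg x (g * P (int N * i) * inverse g)" "cg y (g * P (int N * j) * inverse g)"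
      using xy by (auto simp: rotset_def)
    then have "cg (x * y) ((g * P (int N * i) * inverse g) * (g * P (int N * j) * inverse g))" by (rule cg_mult)
    also have "(g * P (int N * i) * inverse g) * (g * P (int N * j) * inverse g) = g * P (int N * (i + j)) * inverse g"
      by (simp add: gsimps distrib_left powi_add)
    finally show ?thesis unfolding rotset_def by blast
  qed
  moreover have "inverse x \<in> rotset N g" if x: "x \<in> rotset N g" for x
  proof -
    obtain i where "cg x (g * P (int N * i) * inverse g)" using x by (auto simp: rotset_def)
    then have "cg (inverse x) (inverse (g * P (int N * i) * inverse g))" by (rule cg_inverse)
    also have "inverse (g * P (int N * i) * inverse g) = g * P (int N * (- i)) * inverse g"
      by (simp add: gsimps powi_neg)
    finally show ?thesis unfolding rotset_def by blast
  qed
  ultimately show ?thesis by (auto simp: subgr_def)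
qed

lemma R_rotset: "R \<subseteq> rotset N g"
proof
  fix r assume "r \<in> R"
  then have "cg r 1" unfolding cg_def using nsubD(3)[OF nR] by simp
  then show "r \<in> rotset N g" unfolding rotset_def by (intro CollectI exI[of _ 0]) (simp add: gsimps)
qed

lemma rotset_conj: "x \<in> rotset N g \<Longrightarrow> k * x * inverse k \<in> rotset N (k * g)"
proof -
  assume "x \<in> rotset N g"
  then obtain i where "cg x (g * P (int N * i) * inverse g)" by (auto simp: rotset_def)
  then have "cg (k * x * inverse k) (k * (g * P (int N * i) * inverse g) * inverse k)" by (intro cg_mult cg_refl)
  then show ?thesis unfolding rotset_def by (auto simp: gsimps)
qed

lemma nrm_exp: assumes "nrm e M0" "M0 dvd N" shows "\<exists>s\<in>{1,-1}. \<forall>j. cg (e * P (int N * j) * inverse e) (P (s * (int N * j)))"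
proof -
  obtain s where s: "s \<in> {1,-1}" "cg (e * P (int M0) * inverse e) (P (s * int M0))"
    using assms unfolding nrm_def by blast
  obtain k where k: "N = M0 * k" using assms(2) by (auto simp: dvd_def)
  have "cg (e * P (int N * j) * inverse e) (P (s * (int N * j)))" for j
    using nrm_gen[OF s(2), of "int k * j"] unfolding k of_nat_mult by (simp only: mult.assoc)
  then show ?thesis using s(1) by blast
qed

lemma rotset_coset_le:
  assumes N: "M0 dvd N" and e: "e \<in> E" shows "rotset N (g * e) \<subseteq> rotset N g"
proof
  fix x assume "x \<in> rotset N (g * e)"
  then obtain j where j: "cg x (g * e * P (int N * j) * inverse (g * e))" by (auto simp: rotset_def)
  obtain s where s: "cg (e * P (int N * j) * inverse e) (P (s * (int N * j)))"
    using nrm_exp[OF M0(2)[OF e] N] by blast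
  have "g * e * P (int N * j) * inverse (g * e) = g * (e * P (int N * j) * inverse e) * inverse g"
    by (simp add: gsimps)
  moreover have "cg (g * (e * P (int N * j) * inverse e) * inverse g) (g * P (s * (int N * j)) * inverse g)"
    by (rule cg_mult[OF cg_mult[OF cg_refl s] cg_refl])
  ultimately have "cg x (g * P (int N * (s * j)) * inverse g)"
    using cg_trans[OF j] by (simp only: mult.left_commute)
  then show "x \<in> rotset N g" unfolding rotset_def by blast
qed

lemma rotset_coset: "M0 dvd N \<Longrightarrow> e \<in> E \<Longrightarrow> rotset N (g * e) = rotset N g"
  using rotset_coset_le[of N e g] rotset_coset_le[of N "inverse e" "g * e"] subgrD(3)[OF subgr_E, of e]
  by (auto simp: mult.assoc right_inv)

lemma rotset_fix: "k \<in> rotset N g \<Longrightarrow> inverse g * (k * g) \<in> E"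
proof -
  assume "k \<in> rotset N g"
  then obtain j where "cg k (g * P (int N * j) * inverse g)" by (auto simp: rotset_def)
  then have "cg (inverse g * k * g) (inverse g * (g * P (int N * j) * inverse g) * g)" by (intro cg_mult cg_refl)
  then have "cg (P (int N * j)) (inverse g * k * g)" using cg_sym by (simp add: gsimps)
  then have "inverse (P (int N * j)) * (inverse g * k * g) \<in> E" unfolding cg_def using R_sub_E by blast
  then have "P (int N * j) * (inverse (P (int N * j)) * (inverse g * k * g)) \<in> E"
    by (rule subgrD(2)[OF subgr_E P_in_E])
  then show ?thesis by (simp add: gsimps)
qed

definition LN :: "nat \<Rightarrow> int" where "LN N = int (len (v ^ N))"

lemma rotation:
  assumes N: "M0 dvd N" and k: "k \<in> rotset N g" "k \<notin> R" shows "LN N \<le> pd g a (k * a)"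
proof -
  obtain j where j: "cg k (g * P (int N * j) * inverse g)" using k by (auto simp: rotset_def)
  have j0: "j \<noteq> 0"
  proof
    assume "j = 0"
    then have "cg k 1" using j by (simp add: gsimps)
    then show False using k(2) nsubD(3)[OF nR, of "inverse k"] by (simp add: cg_def gsimps)
  qed
  obtain p where p: "prj g a p" using prj_ex by blast
  have "prj (k * g) (k * a) (k * p)" using p prj_left by blast
  moreover have "k * g = g * (inverse g * (k * g))" by (simp add: gsimps)
  ultimately have "prj g (k * a) (k * p)" using prj_coset[OF rotset_fix[OF k(1)]] by metis
  then have "dd p (k * p) \<le> pd g a (k * a)" using pd_upper[OF p] by blast
  moreover have "dd p (k * p) \<ge> LN N"
  proof -
    define e where "e = inverse p * g"
    have "inverse g * p \<in> E" using p by (simp add: prj_def cs_def)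
    then have e: "e \<in> E" using subgrD(3)[OF subgr_E, of "inverse g * p"] by (simp add: e_def gsimps)
    obtain s where s: "s \<in> {1,-1}" "cg (e * P (int N * j) * inverse e) (P (s * (int N * j)))"
      using nrm_exp[OF M0(2)[OF e] N] by blast
    have "cg (inverse p * k * p) (inverse p * (g * P (int N * j) * inverse g) * p)"
      by (rule cg_mult[OF cg_mult[OF cg_refl j] cg_refl])
    also have "inverse p * (g * P (int N * j) * inverse g) * p = e * P (int N * j) * inverse e"
      by (simp add: e_def gsimps)
    finally have "cg (inverse p * k * p) (P (s * (int N * j)))" using s(2) cg_trans by blast
    then have "len (inverse p * k * p) = len (P (s * (int N * j)))" by (rule cg_len)
    also have "\<dots> = len (v ^ (N * nat \<bar>j\<bar>))" using s(1) by (auto simp: len_P abs_mult nat_mult_distrib)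
    also have "\<dots> \<ge> len (v ^ N)" using j0 by (intro len_mono') (simp add: Suc_le_eq)
    finally show ?thesis by (simp add: LN_def dd_def mult.assoc)
  qed
  ultimately show ?thesis by linarith
qed

lemma round_int: "N > 0 \<Longrightarrow> \<exists>j::int. 2 * \<bar>x + int N * j\<bar> \<le> int N"
proof -
  assume N: "N > 0"
  define r where "r = x mod int N"
  have r: "0 \<le> r" "r < int N" "x = int N * (x div int N) + r" using N by (auto simp: r_def)
  show ?thesis
  proof (cases "2 * r \<le> int N")
    case True
    have "x + int N * (- (x div int N)) = r" using r(3) by (simp add: algebra_simps)
    then show ?thesis using True r(1) by (intro exI[of _ "- (x div int N)"]) simp
  next
    case False
    have "x + int N * (- (x div int N) - 1) = r - int N" using r(3) by (simp add: algebra_simps)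
    then show ?thesis using False r(2) by (intro exI[of _ "- (x div int N) - 1"]) simp
  qed
qed

text \<open>A suitable multiple of \<open>N\<close> rotates the two projections to within about half
  of \<open>LN N\<close> of each other. From \<open>3 / 5\<close> of \<open>LN N\<close> this gains
  a tenth of it, which the factor 60 in \<open>big\<close> makes larger than all error
  terms.\<close>

lemma rho_reduce:
  assumes N: "N > 0" and big: "60 * kap + 60 * \<delta> + 60 * C1 + 60 * \<theta>3 + 60 \<le> LN N"
    and ne: "inverse g * h \<notin> E" and far: "3 * LN N \<le> 5 * pd g 1 h"
  shows "\<exists>k\<in>rotset N g. rho (k * h) < rho h"
proof -
  define n where "n = pd g 1 h - \<theta>3 - 1"
  have pos: "0 \<le> kap" "0 \<le> \<delta>" "2 \<le> C1" "0 \<le> \<theta>3" using kap_nonneg dnn C1_pos \<theta>3(1) by auto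
  have nd: "pd g 1 h = n + \<theta>3 + 1" by (simp add: n_def)
  have n: "C1 + \<delta> \<le> n" "5 * n \<ge> 3 * LN N - 5 * \<theta>3 - 5" using far big pos nd by linarith+
  have nf: "n + \<theta>3 < pd g 1 h" using nd by simp
  obtain p p' h' where p: "prj g 1 p" "p' \<in> cs g" "h' \<in> cs h" "len h' = rho h" "n < dd p p'"
    "int (rho g) + dd p p' + dd p' h' - (2 * C1 + \<delta>) \<le> int (rho h)"
    by (rule proj_pair[OF ne nf n(1)])
  define e where "e = inverse g * p"
  define e' where "e' = inverse g * p'"
  have ee: "e \<in> E" "e' \<in> E" "p = g * e" "p' = g * e'" using p by (auto simp: e_def e'_def prj_def cs_def gsimps)
  obtain a where a: "dd e (P a) \<le> kap" using E_near[OF ee(1)] by blast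
  obtain b where b: "dd e' (P b) \<le> kap" using E_near[OF ee(2)] by blast
  obtain j where j: "2 * \<bar>b - a + int N * j\<bar> \<le> int N" using round_int[OF N] by blast
  define k where "k = g * P (int N * j) * inverse g"
  have k: "k \<in> rotset N g" unfolding rotset_def k_def by (intro CollectI exI[of _ j]) simp
  have "2 * int (len (P (b - a + int N * j))) \<le> LN N + 6 * \<delta>"
  proof -
    define m where "m = nat \<bar>b - a + int N * j\<bar>"
    have "int m = \<bar>b - a + int N * j\<bar>" by (simp add: m_def)
    then have "2 * int m \<le> int N" using j by (simp only:)
    then have "m + m \<le> N" by linarith
    then have "len (v ^ (m + m)) \<le> len (v ^ N)" by (rule len_mono')
    then show ?thesis using len_super[of m m] unfolding len_P m_def[symmetric] LN_def by linarith
  qed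
  moreover have "dd (P a) (P (int N * j) * P b) = int (len (P (b - a + int N * j)))"
  proof -
    have "int N * j + b - a = b - a + int N * j" by simp
    then show ?thesis using dd_P[of a "int N * j + b"] by (simp only: powi_add[of v "int N * j" b])
  qed
  moreover have "dd p (k * p') = dd e (P (int N * j) * e')"
    unfolding ee k_def using dd_left[of g e "P (int N * j) * e'"] by (simp add: gsimps)
  moreover have "dd e (P (int N * j) * e') \<le> dd e (P a) + dd (P a) (P (int N * j) * P b) + dd (P b) e'"
    using dd_tri[of e "P (int N * j) * e'" "P a"] dd_tri[of "P a" "P (int N * j) * e'" "P (int N * j) * P b"]
    by simp
  ultimately have "2 * dd p (k * p') \<le> 4 * kap + LN N + 6 * \<delta>" using a b dd_sym[of e' "P b"] by linarith
  moreover have "int (rho (k * h)) \<le> int (rho g) + dd p (k * p') + dd p' h'"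
  proof -
    have "int (rho (k * h)) \<le> dd 1 (k * h')" using rho_le[of "k * h'" "k * h"] cs_left p(3) by (simp add: dd_one)
    also have "\<dots> \<le> dd 1 p + dd p (k * p') + dd (k * p') (k * h')"
      using dd_tri[of 1 "k * h'" p] dd_tri[of p "k * h'" "k * p'"] by linarith
    finally show ?thesis using rho_prj[OF p(1)] by (simp add: dd_one)
  qed
  ultimately have "int (rho (k * h)) < int (rho h)" using p(5,6) n(2) big pos by linarith
  then show ?thesis using k by auto
qed

lemma windmill_rotset:
  assumes N: "N > 0" "M0 dvd N"
    and big: "60 * kap + 60 * \<delta> + 60 * C1 + 60 * \<theta>3 + 60 \<le> LN N" "1000 * \<theta> + 1000 \<le> LN N"
  shows "windmill E R pd rho (rotset N) (LN N) \<theta>"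
proof
  show "subgr E" "nsub R" by (rule subgr_E nR)+
  show "pd g a b = pd g b a" "pd g a c \<le> pd g a b + pd g b c" "pd (k * g) (k * a) (k * b) = pd g a b" for g a b c k
    by (rule pd_sym pd_tri pd_left)+
  show "e \<in> E \<Longrightarrow> pd (g * e) a b = pd g a b" for e g a b by (rule pd_coset)
  show "r \<in> R \<Longrightarrow> pd g 1 r \<le> \<theta>" for r g
    using pd_lip[of g 1 r] len0[of r] th_nonneg \<theta>3(1) C1_pos dnn by (simp add: dd_one)
  show "inverse g * h \<notin> E \<Longrightarrow> pd g a h \<le> \<theta> \<or> pd h a g \<le> \<theta>" for g h a by (rule behrstock_inequality)
  show "k \<in> rotset N g \<Longrightarrow> k \<notin> R \<Longrightarrow> LN N \<le> pd g a (k * a)" for k g a by (rule rotation[OF N(2)])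
  show "subgr (rotset N g)" "R \<subseteq> rotset N g" for g by (rule rotset_subgr R_rotset)+
  show "x \<in> rotset N g \<Longrightarrow> k * x * inverse k \<in> rotset N (k * g)" for x g k by (rule rotset_conj)
  show "e \<in> E \<Longrightarrow> rotset N (g * e) = rotset N g" for e g by (rule rotset_coset[OF N(2)])
  show "k \<in> rotset N g \<Longrightarrow> inverse g * (k * g) \<in> E" for k g by (rule rotset_fix)
  show "e \<in> E \<Longrightarrow> rho (g * e) = rho g" for e g by (rule rho_coset)
  show "inverse g * h \<notin> E \<Longrightarrow> \<theta> < pd g 1 h \<Longrightarrow> rho g < rho h" for g h by (rule rho_less)
  show "inverse g * h \<notin> E \<Longrightarrow> 3 * LN N \<le> 5 * pd g 1 h \<Longrightarrow> \<exists>k\<in>rotset N g. rho (k * h) < rho h" for g h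
    by (rule rho_reduce[OF N(1) big(1)])
  show "0 \<le> \<theta>" by (rule th_nonneg)
  show "1000 * \<theta> + 1000 \<le> LN N" by (rule big(2))
qed

end

section \<open>Adding a large power as a relator\<close>

locale quot = qaxis "wl S R" R \<delta> v for S R :: "'a::grp set" and \<delta> :: int and v :: 'a +
  assumes gS: "genset S"
begin

text \<open>The additional letters cone off the cosets of \<open>E\<close>.\<close>

definition T :: "'a set" where "T = S \<union> E"

lemma gT: "genset T"
  unfolding T_def by (rule genset_mono[OF gS]) (use gS subgrD(3)[OF subgr_E] in \<open>auto simp: genset_def\<close>)

sublocale hat: lenspace "wl T R" by (rule wl_lenspace[OF gT nR])

lemma hat_le: "hat.dd x y \<le> dd x y"
  unfolding hat.dd_def dd_def using wl_mono_gen[OF gS nR, of T] by (simp add: T_def)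

lemma hat_E: "inverse x * y \<in> E \<Longrightarrow> hat.dd x y \<le> 1"
  unfolding hat.dd_def using wl_le[OF prods_1[of "inverse x * y" T], of "inverse x * y" R] nsubD(1)[OF nR]
  by (simp add: T_def left_inv)

lemma hat_cs: "x \<in> cs g \<Longrightarrow> y \<in> cs g \<Longrightarrow> hat.dd x y \<le> 1"
proof (rule hat_E)
  assume "x \<in> cs g" "y \<in> cs g"
  then have "inverse (inverse g * x) * (inverse g * y) \<in> E" using subgrD[OF subgr_E] by (simp add: cs_def)
  then show "inverse x * y \<in> E" by (simp add: gsimps)
qed

lemma wl_step: assumes "nsub K" "wl T K x \<le> 1" obtains t where "t \<in> insert 1 T" "inverse x * t \<in> K"
proof -
  obtain y where y: "y \<in> prods T (wl T K x)" "inverse x * y \<in> K" using wl_attained[OF gT assms(1)] .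
  have "y \<in> insert 1 T"
  proof (cases "wl T K x")
    case 0 then show ?thesis using y(1) by (simp add: prods_0)
  next
    case (Suc n)
    then have "wl T K x = 1" using assms(2) by simp
    then show ?thesis using y(1) by (auto simp: prods_def length_Suc_conv)
  qed
  then show thesis using that y(2) by blast
qed

lemma hat_step: assumes "hat.dd x y \<le> 1" shows "dd x y \<le> 1 \<or> inverse x * y \<in> E"
proof -
  obtain t where t: "t \<in> insert 1 T" "inverse (inverse x * y) * t \<in> R"
    using wl_step[OF nR, of "inverse x * y"] assms by (auto simp: hat.dd_def)
  show ?thesis
  proof (cases "t \<in> E")
    case True
    have "t * inverse (inverse (inverse x * y) * t) \<in> E"
      using subgrD(2)[OF subgr_E True subgrD(3)[OF subgr_E]] t(2) R_sub_E by blast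
    then show ?thesis by (simp add: gsimps)
  next
    case False
    then have "t \<in> S" using t(1) subgrD(1)[OF subgr_E] by (auto simp: T_def)
    then have "wl S R (inverse x * y) \<le> 1" using wl_le[OF prods_1 t(2)] by blast
    then show ?thesis by (simp add: dd_def)
  qed
qed

section \<open>Geodesics of the original and of the coned-off length\<close>

definition hh :: nat where "hh = nat (2 * \<delta> + qc 0 + 2)"

lemma qc0: "0 \<le> qc 0" using kap_nonneg dnn by (simp add: qc_def)

lemma hh: "int hh = 2 * \<delta> + qc 0 + 2" using qc0 dnn by (simp add: hh_def)

text \<open>The points between \<open>x\<close> and \<open>y\<close> in the original length serve as
  guessed geodesics for the coned-off length. They are slim by the original hyperbolicity, and they
  are short when one new letter joins the ends, because cosets of \<open>E\<close> are
  quasiconvex.\<close>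

lemma eta_path:
  "\<exists>e n. e 0 = x \<and> e n = y \<and> (\<forall>i\<le>n. e i \<in> {z. betw x z y}) \<and> (\<forall>i<n. hat.dd (e i) (e (Suc i)) \<le> int hh)"
proof -
  obtain \<gamma> n where \<gamma>: "\<gamma> 0 = x" "dd (\<gamma> n) y = 0" "isgeo \<gamma> n" using ex_geo by blast
  define e where "e i = (if i \<le> n then \<gamma> i else y)" for i
  have ny: "dd a y = dd a (\<gamma> n)" for a
    using dd_tri[of a y "\<gamma> n"] dd_tri[of a "\<gamma> n" y] dd_sym[of y "\<gamma> n"] \<gamma>(2) by linarith
  have "betw x (e i) y" for i
    using isgeo_betw[OF \<gamma>(3), of i] \<gamma>(1) ny by (cases "i \<le> n") (auto simp: e_def betw_def)
  moreover have "dd (e i) (e (Suc i)) \<le> 1" if "i < Suc n" for i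
    using isgeoD[OF \<gamma>(3), of i "Suc i"] that \<gamma>(2) by (cases "i = n") (auto simp: e_def)
  then have "hat.dd (e i) (e (Suc i)) \<le> int hh" if "i < Suc n" for i
    using hat_le[of "e i" "e (Suc i)"] that hh qc0 dnn by fastforce
  ultimately show ?thesis using \<gamma>(1) by (intro exI[of _ e] exI[of _ "Suc n"]) (auto simp: e_def)
qed

lemma eta_short:
  assumes "hat.dd x y \<le> 1" "p \<in> {z. betw x z y}" shows "hat.dd x p \<le> int hh"
  using hat_step[OF assms(1)]
proof
  assume "dd x y \<le> 1"
  then have "dd x p \<le> 1" using assms(2) dd_nonneg[of p y] unfolding betw_def mem_Collect_eq by linarith
  then show ?thesis using hat_le[of x p] hh qc0 dnn by linarith
next
  assume "inverse x * y \<in> E"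
  moreover have "gp p x y \<le> 0" using assms(2) dd_sym[of p x] by (simp add: betw_def gp_def)
  ultimately obtain y' where y': "y' \<in> cs x" "dd p y' \<le> qc 0"
    using cs_quasiconvex[of x x y p 0] cs_self by (auto simp: cs_def)
  have "hat.dd x p \<le> hat.dd x y' + hat.dd y' p" by (rule hat.dd_tri)
  moreover have "hat.dd x y' \<le> 1" using hat_cs[OF cs_self y'(1)] .
  moreover have "hat.dd y' p \<le> qc 0" using hat_le[of y' p] y'(2) dd_sym[of p y'] by linarith
  ultimately show ?thesis using hh dnn by linarith
qed

lemma eta_thin:
  assumes "p \<in> {z. betw x z y}"
  shows "\<exists>q\<in>{q. betw x q z} \<union> {q. betw z q y}. hat.dd p q \<le> int hh"
proof -
  obtain q where q: "betw x q z \<or> betw z q y" "dd p q \<le> 2 * \<delta>"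
    using slim_of_hyp4[OF hyp] assms unfolding slim_def by blast
  then have "hat.dd p q \<le> int hh" using hat_le[of p q] hh qc0 by linarith
  then show ?thesis using q by blast
qed

lemma hat_slim: "\<exists>H. hat.slim (int H)"
  using hat.guess_slim[where \<eta> = "\<lambda>x y. {z. betw x z y}", OF eta_path eta_short eta_thin] .

lemma hat_near: "\<exists>H. \<forall>\<gamma> m p. hat.isgeo \<gamma> m \<longrightarrow> betw (\<gamma> 0) p (\<gamma> m) \<longrightarrow> (\<exists>l\<le>m. hat.dd p (\<gamma> l) \<le> int H)"
  using hat.guess_near[where \<eta> = "\<lambda>x y. {z. betw x z y}", OF eta_path eta_short eta_thin] by simp

text \<open>An original geodesic passes close to the projections, and by \<open>hat_near\<close> a
  coned-off geodesic with the same ends passes close to it.\<close>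

lemma hat_penetrate_near:
  "\<exists>C\<ge>0. \<forall>\<gamma> m g. hat.isgeo \<gamma> m \<longrightarrow> C1 + \<delta> < pd g (\<gamma> 0) (\<gamma> m) \<longrightarrow> (\<exists>l\<le>m. \<exists>p\<in>cs g. hat.dd (\<gamma> l) p \<le> C)"
proof -
  obtain H where H: "\<And>\<gamma> m p. hat.isgeo \<gamma> m \<Longrightarrow> betw (\<gamma> 0) p (\<gamma> m) \<Longrightarrow> \<exists>l\<le>m. hat.dd p (\<gamma> l) \<le> int H"
    using hat_near by blast
  have "\<exists>l\<le>m. \<exists>p\<in>cs g. hat.dd (\<gamma> l) p \<le> 2 * C1 + 3 * \<delta> + int H"
    if g: "hat.isgeo \<gamma> m" and far: "C1 + \<delta> < pd g (\<gamma> 0) (\<gamma> m)" for \<gamma> m g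
  proof -
    obtain p p' where p: "prj g (\<gamma> 0) p" "prj g (\<gamma> m) p'" "C1 + \<delta> < dd p p'" using far by (rule pd_greater)
    have gpp: "gp p (\<gamma> 0) (\<gamma> m) \<le> C1 + \<delta>" by (rule prj_far(1)[OF p])
    define x where "x = \<gamma> 0"
    define y where "y = \<gamma> m"
    \<comment> \<open>The minimum is taken because \<open>p\<close> may be slightly further from
      \<open>x\<close> than \<open>y\<close> is.\<close>
    obtain c where c: "dd x c = min (dd x p) (dd x y)" "dd c y = dd x y - min (dd x p) (dd x y)"
      using dd_point[of "min (dd x p) (dd x y)" x y] by auto
    have bc: "betw x c y" using c by (simp add: betw_def)
    then have "gp c x y \<le> C1 + \<delta>" using C1_pos dnn dd_sym[of c x] by (simp add: betw_def gp_def)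
    then have "dd c p \<le> \<bar>dd x c - dd x p\<bar> + (C1 + \<delta>) + \<delta>"
      using near_points[of c x y "C1 + \<delta>" p] gpp by (simp add: x_def y_def)
    moreover have "dd x p \<le> dd x y + C1 + \<delta>"
      using gpp dd_sym[of p x] dd_nonneg[of p y] unfolding gp_def x_def[symmetric] y_def[symmetric] by linarith
    then have "\<bar>dd x c - dd x p\<bar> \<le> C1 + \<delta>" using c(1) C1_pos dnn by linarith
    ultimately have cp: "dd c p \<le> 2 * C1 + 3 * \<delta>" by linarith
    obtain l where l: "l \<le> m" "hat.dd c (\<gamma> l) \<le> int H" using H[OF g] bc by (auto simp: x_def y_def)
    have "hat.dd (\<gamma> l) p \<le> 2 * C1 + 3 * \<delta> + int H"
      using hat.dd_tri[of "\<gamma> l" p c] l(2) hat.dd_sym[of "\<gamma> l" c] hat_le[of c p] cp by linarith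
    then show ?thesis using l(1) p(1) by (auto simp: prj_def)
  qed
  moreover have "0 \<le> 2 * C1 + 3 * \<delta> + int H" using C1_pos dnn by linarith
  ultimately show ?thesis by blast
qed

definition sg :: int where "sg = 1 + 2 * C1 + \<delta> + \<theta>3"

lemma sg_pos: "1 \<le> sg" "C1 + \<delta> \<le> sg" "2 * C1 + \<delta> \<le> sg"
  using C1_pos dnn \<theta>3(1) unfolding sg_def by linarith+

lemma hat_step_pd:
  assumes "hat.dd x y \<le> 1" "\<not> (x \<in> cs g \<and> y \<in> cs g)" shows "pd g x y \<le> sg"
  using hat_step[OF assms(1)]
proof
  assume "dd x y \<le> 1"
  then show ?thesis using pd_lip[of g x y] \<theta>3(1) C1_pos dnn unfolding sg_def by linarith
next
  assume e: "inverse x * y \<in> E"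
  have "inverse g * x \<notin> E"
  proof
    assume x: "inverse g * x \<in> E"
    then have "inverse g * x * (inverse x * y) \<in> E" using e by (rule subgrD(2)[OF subgr_E])
    then show False using assms(2) x by (simp add: cs_def gsimps)
  qed
  then have "pd g x y \<le> \<theta>3" using axes_proj[of g x x y] cs_self e by (simp add: cs_def)
  then show ?thesis using C1_pos dnn unfolding sg_def by linarith
qed

lemma hat_path_pd:
  assumes "\<And>l. i \<le> l \<Longrightarrow> l < i + k \<Longrightarrow> pd g (\<gamma> l) (\<gamma> (Suc l)) \<le> sg"
  shows "pd g (\<gamma> i) (\<gamma> (i + k)) \<le> (int k + 1) * sg"
  using assms
proof (induction k)
  case 0
  then show ?case using pd_lip[of g "\<gamma> i" "\<gamma> i"] sg_pos by simp
next
  case (Suc k)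
  have "pd g (\<gamma> i) (\<gamma> (i + k)) \<le> (int k + 1) * sg" using Suc by simp
  moreover have "pd g (\<gamma> (i + k)) (\<gamma> (Suc (i + k))) \<le> sg" using Suc.prems[of "i + k"] by simp
  ultimately show ?case using pd_tri[of g "\<gamma> i" "\<gamma> (i + Suc k)" "\<gamma> (i + k)"] by (simp add: algebra_simps)
qed

text \<open>Bounded geodesic image. Without an edge in the coset every step changes the projection
  by at most \<open>sg\<close>. The times at which the geodesic is close to the coset span a bounded
  interval, since the coset has diameter at most 1 after coning off; before and after that,
  \<open>hat_penetrate_near\<close> limits the change.\<close>

lemma hat_penetrate:
  "\<exists>B. \<forall>\<gamma> m g. hat.isgeo \<gamma> m \<longrightarrow> B < pd g (\<gamma> 0) (\<gamma> m) \<longrightarrow> (\<exists>i<m. \<gamma> i \<in> cs g \<and> \<gamma> (Suc i) \<in> cs g)"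
proof -
  obtain C where C0: "0 \<le> C" and C: "\<And>\<gamma> m g. hat.isgeo \<gamma> m \<Longrightarrow> C1 + \<delta> < pd g (\<gamma> 0) (\<gamma> m) \<Longrightarrow>
      \<exists>l\<le>m. \<exists>p\<in>cs g. hat.dd (\<gamma> l) p \<le> C"
    using hat_penetrate_near by blast
  define B where "B = 4 * sg + (2 * C + 2) * sg"
  have "\<exists>i<m. \<gamma> i \<in> cs g \<and> \<gamma> (Suc i) \<in> cs g" if g: "hat.isgeo \<gamma> m" and far: "B < pd g (\<gamma> 0) (\<gamma> m)" for \<gamma> m g
  proof (rule ccontr)
    assume no: "\<not> ?thesis"
    have step: "pd g (\<gamma> l) (\<gamma> (Suc l)) \<le> sg" if "l < m" for l
    proof (rule hat_step_pd)
      show "hat.dd (\<gamma> l) (\<gamma> (Suc l)) \<le> 1" using hat.isgeoD[OF g, of l "Suc l"] that by simp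
    qed (use no that in blast)
    define I where "I = {l. l \<le> m \<and> (\<exists>p\<in>cs g. hat.dd (\<gamma> l) p \<le> C)}"
    have fin: "finite I" by (simp add: I_def)
    have "0 \<le> (2 * C + 2) * sg" using C0 sg_pos by simp
    then have "C1 + \<delta> < pd g (\<gamma> 0) (\<gamma> m)" using far sg_pos unfolding B_def by linarith
    then have ne: "I \<noteq> {}" using C[OF g] by (auto simp: I_def)
    define i0 where "i0 = Min I"
    define i1 where "i1 = Max I"
    have i0: "i0 \<in> I" and i1: "i1 \<in> I" using Min_in[OF fin ne] Max_in[OF fin ne] by (auto simp: i0_def i1_def)
    have le: "i0 \<le> i1" "i1 \<le> m" "i0 \<le> m" using i0 i1 Max_ge[OF fin i0] by (auto simp: I_def i1_def)
    obtain p0 where p0: "p0 \<in> cs g" "hat.dd (\<gamma> i0) p0 \<le> C" using i0 by (auto simp: I_def)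
    obtain p1 where p1: "p1 \<in> cs g" "hat.dd (\<gamma> i1) p1 \<le> C" using i1 by (auto simp: I_def)
    have gap: "int i1 - int i0 \<le> 2 * C + 1"
      using hat.isgeoD[OF g le(1,2)] hat.dd_tri[of "\<gamma> i0" "\<gamma> i1" p0] hat.dd_tri[of p0 "\<gamma> i1" p1]
        hat_cs[OF p0(1) p1(1)] p0(2) p1(2) hat.dd_sym[of p1 "\<gamma> i1"] by linarith
    have left: "pd g (\<gamma> 0) (\<gamma> i0) \<le> 2 * sg"
    proof (cases i0)
      case 0
      then show ?thesis using pd_lip[of g "\<gamma> 0" "\<gamma> 0"] sg_pos by simp
    next
      case (Suc i)
      have "hat.isgeo \<gamma> i" using hat.isgeo_sub[OF g, of 0 i] le Suc by simp
      moreover have "\<not> (\<exists>l\<le>i. \<exists>p\<in>cs g. hat.dd (\<gamma> l) p \<le> C)"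
      proof
        assume "\<exists>l\<le>i. \<exists>p\<in>cs g. hat.dd (\<gamma> l) p \<le> C"
        then obtain l where "l \<le> i" "l \<in> I" using le Suc by (auto simp: I_def)
        then show False using Min_le[OF fin, of l] Suc unfolding i0_def by linarith
      qed
      ultimately have "pd g (\<gamma> 0) (\<gamma> i) \<le> C1 + \<delta>" using C[of \<gamma> i g] by force
      then show ?thesis using pd_tri[of g "\<gamma> 0" "\<gamma> i0" "\<gamma> i"] step[of i] le Suc sg_pos by simp
    qed
    have right: "pd g (\<gamma> i1) (\<gamma> m) \<le> 2 * sg"
    proof (cases "i1 = m")
      case True
      then show ?thesis using pd_lip[of g "\<gamma> m" "\<gamma> m"] sg_pos by simp
    next
      case False
      then have lt: "Suc i1 \<le> m" using le by simp
      have "hat.isgeo (\<lambda>t. \<gamma> (Suc i1 + t)) (m - Suc i1)" using hat.isgeo_sub[OF g, of "Suc i1" "m - Suc i1"] lt by simp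
      moreover have "\<not> (\<exists>l\<le>m - Suc i1. \<exists>p\<in>cs g. hat.dd (\<gamma> (Suc i1 + l)) p \<le> C)"
      proof
        assume "\<exists>l\<le>m - Suc i1. \<exists>p\<in>cs g. hat.dd (\<gamma> (Suc i1 + l)) p \<le> C"
        then obtain l where "l \<le> m - Suc i1" "\<exists>p\<in>cs g. hat.dd (\<gamma> (Suc i1 + l)) p \<le> C" by blast
        then have "Suc i1 + l \<in> I" using lt by (simp add: I_def)
        then show False using Max_ge[OF fin, of "Suc i1 + l"] unfolding i1_def by linarith
      qed
      ultimately have "pd g (\<gamma> (Suc i1 + 0)) (\<gamma> (Suc i1 + (m - Suc i1))) \<le> C1 + \<delta>"
        using C[of "\<lambda>t. \<gamma> (Suc i1 + t)" "m - Suc i1" g] by force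
      then show ?thesis using pd_tri[of g "\<gamma> i1" "\<gamma> m" "\<gamma> (Suc i1)"] step[of i1] lt sg_pos by simp
    qed
    have "pd g (\<gamma> i0) (\<gamma> (i0 + (i1 - i0))) \<le> (int (i1 - i0) + 1) * sg"
      by (rule hat_path_pd) (use step le in auto)
    also have "\<dots> \<le> (2 * C + 2) * sg" using gap le sg_pos by (intro mult_right_mono) auto
    finally have "pd g (\<gamma> i0) (\<gamma> i1) \<le> (2 * C + 2) * sg" using le by simp
    then show False using far left right pd_tri[of g "\<gamma> 0" "\<gamma> m" "\<gamma> i0"] pd_tri[of g "\<gamma> i0" "\<gamma> m" "\<gamma> i1"]
      unfolding B_def by linarith
  qed
  then show ?thesis by blast
qed

definition BB :: int where
  "BB = (SOME B. \<forall>\<gamma> m g. hat.isgeo \<gamma> m \<longrightarrow> B < pd g (\<gamma> 0) (\<gamma> m) \<longrightarrow> (\<exists>i<m. \<gamma> i \<in> cs g \<and> \<gamma> (Suc i) \<in> cs g))"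

lemma BB: "hat.isgeo \<gamma> m \<Longrightarrow> BB < pd g (\<gamma> 0) (\<gamma> m) \<Longrightarrow> \<exists>i<m. \<gamma> i \<in> cs g \<and> \<gamma> (Suc i) \<in> cs g"
  using someI_ex[OF hat_penetrate, folded BB_def] by blast

end

text \<open>\<open>big1\<close> and \<open>big2\<close> feed the windmill. By \<open>big3\<close>,
  when the ends of a triangular path are seen at distance \<open>LN N - 8 * \<theta>\<close>, one of
  its three sides is seen with more than \<open>BB\<close>.\<close>

locale rotquot = quot S R \<delta> v for S R :: "'a::grp set" and \<delta> :: int and v :: 'a +
  fixes N :: nat
  assumes Npos: "N > 0" and NM: "M0 dvd N"
    and big1: "60 * kap + 60 * \<delta> + 60 * C1 + 60 * \<theta>3 + 60 \<le> LN N"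
    and big2: "1000 * \<theta> + 1000 \<le> LN N" and big3: "3 * BB + 8 * \<theta> < LN N"
begin

sublocale wm: windmill E R pd rho "rotset N" "LN N" \<theta>
  by (rule windmill_rotset[OF Npos NM big1 big2])

section \<open>Lifting triangles from the quotient\<close>

abbreviation K where "K \<equiv> wm.KK"

lemma nK: "nsub K" by (rule wm.nsub_KK)

sublocale bar: lenspace "wl T K" by (rule wl_lenspace[OF gT nK])
sublocale quo: lenspace "wl S K" by (rule wl_lenspace[OF gS nK])

lemma R_K: "R \<subseteq> K" using R_rotset wm.Kc_KK by blast

lemma bar_le: "bar.dd x y \<le> hat.dd x y"
  unfolding bar.dd_def hat.dd_def using wl_mono[OF gT nR R_K] by simp

lemma bar_0: "bar.dd x y = 0 \<longleftrightarrow> inverse x * y \<in> K"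
  unfolding bar.dd_def using wl_zero_iff[OF gT nK] by simp

lemma bar_eq: "inverse x * x' \<in> K \<Longrightarrow> inverse y * y' \<in> K \<Longrightarrow> bar.dd x y = bar.dd x' y'"
  using bar.dd_tri[of x y x'] bar.dd_tri[of x' y y'] bar.dd_tri[of x' y' x] bar.dd_tri[of x y' y]
    bar.dd_sym[of x x'] bar.dd_sym[of y y'] bar_0[of x x'] bar_0[of y y'] by linarith

text \<open>Passing to the quotient does not increase distances, so a lift of a geodesic with steps
  of length at most 1 cannot be shortened.\<close>

lemma hat_isgeo_of_bar:
  assumes step: "\<And>i. i < m \<Longrightarrow> hat.dd (x i) (x (Suc i)) \<le> 1" and len: "bar.dd (x 0) (x m) = int m"
  shows "hat.isgeo x m"
proof -
  have up: "hat.dd (x i) (x (i + k)) \<le> int k" if "i + k \<le> m" for i k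
    using that
  proof (induction k)
    case (Suc k)
    then show ?case using step[of "i + k"] hat.dd_tri[of "x i" "x (i + Suc k)" "x (i + k)"] by simp
  qed simp
  show ?thesis
  proof (rule hat.isgeoI)
    fix i j assume ij: "i \<le> j" "j \<le> m"
    have "int m \<le> hat.dd (x 0) (x m)" using bar_le[of "x 0" "x m"] len by simp
    also have "\<dots> \<le> hat.dd (x 0) (x i) + hat.dd (x i) (x j) + hat.dd (x j) (x m)"
      using hat.dd_tri[of "x 0" "x m" "x i"] hat.dd_tri[of "x i" "x m" "x j"] by linarith
    finally show "hat.dd (x i) (x j) = int j - int i"
      using up[of 0 i] up[of i "j - i"] up[of j "m - j"] ij by simp
  qed
qed

text \<open>A triangle of the quotient, lifted and cut open at its first corner: unit steps for the
  coned-off length above, geodesic sides below, corners at times 0, \<open>a\<close>,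
  \<open>b\<close> and \<open>m\<close>.\<close>

definition triangle :: "(nat \<Rightarrow> 'a) \<Rightarrow> nat \<Rightarrow> nat \<Rightarrow> nat \<Rightarrow> bool" where
  "triangle x a b m \<longleftrightarrow> a \<le> b \<and> b \<le> m \<and> x 0 = 1 \<and> (\<forall>i<m. hat.dd (x i) (x (Suc i)) \<le> 1) \<and>
     bar.dd (x 0) (x a) = int a \<and> bar.dd (x a) (x b) = int b - int a \<and> bar.dd (x b) (x m) = int m - int b"

lemma triangle_penetrate:
  assumes x: "triangle x a b m" and far: "LN N - 8 * \<theta> \<le> pd g 1 (x m)"
  shows "\<exists>i<m. x i \<in> cs g \<and> x (Suc i) \<in> cs g"
proof -
  have seg: "\<exists>i<m. x i \<in> cs g \<and> x (Suc i) \<in> cs g"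
    if st: "s \<le> t" "t \<le> m" "bar.dd (x s) (x t) = int t - int s" "BB < pd g (x s) (x t)" for s t
  proof -
    have "hat.isgeo (\<lambda>i. x (s + i)) (t - s)"
      by (rule hat_isgeo_of_bar) (use x st in \<open>auto simp: triangle_def\<close>)
    then obtain i where "i < t - s" "x (s + i) \<in> cs g" "x (Suc (s + i)) \<in> cs g"
      using BB[of "\<lambda>i. x (s + i)" "t - s" g] st by auto
    then show ?thesis using st by (intro exI[of _ "s + i"]) auto
  qed
  have "BB < pd g (x 0) (x a) \<or> BB < pd g (x a) (x b) \<or> BB < pd g (x b) (x m)"
    using far big3 pd_tri[of g "x 0" "x m" "x a"] pd_tri[of g "x a" "x m" "x b"] x unfolding triangle_def by auto
  then show ?thesis using seg[of 0 a] seg[of a b] seg[of b m] x unfolding triangle_def by auto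
qed

text \<open>A closed path in the quotient lifts to a path from 1 to \<open>x m \<in> K\<close>.  Rotating its tail about an
  axis that both ends see at a large distance simplifies \<open>x m\<close> and does not change the projected path.\<close>

lemma lift_triangle:
  assumes "k \<in> wm.Kr r"
  shows "triangle x a b m \<Longrightarrow> x m = k \<Longrightarrow>
    \<exists>x'. triangle x' a b m \<and> (\<forall>i\<le>m. inverse (x i) * x' i \<in> K) \<and> x' m \<in> R"
  using assms
proof (induction arbitrary: x rule: wm.Kr_reduce)
  case (base k)
  then show ?case using nsubD(1)[OF nK] by (intro exI[of _ x]) (auto simp: left_inv)
next
  case (step k y h)
  obtain i where i: "i < m" "x i \<in> cs y" "x (Suc i) \<in> cs y" using triangle_penetrate[OF step(4)] step by blast
  define x1 where "x1 j = (if j \<le> i then x j else h * x j)" for j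
  have hK: "h \<in> K" using step(1) wm.Kc_KK by blast
  have c: "inverse (x j) * x1 j \<in> K" for j
    using nsubD(5)[OF nK hK, of "x j"] nsubD(1)[OF nK] by (simp add: x1_def mult.assoc left_inv)
  have "h * x (Suc i) \<in> cs y"
    using i(3) cs_left[of h "x (Suc i)" y] cs_coset[OF rotset_fix[OF step(1)], of y] by (simp add: gsimps)
  then have j1: "hat.dd (x i) (h * x (Suc i)) \<le> 1" using hat_cs i(2) by blast
  have st: "hat.dd (x1 j) (x1 (Suc j)) \<le> 1" if "j < m" for j
  proof -
    have "hat.dd (x j) (x (Suc j)) \<le> 1" using step(4) that by (simp add: triangle_def)
    then show ?thesis using j1 by (cases "j = i") (auto simp: x1_def)
  qed
  have be: "bar.dd (x1 s) (x1 t) = bar.dd (x s) (x t)" for s t using bar_eq[OF c c] by simp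
  have "x1 0 = 1" using step(4) by (simp add: x1_def triangle_def)
  then have "triangle x1 a b m" using step(4)[unfolded triangle_def] st unfolding triangle_def be by blast
  moreover have "x1 m = h * k" using i(1) step(5) by (simp add: x1_def)
  ultimately obtain x' where x': "triangle x' a b m" "\<forall>i\<le>m. inverse (x1 i) * x' i \<in> K" "x' m \<in> R"
    using step(3) by blast
  have "inverse (x j) * x' j \<in> K" if "j \<le> m" for j
  proof -
    have "(inverse (x j) * x1 j) * (inverse (x1 j) * x' j) \<in> K"
      using nsubD(2)[OF nK c[of j], of "inverse (x1 j) * x' j"] x'(2) that by blast
    then show ?thesis by (simp add: gsimps)
  qed
  then show ?case using x' by blast
qed

lemma bar_path_lift:
  assumes "\<And>i. i < m \<Longrightarrow> bar.dd (\<gamma> i) (\<gamma> (Suc i)) \<le> 1"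
  shows "\<exists>x. x 0 = \<gamma> 0 \<and> (\<forall>i\<le>m. inverse (\<gamma> i) * x i \<in> K) \<and> (\<forall>i<m. hat.dd (x i) (x (Suc i)) \<le> 1)"
  using assms
proof (induction m)
  case 0
  show ?case using nsubD(1)[OF nK] by (intro exI[of _ \<gamma>]) (simp add: left_inv)
next
  case (Suc m)
  then obtain x where x: "x 0 = \<gamma> 0" "\<forall>i\<le>m. inverse (\<gamma> i) * x i \<in> K" "\<forall>i<m. hat.dd (x i) (x (Suc i)) \<le> 1" by auto
  obtain t where t: "t \<in> insert 1 T" "inverse (inverse (\<gamma> m) * \<gamma> (Suc m)) * t \<in> K"
    using wl_step[OF nK, of "inverse (\<gamma> m) * \<gamma> (Suc m)"] Suc.prems[of m] by (auto simp: bar.dd_def)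
  define x' where "x' = x(Suc m := x m * t)"
  have a: "inverse t * (inverse (\<gamma> m) * x m) * t \<in> K" using x(2) by (intro nsubD(5)[OF nK]) auto
  have "(inverse (inverse (\<gamma> m) * \<gamma> (Suc m)) * t) * (inverse t * (inverse (\<gamma> m) * x m) * t) \<in> K"
    by (rule nsubD(2)[OF nK t(2) a])
  then have "inverse (\<gamma> (Suc m)) * x' (Suc m) \<in> K" by (simp add: x'_def gsimps)
  moreover have "hat.dd (x m) (x m * t) \<le> 1"
  proof (cases "t = 1")
    case False
    then have "wl T R t \<le> 1" using t(1) wl_le[OF prods_1, of t T t R] nsubD(1)[OF nR] by (simp add: left_inv)
    then show ?thesis by (simp add: hat.dd_def gsimps)
  qed simp
  ultimately show ?case using x by (intro exI[of _ x']) (auto simp: x'_def le_Suc_eq less_Suc_eq)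
qed

text \<open>A triangle of the quotient lifts to one that closes up modulo \<open>R\<close>, where
  slimness is known. Going down does not increase distances, so the constant \<open>h\<close> is
  kept.\<close>

lemma bar_slim: assumes hs: "hat.slim h" shows "bar.slim h"
  unfolding bar.slim_def
proof (intro allI impI)
  fix X Y Z p assume "bar.betw X p Y"
  then obtain \<gamma>1 a l where 1: "\<gamma>1 0 = X" "bar.dd (\<gamma>1 a) Y = 0" "bar.isgeo \<gamma>1 a" "l \<le> a" "bar.dd (\<gamma>1 l) p = 0"
    using bar.geo_through by blast
  obtain \<gamma>2 n2 where 2: "\<gamma>2 0 = Y" "bar.dd (\<gamma>2 n2) Z = 0" "bar.isgeo \<gamma>2 n2" using bar.ex_geo by blast
  obtain \<gamma>3 n3 where 3: "\<gamma>3 0 = Z" "bar.dd (\<gamma>3 n3) X = 0" "bar.isgeo \<gamma>3 n3" using bar.ex_geo by blast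
  \<comment> \<open>Each side leaves its last vertex to the next side, so at the junctions the sides
    are met only up to pseudo-distance 0.\<close>
  define \<Gamma> where "\<Gamma> i = (if i < a then \<gamma>1 i else if i < a + n2 then \<gamma>2 (i - a) else \<gamma>3 (i - a - n2))" for i
  define m where "m = a + n2 + n3"
  have c0: "bar.dd u v = 0" if "bar.dd u w = 0" "bar.dd w v = 0" for u v w
    using bar.dd_tri[of u v w] bar.dd_nonneg[of u v] that by linarith
  have z: "bar.dd u w = bar.dd u' w'" if "bar.dd u u' = 0" "bar.dd w w' = 0" for u u' w w'
    using bar_eq that bar_0 by blast
  have g1: "bar.dd (\<Gamma> i) (\<gamma>1 i) = 0" if "i \<le> a" for i
  proof (cases "i < a")
    case False
    then have "i = a" using that by simp
    have b: "bar.dd Y (\<gamma>1 a) = 0" using 1(2) bar.dd_sym by metis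
    show ?thesis
    proof (cases "n2 = 0")
      case True
      then have "bar.dd Z Y = 0" using 2 bar.dd_sym by metis
      then show ?thesis using True \<open>i = a\<close> 3(1) c0[OF _ b] by (simp add: \<Gamma>_def)
    next
      case False then show ?thesis using \<open>i = a\<close> b 2(1) by (simp add: \<Gamma>_def)
    qed
  qed (simp add: \<Gamma>_def)
  have g2: "bar.dd (\<Gamma> (a + i)) (\<gamma>2 i) = 0" if "i \<le> n2" for i
  proof (cases "i < n2")
    case False
    then have "i = n2" using that by simp
    have "bar.dd Z (\<gamma>2 n2) = 0" using 2(2) bar.dd_sym by metis
    then show ?thesis using \<open>i = n2\<close> 3(1) by (simp add: \<Gamma>_def)
  qed (simp add: \<Gamma>_def)
  have g3: "\<Gamma> (a + n2 + i) = \<gamma>3 i" for i by (simp add: \<Gamma>_def)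
  have step: "bar.dd (\<Gamma> i) (\<Gamma> (Suc i)) \<le> 1" if im: "i < m" for i
  proof -
    consider "i < a" | "a \<le> i" "i < a + n2" | "a + n2 \<le> i" by linarith
    then show ?thesis
    proof cases
      case 1
      then show ?thesis using z[OF g1[of i] g1[of "Suc i"]] bar.isgeoD[OF \<open>bar.isgeo \<gamma>1 a\<close>, of i "Suc i"] by simp
    next
      case 2
      then obtain j where j: "i = a + j" "j < n2" by (metis le_add_diff_inverse add_less_cancel_left)
      then show ?thesis using z[OF g2[of j] g2[of "Suc j"]] bar.isgeoD[OF \<open>bar.isgeo \<gamma>2 n2\<close>, of j "Suc j"] by simp
    next
      case 3
      define j where "j = i - (a + n2)"
      have j: "i = a + n2 + j" "j < n3" using 3 im by (auto simp: j_def m_def)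
      then show ?thesis using g3[of j] g3[of "Suc j"] bar.isgeoD[OF \<open>bar.isgeo \<gamma>3 n3\<close>, of j "Suc j"] by simp
    qed
  qed
  obtain x where x: "x 0 = \<Gamma> 0" "\<forall>i\<le>m. inverse (\<Gamma> i) * x i \<in> K" "\<forall>i<m. hat.dd (x i) (x (Suc i)) \<le> 1"
    using bar_path_lift[of m \<Gamma>] step by blast
  define g where "g = inverse (\<Gamma> 0)"
  define y where "y i = g * x i" for i
  have be: "bar.dd (y i) (y j) = bar.dd (\<Gamma> i) (\<Gamma> j)" if "i \<le> m" "j \<le> m" for i j
    using bar_eq[of "\<Gamma> i" "x i" "\<Gamma> j" "x j"] x(2) that by (simp add: y_def)
  have tri: "triangle y a (a + n2) m"
    unfolding triangle_def
  proof (intro conjI allI impI)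
    show "y 0 = 1" using x(1) by (simp add: y_def g_def left_inv)
    show "hat.dd (y i) (y (Suc i)) \<le> 1" if "i < m" for i using x(3) that by (simp add: y_def)
    show "bar.dd (y 0) (y a) = int a"
      using be[of 0 a] z[OF g1[of 0] g1[of a]] bar.isgeoD[OF 1(3), of 0 a] by (simp add: m_def)
    show "bar.dd (y a) (y (a + n2)) = int (a + n2) - int a"
      using be[of a "a + n2"] z[OF g2[of 0] g2[of n2]] bar.isgeoD[OF 2(3), of 0 n2] by (simp add: m_def)
    show "bar.dd (y (a + n2)) (y m) = int m - int (a + n2)"
      using be[of "a + n2" m] g3[of 0] g3[of n3] bar.isgeoD[OF 3(3), of 0 n3] by (simp add: m_def)
  qed (auto simp: m_def)
  have "bar.dd (\<Gamma> m) (\<Gamma> 0) = 0" using g3[of n3] 3(2) g1[of 0] 1(1) c0[of "\<Gamma> m" X "\<Gamma> 0"] bar.dd_sym by (simp add: m_def)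
  then have "bar.dd (y 0) (y m) = 0" using be[of 0 m] bar.dd_sym by simp
  then have "y m \<in> K" using tri bar_0[of "y 0" "y m"] by (simp add: triangle_def inv_one)
  then obtain r where "y m \<in> wm.Kr r" by (auto simp: wm.KK_def)
  then obtain w where w: "triangle w a (a + n2) m" "\<forall>i\<le>m. inverse (y i) * w i \<in> K" "w m \<in> R"
    using lift_triangle[OF _ tri] by blast
  have bw: "bar.dd (w i) (g * \<Gamma> i) = 0" if "i \<le> m" for i
  proof -
    have "inverse (g * \<Gamma> i) * y i \<in> K" using x(2) that by (simp add: y_def gsimps)
    then have "bar.dd (g * \<Gamma> i) (y i) = 0" by (simp add: bar_0)
    moreover have "bar.dd (y i) (w i) = 0" using w(2) that by (simp add: bar_0)
    ultimately show ?thesis using c0 bar.dd_sym by metis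
  qed
  have hg: "hat.isgeo w a" by (rule hat_isgeo_of_bar) (use w(1) in \<open>auto simp: triangle_def\<close>)
  have hd: "hat.dd (w s) (w t) = bar.dd (w s) (w t)" if "s \<le> t" "t \<le> m" "bar.dd (w s) (w t) = int t - int s" for s t
  proof -
    have "hat.isgeo (\<lambda>i. w (s + i)) (t - s)"
      by (rule hat_isgeo_of_bar) (use w(1) that in \<open>auto simp: triangle_def\<close>)
    then show ?thesis using hat.isgeoD[of "\<lambda>i. w (s + i)" "t - s" 0 "t - s"] that by simp
  qed
  have am: "a \<le> m" "a + n2 \<le> m" by (auto simp: m_def)
  note wt = w(1)[unfolded triangle_def]
  have e01: "hat.dd (w 0) (w a) = bar.dd (w 0) (w a)" by (rule hd) (use wt am in auto)
  have e12: "hat.dd (w a) (w (a + n2)) = bar.dd (w a) (w (a + n2))" by (rule hd) (use wt am in auto)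
  have e23: "hat.dd (w (a + n2)) (w m) = bar.dd (w (a + n2)) (w m)" by (rule hd) (use wt am in auto)
  \<comment> \<open>The lift closes up modulo \<open>R\<close>, so the third side can be read as
    ending at \<open>w 0\<close>.\<close>
  have "inverse (w 0) * w m \<in> R" using w(1,3) by (simp add: triangle_def inv_one)
  then have wm0: "hat.dd (w 0) (w m) = 0" using wl_zero_iff[OF gT nR] by (simp add: hat.dd_def)
  then have e20: "hat.dd (w (a + n2)) (w 0) = bar.dd (w (a + n2)) (w 0)"
    using e23 hat.dd_tri[of "w (a + n2)" "w 0" "w m"] hat.dd_tri[of "w (a + n2)" "w m" "w 0"] hat.dd_sym[of "w 0" "w m"]
      bar_le[of "w 0" "w m"] bar.dd_nonneg[of "w 0" "w m"] bar.dd_tri[of "w (a + n2)" "w m" "w 0"]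
      bar.dd_tri[of "w (a + n2)" "w 0" "w m"] bar.dd_sym[of "w 0" "w m"] by linarith
  have "hat.betw (w 0) (w l) (w a)" using hat.isgeo_betw[OF hg 1(4)] .
  then obtain q where q: "hat.betw (w 0) q (w (a + n2)) \<or> hat.betw (w (a + n2)) q (w a)" "hat.dd (w l) q \<le> h"
    using hs unfolding hat.slim_def by blast
  define q' where "q' = inverse g * q"
  have gq: "g * q' = q" by (simp add: q'_def gsimps)
  have tr: "bar.dd (w i) q = bar.dd (\<Gamma> i) q'" if "i \<le> m" for i
    using z[OF bw[OF that], of q q] bar.dd_left[of g "\<Gamma> i" q'] gq by simp
  have GX: "bar.dd (\<Gamma> 0) X = 0" using g1[of 0] 1(1) by simp
  have GY: "bar.dd (\<Gamma> a) Y = 0" using c0[OF g1[of a] 1(2)] by simp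
  have GZ: "bar.dd (\<Gamma> (a + n2)) Z = 0" using g3[of 0] 3(1) by simp
  have Gp: "bar.dd (\<Gamma> l) p = 0" using c0[OF g1[OF 1(4)] 1(5)] .
  have wG: "bar.dd (w i) (w j) = bar.dd (\<Gamma> i) (\<Gamma> j)" if "i \<le> m" "j \<le> m" for i j
    using z[OF bw[OF that(1)] bw[OF that(2)]] by simp
  have tb: "bar.betw A q' B"
    if "hat.betw (w i) q (w j)" "hat.dd (w i) (w j) = bar.dd (w i) (w j)" "i \<le> m" "j \<le> m"
      "bar.dd (\<Gamma> i) A = 0" "bar.dd (\<Gamma> j) B = 0" for i j A B
  proof -
    have "bar.dd (w i) q + bar.dd q (w j) = bar.dd (w i) (w j)"
      using that(1,2) bar_le[of "w i" q] bar_le[of q "w j"] bar.dd_tri[of "w i" "w j" q] unfolding hat.betw_def by linarith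
    then have "bar.dd (\<Gamma> i) q' + bar.dd q' (\<Gamma> j) = bar.dd (\<Gamma> i) (\<Gamma> j)"
      using tr[OF that(3)] tr[OF that(4)] wG[OF that(3,4)] bar.dd_sym by metis
    moreover have "bar.dd (\<Gamma> i) q' = bar.dd A q'" "bar.dd q' (\<Gamma> j) = bar.dd q' B" "bar.dd (\<Gamma> i) (\<Gamma> j) = bar.dd A B"
      using z[OF that(5), of q' q'] z[OF _ that(6), of q' q'] z[OF that(5,6)] by simp_all
    ultimately show ?thesis by (simp add: bar.betw_def)
  qed
  have "bar.betw X q' Z \<or> bar.betw Z q' Y"
    using q(1)
  proof
    assume "hat.betw (w 0) q (w (a + n2))"
    then show ?thesis using tb[of 0 "a + n2" X Z] e20 hat.dd_sym bar.dd_sym am GX GZ by simp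
  next
    assume "hat.betw (w (a + n2)) q (w a)"
    then show ?thesis using tb[of "a + n2" a Z Y] e12 hat.dd_sym bar.dd_sym am GZ GY by simp
  qed
  moreover have "bar.dd p q' = bar.dd (\<Gamma> l) q'" using z[OF Gp, of q' q'] by simp
  then have "bar.dd p q' \<le> h" using tr[of l] bar_le[of "w l" q] q(2) 1(4) am by simp
  ultimately show "\<exists>q. (bar.betw X q Z \<or> bar.betw Z q Y) \<and> bar.dd p q \<le> h" by blast
qed

text \<open>Once \<open>v ^ N\<close> is killed, a coset of \<open>E\<close> is bounded: its
  elements are within \<open>kap\<close> of powers of \<open>v\<close>, of which only those below
  \<open>N\<close> count. The 1 is for letters in \<open>S\<close>.\<close>

definition CE :: nat where "CE = nat kap + N * wl S R v + 1"

lemma quo_le: "quo.dd x y \<le> dd x y"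
  unfolding quo.dd_def dd_def using wl_mono[OF gS nR R_K] by simp

lemma quo_P: "wl S K (P i) \<le> N * wl S R v"
proof -
  have "P (int N * (i div int N)) \<in> rotset N 1"
    unfolding rotset_def by (intro CollectI exI[of _ "i div int N"]) (simp add: gsimps)
  then have k: "P (int N * (i div int N)) \<in> K" using wm.Kc_KK by blast
  have "P i = P (int N * (i div int N)) * P (i mod int N)" by (simp flip: powi_add)
  then have "inverse (P (i mod int N)) * P i = inverse (P (i mod int N)) * P (int N * (i div int N)) * P (i mod int N)"
    by (simp add: mult.assoc)
  then have "inverse (P (i mod int N)) * P i \<in> K" using nsubD(5)[OF nK k] by metis
  then have "wl S K (P i) = wl S K (P (i mod int N))" using wl_cong[OF nK] by metis
  also have "\<dots> \<le> wl S R (P (i mod int N))" by (rule wl_mono[OF gS nR R_K])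
  also have "\<dots> \<le> nat (i mod int N) * wl S R v"
    using len_P[of "i mod int N"] len_power_le Npos by simp
  also have "\<dots> \<le> N * wl S R v" using Npos by (intro mult_right_mono) (auto simp: nat_le_iff less_imp_le)
  finally show ?thesis .
qed

lemma quo_step: assumes "bar.dd x y \<le> 1" shows "quo.dd x y \<le> int CE"
proof -
  obtain t where t: "t \<in> insert 1 T" "inverse (inverse x * y) * t \<in> K"
    using wl_step[OF nK, of "inverse x * y"] assms by (auto simp: bar.dd_def)
  have "quo.dd x y = int (wl S K t)" using wl_cong[OF nK t(2)] by (simp add: quo.dd_def)
  moreover have "wl S K t \<le> CE"
  proof (cases "t \<in> E")
    case True
    then obtain i where i: "dd t (P i) \<le> kap" using E_near by blast
    have "quo.dd 1 t \<le> quo.dd 1 (P i) + quo.dd (P i) t" by (rule quo.dd_tri)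
    also have "quo.dd (P i) t \<le> kap" using quo_le[of "P i" t] i dd_sym[of t "P i"] by linarith
    finally have "int (wl S K t) \<le> int (wl S K (P i)) + kap" by (simp add: quo.dd_one)
    then show ?thesis using quo_P[of i] kap_nonneg unfolding CE_def by linarith
  next
    case False
    then have "t \<in> S" using t(1) subgrD(1)[OF subgr_E] by (auto simp: T_def)
    then have "wl S K t \<le> 1" using wl_le[OF prods_1, of t S t K] nsubD(1)[OF nK] by (simp add: left_inv)
    then show ?thesis by (simp add: CE_def)
  qed
  ultimately show ?thesis by simp
qed

lemma quo_bar: "quo.dd x y \<le> int CE * bar.dd x y"
proof -
  obtain \<gamma> n where \<gamma>: "int n = bar.dd x y" "\<gamma> 0 = x" "bar.dd (\<gamma> n) y = 0" "bar.isgeo \<gamma> n" using bar.ex_geo by blast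
  have "quo.dd x (\<gamma> i) \<le> int CE * int i" if "i \<le> n" for i
    using that
  proof (induction i)
    case (Suc i)
    then show ?case
      using quo.dd_tri[of x "\<gamma> (Suc i)" "\<gamma> i"] quo_step[of "\<gamma> i" "\<gamma> (Suc i)"] bar.isgeoD[OF \<gamma>(4), of i "Suc i"]
      by (simp add: distrib_left)
  qed (simp add: \<gamma>(2))
  moreover have "quo.dd (\<gamma> n) y = 0" using \<gamma>(3) wl_zero_iff[OF gS nK] by (simp add: bar_0 quo.dd_def)
  ultimately show ?thesis using quo.dd_tri[of x y "\<gamma> n"] \<gamma>(1) by fastforce
qed

lemma bar_quo: "bar.dd x y \<le> quo.dd x y"
  unfolding quo.dd_def bar.dd_def using wl_mono_gen[OF gS nK, of T] by (simp add: T_def)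

text \<open>In the quotient the cosets of \<open>E\<close> are bounded, so the coned-off and the
  original length differ at most by the factor \<open>CE\<close>. Geodesics of the former are
  therefore admissible guesses for the latter.\<close>

theorem quo_hyp: "\<exists>\<delta>'. quo.hyp4 \<delta>'"
proof -
  obtain H where "hat.slim (int H)" using hat_slim by blast
  then have bs: "bar.slim (int H)" by (rule bar_slim)
  define h where "h = CE + CE * H"
  have CEh: "int CE \<le> int h" by (simp add: h_def)
  have path: "\<exists>e n. e 0 = x \<and> e n = y \<and> (\<forall>i\<le>n. e i \<in> {z. bar.betw x z y}) \<and> (\<forall>i<n. quo.dd (e i) (e (Suc i)) \<le> int h)" for x y
  proof -
    obtain \<gamma> n where \<gamma>: "\<gamma> 0 = x" "bar.dd (\<gamma> n) y = 0" "bar.isgeo \<gamma> n" using bar.ex_geo by blast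
    define e where "e i = (if i \<le> n then \<gamma> i else y)" for i
    have ny: "bar.dd a y = bar.dd a (\<gamma> n)" for a
      using bar.dd_tri[of a y "\<gamma> n"] bar.dd_tri[of a "\<gamma> n" y] bar.dd_sym[of y "\<gamma> n"] \<gamma>(2) by linarith
    have "bar.betw x (e i) y" for i
      using bar.isgeo_betw[OF \<gamma>(3), of i] \<gamma>(1) ny by (cases "i \<le> n") (auto simp: e_def bar.betw_def)
    moreover have "bar.dd (e i) (e (Suc i)) \<le> 1" if "i < Suc n" for i
      using bar.isgeoD[OF \<gamma>(3), of i "Suc i"] that \<gamma>(2) by (cases "i = n") (auto simp: e_def)
    then have "quo.dd (e i) (e (Suc i)) \<le> int h" if "i < Suc n" for i
      using quo_step[of "e i" "e (Suc i)"] CEh that by (meson order_trans)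
    ultimately show ?thesis using \<gamma>(1) by (intro exI[of _ e] exI[of _ "Suc n"]) (auto simp: e_def)
  qed
  have short: "quo.dd x p \<le> int h" if "quo.dd x y \<le> 1" "p \<in> {z. bar.betw x z y}" for x y p
  proof -
    have "bar.dd x p \<le> 1"
      using bar_quo[of x y] that bar.dd_nonneg[of p y] unfolding bar.betw_def mem_Collect_eq by linarith
    then show ?thesis using quo_step[of x p] CEh by linarith
  qed
  have thin: "\<exists>q\<in>{q. bar.betw x q z} \<union> {q. bar.betw z q y}. quo.dd p q \<le> int h" if pxy: "p \<in> {z. bar.betw x z y}" for x y z p
  proof -
    obtain q where q: "bar.betw x q z \<or> bar.betw z q y" "bar.dd p q \<le> int H"
      using bs pxy unfolding bar.slim_def by blast
    have "quo.dd p q \<le> int CE * bar.dd p q" by (rule quo_bar)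
    also have "\<dots> \<le> int CE * int H" using q(2) by (intro mult_left_mono) auto
    finally have "quo.dd p q \<le> int h" by (simp add: h_def)
    then show ?thesis using q(1) by blast
  qed
  have "\<exists>H. quo.slim (int H)"
    using quo.guess_slim[where \<eta> = "\<lambda>x y. {z. bar.betw x z y}", OF path short thin] .
  then show ?thesis using quo.hyp4_of_slim by blast
qed

lemma K_nclos: "K = nclos (insert (v ^ N) R)"
proof
  show "nclos (insert (v ^ N) R) \<subseteq> K"
  proof (rule nclos_least[OF nK])
    have "v ^ N \<in> rotset N 1" unfolding rotset_def by (intro CollectI exI[of _ 1]) (simp add: gsimps powi_nat)
    then show "insert (v ^ N) R \<subseteq> K" using R_K wm.Kc_KK by blast
  qed
  define M where "M = nclos (insert (v ^ N) R)"
  have nM: "nsub M" and sub: "insert (v ^ N) R \<subseteq> M" unfolding M_def by (rule nsub_nclos, rule nclos_incl)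
  show "K \<subseteq> M"
  proof (rule wm.KK_least[OF nM])
    show "R \<subseteq> M" using sub by blast
    fix g show "rotset N g \<subseteq> M"
    proof
      fix x assume "x \<in> rotset N g"
      then obtain j where j: "cg (g * P (int N * j) * inverse g) x" using cg_sym by (auto simp: rotset_def)
      have "(v ^ N) powi j \<in> M" using subgr_powi[OF nsub_subgr[OF nM]] sub by blast
      then have a: "g * P (int N * j) * inverse g \<in> M" using nsubD(4)[OF nM] by (simp add: powi_power)
      have "inverse (g * P (int N * j) * inverse g) * x \<in> M" using j sub unfolding cg_def by blast
      then show "x \<in> M" using subgr_mult_left[OF nsub_subgr[OF nM] subgrD(3)[OF nsub_subgr[OF nM] a]] by blast
    qed
  qed
qed

text \<open>The axis supplied by \<open>Kr_reduce\<close> sees 1 and \<open>k\<close> far apart, and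
  projections are Lipschitz up to a constant. Hence short relations do not change.\<close>

lemma K_long: assumes "k \<in> K" "k \<notin> R" shows "LN N - 8 * \<theta> - 2 * C1 - \<delta> \<le> int (wl S R k)"
proof -
  obtain r where "k \<in> wm.Kr r" using assms(1) by (auto simp: wm.KK_def)
  then have "k \<in> R \<or> (\<exists>y. LN N - 8 * \<theta> \<le> pd y 1 k)" by (induction rule: wm.Kr_reduce) blast+
  then obtain y where "LN N - 8 * \<theta> \<le> pd y 1 k" using assms(2) by blast
  then show ?thesis using pd_lip[of y 1 k] by (simp add: dd_one)
qed

end

section \<open>The power relator for an arbitrary element of infinite order\<close>

definition hyperbolic_mod :: "'a::grp set \<Rightarrow> 'a set \<Rightarrow> bool" where
  "hyperbolic_mod S R \<longleftrightarrow> (\<exists>\<delta>. lenspace.hyp4 (wl S R) \<delta>)"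

lemma nclos_conj: "nsub R \<Longrightarrow> nclos (insert (inverse p * x * p) R) = nclos (insert x R)"
proof -
  have le: "nclos (insert (inverse p * x * p) R) \<subseteq> nclos (insert x R)" for p x :: 'a
    using nclos_incl[of "insert x R"] nsubD(5)[OF nsub_nclos, of x "insert x R" p]
    by (intro nclos_least nsub_nclos) auto
  have "nclos (insert (inverse (inverse p) * (inverse p * x * p) * inverse p) R) \<subseteq> nclos (insert (inverse p * x * p) R)"
    by (rule le)
  then show ?thesis using le[of p x] by (auto simp: gsimps)
qed

text \<open>A conjugate \<open>v\<close> of some \<open>w ^ j\<close> satisfies the hypotheses of
  \<open>qaxis\<close>, and its powers are conjugate to powers of \<open>w\<close>. All multiples of
  \<open>N0\<close> are allowed as exponents so that further divisibility demands can be met at the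
  same time.\<close>

theorem add_power_relator:
  assumes S: "genset S" "finite S" and R: "nsub R" and hyp: "hyperbolic_mod S R"
    and w: "\<And>n. n > 0 \<Longrightarrow> w ^ n \<notin> R"
  shows "\<exists>N0>0. \<forall>m>0. N0 dvd m \<longrightarrow> hyperbolic_mod S (nclos (insert (w ^ m) R)) \<and>
    (\<forall>x\<in>nclos (insert (w ^ m) R). wl S R x \<le> \<rho> \<longrightarrow> x \<in> R)"
proof -
  obtain \<delta> where \<delta>: "lenspace.hyp4 (wl S R) \<delta>" using hyp by (auto simp: hyperbolic_mod_def)
  interpret ls: lenspace "wl S R" by (rule wl_lenspace[OF S(1) R])
  interpret hg: hypgrp "wl S R" R \<delta>
    by unfold_locales (use R \<delta> wl_zero_iff[OF S(1) R] wl_ball_finite[OF S(1) R S(2)] in auto)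
  obtain p j where j: "j > 0" and l1: "int (wl S R (inverse p * w ^ j * p)) > 100 * \<delta> + 100"
    and l2: "2 * int (wl S R (inverse p * w ^ j * p)) - int (wl S R ((inverse p * w ^ j * p) ^ 2)) \<le> 4 * \<delta>"
    using hg.loxodromic[OF w, of "100 * \<delta> + 100"] hg.dnn by auto
  define v where "v = inverse p * w ^ j * p"
  interpret qt: quot S R \<delta> v
    by unfold_locales (use l1 l2 S(1) in \<open>auto simp: v_def\<close>)
  \<comment> \<open>At least as large as each lower bound required of \<open>LN N\<close>; exponents
    \<open>N\<close> beyond it do, since \<open>LN N\<close> is at least \<open>N\<close>.\<close>
  define N1 where "N1 = nat (60 * qt.kap + 60 * \<delta> + 60 * qt.C1 + 60 * qt.\<theta>3 + 60 + 1000 * qt.\<theta> + 1000 +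
    \<bar>3 * qt.BB\<bar> + 8 * qt.\<theta> + 1 + 2 * qt.C1 + \<delta> + int \<rho> + 1)"
  define N0 where "N0 = j * (qt.M0 * (N1 + 1))"
  have vw: "v ^ n = inverse p * w ^ (j * n) * p" for n
    unfolding v_def using conj_power[of "inverse p" "w ^ j" n] by (simp add: inv_inv power_mult)
  have "hyperbolic_mod S (nclos (insert (w ^ m) R)) \<and> (\<forall>x\<in>nclos (insert (w ^ m) R). wl S R x \<le> \<rho> \<longrightarrow> x \<in> R)"
    if m: "m > 0" "N0 dvd m" for m
  proof -
    obtain i where i: "m = N0 * i" using m(2) by (auto simp: dvd_def)
    define N where "N = qt.M0 * (N1 + 1) * i"
    have mN: "m = j * N" by (simp add: i N0_def N_def)
    have Npos: "N > 0" using m(1) mN by simp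
    moreover have "N = (N1 + 1) * (qt.M0 * i)" by (simp add: N_def ac_simps)
    ultimately have "N1 + 1 \<le> N" by (metis dvd_imp_le dvd_triv_left)
    moreover have "int N * 1 \<le> int N * qt.lam" using qt.lam_pos by (intro mult_left_mono) auto
    ultimately have LN: "int N1 \<le> qt.LN N" using qt.len_lower[of N] unfolding qt.LN_def by linarith
    have pos: "0 \<le> qt.kap" "0 \<le> \<delta>" "2 \<le> qt.C1" "0 \<le> qt.\<theta>3" "0 \<le> qt.\<theta>"
      using qt.kap_nonneg hg.dnn qt.C1_pos qt.\<theta>3(1) qt.th_nonneg by auto
    have N1: "60 * qt.kap + 60 * \<delta> + 60 * qt.C1 + 60 * qt.\<theta>3 + 60 + 1000 * qt.\<theta> + 1000 +
      \<bar>3 * qt.BB\<bar> + 8 * qt.\<theta> + 1 + 2 * qt.C1 + \<delta> + int \<rho> + 1 \<le> int N1" unfolding N1_def by simp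
    interpret rq: rotquot S R \<delta> v N
    proof
      show "N > 0" by fact
      show "qt.M0 dvd N" by (simp add: N_def)
      show "60 * qt.kap + 60 * \<delta> + 60 * qt.C1 + 60 * qt.\<theta>3 + 60 \<le> qt.LN N" using N1 LN pos by linarith
      show "1000 * qt.\<theta> + 1000 \<le> qt.LN N" using N1 LN pos by linarith
      show "3 * qt.BB + 8 * qt.\<theta> < qt.LN N" using N1 LN pos by linarith
    qed
    have K: "rq.wm.KK = nclos (insert (w ^ m) R)"
      unfolding rq.K_nclos vw mN by (rule nclos_conj[OF R])
    have "x \<in> R" if "x \<in> rq.wm.KK" "wl S R x \<le> \<rho>" for x
      using rq.K_long[OF that(1)] that(2) N1 LN pos by linarith
    then show ?thesis using rq.quo_hyp K by (auto simp: hyperbolic_mod_def)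
  qed
  moreover have "N0 > 0" using j qt.M0(1) by (simp add: N0_def)
  ultimately show ?thesis by blast
qed

section \<open>The free group of rank two\<close>

text \<open>The first component names the generator, and the second is \<open>False\<close> for its
  inverse.\<close>

type_synonym letter = "bool \<times> bool"

definition linv :: "letter \<Rightarrow> letter" where "linv l = (fst l, \<not> snd l)"

lemma linv_linv [simp]: "linv (linv l) = l" by (simp add: linv_def)

lemma linv_neq [simp]: "linv l \<noteq> l" "l \<noteq> linv l" by (auto simp: linv_def prod_eq_iff)

lemma linv_eq_iff [simp]: "linv l = linv m \<longleftrightarrow> l = m" by (metis linv_linv)

fun red :: "letter list \<Rightarrow> bool" where
  "red (l # m # w) \<longleftrightarrow> m \<noteq> linv l \<and> red (m # w)"
| "red _ \<longleftrightarrow> True"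

definition push :: "letter \<Rightarrow> letter list \<Rightarrow> letter list" where
  "push l w = (if w \<noteq> [] \<and> hd w = linv l then tl w else l # w)"

lemma red_Cons: "red (l # w) \<longleftrightarrow> red w \<and> (w = [] \<or> hd w \<noteq> linv l)"
  by (cases w) auto

lemma red_push: "red w \<Longrightarrow> red (push l w)"
  by (cases w) (auto simp: push_def red_Cons)

lemma push_push: "red w \<Longrightarrow> push (linv l) (push l w) = w"
  by (cases w) (auto simp: push_def red_Cons)

lemma push_push': "red w \<Longrightarrow> push l (push (linv l) w) = w"
  using push_push[of w "linv l"] by simp

definition app :: "letter list \<Rightarrow> letter list \<Rightarrow> letter list" where "app u v = foldr push u v"

lemma red_app: "red v \<Longrightarrow> red (app u v)"
  by (induction u) (auto simp: app_def red_push)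

text \<open>Letters act on reduced words by bijections, with \<open>push (linv l)\<close> inverse to
  \<open>push l\<close>. So cancellation inside \<open>u\<close> does not affect the action, and
  associativity follows without a confluence argument.\<close>

lemma app_push: "red x \<Longrightarrow> app (push l u) x = push l (app u x)"
proof (cases "u \<noteq> [] \<and> hd u = linv l")
  case True
  assume "red x"
  from True obtain u' where "u = linv l # u'" by (cases u) auto
  then show ?thesis using push_push'[OF red_app[OF \<open>red x\<close>], of l u'] by (simp add: push_def app_def)
qed (auto simp: push_def app_def)

lemma app_assoc: "red x \<Longrightarrow> app (app u v) x = app u (app v x)"
proof (induction u)
  case (Cons l u)
  have "app (app (l # u) v) x = app (push l (app u v)) x" by (simp add: app_def)
  also have "\<dots> = push l (app u (app v x))" using app_push Cons by simp
  finally show ?case by (simp add: app_def)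
qed (simp add: app_def)

lemma app_Nil: "red u \<Longrightarrow> app u [] = u"
  by (induction u) (auto simp: app_def push_def red_Cons)

definition winv :: "letter list \<Rightarrow> letter list" where "winv w = rev (map linv w)"

lemma app_winv: "red w \<Longrightarrow> app (winv w) w = []"
proof (induction w)
  case (Cons l w)
  then show ?case by (simp add: winv_def app_def push_def red_Cons)
qed (simp add: winv_def app_def)

lemma red_append: "red (u @ v) \<longleftrightarrow> red u \<and> red v \<and> (u = [] \<or> v = [] \<or> hd v \<noteq> linv (last u))"
  by (induction u) (auto simp: red_Cons)

lemma red_winv: "red w \<Longrightarrow> red (winv w)"
  by (induction w) (auto simp: winv_def red_append red_Cons last_rev hd_map)

typedef fg = "{w. red w}" morphisms word Fg by (rule exI[of _ "[]"]) simp

setup_lifting type_definition_fg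

instantiation fg :: grp begin
lift_definition one_fg :: fg is "[]" by simp
lift_definition times_fg :: "fg \<Rightarrow> fg \<Rightarrow> fg" is app by (simp add: red_app)
lift_definition inverse_fg :: "fg \<Rightarrow> fg" is winv by (simp add: red_winv)
lift_definition divide_fg :: "fg \<Rightarrow> fg \<Rightarrow> fg" is "\<lambda>u v. app u (winv v)" by (simp add: red_app red_winv)
instance
  by standard (transfer; simp add: app_assoc app_winv app_Nil; simp add: app_def)+
end

instance fg :: countable
proof
  show "\<exists>f::fg \<Rightarrow> nat. inj f"
    by (rule exI[of _ "\<lambda>x. to_nat (word x)"]) (auto simp: inj_def word_inject)
qed

section \<open>Generators and word length of the free group\<close>

lift_definition gen :: "letter \<Rightarrow> fg" is "\<lambda>l. [l]" by simp

lemma word_gen_mult: "word (gen l * x) = push l (word x)"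
  by transfer (simp add: app_def)

lemma gen_linv: "gen (linv l) = inverse (gen l)"
  by transfer (simp add: winv_def)

definition gens :: "fg set" where "gens = range gen"

lemma finite_gens: "finite gens" by (simp add: gens_def)

lemma word_prod_gens: "prod_list (map gen w) = Fg (app w [])"
proof (induction w)
  case Nil then show ?case by (simp add: app_def one_fg_def)
next
  case (Cons l w)
  have "word (gen l * prod_list (map gen w)) = push l (app w [])"
    using Cons by (simp add: word_gen_mult Fg_inverse red_app)
  then show ?case by (simp add: app_def) (metis word_inverse)
qed

lemma fg_prod: "x = prod_list (map gen (word x))"
  using word[of x] by (simp add: word_prod_gens app_Nil word_inverse)

lemma word_in_prods: "x \<in> prods gens (length (word x))"
  unfolding prods_def by (rule CollectI, rule exI[of _ "map gen (word x)"]) (use fg_prod[of x] in \<open>auto simp: gens_def\<close>)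

lemma genset_gens: "genset gens"
  unfolding genset_def using word_in_prods by (auto simp: gens_def simp flip: gen_linv)

lemma length_push: "length (push l w) \<le> Suc (length w)" by (auto simp: push_def)

lemma prods_length: "x \<in> prods gens n \<Longrightarrow> length (word x) \<le> n"
proof (induction n arbitrary: x)
  case 0 then show ?case by (simp add: prods_0 one_fg.rep_eq)
next
  case (Suc n)
  then obtain y z where yz: "y \<in> prods gens 1" "z \<in> prods gens n" "x = y * z" using prods_split[of x gens 1 n] by auto
  then obtain l where "y = gen l" by (auto simp: prods_def length_Suc_conv gens_def)
  then show ?case using Suc.IH[OF yz(2)] length_push[of l "word z"] yz(3) by (simp add: word_gen_mult)
qed

lemma nsub_one: "nsub {1::'a::grp}" by (auto simp: nsub_def subgr_def gsimps)

lemma wl_gens: "wl gens {1} x = length (word x)"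
proof (rule antisym)
  show "wl gens {1} x \<le> length (word x)" using wl_le[OF word_in_prods[of x], of x "{1}"] by (simp add: left_inv)
  obtain y where y: "y \<in> prods gens (wl gens {1} x)" "inverse x * y \<in> {1}" using wl_attained[OF genset_gens nsub_one] .
  then have "y = x" using cancel_inv_left[of x y] by simp
  then show "length (word x) \<le> wl gens {1} x" using prods_length y(1) by blast
qed

text \<open>The common prefix length is the ordinary Gromov product at 1 on the tree of reduced
  words; its ultrametric inequality is hyperbolicity with constant 0.\<close>

fun lcp :: "letter list \<Rightarrow> letter list \<Rightarrow> nat" where
  "lcp (l # u) (m # v) = (if l = m then Suc (lcp u v) else 0)"
| "lcp _ _ = 0"

lemma lcp_ultra: "min (lcp u v) (lcp v w) \<le> lcp u w"
proof (induction u w arbitrary: v rule: lcp.induct)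
  case (1 l u m w)
  then show ?case by (cases v) auto
next
  case ("2_1" w) then show ?case by simp
next
  case ("2_2" u) then show ?case by (cases v) auto
qed

lemma length_noncancel: "red (l # u) \<Longrightarrow> length (app (winv u) (linv l # v)) = length u + Suc (length v)"
proof (induction u arbitrary: l v)
  case (Cons m u)
  have "app (winv (m # u)) (linv l # v) = app (winv u) (push (linv m) (linv l # v))" by (simp add: winv_def app_def)
  also have "push (linv m) (linv l # v) = linv m # linv l # v" using Cons.prems by (auto simp: push_def)
  finally show ?case using Cons by simp
qed (simp add: winv_def app_def)

lemma length_app_winv: "red u \<Longrightarrow> red v \<Longrightarrow> length (app (winv u) v) + 2 * lcp u v = length u + length v"
proof (induction u v rule: lcp.induct)
  case (1 l u m v)
  show ?case
  proof (cases "l = m")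
    case True
    have "app (winv (l # u)) (m # v) = app (winv u) v" using True by (simp add: winv_def app_def push_def)
    then show ?thesis using 1 True by (simp add: red_Cons)
  next
    case False
    have "app (winv (l # u)) (m # v) = app (winv u) (linv l # m # v)" using False by (simp add: winv_def app_def push_def)
    then show ?thesis using length_noncancel[OF 1(2), of "m # v"] False by simp
  qed
next
  case ("2_1" v) then show ?case by (simp add: winv_def app_def)
next
  case ("2_2" u)
  have "app (winv u) [] = winv u" using "2_2" by (simp add: app_Nil red_winv)
  then show ?case by (simp add: winv_def)
qed

lemma hyperbolic_free: "hyperbolic_mod gens {1}"
proof -
  interpret lenspace "wl gens {1::fg}" by (rule wl_lenspace[OF genset_gens nsub_one])
  have g1: "gp 1 x y = 2 * int (lcp (word x) (word y))" for x y
    using length_app_winv[of "word x" "word y"] word[of x] word[of y]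
    unfolding gp_def dd_one by (simp add: dd_def wl_gens times_fg.rep_eq inverse_fg.rep_eq)
  have "hyp4 0" unfolding hyp4_def
  proof (intro allI)
    fix p x y z :: fg
    have s: "gp p a b = 2 * int (lcp (word (inverse p * a)) (word (inverse p * b)))" for a b
      using gp_left[of "inverse p" p a b] g1 by (simp add: left_inv)
    show "min (gp p x y) (gp p y z) - 0 \<le> gp p x z"
      unfolding s using lcp_ultra[of "word (inverse p * x)" "word (inverse p * y)" "word (inverse p * z)"] by linarith
  qed
  then show ?thesis by (auto simp: hyperbolic_mod_def)
qed

section \<open>Derivations into permutation modules\<close>

definition shift :: "fg \<Rightarrow> (fg \<Rightarrow> int) \<Rightarrow> fg \<Rightarrow> int" where "shift g f = (\<lambda>x. f (inverse g * x))"

text \<open>The value at an inverse letter is forced by the product rule for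
  \<open>inverse s * s = 1\<close>.\<close>

definition der0 :: "(bool \<Rightarrow> fg \<Rightarrow> int) \<Rightarrow> letter \<Rightarrow> fg \<Rightarrow> int" where
  "der0 \<phi> l = (if snd l then \<phi> (fst l) else (\<lambda>x. - \<phi> (fst l) (gen (fst l, True) * x)))"

fun derl :: "(bool \<Rightarrow> fg \<Rightarrow> int) \<Rightarrow> letter list \<Rightarrow> fg \<Rightarrow> int" where
  "derl \<phi> [] = (\<lambda>x. 0)"
| "derl \<phi> (l # w) = (\<lambda>x. der0 \<phi> l x + shift (gen l) (derl \<phi> w) x)"

text \<open>The Fox derivative, with values in the functions on the group, that maps the generators to \<open>\<phi>\<close>.\<close>

definition der :: "(bool \<Rightarrow> fg \<Rightarrow> int) \<Rightarrow> fg \<Rightarrow> fg \<Rightarrow> int" where "der \<phi> g = derl \<phi> (word g)"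

lemma shift_shift: "shift g (shift h f) = shift (g * h) f" by (simp add: shift_def inv_mult mult.assoc)

lemma shift_one: "shift 1 f = f" by (simp add: shift_def inv_one)

lemma der0_linv: "der0 \<phi> l x + shift (gen l) (der0 \<phi> (linv l)) x = 0"
proof (cases "snd l")
  case True
  then have "l = (fst l, True)" by (simp add: prod_eq_iff)
  then show ?thesis using True by (simp add: der0_def shift_def linv_def) (metis cancel_inv_left)
next
  case False
  have "gen (fst l, True) = inverse (gen l)" using False gen_linv[of l] by (simp add: linv_def)
  then show ?thesis using False by (simp add: der0_def shift_def linv_def)
qed

lemma derl_push: "derl \<phi> (push l w) x = der0 \<phi> l x + shift (gen l) (derl \<phi> w) x"
proof (cases "w \<noteq> [] \<and> hd w = linv l")
  case True
  then obtain w' where w: "w = linv l # w'" by (cases w) auto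
  have "shift (gen l) (derl \<phi> w) x = shift (gen l) (der0 \<phi> (linv l)) x + shift (gen l) (shift (gen (linv l)) (derl \<phi> w')) x"
    by (simp add: w shift_def)
  also have "shift (gen l) (shift (gen (linv l)) (derl \<phi> w')) = derl \<phi> w'"
    by (simp add: shift_shift gen_linv right_inv shift_one)
  finally show ?thesis using der0_linv[of \<phi> l x] by (simp add: w push_def)
qed (auto simp: push_def)

lemma derl_app: "derl \<phi> (app u v) x = derl \<phi> u x + shift (prod_list (map gen u)) (derl \<phi> v) x"
proof (induction u arbitrary: x)
  case Nil then show ?case by (simp add: app_def shift_one)
next
  case (Cons l u)
  have "derl \<phi> (app (l # u) v) x = der0 \<phi> l x + shift (gen l) (derl \<phi> (app u v)) x"
    using derl_push by (simp add: app_def)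
  also have "shift (gen l) (derl \<phi> (app u v)) x = shift (gen l) (derl \<phi> u) x + shift (gen l * prod_list (map gen u)) (derl \<phi> v) x"
    using Cons by (simp add: shift_def inv_mult mult.assoc)
  finally show ?case by simp
qed

lemma der_mult: "der \<phi> (g * h) x = der \<phi> g x + der \<phi> h (inverse g * x)"
  using derl_app[of \<phi> "word g" "word h" x] fg_prod[of g] by (simp add: der_def times_fg.rep_eq shift_def)

lemma der_one: "der \<phi> 1 x = 0" by (simp add: der_def one_fg.rep_eq)

lemma der_gen: "der \<phi> (gen (b, True)) x = \<phi> b x"
  by (simp add: der_def gen.rep_eq der0_def shift_def)

lemma der_inverse: "der \<phi> (inverse g) x = - der \<phi> g (g * x)"
  using der_mult[of \<phi> "inverse g" g x] by (simp add: left_inv der_one inv_inv)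

lemma der_linear: "der (\<lambda>b x. a * \<phi> b x + c * \<psi> b x) g x = a * der \<phi> g x + c * der \<psi> g x"
proof -
  have "derl (\<lambda>b x. a * \<phi> b x + c * \<psi> b x) w x = a * derl \<phi> w x + c * derl \<psi> w x" for w
    by (induction w arbitrary: x) (auto simp: der0_def shift_def algebra_simps)
  then show ?thesis by (simp add: der_def)
qed

lemma der_bound:
  assumes "\<And>b x. \<bar>\<phi> b x\<bar> \<le> C" shows "\<bar>der \<phi> g x\<bar> \<le> int (length (word g)) * C"
proof -
  have "\<bar>derl \<phi> w x\<bar> \<le> int (length w) * C" for w
  proof (induction w arbitrary: x)
    case (Cons l w)
    have "\<bar>der0 \<phi> l x\<bar> \<le> C" using assms by (simp add: der0_def)
    moreover have "\<bar>shift (gen l) (derl \<phi> w) x\<bar> \<le> int (length w) * C" using Cons by (simp add: shift_def)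
    ultimately show ?case using abs_triangle_ineq[of "der0 \<phi> l x" "shift (gen l) (derl \<phi> w) x"]
      by (simp add: distrib_right)
  qed simp
  then show ?thesis by (simp add: der_def)
qed

text \<open>Functions on the quotient by \<open>N\<close>, kept as functions on the group; for
  finite quotients this is the permutation module.\<close>

definition ninv :: "fg set \<Rightarrow> (fg \<Rightarrow> int) \<Rightarrow> bool" where "ninv N f \<longleftrightarrow> (\<forall>x. \<forall>n\<in>N. f (x * n) = f x)"

lemma ninv_left: "nsub N \<Longrightarrow> ninv N f \<Longrightarrow> n \<in> N \<Longrightarrow> f (n * x) = f x"
proof -
  assume a: "nsub N" "ninv N f" "n \<in> N"
  then have "f (x * (inverse x * n * x)) = f x" using nsubD(5)[OF a(1,3), of x] by (simp add: ninv_def)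
  then show ?thesis by (simp add: gsimps)
qed

lemma ninv_der: "(\<And>b. ninv N (\<phi> b)) \<Longrightarrow> ninv N (der \<phi> g)"
proof -
  assume a: "\<And>b. ninv N (\<phi> b)"
  have "ninv N (derl \<phi> w)" for w
    by (induction w) (use a in \<open>auto simp: ninv_def der0_def shift_def simp flip: mult.assoc\<close>)
  then show ?thesis by (simp add: der_def)
qed

locale nder =
  fixes N :: "fg set" and \<phi> :: "bool \<Rightarrow> fg \<Rightarrow> int"
  assumes nN: "nsub N" and inv: "\<And>b. ninv N (\<phi> b)"
begin

lemma der_left: "n \<in> N \<Longrightarrow> der \<phi> g (n * x) = der \<phi> g x"
  by (rule ninv_left[OF nN]) (auto intro: ninv_der inv)

text \<open>\<open>N\<close> acts trivially on the \<open>N\<close>-invariant functions, so on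
  \<open>N\<close> the product rule becomes additivity.\<close>

lemma der_N_mult: "n \<in> N \<Longrightarrow> der \<phi> (n * g) x = der \<phi> n x + der \<phi> g x"
  using der_left[OF nsubD(3)[OF nN], of n g x] by (simp add: der_mult)

lemma der_N_inverse: "n \<in> N \<Longrightarrow> der \<phi> (inverse n) x = - der \<phi> n x"
  by (simp add: der_inverse der_left)

lemma der_N_power: "n \<in> N \<Longrightarrow> der \<phi> (n ^ k) x = int k * der \<phi> n x"
  by (induction k) (auto simp: der_one der_N_mult algebra_simps)

lemma der_N_conj: "n \<in> N \<Longrightarrow> der \<phi> (g * n * inverse g) x = der \<phi> n (inverse g * x)"
proof -
  assume n: "n \<in> N"
  have "der \<phi> (g * (n * inverse g)) x = der \<phi> g x + (der \<phi> n (inverse g * x) + der \<phi> (inverse g) (inverse g * x))"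
    using der_N_mult[OF n] by (simp add: der_mult)
  then show ?thesis by (simp add: der_inverse cancel_inv_left mult.assoc)
qed

text \<open>One statement for two uses: \<open>e = 0\<close> gives the kernel itself, and
  \<open>e > 0\<close> the kernel modulo \<open>e\<close>, which has finite index if
  \<open>N\<close> does.\<close>

lemma nsub_ker: "nsub {n \<in> N. \<forall>x. e dvd der \<phi> n x}"
  unfolding nsub_def subgr_def
  using nsubD[OF nN] by (auto simp: der_one der_N_mult der_N_inverse der_N_conj)

end

section \<open>Finite quotients and virtual first Betti numbers\<close>

definition cosN :: "'a::grp set \<Rightarrow> 'a \<Rightarrow> 'a set" where "cosN N x = {y. inverse x * y \<in> N}"

definition finite_index :: "'a::grp set \<Rightarrow> bool" where "finite_index N \<longleftrightarrow> nsub N \<and> finite (range (cosN N))"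

lemma cosN_eq: assumes "nsub N" shows "cosN N x = cosN N y \<longleftrightarrow> inverse x * y \<in> N"
proof
  assume "cosN N x = cosN N y"
  moreover have "y \<in> cosN N y" using nsubD(1)[OF assms] by (simp add: cosN_def left_inv)
  ultimately show "inverse x * y \<in> N" by (auto simp: cosN_def)
next
  assume a: "inverse x * y \<in> N"
  have "inverse x * z \<in> N \<longleftrightarrow> inverse y * z \<in> N" for z
    using subgr_mult_left[OF nsub_subgr[OF assms] a, of "inverse y * z"] by (simp add: gsimps)
  then show "cosN N x = cosN N y" by (simp add: cosN_def)
qed

lemma finite_index_of_fun:
  assumes "nsub N" "finite (range f)" "\<And>x y. f x = f y \<Longrightarrow> inverse x * y \<in> N" shows "finite_index N"
proof -
  have "cosN N x = cosN N (inv_into UNIV f (f x))" for x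
    unfolding cosN_eq[OF assms(1)] by (rule assms(3)) (simp add: f_inv_into_f)
  then have "range (cosN N) \<subseteq> (\<lambda>z. cosN N (inv_into UNIV f z)) ` range f" by auto
  moreover have "finite ((\<lambda>z. cosN N (inv_into UNIV f z)) ` range f)" by (rule finite_imageI[OF assms(2)])
  ultimately have "finite (range (cosN N))" by (rule finite_subset)
  then show ?thesis using assms(1) by (simp add: finite_index_def)
qed

lemma finite_index_Int: assumes "finite_index A" "finite_index B" shows "finite_index (A \<inter> B)"
proof (rule finite_index_of_fun)
  have n: "nsub A" "nsub B" using assms by (auto simp: finite_index_def)
  then show "nsub (A \<inter> B)" by (rule nsub_Int)
  have "range (\<lambda>x. (cosN A x, cosN B x)) \<subseteq> range (cosN A) \<times> range (cosN B)" by auto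
  moreover have "finite (range (cosN A) \<times> range (cosN B))" using assms by (simp add: finite_index_def)
  ultimately show "finite (range (\<lambda>x. (cosN A x, cosN B x)))" by (rule finite_subset)
  show "inverse x * y \<in> A \<inter> B" if "(cosN A x, cosN B x) = (cosN A y, cosN B y)" for x y
    using that n by (simp add: cosN_eq)
qed

lemma finite_index_UNIV: "finite_index UNIV"
proof -
  have "nsub UNIV" by (simp add: nsub_def subgr_def)
  moreover have "range (cosN UNIV) \<subseteq> {UNIV}" by (auto simp: cosN_def)
  ultimately show ?thesis using finite_subset unfolding finite_index_def by blast
qed

lemma finite_index_power: assumes "finite_index N" shows "\<exists>k>0. w ^ k \<in> N"
proof -
  have "finite (range (\<lambda>i. cosN N (w ^ i)))"
    by (rule finite_subset[of _ "range (cosN N)"]) (use assms in \<open>auto simp: finite_index_def\<close>)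
  then have "\<not> inj (\<lambda>i::nat. cosN N (w ^ i))" using finite_imageD infinite_UNIV_nat by blast
  then obtain i j :: nat where ij: "i < j" "cosN N (w ^ i) = cosN N (w ^ j)"
    unfolding inj_def by (metis linorder_neqE_nat)
  have "w ^ j = w ^ i * w ^ (j - i)" using ij(1) by (simp flip: power_add)
  then have "w ^ (j - i) \<in> N" using ij(2) assms by (simp add: cosN_eq finite_index_def inv_cancel_left)
  then show ?thesis using ij(1) by (intro exI[of _ "j - i"]) simp
qed

section \<open>Orders of elements in finite quotients\<close>

definition ordN :: "'a::grp set \<Rightarrow> 'a \<Rightarrow> nat" where "ordN N w = (LEAST k. k > 0 \<and> w ^ k \<in> N)"

lemma ordN: assumes "finite_index N" shows "ordN N w > 0" "w ^ ordN N w \<in> N"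
  using LeastI_ex[OF finite_index_power[OF assms, of w]] by (auto simp: ordN_def)

lemma ordN_le: "k > 0 \<Longrightarrow> w ^ k \<in> N \<Longrightarrow> ordN N w \<le> k" unfolding ordN_def by (rule Least_le) simp

lemma ordN_dvd: assumes "finite_index N" "w ^ k \<in> N" shows "ordN N w dvd k"
proof -
  let ?o = "ordN N w"
  have n: "nsub N" using assms by (simp add: finite_index_def)
  have "w ^ k = (w ^ ?o) ^ (k div ?o) * w ^ (k mod ?o)" by (simp flip: power_mult power_add)
  moreover have "(w ^ ?o) ^ (k div ?o) \<in> N" using subgr_power[OF nsub_subgr[OF n] ordN(2)[OF assms(1)]] .
  ultimately have "w ^ (k mod ?o) \<in> N" using assms(2) subgr_mult_left[OF nsub_subgr[OF n]] by metis
  then have "k mod ?o = 0" using ordN_le[of "k mod ?o" w N] ordN(1)[OF assms(1)] mod_less_divisor[of ?o k]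
    by (meson gr_zeroI leD)
  then show ?thesis by auto
qed

lemma ordN_mono: "finite_index N \<Longrightarrow> finite_index N' \<Longrightarrow> N' \<subseteq> N \<Longrightarrow> ordN N w \<le> ordN N' w"
  using ordN[of N' w] by (intro ordN_le) auto

section \<open>Integral solutions of homogeneous linear systems\<close>

definition lin :: "(('u \<Rightarrow> int) \<Rightarrow> int) \<Rightarrow> bool" where
  "lin l \<longleftrightarrow> (\<forall>a c f g. l (\<lambda>u. a * f u + c * g u) = a * l f + c * l g)"

lemma linD: "lin l \<Longrightarrow> l (\<lambda>u. a * f u + c * g u) = a * l f + c * l g" by (simp add: lin_def)

lemma lin_expand:
  assumes l: "lin l" and "finite U" "\<And>u. u \<notin> U \<Longrightarrow> f u = 0" "\<And>u. u \<in> U \<Longrightarrow> l (\<lambda>x. if x = u then 1 else 0) = 0"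
  shows "l f = 0"
  using assms(2-4)
proof (induction U arbitrary: f)
  case empty
  then have "(\<lambda>u. 0 * f u + 0 * f u) = f" by auto
  then show ?case using linD[OF l, of 0 f 0 f] by simp
next
  case (insert v U)
  define g where "g = f(v := 0)"
  have "f = (\<lambda>u. 1 * g u + f v * (if u = v then 1 else 0))" by (auto simp: g_def)
  then have "l f = 1 * l g + f v * l (\<lambda>x. if x = v then 1 else 0)" using linD[OF l] by metis
  moreover have "l g = 0" by (rule insert.IH) (use insert.prems in \<open>auto simp: g_def\<close>)
  ultimately show ?case using insert.prems(2)[of v] by simp
qed

text \<open>Gaussian elimination by cross-multiplication with the pivot \<open>c\<close> instead of
  division, so that the solution stays integral.\<close>

lemma lin_system:
  assumes "finite J"
  shows "finite U \<Longrightarrow> card J < card U \<Longrightarrow> (\<And>j. j \<in> J \<Longrightarrow> lin (l j)) \<Longrightarrow>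
    \<exists>f::'u \<Rightarrow> int. (\<exists>u\<in>U. f u \<noteq> 0) \<and> (\<forall>u. u \<notin> U \<longrightarrow> f u = 0) \<and> (\<forall>j\<in>J. l j f = 0)"
  using assms
proof (induction J arbitrary: U l)
  case empty
  then obtain u where "u \<in> U" by fastforce
  then show ?case by (intro exI[of _ "\<lambda>x. if x = u then 1 else 0"]) auto
next
  case (insert j J)
  let ?e = "\<lambda>u x. if x = u then 1 else 0 :: int"
  note lj = insert.prems(3)[of j, simplified]
  show ?case
  proof (cases "\<exists>u0\<in>U. l j (?e u0) \<noteq> 0")
    case False
    have "card J < card U" using insert by simp
    then obtain f where f: "\<exists>u\<in>U. f u \<noteq> 0" "\<forall>u. u \<notin> U \<longrightarrow> f u = 0" "\<forall>i\<in>J. l i f = 0"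
      using insert.IH[of U l] insert.prems by auto
    moreover have "l j f = 0" using lin_expand[OF lj insert.prems(1)] f(2) False by blast
    ultimately show ?thesis by auto
  next
    case True
    then obtain u0 where u0: "u0 \<in> U" "l j (?e u0) \<noteq> 0" by blast
    define c where "c = l j (?e u0)"
    \<comment> \<open>Equation \<open>i\<close> evaluated at the combination of \<open>f\<close> and
      the pivot vector that satisfies equation \<open>j\<close>.\<close>
    define m where "m i f = l i (\<lambda>u. c * f u + (- l j f) * ?e u0 u)" for i f
    have m: "m i f = c * l i f + (- l j f) * l i (?e u0)" if "i \<in> J" for i f
      unfolding m_def using insert.prems(3)[of i] that by (intro linD) simp
    have "lin (m i)" if "i \<in> J" for i
      unfolding lin_def
    proof (intro allI)
      fix a b f g
      show "m i (\<lambda>u. a * f u + b * g u) = a * m i f + b * m i g"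
        using linD[OF lj, of a f b g] linD[OF insert.prems(3)[of i], of a f b g] that
        by (simp add: m algebra_simps)
    qed
    moreover have "card J < card (U - {u0})" using insert u0(1) by (simp add: card_Diff_singleton)
    ultimately obtain f where f: "\<exists>u\<in>U - {u0}. f u \<noteq> 0" "\<forall>u. u \<notin> U - {u0} \<longrightarrow> f u = 0" "\<forall>i\<in>J. m i f = 0"
      using insert.IH[of "U - {u0}" m] insert.prems(1) by auto
    define F where "F u = c * f u + (- l j f) * ?e u0 u" for u
    have "l j F = c * l j f + (- l j f) * l j (?e u0)" unfolding F_def by (rule linD[OF lj])
    then have "l j F = 0" by (simp add: c_def)
    moreover have "l i F = 0" if "i \<in> J" for i
    proof -
      have "l i F = m i f" unfolding m_def F_def ..
      then show ?thesis using f(3) that by metis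
    qed
    moreover have "\<exists>u\<in>U. F u \<noteq> 0" using f(1) u0(2) by (auto simp: F_def c_def)
    moreover have "F u = 0" if "u \<notin> U" for u using f(2) that u0(1) by (auto simp: F_def)
    ultimately show ?thesis by (intro exI[of _ F]) auto
  qed
qed

definition orb :: "'a::grp set \<Rightarrow> 'a \<Rightarrow> 'a \<Rightarrow> 'a set set" where "orb N w x = range (\<lambda>i::int. cosN N (w powi i * x))"

text \<open>Since \<open>N\<close> is normal, left multiplication by \<open>w\<close> permutes its
  cosets in cycles that all have length \<open>ordN N w\<close>.\<close>

lemma orb_card: assumes N: "finite_index N" shows "card (range (orb N w)) * ordN N w = card (range (cosN N))"
proof -
  let ?o = "ordN N w"
  have n: "nsub N" and fin: "finite (range (cosN N))" using N by (auto simp: finite_index_def)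
  have same: "orb N w x = orb N w y" if "cosN N (w powi i * x) = cosN N (w powi j * y)" for x y i j
  proof -
    have le: "orb N w x \<subseteq> orb N w y" if c: "cosN N (w powi i * x) = cosN N (w powi j * y)" for x y i j
    proof
      fix c assume "c \<in> orb N w x"
      then obtain k where k: "c = cosN N (w powi k * x)" by (auto simp: orb_def)
      have "inverse (w powi (k - i) * (w powi i * x)) * (w powi (k - i) * (w powi j * y)) \<in> N"
        using c by (simp add: cosN_eq[OF n] gsimps)
      then have "cosN N (w powi (k - i) * (w powi i * x)) = cosN N (w powi (k - i) * (w powi j * y))"
        by (simp add: cosN_eq[OF n])
      then have "c = cosN N (w powi (k - i + j) * y)" unfolding k powi_add by (simp add: powi_add flip: mult.assoc) (metis powi_add diff_add_cancel)
      then show "c \<in> orb N w y" by (auto simp: orb_def)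
    qed
    show ?thesis using le[OF that] le[OF that[symmetric]] by blast
  qed
  have card1: "card (orb N w x) = ?o" for x
  proof -
    have key: "cosN N (w ^ a * x) = cosN N (w ^ b * x) \<longleftrightarrow> ?o dvd (b - a)" if "a \<le> b" for a b
    proof -
      have "inverse (w ^ a * x) * (w ^ b * x) = inverse x * w ^ (b - a) * x"
      proof -
        have "w ^ b = w ^ a * w ^ (b - a)" using that by (simp flip: power_add)
        then show ?thesis by (simp add: gsimps)
      qed
      moreover have "inverse x * w ^ (b - a) * x \<in> N \<longleftrightarrow> w ^ (b - a) \<in> N"
        using nsubD(4)[OF n, of "inverse x * w ^ (b - a) * x" x] nsubD(5)[OF n, of "w ^ (b - a)" x] by (auto simp: gsimps)
      moreover have "w ^ (b - a) \<in> N \<longleftrightarrow> ?o dvd (b - a)"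
        using ordN_dvd[OF N] subgr_power[OF nsub_subgr[OF n] ordN(2)[OF N]] by (auto simp: dvd_def power_mult)
      ultimately show ?thesis by (simp add: cosN_eq[OF n])
    qed
    have "orb N w x = (\<lambda>i. cosN N (w ^ i * x)) ` {..<?o}"
    proof
      show "(\<lambda>i. cosN N (w ^ i * x)) ` {..<?o} \<subseteq> orb N w x"
      proof
        fix c assume "c \<in> (\<lambda>i. cosN N (w ^ i * x)) ` {..<?o}"
        then obtain i where "c = cosN N (w powi int i * x)" unfolding powi_nat by blast
        then show "c \<in> orb N w x" unfolding orb_def by blast
      qed
      show "orb N w x \<subseteq> (\<lambda>i. cosN N (w ^ i * x)) ` {..<?o}"
      proof
        fix c assume "c \<in> orb N w x"
        then obtain k where k: "c = cosN N (w powi k * x)" by (auto simp: orb_def)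
        define i where "i = nat (k mod int ?o)"
        have i: "int i = k mod int ?o" "i < ?o" using ordN(1)[OF N, of w] by (auto simp: i_def nat_less_iff)
        have "w powi k = (w ^ ?o) powi (k div int ?o) * w ^ i"
        proof -
          have "w ^ i = w powi (k mod int ?o)" using i(1) powi_nat by metis
          moreover have "(w ^ ?o) powi (k div int ?o) = w powi (int ?o * (k div int ?o))" by (simp add: powi_power)
          moreover have "w powi k = w powi (int ?o * (k div int ?o) + k mod int ?o)" by simp
          ultimately show ?thesis unfolding powi_add by simp
        qed
        moreover have "(w ^ ?o) powi (k div int ?o) \<in> N" by (rule subgr_powi[OF nsub_subgr[OF n] ordN(2)[OF N]])
        then have "inverse (w ^ i * x) * (w ^ ?o) powi (k div int ?o) * (w ^ i * x) \<in> N" by (rule nsubD(5)[OF n])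
        ultimately have "cosN N (w ^ i * x) = c" unfolding k by (simp add: cosN_eq[OF n] mult.assoc)
        then show "c \<in> (\<lambda>i. cosN N (w ^ i * x)) ` {..<?o}" using i(2) by auto
      qed
    qed
    moreover have "inj_on (\<lambda>i. cosN N (w ^ i * x)) {..<?o}"
    proof (rule linorder_inj_onI)
      fix a b assume ab: "a < b" "a \<in> {..<?o}" "b \<in> {..<?o}"
      show "cosN N (w ^ a * x) \<noteq> cosN N (w ^ b * x)"
      proof
        assume "cosN N (w ^ a * x) = cosN N (w ^ b * x)"
        then have "?o dvd (b - a)" using key[of a b] ab by simp
        then show False using ab nat_dvd_not_less[of "b - a" ?o] by (meson less_imp_diff_less lessThan_iff zero_less_diff)
      qed
    qed auto
    ultimately show ?thesis by (simp add: card_image)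
  qed
  have U: "\<Union> (range (orb N w)) = range (cosN N)"
  proof
    show "range (cosN N) \<subseteq> \<Union> (range (orb N w))"
    proof
      fix c assume "c \<in> range (cosN N)"
      then obtain x where "c = cosN N (w powi 0 * x)" by auto
      then show "c \<in> \<Union> (range (orb N w))" unfolding orb_def by blast
    qed
  qed (auto simp: orb_def)
  have "finite (range (orb N w))"
    by (rule finite_subset[of _ "Pow (range (cosN N))"]) (use fin in \<open>auto simp: orb_def\<close>)
  moreover have "c1 \<inter> c2 = {}" if c12: "c1 \<in> range (orb N w)" "c2 \<in> range (orb N w)" "c1 \<noteq> c2" for c1 c2
  proof (rule ccontr)
    assume "c1 \<inter> c2 \<noteq> {}"
    then obtain c where c: "c \<in> c1" "c \<in> c2" by blast
    obtain x y where xy: "c1 = orb N w x" "c2 = orb N w y" using c12 by blast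
    obtain i j where "c = cosN N (w powi i * x)" "c = cosN N (w powi j * y)" using c unfolding xy orb_def by blast
    then show False using same[of i x j y] c12(3) xy by metis
  qed
  ultimately have "?o * card (range (orb N w)) = card (\<Union> (range (orb N w)))"
    using U fin card1 by (intro card_partition) auto
  then show ?thesis using U by (simp add: mult.commute)
qed

text \<open>Comparing the derivatives of \<open>w ^ k * w\<close> and \<open>w * w ^ k\<close> gives
  invariance under \<open>w\<close>. So the vanishing of this derivative is one condition per orbit
  of \<open>w\<close>, not one per coset.\<close>

lemma der_power_invariant:
  assumes "nder N \<phi>" "w ^ k \<in> N" shows "der \<phi> (w ^ k) (w powi i * x) = der \<phi> (w ^ k) x"
proof -
  interpret nder N \<phi> by fact
  have "der \<phi> (w ^ k * w) y = der \<phi> (w * w ^ k) y" for y by (simp add: power_commutes)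
  then have s: "der \<phi> (w ^ k) (inverse w * y) = der \<phi> (w ^ k) y" for y
    using der_N_mult[OF assms(2), of w y] by (simp add: der_mult)
  show ?thesis
  proof (induction i rule: int_induct[where k=0])
    case base show ?case by simp
  next
    case (step1 i)
    have "w powi (i + 1) = w * w powi i" using powi_add[of w 1 i] by (simp add: add.commute)
    then show ?case using step1 s[of "w * (w powi i * x)"] by (simp add: gsimps)
  next
    case (step2 i)
    have "w powi (i - 1) = inverse w * w powi i" using powi_add[of w "-1" i] powi_neg[of w 1] by (simp add: add.commute)
    then show ?case using step2 s[of "w powi i * x"] by (simp add: mult.assoc)
  qed
qed

definition phi :: "fg set \<Rightarrow> (bool \<times> fg set \<Rightarrow> int) \<Rightarrow> bool \<Rightarrow> fg \<Rightarrow> int" where "phi N f b x = f (b, cosN N x)"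

lemma nder_phi: "nsub N \<Longrightarrow> nder N (phi N f)"
proof
  fix b assume n: "nsub N"
  have "cosN N (x * n) = cosN N x" if "n \<in> N" for x n
    using cosN_eq[OF n, of x "x * n"] that by (simp add: inv_cancel_left)
  then show "ninv N (phi N f b)" by (simp add: ninv_def phi_def)
qed simp

text \<open>Each relator \<open>w ^ ordN N w\<close> imposes one linear condition per orbit of \<open>w\<close> on the finite quotient;
  a further condition per coset excludes the derivations that vanish on \<open>N\<close>.\<close>

lemma ex_derivation:
  assumes N: "finite_index N" and L: "(\<Sum>w\<leftarrow>L. 1 / real (ordN N w)) < 1"
  shows "\<exists>\<phi>. nder N \<phi> \<and> (\<forall>w\<in>set L. \<forall>x. der \<phi> (w ^ ordN N w) x = 0) \<and> (\<exists>n\<in>N. \<exists>x. der \<phi> n x \<noteq> 0)"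
proof -
  have n: "nsub N" and fin: "finite (range (cosN N))" using N by (auto simp: finite_index_def)
  define C where "C = range (cosN N)"
  define O' where "O' k = range (orb N (L ! k))" for k
  define J1 where "J1 = (SIGMA k:{..<length L}. O' k)"
  define rO where "rO k X = (SOME x. orb N (L ! k) x = X)" for k X
  define rC where "rC c = (SOME x. cosN N x = c)" for c
  define l where "l j f = (case j of Inl (k, X) \<Rightarrow> der (phi N f) ((L ! k) ^ ordN N (L ! k)) (rO k X) | Inr c \<Rightarrow> der (phi N f) (rC c) 1)"
    for j :: "(nat \<times> fg set set) + fg set" and f
  have q: "card C > 0" "finite C" using fin by (auto simp: C_def card_gt_0_iff)
  have finO: "finite (O' k)" for k
    unfolding O'_def by (rule finite_subset[of _ "Pow C"]) (use q in \<open>auto simp: C_def orb_def\<close>)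
  have cardO: "real (card (O' k)) = real (card C) * (1 / real (ordN N (L ! k)))" for k
  proof -
    have "real (card (O' k)) * real (ordN N (L ! k)) = real (card C)"
      unfolding O'_def C_def of_nat_mult[symmetric] orb_card[OF N] ..
    then show ?thesis using ordN(1)[OF N, of "L ! k"] by (simp add: field_simps)
  qed
  have "real (card J1) = (\<Sum>k<length L. real (card (O' k)))" unfolding J1_def using finO by (simp add: card_SigmaI)
  also have "\<dots> = real (card C) * (\<Sum>k<length L. 1 / real (ordN N (L ! k)))" by (simp add: cardO sum_distrib_left)
  also have "(\<Sum>k<length L. 1 / real (ordN N (L ! k))) = (\<Sum>w\<leftarrow>L. 1 / real (ordN N w))"
    by (simp add: sum_list_sum_nth atLeast0LessThan)
  also have "real (card C) * (\<Sum>w\<leftarrow>L. 1 / real (ordN N w)) < real (card C) * 1"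
    using L q by (intro mult_strict_left_mono) auto
  finally have J1: "card J1 < card C" by simp
  have finJ: "finite (J1 <+> C)" using finO q by (auto simp: J1_def)
  \<comment> \<open>There are \<open>2 * card C\<close> unknowns, one for each generator and coset;
    \<open>card J1 < card C\<close> leaves room for the \<open>card C\<close> conditions at coset
    representatives.\<close>
  have cardJ: "card (J1 <+> C) < card (UNIV \<times> C :: (bool \<times> fg set) set)"
    using J1 q finO by (simp add: card_Plus J1_def card_cartesian_product card_UNIV_bool)
  have phi_lin: "phi N (\<lambda>u. a * f u + c * g u) = (\<lambda>b x. a * phi N f b x + c * phi N g b x)" for a c f g
    by (simp add: phi_def fun_eq_iff)
  have "lin (l j)" for j unfolding lin_def l_def by (auto simp: phi_lin der_linear split: sum.split prod.split)
  then obtain f where f: "\<exists>u\<in>UNIV \<times> C. f u \<noteq> 0" "\<forall>j\<in>J1 <+> C. l j f = 0"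
    using lin_system[OF finJ _ cardJ, of l] q by auto
  interpret nder N "phi N f" by (rule nder_phi[OF n])
  have rel: "der (phi N f) (w ^ ordN N w) x = 0" if w: "w \<in> set L" for w x
  proof -
    obtain k where k: "k < length L" "L ! k = w" using w by (auto simp: in_set_conv_nth)
    define y where "y = rO k (orb N w x)"
    have y: "orb N w y = orb N w x" unfolding y_def rO_def k(2) by (rule someI) simp
    have "Inl (k, orb N w x) \<in> J1 <+> C" using k by (auto simp: J1_def O'_def)
    then have "l (Inl (k, orb N w x)) f = 0" using f(2) by blast
    then have 0: "der (phi N f) (w ^ ordN N w) y = 0" by (simp add: l_def k(2) y_def)
    have "cosN N (w powi 0 * x) \<in> orb N w x" unfolding orb_def by blast
    then have "cosN N x \<in> orb N w y" unfolding y by simp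
    then obtain i where i: "cosN N x = cosN N (w powi i * y)" by (auto simp: orb_def)
    have "x = (w powi i * y) * (inverse (w powi i * y) * x)" by (simp add: gsimps)
    moreover have "inverse (w powi i * y) * x \<in> N" using i[symmetric] by (simp only: cosN_eq[OF n])
    moreover have "ninv N (der (phi N f) (w ^ ordN N w))" using inv by (intro ninv_der)
    ultimately have "der (phi N f) (w ^ ordN N w) x = der (phi N f) (w ^ ordN N w) (w powi i * y)"
      unfolding ninv_def by metis
    then show ?thesis using 0 der_power_invariant[OF nder_phi[OF n] ordN(2)[OF N]] by simp
  qed
  have "\<exists>n\<in>N. \<exists>x. der (phi N f) n x \<noteq> 0"
  proof (rule ccontr)
    assume no: "\<not> ?thesis"
    \<comment> \<open>Vanishing on \<open>N\<close> together with the conditions at representatives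
      spreads to all \<open>g\<close>; the value of a generator at \<open>x\<close> is a difference
      of two such values, so \<open>f\<close> would be 0.\<close>
    have one: "der (phi N f) g 1 = 0" for g
    proof -
      define t where "t = rC (cosN N g)"
      have t: "cosN N t = cosN N g" unfolding t_def rC_def by (rule someI) simp
      have "Inr (cosN N g) \<in> J1 <+> C" by (auto simp: C_def)
      then have "l (Inr (cosN N g)) f = 0" using f(2) by blast
      then have "der (phi N f) t 1 = 0" by (simp add: l_def t_def)
      moreover have "inverse t * g \<in> N" using t by (simp only: cosN_eq[OF n])
      then have "der (phi N f) (inverse t * g) (inverse t * 1) = 0" using no by blast
      ultimately show ?thesis using der_mult[of "phi N f" t "inverse t * g" 1] by (simp add: cancel_inv_left)
    qed
    obtain b x where "phi N f b x \<noteq> 0" using f(1) by (auto simp: C_def phi_def)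
    moreover have "der (phi N f) (gen (b, True)) x = 0"
      using der_mult[of "phi N f" "inverse x" "gen (b, True)" 1] one by (simp add: inv_inv)
    ultimately show False by (simp add: der_gen)
  qed
  then show ?thesis using rel nder_phi[OF n] by blast
qed

lemma finite_index_ker: assumes N: "finite_index N" and d: "nder N \<phi>" and e: "e > 0" shows "finite_index {n \<in> N. \<forall>x. e dvd der \<phi> n x}"
proof -
  interpret nder N \<phi> by fact
  have n: "nsub N" and fin: "finite (range (cosN N))" using N by (auto simp: finite_index_def)
  define rC where "rC c = (SOME x. cosN N x = c)" for c
  have rC: "inverse (rC (cosN N x)) * x \<in> N" for x
  proof -
    have "cosN N (rC (cosN N x)) = cosN N x" unfolding rC_def by (rule someI) simp
    then show ?thesis by (simp only: cosN_eq[OF n])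
  qed
  \<comment> \<open>\<open>u x\<close> is the part of \<open>x\<close> in \<open>N\<close>. The
    coset of \<open>x\<close> and the derivative of \<open>u x\<close> modulo \<open>e\<close>, read
    off at representatives, take finitely many values and determine \<open>x\<close> modulo the
    kernel.\<close>
  define u where "u x = inverse (rC (cosN N x)) * x" for x
  define f where "f x = (cosN N x, restrict (\<lambda>c. der \<phi> (u x) (rC c) mod e) (range (cosN N)))" for x
  show ?thesis
  proof (rule finite_index_of_fun[of _ f])
    show "nsub {n \<in> N. \<forall>x. e dvd der \<phi> n x}" by (rule nsub_ker)
    have "range f \<subseteq> range (cosN N) \<times> (range (cosN N) \<rightarrow>\<^sub>E {0..<e})" using e by (auto simp: f_def)
    then show "finite (range f)" using fin by (meson finite_PiE finite_SigmaI finite_atLeastLessThan_int finite_subset)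
    fix x y assume "f x = f y"
    then have c: "cosN N x = cosN N y" and
      r: "restrict (\<lambda>c. der \<phi> (u x) (rC c) mod e) (range (cosN N)) = restrict (\<lambda>c. der \<phi> (u y) (rC c) mod e) (range (cosN N))"
      by (auto simp: f_def)
    have uN: "u x \<in> N" "u y \<in> N" using rC by (auto simp: u_def)
    have xy: "inverse x * y = inverse (u x) * u y" using c by (simp add: u_def gsimps)
    have "e dvd der \<phi> (inverse x * y) z" for z
    proof -
      have z: "der \<phi> g z = der \<phi> g (rC (cosN N z))" for g
      proof -
        have "z = rC (cosN N z) * (inverse (rC (cosN N z)) * z)" by (simp add: cancel_inv_left)
        moreover have "ninv N (der \<phi> g)" using inv by (intro ninv_der)
        ultimately show ?thesis using rC[of z] unfolding ninv_def by metis
      qed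
      have "der \<phi> (u x) z mod e = der \<phi> (u y) z mod e"
        using fun_cong[OF r, of "cosN N z"] z by simp
      then have "e dvd der \<phi> (u y) z - der \<phi> (u x) z" by (metis mod_eq_dvd_iff)
      moreover have "der \<phi> (inverse (u x) * u y) z = der \<phi> (u y) z - der \<phi> (u x) z"
        using der_N_mult[OF nsubD(3)[OF n uN(1)]] der_N_inverse[OF uN(1)] by simp
      ultimately show ?thesis by (simp add: xy)
    qed
    then show "inverse x * y \<in> {n \<in> N. \<forall>x. e dvd der \<phi> n x}" using c cosN_eq[OF n] by simp
  qed
qed

text \<open>For derivations over any finite quotient, the relators in \<open>R\<close> follow from the finitely many relators \<open>w ^ ordN N' w\<close> with \<open>w\<close> in \<open>L\<close>.\<close>

definition determines :: "fg list \<Rightarrow> fg set \<Rightarrow> fg set \<Rightarrow> bool" where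
  "determines L N R \<longleftrightarrow> (\<forall>N' \<phi>. finite_index N' \<longrightarrow> N' \<subseteq> N \<longrightarrow> R \<subseteq> N' \<longrightarrow> nder N' \<phi> \<longrightarrow>
     (\<forall>w\<in>set L. \<forall>x. der \<phi> (w ^ ordN N' w) x = 0) \<longrightarrow> (\<forall>r\<in>R. \<forall>x. der \<phi> r x = 0))"

lemma determinesI:
  "(\<And>N' \<phi> r x. finite_index N' \<Longrightarrow> N' \<subseteq> N \<Longrightarrow> R \<subseteq> N' \<Longrightarrow> nder N' \<phi> \<Longrightarrow>
     \<forall>w\<in>set L. \<forall>x. der \<phi> (w ^ ordN N' w) x = 0 \<Longrightarrow> r \<in> R \<Longrightarrow> der \<phi> r x = 0) \<Longrightarrow> determines L N R"
  unfolding determines_def by simp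

lemma determinesD:
  "determines L N R \<Longrightarrow> finite_index N' \<Longrightarrow> N' \<subseteq> N \<Longrightarrow> R \<subseteq> N' \<Longrightarrow> nder N' \<phi> \<Longrightarrow>
     \<forall>w\<in>set L. \<forall>x. der \<phi> (w ^ ordN N' w) x = 0 \<Longrightarrow> r \<in> R \<Longrightarrow> der \<phi> r x = 0"
  unfolding determines_def by simp

text \<open>The invariant of the construction. By \<open>ex_derivation\<close> it provides a
  derivation over a finite quotient that kills the relators but not all of \<open>N\<close>;
  \<open>determines\<close> says that \<open>R\<close> imposes no conditions beyond those of the
  finite list \<open>L\<close>, even over smaller subgroups.\<close>

definition rich :: "fg set \<Rightarrow> bool" where
  "rich R \<longleftrightarrow> nsub R \<and> (\<exists>N L. finite_index N \<and> R \<subseteq> N \<and> (\<Sum>w\<leftarrow>L. 1 / real (ordN N w)) < 1 \<and> determines L N R)"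

lemma richI:
  "nsub R \<Longrightarrow> finite_index N \<Longrightarrow> R \<subseteq> N \<Longrightarrow> (\<Sum>w\<leftarrow>L. 1 / real (ordN N w)) < 1 \<Longrightarrow> determines L N R \<Longrightarrow> rich R"
  unfolding rich_def by blast

lemma richE:
  assumes "rich R"
  obtains N L where "finite_index N" "R \<subseteq> N" "(\<Sum>w\<leftarrow>L. 1 / real (ordN N w)) < 1" "determines L N R"
  using assms unfolding rich_def by blast

lemma rich_one: "rich {1}"
  by (rule richI[of _ UNIV "[]"]) (auto simp: finite_index_UNIV nsub_one der_one intro!: determinesI)

lemma rich_derivation:
  assumes "rich R"
  obtains N \<phi> y where "finite_index N" "R \<subseteq> N" "nder N \<phi>" "\<And>r x. r \<in> R \<Longrightarrow> der \<phi> r x = 0" "y \<in> N" "\<exists>x. der \<phi> y x \<noteq> 0"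
proof -
  obtain N L where N: "finite_index N" "R \<subseteq> N" "(\<Sum>w\<leftarrow>L. 1 / real (ordN N w)) < 1"
    and *: "determines L N R"
    using assms by (rule richE)
  obtain \<phi> where \<phi>: "nder N \<phi>" "\<forall>w\<in>set L. \<forall>x. der \<phi> (w ^ ordN N w) x = 0" "\<exists>n\<in>N. \<exists>x. der \<phi> n x \<noteq> 0"
    using ex_derivation[OF N(1,3)] by blast
  have "der \<phi> r x = 0" if "r \<in> R" for r x using determinesD[OF * N(1) subset_refl N(2) \<phi>(1,2) that] .
  then show thesis using that[OF N(1,2) \<phi>(1)] \<phi>(3) by blast
qed

lemma der_zero_nclos:
  assumes d: "nder N \<phi>" and X: "insert w R \<subseteq> N" and z: "\<And>r x. r \<in> insert w R \<Longrightarrow> der \<phi> r x = 0"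
    and r: "r \<in> nclos (insert w R)"
  shows "der \<phi> r x = 0"
proof -
  interpret nder N \<phi> by fact
  have "nclos (insert w R) \<subseteq> {n \<in> N. \<forall>x. 0 dvd der \<phi> n x}"
    by (rule nclos_least[OF nsub_ker]) (use X z in auto)
  then show ?thesis using r by auto
qed

text \<open>If \<open>w\<close> has bounded order in the finite quotients, a high power of \<open>w\<close> is invisible to all derivations;
  otherwise it is a relator of large order in some finite quotient.\<close>

lemma rich_step:
  assumes R: "rich R" shows "\<exists>q>0. \<forall>m>0. q dvd m \<longrightarrow> rich (nclos (insert (w ^ m) R))"
proof -
  obtain N L where N: "finite_index N" "R \<subseteq> N" "(\<Sum>w\<leftarrow>L. 1 / real (ordN N w)) < 1"
    and *: "determines L N R"
    using R by (rule richE)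
  show ?thesis
  proof (cases "\<exists>q>0. \<forall>N'. finite_index N' \<longrightarrow> R \<subseteq> N' \<longrightarrow> w ^ q \<in> N'")
    case True
    then obtain q where q: "q > 0" "\<And>N'. finite_index N' \<Longrightarrow> R \<subseteq> N' \<Longrightarrow> w ^ q \<in> N'" by blast
    have "rich (nclos (insert (w ^ m) R))" if m: "q dvd m" for m
    proof -
      define R1 where "R1 = nclos (insert (w ^ m) R)"
      have wm: "w ^ m \<in> N'" if "finite_index N'" "R \<subseteq> N'" for N'
        using q(2)[OF that] m that(1) subgr_power[of N' "w ^ q"] by (auto simp: dvd_def power_mult finite_index_def nsub_subgr)
      have "R1 \<subseteq> N" unfolding R1_def using N wm by (intro nclos_least) (auto simp: finite_index_def)
      moreover have "determines L N R1"
      proof (rule determinesI)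
        fix N' \<phi> r x
        assume N': "finite_index N'" "N' \<subseteq> N" "R1 \<subseteq> N'" and d: "nder N' \<phi>" and L: "\<forall>w\<in>set L. \<forall>x. der \<phi> (w ^ ordN N' w) x = 0" and r: "r \<in> R1"
        interpret nder N' \<phi> by fact
        have RN': "R \<subseteq> N'" using N'(3) nclos_incl[of "insert (w ^ m) R"] unfolding R1_def by blast
        have z: "der \<phi> r x = 0" if "r \<in> R" for r x using determinesD[OF * N'(1,2) RN' d L that] .
        have "der \<phi> (w ^ q) x = 0" for x
        proof -
          \<comment> \<open>The kernel modulo \<open>e\<close> contains \<open>R\<close> and has
            finite index, so \<open>w ^ q\<close> lies in it; as \<open>e\<close> exceeds the
            absolute value in question, that value is 0.\<close>
          define e where "e = \<bar>der \<phi> (w ^ q) x\<bar> + 1"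
          have "R \<subseteq> {n \<in> N'. \<forall>x. e dvd der \<phi> n x}" using RN' z by auto
          then have "w ^ q \<in> {n \<in> N'. \<forall>x. e dvd der \<phi> n x}" by (intro q(2) finite_index_ker[OF N'(1) d]) (auto simp: e_def)
          then have "e dvd der \<phi> (w ^ q) x" by blast
          then show ?thesis using zdvd_imp_le[of e "\<bar>der \<phi> (w ^ q) x\<bar>"] unfolding e_def by fastforce
        qed
        moreover obtain i where "m = q * i" using m by (auto simp: dvd_def)
        ultimately have "der \<phi> (w ^ m) x = 0" for x using der_N_power[OF q(2)[OF N'(1) RN']] by (simp add: power_mult)
        then show "der \<phi> r x = 0" using der_zero_nclos[OF d, of "w ^ m" R r x] wm[OF N'(1) RN'] RN' z r unfolding R1_def by blast
      qed
      ultimately show ?thesis unfolding R1_def[symmetric]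
        using N(1,3) by (intro richI[of R1 N L]) (simp_all add: R1_def nsub_nclos)
    qed
    then show ?thesis using q(1) by blast
  next
    case False
    define s where "s = 1 - (\<Sum>w\<leftarrow>L. 1 / real (ordN N w))"
    obtain t :: nat where t: "t > 0" "1 / real t < s" using N(3) reals_Archimedean[of s] unfolding s_def
      by (metis diff_gt_0_iff_gt inverse_eq_divide of_nat_0_less_iff zero_less_Suc)
    \<comment> \<open>Every order up to \<open>t\<close> divides \<open>fact t\<close>, so the order
      of \<open>w\<close> modulo \<open>N0\<close> exceeds \<open>t\<close>.\<close>
    obtain N0 where N0: "finite_index N0" "R \<subseteq> N0" "w ^ fact t \<notin> N0" using False fact_gt_zero[of t] by meson
    have big: "t < ordN N0 w"
    proof (rule ccontr)
      assume "\<not> ?thesis"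
      then have "ordN N0 w dvd fact t" using ordN(1)[OF N0(1), of w] by (intro dvd_fact) auto
      then have "w ^ fact t \<in> N0"
        using ordN(2)[OF N0(1), of w] N0(1) subgr_power[of N0] by (auto simp: dvd_def power_mult finite_index_def nsub_subgr)
      then show False using N0(3) by blast
    qed
    define N1 where "N1 = N \<inter> N0"
    have N1: "finite_index N1" "R \<subseteq> N1" "N1 \<subseteq> N" "N1 \<subseteq> N0" using N N0 finite_index_Int by (auto simp: N1_def)
    have "rich (nclos (insert (w ^ m) R))" if m: "m > 0" "ordN N1 w dvd m" for m
    proof -
      define R1 where "R1 = nclos (insert (w ^ m) R)"
      have "w ^ m \<in> N1"
        using m(2) ordN(2)[OF N1(1), of w] N1(1) subgr_power[of N1] by (auto simp: dvd_def power_mult finite_index_def nsub_subgr)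
      then have R1N: "R1 \<subseteq> N1" unfolding R1_def using N1 by (intro nclos_least) (auto simp: finite_index_def)
      have "(\<Sum>w\<leftarrow>L. 1 / real (ordN N1 w)) \<le> (\<Sum>w\<leftarrow>L. 1 / real (ordN N w))"
        using ordN_mono[OF N(1) N1(1,3)] ordN(1)[OF N(1)] by (intro sum_list_mono frac_le) auto
      moreover have "1 / real (ordN N1 w) \<le> 1 / real t"
        using ordN_mono[OF N0(1) N1(1,4), of w] big t(1) by (intro frac_le) auto
      ultimately have sum: "(\<Sum>w\<leftarrow>w # L. 1 / real (ordN N1 w)) < 1" using t(2) unfolding s_def by simp
      have "determines (w # L) N1 R1"
      proof (rule determinesI)
        fix N' \<phi> r x
        assume N': "finite_index N'" "N' \<subseteq> N1" "R1 \<subseteq> N'" and d: "nder N' \<phi>" and L: "\<forall>w\<in>set (w # L). \<forall>x. der \<phi> (w ^ ordN N' w) x = 0" and r: "r \<in> R1"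
        interpret nder N' \<phi> by fact
        have ins: "insert (w ^ m) R \<subseteq> N'" using N'(3) nclos_incl[of "insert (w ^ m) R"] unfolding R1_def by blast
        have "N' \<subseteq> N" "R \<subseteq> N'" using N'(2) N1(3) ins by auto
        then have z: "der \<phi> r x = 0" if "r \<in> R" for r x using determinesD[OF * N'(1) _ _ d _ that] L by simp
        obtain i where "m = ordN N' w * i" using ordN_dvd[OF N'(1), of w m] ins by (auto simp: dvd_def)
        then have "der \<phi> (w ^ m) x = 0" for x using der_N_power[OF ordN(2)[OF N'(1)]] L by (simp add: power_mult)
        then show "der \<phi> r x = 0" using der_zero_nclos[OF d ins _ r[unfolded R1_def]] z by blast
      qed
      then show ?thesis unfolding R1_def[symmetric]
        using N1(1) R1N sum nsub_nclos[of "insert (w ^ m) R"] by (intro richI[of R1 N1 "w # L"]) (simp_all add: R1_def)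
    qed
    then show ?thesis using ordN(1)[OF N1(1), of w] by blast
  qed
qed

section \<open>Stable lengths modulo kernels of derivations\<close>

abbreviation W :: "fg set \<Rightarrow> fg \<Rightarrow> nat" where "W A x \<equiv> wl gens A x"

lemma W_lenspace: "nsub A \<Longrightarrow> lenspace (wl gens A)"
  by (rule wl_lenspace[OF genset_gens])

lemma W_le_length: "nsub A \<Longrightarrow> W A x \<le> length (word x)"
  using wl_mono[OF genset_gens nsub_one, of A x] nsubD(1) by (auto simp: wl_gens)

lemma W_rep:
  assumes "nsub A"
  obtains v where "length (word v) = W A x" "inverse x * v \<in> A"
proof -
  obtain v where v: "v \<in> prods gens (W A x)" "inverse x * v \<in> A" using wl_attained[OF genset_gens assms] .
  have "W A x = W A v" using wl_cong[OF assms v(2)] .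
  then have "length (word v) = W A x" using prods_length[OF v(1)] W_le_length[OF assms, of v] by simp
  then show thesis using that v by blast
qed

text \<open>Shortest representatives of the two cosets of \<open>x\<close> differ by an element of
  \<open>A'\<close> of length at most \<open>b\<close>, which then lies in \<open>A\<close>.\<close>

lemma W_agree:
  assumes A: "nsub A" "nsub A'" "A \<subseteq> A'" and short: "\<And>h. h \<in> A' \<Longrightarrow> length (word h) \<le> b \<Longrightarrow> h \<in> A"
    and x: "2 * W A x \<le> b"
  shows "W A' x = W A x"
proof -
  have le: "W A' x \<le> W A x" by (rule wl_mono[OF genset_gens A(1,3)])
  obtain v where v: "length (word v) = W A' x" "inverse x * v \<in> A'" using W_rep[OF A(2)] .
  obtain u where u: "length (word u) = W A x" "inverse x * u \<in> A" using W_rep[OF A(1)] .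
  have "inverse v * u = inverse (inverse x * v) * (inverse x * u)" by (simp add: gsimps)
  then have "inverse v * u \<in> A'" using nsubD(2,3)[OF A(2)] v(2) u(2) A(3) by auto
  moreover have "length (word (inverse v * u)) \<le> b"
  proof -
    interpret l: lenspace "wl gens {1}" by (rule W_lenspace[OF nsub_one])
    have "W {1} (inverse v * u) \<le> W {1} v + W {1} u" using l.len_mult[of "inverse v" u] by simp
    then show ?thesis using v(1) u(1) le x unfolding wl_gens by linarith
  qed
  ultimately have "inverse v * u \<in> A" by (rule short)
  moreover have "inverse x * v = inverse x * u * inverse (inverse v * u)" by (simp add: gsimps)
  ultimately have "inverse x * v \<in> A" using nsubD(2,3)[OF A(1)] u(2) by auto
  then have "W A x = W A v" by (rule wl_cong[OF A(1)])
  then show ?thesis using W_le_length[OF A(1), of v] v(1) le by simp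
qed

section \<open>Finite-index subgroups and hyperbolicity\<close>

lemma finite_index_transversal:
  assumes "finite_index N"
  obtains T where "finite T" "\<And>g. \<exists>h\<in>N. \<exists>t\<in>T. g = h * t"
proof -
  have n: "nsub N" and fin: "finite (range (cosN N))" using assms by (auto simp: finite_index_def)
  define r where "r c = (SOME x. cosN N x = c)" for c
  have "\<exists>h\<in>N. \<exists>t\<in>r ` range (cosN N). g = h * t" for g
  proof -
    have "cosN N (r (cosN N g)) = cosN N g" unfolding r_def by (rule someI) simp
    then have "inverse (r (cosN N g)) * g \<in> N" by (simp only: cosN_eq[OF n])
    then have "r (cosN N g) * (inverse (r (cosN N g)) * g) * inverse (r (cosN N g)) \<in> N" by (rule nsubD(4)[OF n])
    then have "g * inverse (r (cosN N g)) \<in> N" by (simp add: gsimps)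
    then show ?thesis by (intro bexI[of _ "g * inverse (r (cosN N g))"] bexI[of _ "r (cosN N g)"]) (auto simp: gsimps)
  qed
  then show thesis using that finite_imageI[OF fin] by blast
qed

text \<open>\<open>R \<inter> M\<close> has finite index in \<open>R\<close>, so elements of
  \<open>R\<close> have bounded length modulo \<open>R \<inter> M\<close>, and the two lengths
  differ by at most this bound everywhere.\<close>

lemma hyperbolic_finite_index:
  assumes R: "nsub R" and M: "finite_index M" and hyp: "hyperbolic_mod gens R"
  shows "hyperbolic_mod gens (R \<inter> M)"
proof -
  have n: "nsub M" "nsub (R \<inter> M)" using M R nsub_Int by (auto simp: finite_index_def)
  interpret l: lenspace "wl gens R" by (rule W_lenspace[OF R])
  interpret k: lenspace "wl gens (R \<inter> M)" by (rule W_lenspace[OF n(2)])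
  obtain T where T: "finite T" "\<And>g. \<exists>h\<in>M. \<exists>t\<in>T. g = h * t" using finite_index_transversal[OF M] by metis
  \<comment> \<open>One element of \<open>R\<close> from each coset of \<open>M\<close> that meets
    \<open>R\<close>; for the other cosets the arbitrary choice can only increase
    \<open>c\<close>.\<close>
  define T' where "T' = (\<lambda>t. SOME r. r \<in> R \<and> (\<exists>h\<in>M. r = h * t)) ` T"
  define c where "c = Max (insert 0 ((\<lambda>x. length (word x)) ` T'))"
  have bound: "W (R \<inter> M) r \<le> c" if "r \<in> R" for r
  proof -
    obtain h t where ht: "h \<in> M" "t \<in> T" "r = h * t" using T(2) by blast
    define s where "s = (SOME r. r \<in> R \<and> (\<exists>h\<in>M. r = h * t))"
    have "r \<in> R \<and> (\<exists>h\<in>M. r = h * t)" using that ht(1,3) by blast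
    then have s: "s \<in> R \<and> (\<exists>h\<in>M. s = h * t)" unfolding s_def by (rule someI)
    then obtain h' where h': "h' \<in> M" "s = h' * t" by blast
    have "inverse r * s \<in> R" using s that nsubD(2,3)[OF R] by blast
    moreover have "inverse r * s = inverse t * (inverse h * h') * t" using ht h' by (simp add: gsimps)
    then have "inverse r * s \<in> M" using ht(1) h'(1) nsubD(2,3,5)[OF n(1)] by metis
    ultimately have "W (R \<inter> M) r = W (R \<inter> M) s" using wl_cong[OF n(2)] by blast
    also have "\<dots> \<le> length (word s)" by (rule W_le_length[OF n(2)])
    also have "s \<in> T'" unfolding T'_def s_def using ht(2) by blast
    then have "length (word s) \<le> c" unfolding c_def using T(1) by (intro Max_ge) (auto simp: T'_def)
    finally show ?thesis .
  qed
  have up: "W (R \<inter> M) x \<le> W R x + c" for x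
  proof -
    obtain v where v: "length (word v) = W R x" "inverse x * v \<in> R" using W_rep[OF R] .
    have "x = v * inverse (inverse x * v)" by (simp add: gsimps)
    then have "W (R \<inter> M) x \<le> W (R \<inter> M) v + W (R \<inter> M) (inverse x * v)" using k.len_mult k.len_inv by metis
    then show ?thesis using bound[OF v(2)] W_le_length[OF n(2), of v] v(1) by simp
  qed
  have low: "W R x \<le> W (R \<inter> M) x" for x by (rule wl_mono[OF genset_gens n(2)]) auto
  obtain \<delta> where \<delta>: "l.hyp4 \<delta>" using hyp by (auto simp: hyperbolic_mod_def)
  have d: "l.dd x y \<le> k.dd x y" "k.dd x y \<le> l.dd x y + int c" for x y
    using low[of "inverse x * y"] up[of "inverse x * y"] unfolding l.dd_def k.dd_def by linarith+
  have "k.hyp4 (\<delta> + 3 * int c)"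
    unfolding k.hyp4_def
  proof (intro allI)
    fix p x y z
    have "min (l.gp p x y) (l.gp p y z) - \<delta> \<le> l.gp p x z" using \<delta> unfolding l.hyp4_def by blast
    then show "min (k.gp p x y) (k.gp p y z) - (\<delta> + 3 * int c) \<le> k.gp p x z"
      using d[of p x] d[of p y] d[of p z] d[of x y] d[of y z] d[of x z]
      unfolding l.gp_def k.gp_def by (simp add: min_le_iff_disj)
  qed
  then show ?thesis unfolding hyperbolic_mod_def by blast
qed


section \<open>Linear bounds for derivations and uniform translations\<close>

lemma ninv_bounded:
  assumes N: "finite_index N" and f: "ninv N f" obtains C where "C > 0" "\<And>x. \<bar>f x\<bar> \<le> (C::int)"
proof -
  have n: "nsub N" using N by (simp add: finite_index_def)
  obtain T where T: "finite T" "\<And>g. \<exists>h\<in>N. \<exists>t\<in>T. g = h * t" using finite_index_transversal[OF N] by metis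
  have "f x \<in> f ` T" for x
  proof -
    obtain h t where "h \<in> N" "t \<in> T" "x = h * t" using T(2) by blast
    then show ?thesis using ninv_left[OF n f, of h t] by simp
  qed
  then have sub: "range f \<subseteq> f ` T" by blast
  have fin: "finite (abs ` f ` T)" using T(1) by simp
  define C where "C = Max (insert 1 (abs ` f ` T))"
  have "\<bar>f x\<bar> \<le> C" for x unfolding C_def using sub fin by (intro Max_ge) auto
  moreover have "1 \<le> C" unfolding C_def using fin by (intro Max_ge) auto
  ultimately show thesis using that[of C] by simp
qed

lemma nder_bound:
  assumes "finite_index N" "nder N \<phi>" obtains C where "C > 0" "\<And>g x. \<bar>der \<phi> g x\<bar> \<le> int (length (word g)) * C"
proof -
  interpret nder N \<phi> by fact
  obtain C1 where C1: "C1 > 0" "\<And>x. \<bar>\<phi> True x\<bar> \<le> C1" using ninv_bounded[OF assms(1) inv[of True]] by metis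
  obtain C2 where C2: "C2 > 0" "\<And>x. \<bar>\<phi> False x\<bar> \<le> C2" using ninv_bounded[OF assms(1) inv[of False]] by metis
  have "\<bar>\<phi> b x\<bar> \<le> C1 + C2" for b x using C1(1) C2(1) C1(2)[of x] C2(2)[of x] by (cases b) auto
  then have "\<bar>der \<phi> g x\<bar> \<le> int (length (word g)) * (C1 + C2)" for g x by (rule der_bound)
  then show thesis using that[of "C1 + C2"] C1(1) C2(1) by simp
qed

text \<open>Left multiplication by \<open>z powi i\<close> moves \<open>g\<close> by the length of
  this conjugate. So the powers up to \<open>J\<close> translate all points at a speed between
  \<open>\<tau>\<close> and \<open>2 * \<tau>\<close>, up to the error \<open>c\<close>.\<close>

definition translates :: "fg set \<Rightarrow> fg \<Rightarrow> real \<Rightarrow> real \<Rightarrow> nat \<Rightarrow> bool" where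
  "translates A z \<tau> c J \<longleftrightarrow> (\<forall>g i. \<bar>i\<bar> \<le> int J \<longrightarrow>
     \<tau> * \<bar>real_of_int i\<bar> - c \<le> real (W A (inverse g * z powi i * g)) \<and>
     real (W A (inverse g * z powi i * g)) \<le> 2 * \<tau> * \<bar>real_of_int i\<bar> + c)"

lemma translates_agree:
  assumes "translates A z \<tau> c J" "nsub A" "nsub A'" "A \<subseteq> A'"
    and "\<And>h. h \<in> A' \<Longrightarrow> length (word h) \<le> b \<Longrightarrow> h \<in> A" and b: "2 * (2 * \<tau> * real J + c) \<le> real b" and \<tau>: "0 \<le> \<tau>"
  shows "translates A' z \<tau> c J"
  unfolding translates_def
proof (intro allI impI)
  fix g i assume i: "\<bar>i\<bar> \<le> int J"
  have e: "\<tau> * \<bar>real_of_int i\<bar> - c \<le> real (W A (inverse g * z powi i * g))"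
    "real (W A (inverse g * z powi i * g)) \<le> 2 * \<tau> * \<bar>real_of_int i\<bar> + c"
    using assms(1) i unfolding translates_def by auto
  have "\<bar>real_of_int i\<bar> \<le> real J" using i by linarith
  then have "\<tau> * \<bar>real_of_int i\<bar> \<le> \<tau> * real J" using \<tau> by (intro mult_left_mono)
  then have "real (2 * W A (inverse g * z powi i * g)) \<le> real b" using e(2) b unfolding of_nat_mult by simp
  then have "2 * W A (inverse g * z powi i * g) \<le> b" by (simp only: of_nat_le_iff)
  then have "W A' (inverse g * z powi i * g) = W A (inverse g * z powi i * g)"
    using W_agree[of A A' b "inverse g * z powi i * g"] assms(2-5) by blast
  then show "\<tau> * \<bar>real_of_int i\<bar> - c \<le> real (W A' (inverse g * z powi i * g)) \<and>
     real (W A' (inverse g * z powi i * g)) \<le> 2 * \<tau> * \<bar>real_of_int i\<bar> + c" using e by simp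
qed

text \<open>The derivation bounds the length of \<open>u ^ j\<close> from below; passing to a power that nearly attains the stable length
  gives the factor 2. Elements of \<open>N\<close> commute with the powers of \<open>u\<close> modulo the kernel, so only a transversal of \<open>N\<close>
  contributes to the error \<open>c\<close>.\<close>

lemma stable_length:
  assumes R: "nsub R" and M: "finite_index M" and N: "finite_index N" and d: "nder N \<phi>"
    and u: "u \<in> R" "u \<in> M" "u \<in> N" "der \<phi> u x0 \<noteq> 0"
  obtains z \<tau> c where "z \<in> R" "z \<in> M" "\<tau> > 0" "c \<ge> 0" "\<And>J. translates (R \<inter> M \<inter> {n \<in> N. \<forall>x. 0 dvd der \<phi> n x}) z \<tau> c J"
proof -
  interpret nder N \<phi> by fact
  define H where "H = R \<inter> M \<inter> {n \<in> N. \<forall>x. 0 dvd der \<phi> n x}"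
  have nM: "nsub M" using M by (simp add: finite_index_def)
  have nH: "nsub H" unfolding H_def by (intro nsub_Int R nM nsub_ker)
  interpret l: lenspace "wl gens H" by (rule W_lenspace[OF nH])
  obtain C where C: "C > 0" "\<And>g x. \<bar>der \<phi> g x\<bar> \<le> int (length (word g)) * C" using nder_bound[OF N d] by metis
  have low: "real j / real_of_int C \<le> real (W H (u ^ j))" for j
  proof -
    obtain v where v: "length (word v) = W H (u ^ j)" "inverse (u ^ j) * v \<in> H" using W_rep[OF nH] .
    have "v = u ^ j * (inverse (u ^ j) * v)" by (simp add: gsimps)
    then have "der \<phi> v x0 = der \<phi> (u ^ j) x0 + der \<phi> (inverse (u ^ j) * v) (inverse (u ^ j) * x0)" by (metis der_mult)
    also have "\<dots> = int j * der \<phi> u x0" using v(2) der_N_power[OF u(3)] by (simp add: H_def)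
    finally have "\<bar>der \<phi> v x0\<bar> = int j * \<bar>der \<phi> u x0\<bar>" by (simp add: abs_mult)
    moreover have "int j * 1 \<le> int j * \<bar>der \<phi> u x0\<bar>" using u(4) by (intro mult_left_mono) auto
    ultimately have "int j \<le> int (W H (u ^ j)) * C" using C(2)[of v x0] v(1) by simp
    then have "real j \<le> real (W H (u ^ j)) * real_of_int C" by (metis of_int_le_iff of_int_mult of_int_of_nat_eq)
    then show ?thesis using C(1) by (simp add: divide_le_eq)
  qed
  define L where "L = (\<lambda>j. real (W H (u ^ j)) / real j) ` {1..}"
  define \<tau>0 where "\<tau>0 = Inf L"
  have lowL: "1 / real_of_int C \<le> y" if y: "y \<in> L" for y
  proof -
    obtain j where j: "j \<ge> 1" "y = real (W H (u ^ j)) / real j" using y by (auto simp: L_def)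
    have "1 / real_of_int C * real j \<le> real (W H (u ^ j))" using low[of j] by simp
    then show ?thesis unfolding j(2) using j(1) by (subst pos_le_divide_eq) auto
  qed
  have ne: "L \<noteq> {}" by (auto simp: L_def)
  have bdd: "bdd_below L" using lowL by (rule bdd_belowI)
  have "1 / real_of_int C \<le> \<tau>0" unfolding \<tau>0_def using ne lowL by (rule cInf_greatest)
  then have \<tau>0: "\<tau>0 > 0" using C(1) by (smt (verit) of_int_0_less_iff zero_less_divide_1_iff)
  have inf: "\<tau>0 * real j \<le> real (W H (u ^ j))" for j
  proof (cases "j = 0")
    case False
    then have "\<tau>0 \<le> real (W H (u ^ j)) / real j" unfolding \<tau>0_def by (intro cInf_lower bdd) (auto simp: L_def)
    then show ?thesis using False by (simp add: pos_le_divide_eq)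
  qed simp
  have "Inf L < 2 * \<tau>0" using \<tau>0 by (simp add: \<tau>0_def)
  then obtain y where "y \<in> L" "y < 2 * \<tau>0" using cInf_lessD[OF ne] by blast
  then obtain j0 where j0: "j0 \<ge> 1" "real (W H (u ^ j0)) / real j0 < 2 * \<tau>0" by (auto simp: L_def)
  define z where "z = u ^ j0"
  define \<tau> where "\<tau> = \<tau>0 * real j0"
  have \<tau>: "\<tau> > 0" using \<tau>0 j0(1) by (simp add: \<tau>_def)
  have z: "z \<in> R" "z \<in> M" "z \<in> N" unfolding z_def using u subgr_power nsub_subgr R nM nN by blast+
  have Wz: "real (W H z) \<le> 2 * \<tau>" using j0 by (simp add: z_def \<tau>_def divide_less_eq)
  have pw: "\<tau> * real k \<le> real (W H (z ^ k)) \<and> real (W H (z ^ k)) \<le> 2 * \<tau> * real k" for k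
  proof
    show "\<tau> * real k \<le> real (W H (z ^ k))" using inf[of "j0 * k"] by (simp add: z_def \<tau>_def power_mult mult.assoc)
    show "real (W H (z ^ k)) \<le> 2 * \<tau> * real k"
    proof (induction k)
      case (Suc k)
      have "real (W H (z ^ Suc k)) \<le> real (W H z) + real (W H (z ^ k))" using l.len_mult[of z "z ^ k"] by simp
      then show ?case using Suc Wz by (simp add: algebra_simps)
    qed simp
  qed
  have pwi: "\<tau> * \<bar>real_of_int i\<bar> \<le> real (W H (z powi i)) \<and> real (W H (z powi i)) \<le> 2 * \<tau> * \<bar>real_of_int i\<bar>" for i
  proof (cases "i \<ge> 0")
    case True
    then have "z powi i = z ^ nat i" by (simp add: power_int_def)
    then show ?thesis using pw[of "nat i"] True by simp
  next
    case False
    then have "z powi i = inverse (z ^ nat (- i))" by (simp add: power_int_def inverse_power)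
    then show ?thesis using pw[of "nat (- i)"] False by simp
  qed
  obtain T where T: "finite T" "\<And>g. \<exists>h\<in>N. \<exists>t\<in>T. g = h * t" using finite_index_transversal[OF N] by metis
  define c0 where "c0 = Max (insert 0 (wl gens H ` T))"
  have c0: "W H t \<le> c0" if "t \<in> T" for t unfolding c0_def using T(1) that by (intro Max_ge) auto
  have conj: "inverse (inverse h * z powi i * h) * z powi i \<in> H" if h: "h \<in> N" for h i
  proof -
    have zi: "z powi i \<in> R" "z powi i \<in> M" "z powi i \<in> N"
      using z subgr_powi nsub_subgr R nM nN by blast+
    let ?k = "inverse h * z powi i * h"
    have k: "?k \<in> R" "?k \<in> M" "?k \<in> N" using zi nsubD(5) R nM nN by blast+
    have "der \<phi> ?k x = der \<phi> (z powi i) x" for x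
      using der_N_conj[OF zi(3), of "inverse h" x] der_left[OF h] by (simp add: inv_inv)
    then have "der \<phi> (inverse ?k * z powi i) x = 0" for x
      using der_N_mult[OF nsubD(3)[OF nN k(3)]] der_N_inverse[OF k(3)] by simp
    moreover have "inverse ?k * z powi i \<in> R" "inverse ?k * z powi i \<in> M" "inverse ?k * z powi i \<in> N"
      using zi k nsubD(2,3) R nM nN by blast+
    ultimately show ?thesis by (simp add: H_def)
  qed
  have "translates H z \<tau> (2 * real c0) J" for J
    unfolding translates_def
  proof (intro allI impI)
    fix g i
    obtain h t where ht: "h \<in> N" "t \<in> T" "g = h * t" using T(2) by blast
    have "W H (inverse h * z powi i * h) = W H (z powi i)" by (rule wl_cong[OF nH conj[OF ht(1)]])
    moreover have "inverse g * z powi i * g = inverse t * (inverse h * z powi i * h) * t"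
      "inverse h * z powi i * h = t * (inverse g * z powi i * g) * inverse t" by (simp_all add: ht(3) gsimps)
    then have "W H (inverse g * z powi i * g) \<le> W H t + W H (inverse h * z powi i * h) + W H t"
      "W H (inverse h * z powi i * h) \<le> W H t + W H (inverse g * z powi i * g) + W H t"
      using l.len_mult l.len_inv by (metis add_le_mono1 order_trans)+
    ultimately show "\<tau> * \<bar>real_of_int i\<bar> - 2 * real c0 \<le> real (W H (inverse g * z powi i * g)) \<and>
      real (W H (inverse g * z powi i * g)) \<le> 2 * \<tau> * \<bar>real_of_int i\<bar> + 2 * real c0"
      using pwi[of i] c0[OF ht(2)] by linarith
  qed
  then show thesis using that[OF z(1,2) \<tau>, of "2 * real c0"] by (simp add: H_def)
qed

text \<open>On words of length at most \<open>b\<close> the derivation is bounded by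
  \<open>int b * C\<close>, so with \<open>e = int b * C + 1\<close> divisibility by
  \<open>e\<close> means vanishing there. The bound \<open>b\<close> covers twice the lengths that
  occur in \<open>translates\<close>.\<close>

lemma translates_truncate:
  assumes R: "nsub R" and M: "finite_index M" and N: "finite_index N" and d: "nder N \<phi>"
    and t: "translates (R \<inter> M \<inter> {n \<in> N. \<forall>x. 0 dvd der \<phi> n x}) z \<tau> c J" and \<tau>: "0 \<le> \<tau>"
  obtains e where "e > 0" "translates (R \<inter> M \<inter> {n \<in> N. \<forall>x. e dvd der \<phi> n x}) z \<tau> c J"
proof -
  interpret nder N \<phi> by fact
  have nM: "nsub M" using M by (simp add: finite_index_def)
  obtain C where C: "C > 0" "\<And>g x. \<bar>der \<phi> g x\<bar> \<le> int (length (word g)) * C" using nder_bound[OF N d] by metis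
  define b where "b = nat \<lceil>2 * (2 * \<tau> * real J + c)\<rceil>"
  define e where "e = int b * C + 1"
  have e: "e > 0" using C(1) by (simp add: e_def add_nonneg_pos)
  have "translates (R \<inter> M \<inter> {n \<in> N. \<forall>x. e dvd der \<phi> n x}) z \<tau> c J"
  proof (rule translates_agree[OF t _ _ _ _ _ \<tau>, of _ b])
    show "nsub (R \<inter> M \<inter> {n \<in> N. \<forall>x. 0 dvd der \<phi> n x})" by (intro nsub_Int R nM nsub_ker)
    show "nsub (R \<inter> M \<inter> {n \<in> N. \<forall>x. e dvd der \<phi> n x})" by (intro nsub_Int R nM nsub_ker)
    show "R \<inter> M \<inter> {n \<in> N. \<forall>x. 0 dvd der \<phi> n x} \<subseteq> R \<inter> M \<inter> {n \<in> N. \<forall>x. e dvd der \<phi> n x}" by auto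
    show "2 * (2 * \<tau> * real J + c) \<le> real b" unfolding b_def by linarith
    fix h assume h: "h \<in> R \<inter> M \<inter> {n \<in> N. \<forall>x. e dvd der \<phi> n x}" "length (word h) \<le> b"
    have "der \<phi> h x = 0" for x
    proof (rule ccontr)
      assume "der \<phi> h x \<noteq> 0"
      then have "e \<le> \<bar>der \<phi> h x\<bar>" using h(1) by (intro zdvd_imp_le) auto
      moreover have "int (length (word h)) * C \<le> int b * C" using h(2) C(1) by (intro mult_right_mono) auto
      ultimately show False using C(2)[of h x] by (simp add: e_def)
    qed
    then show "h \<in> R \<inter> M \<inter> {n \<in> N. \<forall>x. 0 dvd der \<phi> n x}" using h(1) by auto
  qed
  then show thesis using that e by blast
qed

section \<open>The limit group\<close>

definition stage :: "fg set \<Rightarrow> bool" where "stage R \<longleftrightarrow> nsub R \<and> hyperbolic_mod gens R \<and> rich R"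

text \<open>All demands on the exponent are divisibilities by positive numbers, so the product of
  these numbers meets them together.\<close>

lemma stage_power:
  assumes R: "stage R" and w: "\<And>n. n > 0 \<Longrightarrow> w ^ n \<notin> R" and q: "q > 0"
  obtains m where "m > 0" "q dvd m" "stage (nclos (insert (w ^ m) R))"
    "\<And>x. x \<in> nclos (insert (w ^ m) R) \<Longrightarrow> length (word x) \<le> b \<Longrightarrow> x \<in> R"
proof -
  have R': "nsub R" "hyperbolic_mod gens R" "rich R" using R by (auto simp: stage_def)
  obtain N0 where N0: "N0 > 0" "\<And>m. m > 0 \<Longrightarrow> N0 dvd m \<Longrightarrow> hyperbolic_mod gens (nclos (insert (w ^ m) R)) \<and>
    (\<forall>x\<in>nclos (insert (w ^ m) R). W R x \<le> b \<longrightarrow> x \<in> R)"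
    using add_power_relator[OF genset_gens finite_gens R'(1,2) w, of b] by blast
  obtain q1 where q1: "q1 > 0" "\<And>m. m > 0 \<Longrightarrow> q1 dvd m \<Longrightarrow> rich (nclos (insert (w ^ m) R))"
    using rich_step[OF R'(3), of w] by blast
  define m where "m = N0 * q1 * q"
  have m: "m > 0" "N0 dvd m" "q1 dvd m" "q dvd m" using N0(1) q1(1) q by (auto simp: m_def)
  have "stage (nclos (insert (w ^ m) R))" using N0(2) q1(2) m nsub_nclos by (auto simp: stage_def)
  moreover have "x \<in> R" if "x \<in> nclos (insert (w ^ m) R)" "length (word x) \<le> b" for x
    using N0(2)[OF m(1,2)] that W_le_length[OF R'(1), of x] by (meson order_trans)
  ultimately show thesis using that m by blast
qed

lemma stage_torsion:
  assumes R: "stage R"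
  obtains R1 k where "stage R1" "R \<subseteq> R1" "k > 0" "w ^ k \<in> R1"
    "\<And>x. x \<in> R1 \<Longrightarrow> length (word x) \<le> b \<Longrightarrow> x \<in> R"
proof (cases "\<exists>k>0. w ^ k \<in> R")
  case True
  then show thesis using that R by blast
next
  case False
  then obtain m where m: "m > 0" "stage (nclos (insert (w ^ m) R))"
    "\<And>x. x \<in> nclos (insert (w ^ m) R) \<Longrightarrow> length (word x) \<le> b \<Longrightarrow> x \<in> R"
    using stage_power[OF R, of w 1 b] by (metis zero_less_one)
  then show thesis using that[of "nclos (insert (w ^ m) R)" m] nclos_incl[of "insert (w ^ m) R"] by blast
qed

text \<open>The four-point condition on a ball around 1. Unlike \<open>hyp4\<close> it depends on
  short relations only, so it survives later changes of the group.\<close>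

definition ball4 :: "fg set \<Rightarrow> nat \<Rightarrow> int \<Rightarrow> bool" where
  "ball4 A r \<delta> \<longleftrightarrow> (\<forall>x y z. W A x \<le> r \<and> W A y \<le> r \<and> W A z \<le> r \<longrightarrow>
     min (int (W A x) + int (W A y) - int (W A (inverse x * y))) (int (W A y) + int (W A z) - int (W A (inverse y * z))) - \<delta>
     \<le> int (W A x) + int (W A z) - int (W A (inverse x * z)))"

text \<open>The interval from \<open>a\<close> to \<open>b\<close> contains a scale \<open>d\<close> that is far above the hyperbolicity constant and whose
  multiple \<open>n * d\<close> is far below the next change of the group.\<close>

definition tree_scale :: "fg set \<Rightarrow> nat \<Rightarrow> nat \<Rightarrow> nat \<Rightarrow> bool" where
  "tree_scale A n a b \<longleftrightarrow> (\<exists>d \<delta>. a \<le> d \<and> d \<le> b \<and> n \<le> d \<and> n * \<delta> \<le> d \<and> 4 * (n * d) \<le> b \<and> ball4 A (n * d) (int \<delta>))"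

text \<open>At scale \<open>d\<close> a single power of \<open>z\<close> and the error
  \<open>c\<close> are negligible, while the powers up to \<open>J\<close> reach beyond
  \<open>n * d\<close>. The last clause keeps all lengths involved inside the ball that later stages
  leave unchanged.\<close>

definition cut_scale :: "fg set \<Rightarrow> fg set \<Rightarrow> nat \<Rightarrow> nat \<Rightarrow> nat \<Rightarrow> bool" where
  "cut_scale A P n a b \<longleftrightarrow> (\<exists>d z \<tau> c J. a \<le> d \<and> d \<le> b \<and> n \<le> d \<and> z \<in> P \<and> 0 < \<tau> \<and> 0 \<le> c \<and>
     real n * (\<tau> + c + 1) \<le> real d \<and> real (n * d) \<le> \<tau> * real J \<and> translates A z \<tau> c J \<and> 2 * (2 * \<tau> * real J + c) \<le> real b)"

text \<open>After \<open>w\<close> has become torsion modulo \<open>R1\<close>, a derivation kills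
  \<open>R1\<close> but not some \<open>y\<close>, so \<open>y\<close> has infinite order modulo
  \<open>R1\<close> and its power \<open>y ^ m\<close> can be the next relator. It lies in
  \<open>M\<close> and has non-zero derivative: modulo the kernel of the derivation it generates an
  infinite cyclic group, which reduction modulo \<open>e\<close> closes to a long cycle. Because the
  derivation kills \<open>R1\<close>, the new subgroup \<open>M2\<close> still contains
  \<open>R \<inter> M\<close>.\<close>

lemma stage_step:
  assumes R: "stage R" and M: "finite_index M"
  shows "\<exists>R2 M2 b2. stage R2 \<and> finite_index M2 \<and> b < b2 \<and> R \<subseteq> R2 \<and> R \<inter> M \<subseteq> M2 \<and> M2 \<subseteq> M \<and>
    (\<forall>x\<in>R2. length (word x) \<le> b \<longrightarrow> x \<in> R) \<and> (\<exists>k>0. w ^ k \<in> R2) \<and>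
    tree_scale (R2 \<inter> M2) n b b2 \<and> cut_scale (R2 \<inter> M2) R2 n b b2"
proof -
  obtain R1 k where R1: "stage R1" "R \<subseteq> R1" "k > 0" "w ^ k \<in> R1"
    "\<And>x. x \<in> R1 \<Longrightarrow> length (word x) \<le> b \<Longrightarrow> x \<in> R" using stage_torsion[OF R] by metis
  have "rich R1" using R1(1) by (simp add: stage_def)
  then obtain N \<phi> y where N: "finite_index N" "R1 \<subseteq> N" "nder N \<phi>" and z: "\<And>r x. r \<in> R1 \<Longrightarrow> der \<phi> r x = 0"
    and y: "y \<in> N" "\<exists>x. der \<phi> y x \<noteq> 0" using rich_derivation by blast
  interpret nder N \<phi> by (rule N(3))
  obtain x0 where x0: "der \<phi> y x0 \<noteq> 0" using y(2) by blast
  have inf: "y ^ i \<notin> R1" if "i > 0" for i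
    using z[of "y ^ i" x0] der_N_power[OF y(1), of i x0] x0 that by auto
  obtain q where q: "q > 0" "y ^ q \<in> M" using finite_index_power[OF M] by blast
  obtain m where m: "m > 0" "q dvd m" "stage (nclos (insert (y ^ m) R1))"
    "\<And>x. x \<in> nclos (insert (y ^ m) R1) \<Longrightarrow> length (word x) \<le> b \<Longrightarrow> x \<in> R1"
    using stage_power[OF R1(1) inf q(1), of b] by blast
  define R2 where "R2 = nclos (insert (y ^ m) R1)"
  have R2: "stage R2" "R1 \<subseteq> R2" "y ^ m \<in> R2" using m nclos_incl[of "insert (y ^ m) R1"] by (auto simp: R2_def)
  have nR2: "nsub R2" using R2 by (simp add: stage_def)
  have nM: "nsub M" using M by (simp add: finite_index_def)
  have yM: "y ^ m \<in> M" using m(2) q(2) subgr_power[OF nsub_subgr[OF nM]] by (auto simp: dvd_def power_mult)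
  have yN: "y ^ m \<in> N" using subgr_power[OF nsub_subgr[OF nN]] y(1) .
  have ym: "der \<phi> (y ^ m) x0 \<noteq> 0" using der_N_power[OF y(1), of m x0] x0 m(1) by simp
  obtain v \<tau> c where v: "v \<in> R2" "v \<in> M" and \<tau>: "\<tau> > 0" "c \<ge> 0"
    and tr: "\<And>J. translates (R2 \<inter> M \<inter> {n \<in> N. \<forall>x. 0 dvd der \<phi> n x}) v \<tau> c J"
    by (rule stable_length[OF nR2 M N(1,3) R2(3) yM yN ym]) (rule that)
  \<comment> \<open>The scale \<open>d\<close> and the range \<open>J\<close> depend on
    \<open>\<tau>\<close> and \<open>c\<close> only; the modulus \<open>e\<close> is chosen
    afterwards, large enough for this range.\<close>
  define d where "d = b + n + nat \<lceil>real n * (\<tau> + c + 1)\<rceil>"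
  define J where "J = nat \<lceil>real (n * d) / \<tau>\<rceil>"
  obtain e where e: "e > 0" "translates (R2 \<inter> M \<inter> {n \<in> N. \<forall>x. e dvd der \<phi> n x}) v \<tau> c J"
    by (rule translates_truncate[OF nR2 M N(1,3) tr less_imp_le[OF \<tau>(1)]]) (rule that)
  define M2 where "M2 = M \<inter> {n \<in> N. \<forall>x. e dvd der \<phi> n x}"
  have M2: "finite_index M2" unfolding M2_def using finite_index_Int[OF M finite_index_ker[OF N(1,3) e(1)]] .
  have RM: "R \<inter> M \<subseteq> M2" using R1(2) N(2) z by (auto simp: M2_def)
  have tr2: "translates (R2 \<inter> M2) v \<tau> c J" using e(2) by (simp add: M2_def Int_assoc)
  have nA: "nsub (R2 \<inter> M2)" using nR2 M2 nsub_Int by (auto simp: finite_index_def)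
  have "hyperbolic_mod gens (R2 \<inter> M2)" using hyperbolic_finite_index[OF nR2 M2] R2(1) by (simp add: stage_def)
  then obtain \<delta> where \<delta>: "lenspace.hyp4 (wl gens (R2 \<inter> M2)) \<delta>" by (auto simp: hyperbolic_mod_def)
  interpret l: lenspace "wl gens (R2 \<inter> M2)" by (rule W_lenspace[OF nA])
  have b4: "ball4 (R2 \<inter> M2) r (int (nat \<delta>))" for r
    unfolding ball4_def
  proof (intro allI impI)
    fix x y z
    have "min (l.gp 1 x y) (l.gp 1 y z) - \<delta> \<le> l.gp 1 x z" using \<delta> unfolding l.hyp4_def by blast
    then show "min (int (W (R2 \<inter> M2) x) + int (W (R2 \<inter> M2) y) - int (W (R2 \<inter> M2) (inverse x * y)))
       (int (W (R2 \<inter> M2) y) + int (W (R2 \<inter> M2) z) - int (W (R2 \<inter> M2) (inverse y * z))) - int (nat \<delta>)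
       \<le> int (W (R2 \<inter> M2) x) + int (W (R2 \<inter> M2) z) - int (W (R2 \<inter> M2) (inverse x * z))"
      unfolding l.gp_def l.dd_one by (simp add: l.dd_def)
  qed
  define dt where "dt = b + n + n * nat \<delta>"
  define b2 where "b2 = b + 1 + dt + 4 * (n * dt) + d + nat \<lceil>2 * (2 * \<tau> * real J + c)\<rceil>"
  have "tree_scale (R2 \<inter> M2) n b b2" unfolding tree_scale_def
    by (rule exI[of _ dt], rule exI[of _ "nat \<delta>"], intro conjI b4) (simp_all add: dt_def b2_def)
  moreover have "cut_scale (R2 \<inter> M2) R2 n b b2" unfolding cut_scale_def
  proof (rule exI[of _ d], rule exI[of _ v], rule exI[of _ \<tau>], rule exI[of _ c], rule exI[of _ J], intro conjI)
    show "real n * (\<tau> + c + 1) \<le> real d" unfolding d_def by linarith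
    have "real (n * d) / \<tau> \<le> real J" unfolding J_def by linarith
    then show "real (n * d) \<le> \<tau> * real J" using \<tau>(1) by (simp add: divide_le_eq mult.commute)
    show "translates (R2 \<inter> M2) v \<tau> c J" by fact
    show "d \<le> b2" unfolding b2_def by simp
    show "2 * (2 * \<tau> * real J + c) \<le> real b2" unfolding b2_def by linarith
  qed (use v \<tau> in \<open>auto simp: d_def b2_def\<close>)
  moreover have "x \<in> R" if "x \<in> R2" "length (word x) \<le> b" for x using R1(5) m(4) that by (simp add: R2_def)
  moreover have "M2 \<subseteq> M" "b < b2" by (auto simp: M2_def b2_def)
  moreover have "\<exists>k>0. w ^ k \<in> R2" using R1(3,4) R2(2) by blast
  moreover have "R \<subseteq> R2" using R1(2) R2(2) by blast
  ultimately show ?thesis using R2(1) M2 RM 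
    by - (rule exI[of _ R2], rule exI[of _ M2], rule exI[of _ b2], blast)
qed

text \<open>Points of the ball are represented by words of length at most \<open>n * d\<close>, and
  all lengths in the condition are at most \<open>2 * (n * d)\<close>, within the range where both
  groups agree.\<close>

lemma tree_scale_agree:
  assumes "tree_scale A n a b" "nsub A" "nsub A'" "A \<subseteq> A'" "\<And>h. h \<in> A' \<Longrightarrow> length (word h) \<le> b \<Longrightarrow> h \<in> A"
  shows "tree_scale A' n a b"
proof -
  obtain d \<delta> where d: "a \<le> d" "d \<le> b" "n \<le> d" "n * \<delta> \<le> d" "4 * (n * d) \<le> b" "ball4 A (n * d) (int \<delta>)"
    using assms(1) by (auto simp: tree_scale_def)
  interpret l: lenspace "wl gens {1}" by (rule W_lenspace[OF nsub_one])
  have agree: "W A' u = W A u" if "length (word u) \<le> 2 * (n * d)" for u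
    using W_agree[of A A' b u] assms(2-5) W_le_length[OF assms(2), of u] d(5) that by simp
  have tri: "length (word (inverse u * v)) \<le> length (word u) + length (word v)" for u v
    using l.len_mult[of "inverse u" v] unfolding l.len_inv unfolding wl_gens .
  have "ball4 A' (n * d) (int \<delta>)"
    unfolding ball4_def
  proof (intro allI impI, elim conjE)
    fix x y z assume xyz: "W A' x \<le> n * d" "W A' y \<le> n * d" "W A' z \<le> n * d"
    have rep: "\<exists>u. length (word u) \<le> n * d \<and> inverse x * u \<in> A'" if "W A' x \<le> n * d" for x
      using W_rep[OF assms(3), of x] that by metis
    obtain u v t where uvt: "length (word u) \<le> n * d" "inverse x * u \<in> A'" "length (word v) \<le> n * d" "inverse y * v \<in> A'"
      "length (word t) \<le> n * d" "inverse z * t \<in> A'" using rep[OF xyz(1)] rep[OF xyz(2)] rep[OF xyz(3)] by blast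
    have diff: "W A' (inverse x * y) = W A' (inverse u * v)" if "inverse x * u \<in> A'" "inverse y * v \<in> A'" for x y u v
    proof -
      have "inverse (inverse x * y) * (inverse u * v) = inverse y * (x * inverse u) * y * (inverse y * v)" by (simp add: gsimps)
      moreover have "x * inverse u = x * inverse (inverse x * u) * inverse x" by (simp add: gsimps)
      then have "x * inverse u \<in> A'" using nsubD(3,4)[OF assms(3)] that(1) by metis
      ultimately show ?thesis using nsubD(2,5)[OF assms(3)] that(2) by (intro wl_cong[OF assms(3)]) metis
    qed
    have "W A' x = W A u" "W A' y = W A v" "W A' z = W A t"
      using wl_cong[OF assms(3) uvt(2)] wl_cong[OF assms(3) uvt(4)] wl_cong[OF assms(3) uvt(6)] agree uvt(1,3,5) by auto
    moreover have "W A' (inverse x * y) = W A (inverse u * v)" "W A' (inverse y * z) = W A (inverse v * t)"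
      "W A' (inverse x * z) = W A (inverse u * t)"
      using diff[OF uvt(2,4)] diff[OF uvt(4,6)] diff[OF uvt(2,6)] agree[of "inverse u * v"] agree[of "inverse v * t"]
        agree[of "inverse u * t"] tri[of u v] tri[of v t] tri[of u t] uvt(1,3,5) by auto
    moreover have "W A u \<le> n * d" "W A v \<le> n * d" "W A t \<le> n * d"
      using W_le_length[OF assms(2)] uvt(1,3,5) order_trans by blast+
    ultimately show "min (int (W A' x) + int (W A' y) - int (W A' (inverse x * y))) (int (W A' y) + int (W A' z) - int (W A' (inverse y * z))) - int \<delta>
     \<le> int (W A' x) + int (W A' z) - int (W A' (inverse x * z))"
      using d(6) unfolding ball4_def by presburger
  qed
  then show ?thesis using d unfolding tree_scale_def by blast
qed

lemma cut_scale_agree: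
  assumes "cut_scale A P n a b" "nsub A" "nsub A'" "A \<subseteq> A'" "\<And>h. h \<in> A' \<Longrightarrow> length (word h) \<le> b \<Longrightarrow> h \<in> A" "P \<subseteq> P'"
  shows "cut_scale A' P' n a b"
proof -
  obtain d z \<tau> c J where d: "a \<le> d" "d \<le> b" "n \<le> d" "z \<in> P" "0 < \<tau>" "0 \<le> c"
     "real n * (\<tau> + c + 1) \<le> real d" "real (n * d) \<le> \<tau> * real J" "translates A z \<tau> c J" "2 * (2 * \<tau> * real J + c) \<le> real b"
    using assms(1) unfolding cut_scale_def by blast
  have "translates A' z \<tau> c J" using translates_agree[OF d(9) assms(2-4) _ d(10)] assms(5) d(5) by simp
  then show ?thesis unfolding cut_scale_def using d assms(6) by (intro exI conjI) auto
qed

text \<open>A derivation that kills \<open>R\<close> takes the same value at \<open>x0\<close> on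
  \<open>y ^ k\<close> and on its shortest representative. It grows at most linearly with word
  length, yet is unbounded on the powers of \<open>y\<close>.\<close>

lemma stage_unbounded: assumes "stage R" shows "\<exists>x. W R x = n"
proof -
  have nR: "nsub R" and "rich R" using assms by (auto simp: stage_def)
  then obtain N \<phi> y where N: "finite_index N" "R \<subseteq> N" "nder N \<phi>" and z: "\<And>r x. r \<in> R \<Longrightarrow> der \<phi> r x = 0"
    and y: "y \<in> N" "\<exists>x. der \<phi> y x \<noteq> 0" using rich_derivation by blast
  interpret nder N \<phi> by (rule N(3))
  interpret l: lenspace "wl gens R" by (rule W_lenspace[OF nR])
  obtain x0 where x0: "der \<phi> y x0 \<noteq> 0" using y(2) by blast
  have "\<exists>x. n \<le> W R x"
  proof (rule ccontr)
    assume "\<not> ?thesis"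
    then have le: "W R x \<le> n" for x by (meson le_cases)
    obtain C where C: "C > 0" "\<And>g x. \<bar>der \<phi> g x\<bar> \<le> int (length (word g)) * C" using nder_bound[OF N(1,3)] by metis
    define k where "k = nat (int n * C) + 1"
    obtain v where v: "length (word v) = W R (y ^ k)" "inverse (y ^ k) * v \<in> R" using W_rep[OF nR] .
    have "v = y ^ k * (inverse (y ^ k) * v)" by (simp add: gsimps)
    then have "der \<phi> v x0 = der \<phi> (y ^ k) x0 + der \<phi> (inverse (y ^ k) * v) (inverse (y ^ k) * x0)" by (metis der_mult)
    also have "\<dots> = int k * der \<phi> y x0" using z[OF v(2)] der_N_power[OF y(1)] by simp
    finally have "\<bar>der \<phi> v x0\<bar> = int k * \<bar>der \<phi> y x0\<bar>" by (simp add: abs_mult)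
    moreover have "int k * 1 \<le> int k * \<bar>der \<phi> y x0\<bar>" using x0 by (intro mult_left_mono) auto
    moreover have "int (length (word v)) * C \<le> int n * C" using le v(1) C(1) by (intro mult_right_mono) auto
    ultimately have "int k \<le> int n * C" using C(2)[of v x0] by simp
    moreover have "0 \<le> int n * C" using C(1) by simp
    ultimately show False unfolding k_def by linarith
  qed
  then show ?thesis using l.len_geo by blast
qed

text \<open>\<open>stage_step\<close> is iterated along an enumeration of the group.
  \<open>P\<close> is kept beside \<open>A\<close> because the quotient by \<open>P\<close> is still
  infinite while the translating elements vanish in it; this separates points from the orbits of the
  translations.\<close>

theorem limit_group:
  obtains A P b where "nsub A" "nsub P" "A \<subseteq> P" "\<And>w. \<exists>k>0. w ^ k \<in> A" "\<And>n. \<exists>x. W P x = n"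
    "\<And>n. b n < b (Suc n)" "\<And>n. tree_scale A n (b n) (b (Suc n))" "\<And>n. cut_scale A P n (b n) (b (Suc n))"
proof -
  let ?w = "from_nat :: nat \<Rightarrow> fg"
  define Q where "Q n s t \<longleftrightarrow> (case (s, t) of ((R, M, b), (R2, M2, b2)) \<Rightarrow> b < b2 \<and> R \<subseteq> R2 \<and> R \<inter> M \<subseteq> M2 \<and> M2 \<subseteq> M \<and>
    (\<forall>x\<in>R2. length (word x) \<le> b \<longrightarrow> x \<in> R) \<and> (\<exists>k>0. ?w n ^ k \<in> R2) \<and>
    tree_scale (R2 \<inter> M2) n b b2 \<and> cut_scale (R2 \<inter> M2) R2 n b b2)" for n and s t :: "fg set \<times> fg set \<times> nat"
  define I where "I s \<longleftrightarrow> (case s of (R, M, b) \<Rightarrow> stage R \<and> finite_index M)" for s :: "fg set \<times> fg set \<times> nat"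
  have "\<exists>f. \<forall>n. I (f n) \<and> Q n (f n) (f (Suc n))"
  proof (rule dependent_nat_choice)
    show "\<exists>s. I s" using rich_one hyperbolic_free nsub_one finite_index_UNIV
      by (intro exI[of _ "({1}, UNIV, 0)"]) (simp add: I_def stage_def)
    fix s n assume "I s"
    obtain R M b where s: "s = (R, M, b)" by (cases s)
    then show "\<exists>t. I t \<and> Q n s t"
      using stage_step[of R M b "?w n" n] \<open>I s\<close> unfolding I_def Q_def s by (simp add: conj_ac)
  qed
  then obtain f where f: "\<And>n. I (f n)" "\<And>n. Q n (f n) (f (Suc n))" by blast
  define R where "R n = fst (f n)" for n
  define M where "M n = fst (snd (f n))" for n
  define b where "b n = snd (snd (f n))" for n
  have fe: "f n = (R n, M n, b n)" for n by (simp add: R_def M_def b_def)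
  have st: "stage (R n)" "finite_index (M n)" for n using f(1)[of n] by (auto simp: I_def fe)
  have q: "b n < b (Suc n)" "R n \<subseteq> R (Suc n)" "R n \<inter> M n \<subseteq> M (Suc n)" "M (Suc n) \<subseteq> M n"
    "x \<in> R (Suc n) \<Longrightarrow> length (word x) \<le> b n \<Longrightarrow> x \<in> R n" "\<exists>k>0. ?w n ^ k \<in> R (Suc n)"
    "tree_scale (R (Suc n) \<inter> M (Suc n)) n (b n) (b (Suc n))" "cut_scale (R (Suc n) \<inter> M (Suc n)) (R (Suc n)) n (b n) (b (Suc n))" for n x
    using f(2)[of n] by (auto simp: Q_def fe)
  have nR: "nsub (R n)" "nsub (R n \<inter> M n)" for n using st nsub_Int by (auto simp: stage_def finite_index_def)
  have R: "R m \<subseteq> R n" if "m \<le> n" for m n using q(2) that by (rule lift_Suc_mono_le)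
  have M: "M n \<subseteq> M m" if "m \<le> n" for m n using q(4) that by (rule lift_Suc_antimono_le)
  have RM: "R m \<inter> M m \<subseteq> R n \<inter> M n" if "m \<le> n" for m n
  proof -
    have "R n \<inter> M n \<subseteq> R (Suc n) \<inter> M (Suc n)" for n using q(2,3)[of n] by blast
    then show ?thesis using that by (rule lift_Suc_mono_le[of "\<lambda>n. R n \<inter> M n"])
  qed
  have bm: "b m \<le> b n" if "m \<le> n" for m n using less_imp_le[OF q(1)] that by (rule lift_Suc_mono_le)
  have Rs: "x \<in> R m" if "m \<le> n" "x \<in> R n" "length (word x) \<le> b m" for m n x
    using that
  proof (induction n rule: dec_induct)
    case (step n)
    then show ?case using q(5)[of x n] bm[of m n] by simp
  qed
  have union: "nsub (\<Union>n. F n)" if F: "\<And>m n. m \<le> n \<Longrightarrow> F m \<subseteq> F n" "\<And>n. nsub (F n)" for F :: "nat \<Rightarrow> fg set"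
  proof -
    have "x * y \<in> (\<Union>n. F n)" if xy: "x \<in> (\<Union>n. F n)" "y \<in> (\<Union>n. F n)" for x y
    proof -
      obtain i j where "x \<in> F i" "y \<in> F j" using xy by blast
      then have "x \<in> F (max i j)" "y \<in> F (max i j)" using F(1)[of i "max i j"] F(1)[of j "max i j"] by auto
      then show ?thesis using nsubD(2)[OF F(2)] by blast
    qed
    moreover have "1 \<in> (\<Union>n. F n)" using nsubD(1)[OF F(2)] by blast
    moreover have "inverse x \<in> (\<Union>n. F n)" "g * x * inverse g \<in> (\<Union>n. F n)" if x: "x \<in> (\<Union>n. F n)" for x g
    proof -
      obtain i where i: "x \<in> F i" using x by (rule UN_E)
      show "inverse x \<in> (\<Union>n. F n)" by (rule UN_I[of i]) (auto intro: nsubD(3)[OF F(2) i])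
      show "g * x * inverse g \<in> (\<Union>n. F n)" by (rule UN_I[of i]) (auto intro: nsubD(4)[OF F(2) i])
    qed
    ultimately show ?thesis unfolding nsub_def subgr_def by simp
  qed
  \<comment> \<open>The union is increasing because each \<open>R n \<inter> M n\<close> stays
    inside the later \<open>M\<close>; it equals \<open>P \<inter> (\<Inter>n. M n)\<close>.\<close>
  define A where "A = (\<Union>n. R n \<inter> M n)"
  define P where "P = (\<Union>n. R n)"
  have nA: "nsub A" unfolding A_def by (rule union[OF RM nR(2)])
  have nP: "nsub P" unfolding P_def by (rule union[OF R nR(1)])
  have shortP: "h \<in> R n" if "h \<in> P" "length (word h) \<le> b n" for h n
  proof -
    obtain k where k: "h \<in> R k" using \<open>h \<in> P\<close> by (auto simp: P_def)
    show ?thesis using Rs[of n "max k n" h] R[of k "max k n"] k that(2) by auto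
  qed
  have shortA: "h \<in> R n \<inter> M n" if "h \<in> A" "length (word h) \<le> b n" for h n
  proof -
    obtain k where k: "h \<in> R k \<inter> M k" using \<open>h \<in> A\<close> by (auto simp: A_def)
    have "h \<in> R n" using shortP that k by (auto simp: P_def)
    moreover have "h \<in> M n" using RM[of k "max k n"] M[of n "max k n"] k by auto
    ultimately show ?thesis by blast
  qed
  have bn: "n \<le> b n" for n by (induction n) (use q(1) in \<open>auto simp: Suc_le_eq intro: le_less_trans\<close>)
  have "\<exists>k>0. w ^ k \<in> A" for w
  proof -
    obtain n where n: "w = ?w n" by (metis from_nat_to_nat)
    obtain k where k: "k > 0" "w ^ k \<in> R (Suc n)" using q(6)[of n] n by blast
    \<comment> \<open>Finite index of \<open>M\<close> turns torsion modulo \<open>R\<close> into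
      torsion modulo \<open>R \<inter> M\<close>.\<close>
    obtain j where j: "j > 0" "(w ^ k) ^ j \<in> M (Suc n)" using finite_index_power[OF st(2)] by blast
    have "(w ^ k) ^ j \<in> R (Suc n)" using subgr_power[OF nsub_subgr[OF nR(1)] k(2)] .
    then have "w ^ (k * j) \<in> A" unfolding A_def power_mult using j(2) by blast
    then show ?thesis using k(1) j(1) by (intro exI[of _ "k * j"]) simp
  qed
  moreover have "\<exists>x. W P x = n" for n
  proof -
    obtain x where x: "W (R (2 * n)) x = n" using stage_unbounded[OF st(1)] by blast
    have "R (2 * n) \<subseteq> P" by (auto simp: P_def)
    moreover have "2 * W (R (2 * n)) x \<le> b (2 * n)" using x bn[of "2 * n"] by simp
    ultimately have "W P x = W (R (2 * n)) x" by (intro W_agree[OF nR(1) nP]) (use shortP in auto)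
    then show ?thesis using x by auto
  qed
  moreover have RA: "R n \<inter> M n \<subseteq> A" "R n \<subseteq> P" for n by (auto simp: A_def P_def)
  have "tree_scale A n (b n) (b (Suc n))" for n
    by (rule tree_scale_agree[OF q(7) nR(2) nA RA(1) shortA])
  moreover have "cut_scale A P n (b n) (b (Suc n))" for n
    by (rule cut_scale_agree[OF q(8) nR(2) nA RA(1) shortA RA(2)])
  moreover have "A \<subseteq> P" by (auto simp: A_def P_def)
  ultimately show thesis using that nA nP q(1) by blast
qed

section \<open>Real trees from the four-point condition\<close>

locale mspc = fixes X :: "'b metric"
begin

sublocale Metric_space "mspace X" "mdist X" by (rule Metric_space_mspace_mdist)

lemma top: "mtopology_of X = mtopology" by (simp add: mtopology_of_def)

lemma lipschitz_continuous:
  assumes f: "\<And>s. s \<in> S \<Longrightarrow> f s \<in> mspace X" and K: "0 \<le> K"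
    and l: "\<And>s t. s \<in> S \<Longrightarrow> t \<in> S \<Longrightarrow> mdist X (f s) (f t) \<le> K * \<bar>s - t :: real\<bar>"
  shows "continuous_map (top_of_set S) (mtopology_of X) f"
  unfolding top continuous_map_to_metric
proof (intro ballI allI impI)
  fix s \<epsilon> :: real assume s: "s \<in> topspace (top_of_set S)" and e: "\<epsilon> > 0"
  \<comment> \<open>\<open>K + 1\<close> in place of \<open>K\<close> allows
    \<open>K = 0\<close>.\<close>
  let ?U = "S \<inter> ball s (\<epsilon> / (K + 1))"
  have "openin (top_of_set S) ?U" by (simp add: openin_open_Int)
  moreover have "s \<in> ?U" using s e K by simp
  moreover have "f t \<in> mball (f s) \<epsilon>" if t: "t \<in> ?U" for t
  proof -
    have "\<bar>s - t\<bar> < \<epsilon> / (K + 1)" using t by (simp add: dist_real_def)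
    then have "(K + 1) * \<bar>s - t\<bar> < \<epsilon>" using K by (simp add: pos_less_divide_eq mult.commute)
    moreover have "K * \<bar>s - t\<bar> \<le> (K + 1) * \<bar>s - t\<bar>" by (intro mult_right_mono) auto
    ultimately have "mdist X (f s) (f t) < \<epsilon>" using l[of s t] s t by auto
    then show ?thesis using f[of s] f[of t] s t by (simp add: in_mball)
  qed
  ultimately show "\<exists>U. openin (top_of_set S) U \<and> s \<in> U \<and> (\<forall>y\<in>U. f y \<in> mball (f s) \<epsilon>)" by blast
qed

text \<open>Twice the Gromov product, the real counterpart of \<open>gp\<close>.\<close>

definition prd :: "'b \<Rightarrow> 'b \<Rightarrow> 'b \<Rightarrow> real" where "prd w x y = mdist X w x + mdist X w y - mdist X x y"

lemma arc_connected: assumes "arc_between (mtopology_of X) x y A" shows "connectedin (mtopology_of X) A" "x \<in> A" "y \<in> A"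
proof -
  obtain g where g: "embedding_map (top_of_set {0..1::real}) (mtopology_of X) g" "g 0 = x" "g 1 = y" "A = g ` {0..1}"
    using assms by (auto simp: arc_between_def)
  have "connectedin (top_of_set {0..1::real}) {0..1}" by (simp add: connectedin_subtopology)
  moreover have "continuous_map (top_of_set {0..1}) (mtopology_of X) g"
    using g(1) unfolding embedding_map_def by (meson continuous_map_in_subtopology homeomorphic_imp_continuous_map)
  ultimately show "connectedin (mtopology_of X) A" unfolding g(4) using connectedin_continuous_map_image by blast
  show "x \<in> A" "y \<in> A" using g by auto
qed

text \<open>The points \<open>p\<close> with \<open>prd z x p > 0\<close> form a clopen subset of the complement of \<open>z\<close>, so an arc cannot avoid a point
  \<open>z\<close> of the geodesic.\<close>

lemma real_tree_of_four_point:
  assumes geo: "geodesic_space X"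
    and h: "\<And>w x y z. w \<in> mspace X \<Longrightarrow> x \<in> mspace X \<Longrightarrow> y \<in> mspace X \<Longrightarrow> z \<in> mspace X \<Longrightarrow>
      min (prd w x y) (prd w y z) \<le> prd w x z"
  shows "real_tree X"
  unfolding real_tree_def
proof (intro conjI geo ballI impI)
  fix x y assume x: "x \<in> mspace X" and y: "y \<in> mspace X" and xy: "x \<noteq> y"
  let ?T = "mtopology_of X"
  define L where "L = mdist X x y"
  have L: "L > 0" using x y xy by (simp add: L_def)
  obtain c where c: "c \<in> {0..L} \<rightarrow> mspace X" "c 0 = x" "c L = y"
    "\<And>s t. s \<in> {0..L} \<Longrightarrow> t \<in> {0..L} \<Longrightarrow> mdist X (c s) (c t) = \<bar>s - t\<bar>"
    using geo x y unfolding geodesic_space_def L_def by blast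
  define S where "S = c ` {0..L}"
  define g where "g t = c (L * t)" for t
  have Lt: "L * t \<in> {0..L}" if "t \<in> {0..1}" for t using that L by (auto intro: mult_left_le)
  have "continuous_map (top_of_set {0..1}) ?T g"
  proof (rule lipschitz_continuous[of _ _ L])
    show "g s \<in> mspace X" if "s \<in> {0..1}" for s using Lt[OF that] c(1) unfolding g_def by blast
    show "mdist X (g s) (g t) \<le> L * \<bar>s - t\<bar>" if "s \<in> {0..1}" "t \<in> {0..1}" for s t
      using c(4)[OF Lt[OF that(1)] Lt[OF that(2)]] L by (simp add: g_def abs_mult flip: right_diff_distrib)
  qed (use L in auto)
  moreover have "inj_on g (topspace (top_of_set {0..1}))"
  proof (rule inj_onI)
    fix s t assume st: "s \<in> topspace (top_of_set {0..1})" "t \<in> topspace (top_of_set {0..1})" "g s = g t"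
    then have L2: "L * s \<in> {0..L}" "L * t \<in> {0..L}" using Lt by auto
    then have "c (L * t) \<in> mspace X" using c(1) by blast
    then have "\<bar>L * s - L * t\<bar> = 0" using c(4)[OF L2] st(3) unfolding g_def by simp
    then show "s = t" using L by simp
  qed
  moreover have "compact_space (top_of_set {0..1::real})" by (simp add: compact_space_subtopology)
  ultimately have "embedding_map (top_of_set {0..1}) ?T g"
    by (intro continuous_imp_embedding_map) (auto simp: top Hausdorff_space_mtopology)
  moreover have "g ` {0..1} = S"
  proof -
    have "(\<lambda>t. L * t) ` {0..1} = {0..L}" using L by (simp add: image_mult_atLeastAtMost)
    then show ?thesis unfolding S_def g_def by (metis image_image)
  qed
  ultimately have arcS: "arc_between ?T x y S" using c unfolding arc_between_def by (intro exI[of _ g]) (auto simp: g_def)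
  have uniq: "B = S" if B: "arc_between ?T x y B" for B
  proof -
    note conB = arc_connected[OF B]
    have BM: "B \<subseteq> mspace X" using connectedin_subset_topspace[OF conB(1)] by simp
    have sub: "S \<subseteq> B"
    proof
      fix z assume "z \<in> S"
      then obtain s where s: "s \<in> {0..L}" "z = c s" by (auto simp: S_def)
      then have z: "z \<in> mspace X" using c(1) by blast
      have zx: "mdist X z x = s" "mdist X z y = L - s" using c(4)[OF s(1), of 0] c(4)[OF s(1), of L] c(2,3) s L by auto
      show "z \<in> B"
      proof (rule ccontr)
        assume zB: "z \<notin> B"
        define E1 where "E1 = {p \<in> mspace X. prd z x p > 0}"
        define E2 where "E2 = {p \<in> mspace X. p \<noteq> z \<and> \<not> prd z x p > 0}"
        have near: "prd z p q > 0" if "p \<in> mspace X" "q \<in> mball p (mdist X z p)" for p q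
          using that triangle[of z q p] triangle'[of p z q] z by (auto simp: prd_def in_mball commute)
        have "openin ?T E1" unfolding top openin_mtopology
        proof (intro conjI allI impI)
          fix p assume p: "p \<in> E1"
          have pM: "p \<in> mspace X" using p by (simp add: E1_def)
          show "\<exists>r>0. mball p r \<subseteq> E1"
          proof (intro exI[of _ "mdist X z p"] conjI subsetI)
            have "prd z x z = 0" using z x by (simp add: prd_def commute)
            then have "p \<noteq> z" using p by (auto simp: E1_def)
            then show "mdist X z p > 0" using pM z by simp
            fix q assume q: "q \<in> mball p (mdist X z p)"
            then have qM: "q \<in> mspace X" by (simp add: in_mball)
            show "q \<in> E1" using h[OF z x pM qM] near[OF pM q] p qM by (auto simp: E1_def)
          qed
        qed (auto simp: E1_def)
        moreover have "openin ?T E2" unfolding top openin_mtopology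
        proof (intro conjI allI impI)
          fix p assume p: "p \<in> E2"
          have pM: "p \<in> mspace X" using p by (simp add: E2_def)
          show "\<exists>r>0. mball p r \<subseteq> E2"
          proof (intro exI[of _ "mdist X z p"] conjI subsetI)
            show "mdist X z p > 0" using pM z p by (auto simp: E2_def)
            fix q assume q: "q \<in> mball p (mdist X z p)"
            then have qM: "q \<in> mspace X" by (simp add: in_mball)
            have "prd z q p > 0" using near[OF pM q] by (simp add: prd_def commute add.commute)
            then have "\<not> prd z x q > 0" using h[OF z x qM pM] p by (auto simp: E2_def)
            moreover have "q \<noteq> z" using q by (auto simp: in_mball commute)
            ultimately show "q \<in> E2" using qM by (simp add: E2_def)
          qed
        qed (auto simp: E2_def)
        moreover have "B \<subseteq> E1 \<union> E2" using BM zB by (auto simp: E1_def E2_def)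
        moreover have "E1 \<inter> E2 \<inter> B = {}" by (auto simp: E1_def E2_def)
        moreover have "x \<in> E1 \<inter> B"
          using conB(2) zB x z mdist_pos_less[of z x] by (auto simp: E1_def prd_def)
        moreover have "y \<in> E2 \<inter> B"
          using conB(3) zB y zx by (auto simp: E2_def prd_def L_def)
        ultimately show False using conB(1) unfolding connectedin by blast
      qed
    qed
    \<comment> \<open>For the other inclusion, \<open>S\<close> is pulled back to the parameter
      interval of \<open>B\<close>: the result is connected and contains 0 and 1, hence is
      everything.\<close>
    obtain g' where g': "embedding_map (top_of_set {0..1::real}) ?T g'" "g' 0 = x" "g' 1 = y" "B = g' ` {0..1}"
      using B by (auto simp: arc_between_def)
    have "homeomorphic_map (top_of_set {0..1}) (subtopology ?T B) g'" using g'(1,4) by (simp add: embedding_map_def)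
    then obtain k where k: "homeomorphic_maps (top_of_set {0..1}) (subtopology ?T B) g' k"
      unfolding homeomorphic_map_maps by blast
    have kg: "k (g' t) = t" if "t \<in> {0..1}" for t using k that by (auto simp: homeomorphic_maps_def)
    have "connectedin (subtopology ?T B) S" using arc_connected(1)[OF arcS] sub by (simp add: connectedin_subtopology)
    moreover have "continuous_map (subtopology ?T B) (top_of_set {0..1}) k" using k by (simp add: homeomorphic_maps_def)
    ultimately have "connectedin (top_of_set {0..1}) (k ` S)" by (rule connectedin_continuous_map_image[rotated])
    then have con: "connected (k ` S)" by (simp add: connectedin_subtopology)
    have "0 \<in> k ` S" "1 \<in> k ` S" using arc_connected(2,3)[OF arcS] kg[of 0] kg[of 1] g'(2,3) by force+
    then have "{0..1} \<subseteq> k ` S" using con connected_contains_Icc by blast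
    have "B \<subseteq> S"
    proof
      fix b assume "b \<in> B"
      then obtain t where t: "t \<in> {0..1}" "b = g' t" using g'(4) by blast
      obtain s where s: "s \<in> S" "t = k s" using t(1) \<open>{0..1} \<subseteq> k ` S\<close> by blast
      then obtain t' where t': "t' \<in> {0..1}" "s = g' t'" using sub g'(4) by blast
      then show "b \<in> S" using kg[OF t'(1)] s t(2) by simp
    qed
    then show "B = S" using sub by blast
  qed
  show "\<exists>!A. arc_between ?T x y A" using arcS uniq by blast
qed

end

section \<open>Cut points and actions of the line\<close>

context mspc begin

text \<open>Half-orbits in different components of the complement of \<open>p\<close> are joined by far translates of a geodesic, which miss
  \<open>p\<close> if both half-orbits go in the same direction. A point off the orbit of \<open>p\<close> may choose its direction.\<close>

lemma no_cut_point:
  assumes geo: "geodesic_space X"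
    and a: "\<And>s x. x \<in> mspace X \<Longrightarrow> a s x \<in> mspace X"
    and iso: "\<And>s x y. x \<in> mspace X \<Longrightarrow> y \<in> mspace X \<Longrightarrow> mdist X (a s x) (a s y) = mdist X x y"
    and add: "\<And>s t x. x \<in> mspace X \<Longrightarrow> a s (a t x) = a (s + t) x"
    and disp: "\<And>s x. x \<in> mspace X \<Longrightarrow> \<bar>s\<bar> \<le> mdist X (a s x) x \<and> mdist X (a s x) x \<le> 2 * \<bar>s :: real\<bar>"
    and off: "\<And>x. x \<in> mspace X \<Longrightarrow> \<exists>y\<in>mspace X. \<forall>s. a s x \<noteq> y"
  shows "\<not> cut_point (mtopology_of X) p"
proof
  let ?T = "mtopology_of X"
  assume "cut_point ?T p"
  then have p: "p \<in> mspace X" and "\<not> connectedin ?T (mspace X - {p})"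
    by (auto simp: cut_point_def connectedin_def)
  then obtain U V where UV: "openin ?T U" "openin ?T V" "mspace X - {p} \<subseteq> U \<union> V" "U \<inter> V \<inter> (mspace X - {p}) = {}"
    and ne: "U \<inter> (mspace X - {p}) \<noteq> {}" "V \<inter> (mspace X - {p}) \<noteq> {}"
    unfolding connectedin by auto
  have side: "S \<inter> U = {} \<or> S \<inter> V = {}" if S: "connectedin ?T S" "p \<notin> S" for S
  proof -
    have "S \<subseteq> mspace X - {p}" using connectedin_subset_topspace[OF S(1)] S(2) by auto
    then show ?thesis using S(1) UV unfolding connectedin by (metis Int_commute disjoint_iff subset_iff)
  qed
  have a0: "a 0 x = x" if "x \<in> mspace X" for x using disp[OF that, of 0] zero[OF a[OF that, of 0] that] nonneg[of "a 0 x" x] by auto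
  have lip: "mdist X (a s x) (a t x) \<le> 2 * \<bar>s - t\<bar>" "\<bar>s - t\<bar> \<le> mdist X (a s x) (a t x)" if "x \<in> mspace X" for s t x
  proof -
    have "a s x = a (s - t) (a t x)" using add[OF that, of "s - t" t] by simp
    then show "mdist X (a s x) (a t x) \<le> 2 * \<bar>s - t\<bar>" "\<bar>s - t\<bar> \<le> mdist X (a s x) (a t x)"
      using disp[OF a[OF that], of "s - t" t] by auto
  qed
  have ray: "connectedin ?T ((\<lambda>s. a (e * s) x) ` {0..})" if x: "x \<in> mspace X" and e: "\<bar>e\<bar> = 1" for x e
  proof -
    have "continuous_map (top_of_set {0..}) ?T (\<lambda>s. a (e * s) x)"
    proof (rule lipschitz_continuous[of _ _ 2])
      show "mdist X (a (e * s) x) (a (e * t) x) \<le> 2 * \<bar>s - t\<bar>" for s t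
        using lip(1)[OF x, of "e * s" "e * t"] e by (simp add: abs_mult flip: right_diff_distrib)
    qed (use a[OF x] in auto)
    moreover have "connectedin (top_of_set {0::real..}) {0..}" by (simp add: connectedin_subtopology)
    ultimately show ?thesis by (rule connectedin_continuous_map_image)
  qed
  define esc where "esc e x \<longleftrightarrow> p \<notin> (\<lambda>s. a (e * s) x) ` {0..}" for e x
  have contra: False if x: "x \<in> U" "x \<in> mspace X" "x \<noteq> p" "esc e x" and y: "y \<in> V" "y \<in> mspace X" "y \<noteq> p" "esc e y"
    and e: "\<bar>e\<bar> = 1" for x y e
  proof -
    define D where "D = mdist X x y"
    \<comment> \<open>So large that the translate of \<open>x\<close> is further than
      \<open>D\<close> from \<open>p\<close>; the translated geodesic, of length \<open>D\<close>,
      then misses \<open>p\<close>.\<close>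
    define s where "s = mdist X x p + D + 1"
    have D: "0 \<le> D" by (simp add: D_def)
    have s: "s \<ge> 0" using D by (simp add: s_def)
    define S where "S = (\<lambda>s. a (e * s) x) ` {0..} \<union> (\<lambda>s. a (e * s) y) ` {0..}"
    obtain c where c: "c \<in> {0..D} \<rightarrow> mspace X" "c 0 = x" "c D = y"
      "\<And>s t. s \<in> {0..D} \<Longrightarrow> t \<in> {0..D} \<Longrightarrow> mdist X (c s) (c t) = \<bar>s - t\<bar>"
      using geo x(2) y(2) unfolding geodesic_space_def D_def by blast
    define B where "B = (\<lambda>t. a (e * s) (c t)) ` {0..D}"
    have cM: "c t \<in> mspace X" if "t \<in> {0..D}" for t using c(1) that by blast
    have "continuous_map (top_of_set {0..D}) ?T (\<lambda>t. a (e * s) (c t))"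
      by (rule lipschitz_continuous[of _ _ 1]) (use a cM iso c(4) in auto)
    moreover have "connectedin (top_of_set {0..D}) {0..D}" by (simp add: connectedin_subtopology)
    ultimately have B: "connectedin ?T B" unfolding B_def by (rule connectedin_continuous_map_image)
    have pB: "p \<notin> B"
    proof
      assume "p \<in> B"
      then obtain t where t: "t \<in> {0..D}" "p = a (e * s) (c t)" by (auto simp: B_def)
      have "mdist X (a (e * s) x) p = t" using iso[OF x(2) cM[OF t(1)]] c(4)[of 0 t] t c(2) by simp
      moreover have "s \<le> mdist X (a (e * s) x) x" using disp[OF x(2), of "e * s"] e s by (simp add: abs_mult)
      moreover have "mdist X (a (e * s) x) x \<le> mdist X (a (e * s) x) p + mdist X p x" using triangle a x(2) p by blast
      ultimately show False using t(1) commute[of p x] by (simp add: s_def)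
    qed
    have "0 \<in> {0..D}" "D \<in> {0..D}" using D by auto
    then have "a (e * s) (c 0) \<in> B" "a (e * s) (c D) \<in> B" unfolding B_def by blast+
    then have ends: "a (e * s) x \<in> B" "a (e * s) y \<in> B" using c(2,3) by simp_all
    have in_ray: "a (e * s) z \<in> (\<lambda>s. a (e * s) z) ` {0..}" "z \<in> (\<lambda>s. a (e * s) z) ` {0..}" if "z \<in> mspace X" for z
      using s a0[OF that] by (auto intro: image_eqI[of _ _ 0])
    have "(\<lambda>s. a (e * s) x) ` {0..} \<inter> V = {}"
      using side[OF ray[OF x(2) e]] x(1,2,4) in_ray[OF x(2)] unfolding esc_def by blast
    then have 1: "a (e * s) x \<notin> V" using in_ray[OF x(2)] by blast
    have "(\<lambda>s. a (e * s) y) ` {0..} \<inter> U = {}"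
      using side[OF ray[OF y(2) e]] y(1,2,4) in_ray[OF y(2)] unfolding esc_def by blast
    then have 2: "a (e * s) y \<notin> U" using in_ray[OF y(2)] by blast
    have "a (e * s) x \<in> U" "a (e * s) y \<in> V" using 1 2 ends pB a[OF x(2), of "e * s"] a[OF y(2), of "e * s"] UV(3) by blast+
    then show False using side[OF B pB] ends by blast
  qed
  have some: "esc 1 x \<or> esc (- 1) x" if x: "x \<in> mspace X" "x \<noteq> p" for x
  proof (rule ccontr)
    assume "\<not> ?thesis"
    then obtain s t where st: "s \<ge> 0" "t \<ge> 0" "p = a (1 * s) x" "p = a (- 1 * t) x" unfolding esc_def by auto
    then have "mdist X (a (1 * s) x) (a (- 1 * t) x) = 0" using p by simp
    then have "s = 0" using lip(2)[OF x(1), of "1 * s" "- 1 * t"] st(1,2) by simp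
    then show False using st(3) a0[OF x(1)] x(2) by simp
  qed
  obtain t where t: "t \<in> mspace X" "\<And>s. a s p \<noteq> t" using off[OF p] by blast
  have tp: "t \<noteq> p" using t(2)[of 0] a0[OF p] by auto
  have esct: "esc e t" for e
  proof -
    have "a (e * s) t \<noteq> p" for s
    proof
      assume "a (e * s) t = p"
      then have "a (- (e * s)) p = t" using add[OF t(1), of "- (e * s)" "e * s"] a0[OF t(1)] by simp
      then show False using t(2) by blast
    qed
    then show ?thesis unfolding esc_def by (auto simp: image_iff)
  qed
  obtain u v where u: "u \<in> U" "u \<in> mspace X" "u \<noteq> p" and v: "v \<in> V" "v \<in> mspace X" "v \<noteq> p" using ne by blast
  have "t \<in> U \<or> t \<in> V" using UV(3) t(1) tp by blast
  then show False
  proof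
    assume "t \<in> U"
    then show False using some[OF v(2,3)] contra[OF _ t(1) tp esct v(1-3)] by fastforce
  next
    assume "t \<in> V"
    then show False using some[OF u(2,3)] contra[OF u(1-3) _ _ t(1) tp esct] by fastforce
  qed
qed

end

section \<open>Free ultrafilters\<close>

lemma ultrafilter_sequentially: assumes "nonprincipal_ultrafilter \<omega>" shows "\<omega> \<le> sequentially"
proof (rule filter_leI)
  fix P assume "eventually P sequentially"
  then obtain N where N: "\<And>n. n \<ge> N \<Longrightarrow> P n" by (auto simp: eventually_sequentially)
  have "eventually (\<lambda>n. n \<noteq> k) \<omega>" for k using assms unfolding nonprincipal_ultrafilter_def by blast
  then have "eventually (\<lambda>n. \<forall>k\<in>{..<N}. n \<noteq> k) \<omega>" by (intro eventually_ball_finite) auto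
  then show "eventually P \<omega>" by (rule eventually_mono) (use N in \<open>auto simp: not_less[symmetric]\<close>)
qed

text \<open>Smaller filters are finer, so an ultrafilter is a minimal proper filter; Zorn's lemma is
  applied to the reversed order below \<open>sequentially\<close>, which makes the result
  non-principal.\<close>

lemma ex_ultrafilter: "\<exists>\<omega>. nonprincipal_ultrafilter \<omega>"
proof -
  define A where "A = {F :: nat filter. F \<noteq> bot \<and> F \<le> sequentially}"
  have "\<exists>m\<in>A. \<forall>a\<in>A. a \<le> m \<longrightarrow> a = m"
  proof (rule predicate_Zorn)
    show "partial_order_on A (relation_of (\<lambda>F G. G \<le> F) A)"
      by (auto simp: partial_order_on_def preorder_on_def refl_on_def trans_def antisym_def relation_of_def)
    fix C assume C: "C \<in> Chains (relation_of (\<lambda>F G. G \<le> F) A)"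
    have CA: "C \<subseteq> A" and lin: "\<And>F G. F \<in> C \<Longrightarrow> G \<in> C \<Longrightarrow> F \<le> G \<or> G \<le> F"
      using C by (auto simp: Chains_def relation_of_def)
    show "\<exists>u\<in>A. \<forall>a\<in>C. u \<le> a"
    proof (cases "C = {}")
      case True
      then show ?thesis by (auto simp: A_def intro!: exI[of _ sequentially])
    next
      case False
      have fin: "\<exists>F\<in>C. F \<le> Inf Y" if "finite Y" "Y \<subseteq> C" for Y
        using that
      proof (induction Y)
        case empty then show ?case using False by auto
      next
        case (insert G Y)
        then obtain F where F: "F \<in> C" "F \<le> Inf Y" by auto
        then have "F \<le> G \<or> G \<le> F" using lin insert.prems by blast
        then show ?case using F insert.prems by (auto intro: order_trans bexI[of _ G])
      qed
      have "Inf C \<noteq> bot"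
      proof (rule Inf_filter_not_bot)
        fix Y assume "Y \<subseteq> C" "finite Y"
        then obtain F where "F \<in> C" "F \<le> Inf Y" using fin by blast
        moreover from this have "F \<noteq> bot" using CA by (auto simp: A_def)
        ultimately show "Inf Y \<noteq> bot" using bot_unique by metis
      qed
      moreover obtain F where "F \<in> C" using False by blast
      then have "Inf C \<le> sequentially" using CA by (intro Inf_lower2[of F]) (auto simp: A_def)
      ultimately show ?thesis using Inf_lower by (auto simp: A_def)
    qed
  qed
  then obtain \<omega> where \<omega>: "\<omega> \<noteq> bot" "\<omega> \<le> sequentially" "\<And>F. F \<noteq> bot \<Longrightarrow> F \<le> sequentially \<Longrightarrow> F \<le> \<omega> \<Longrightarrow> F = \<omega>"
    unfolding A_def by blast
  have "eventually P \<omega> \<or> eventually (\<lambda>n. \<not> P n) \<omega>" for P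
  proof (rule disjCI)
    assume no: "\<not> eventually (\<lambda>n. \<not> P n) \<omega>"
    let ?F = "inf \<omega> (principal {n. P n})"
    have "?F \<noteq> bot" using no by (simp add: trivial_limit_def eventually_inf_principal)
    then have "?F = \<omega>" using \<omega>(2,3) by (simp add: le_infI1)
    moreover have "eventually P ?F" by (simp add: eventually_inf_principal)
    ultimately show "eventually P \<omega>" by simp
  qed
  moreover have "\<not> eventually (\<lambda>n. n = k) \<omega>" for k
  proof
    assume "eventually (\<lambda>n. n = k) \<omega>"
    moreover have "eventually (\<lambda>n. n > k) \<omega>" using \<omega>(2) eventually_gt_at_top[of k] by (rule filter_leD)
    ultimately have "eventually (\<lambda>n. False) \<omega>" by (rule eventually_elim2) simp
    then show False using \<omega>(1) by (simp add: trivial_limit_def)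
  qed
  ultimately show ?thesis using \<omega>(1) unfolding nonprincipal_ultrafilter_def by blast
qed

section \<open>Cones of length functions\<close>

definition bounded_seq :: "('a \<Rightarrow> nat) \<Rightarrow> (nat \<Rightarrow> real) \<Rightarrow> (nat \<Rightarrow> 'a) \<Rightarrow> bool" where
  "bounded_seq len d u \<longleftrightarrow> bdd_above (range (\<lambda>n. real (len (u n)) / d n))"

text \<open>\<open>pt\<close> maps a bounded sequence of group elements to its point of the cone.
  This hides equivalence classes and representatives of cosets from the geometric arguments.\<close>

locale ucone = lenspace len for len :: "'a::grp \<Rightarrow> nat" +
  fixes \<omega> :: "nat filter" and d :: "nat \<Rightarrow> real" and X :: "'b metric" and pt :: "(nat \<Rightarrow> 'a) \<Rightarrow> 'b"
  assumes ultra: "nonprincipal_ultrafilter \<omega>" and scal: "scaling_sequence d"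
    and pts: "x \<in> mspace X \<longleftrightarrow> (\<exists>u. bounded_seq len d u \<and> x = pt u)"
    and lim: "bounded_seq len d u \<Longrightarrow> bounded_seq len d v \<Longrightarrow>
      ((\<lambda>n. real (len (inverse (u n) * v n)) / d n) \<longlongrightarrow> mdist X (pt u) (pt v)) \<omega>"
begin

sublocale ms: mspc X .

lemma ntriv: "\<omega> \<noteq> bot" using ultra by (simp add: nonprincipal_ultrafilter_def)

lemma dpos: "d n > 0" using scal by (simp add: scaling_sequence_def)

lemma seq: "eventually P sequentially \<Longrightarrow> eventually P \<omega>"
  using ultrafilter_sequentially[OF ultra] by (rule filter_leD)

lemma ev_ge: "eventually (\<lambda>n. real n \<ge> K) \<omega>"
  by (rule seq) (use eventually_ge_at_top[of "nat \<lceil>K\<rceil>"] in eventually_elim, linarith)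

lemma one_over_n: "((\<lambda>n. K / real n) \<longlongrightarrow> 0) \<omega>"
  using ultrafilter_sequentially[OF ultra] lim_const_over_n by (rule tendsto_mono)

lemma one_over_d: "((\<lambda>n. K / d n) \<longlongrightarrow> 0) \<omega>"
proof -
  have "filterlim d at_top sequentially"
    unfolding filterlim_at_top
  proof
    fix Z
    obtain N where N: "Z \<le> d N" using scal unfolding scaling_sequence_def bdd_above_def by (metis linear rangeE)
    have "mono d" using scal by (simp add: scaling_sequence_def)
    then have "Z \<le> d n" if "n \<ge> N" for n using N that by (meson monoD order_trans)
    then show "eventually (\<lambda>n. Z \<le> d n) sequentially" unfolding eventually_sequentially by blast
  qed
  then have "((\<lambda>n. K / d n) \<longlongrightarrow> 0) sequentially" by (intro real_tendsto_divide_at_top[of _ K]) auto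
  with ultrafilter_sequentially[OF ultra] show ?thesis by (rule tendsto_mono)
qed

lemma pt_in: "bounded_seq len d u \<Longrightarrow> pt u \<in> mspace X" using pts by blast

lemma pt_eq:
  assumes "bounded_seq len d u" "bounded_seq len d v" "((\<lambda>n. real (len (inverse (u n) * v n)) / d n) \<longlongrightarrow> 0) \<omega>"
  shows "pt u = pt v"
  using tendsto_unique[OF ntriv lim[OF assms(1,2)] assms(3)] pt_in assms by simp

lemma bd_close:
  assumes "bounded_seq len d u" "\<And>n. real (len (inverse (u n) * v n)) \<le> K * d n" shows "bounded_seq len d v"
proof -
  obtain C where C: "\<And>n. real (len (u n)) / d n \<le> C" using assms(1) by (auto simp: bounded_seq_def bdd_above_def)
  have "real (len (v n)) / d n \<le> C + K" for n
  proof -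
    have "len (v n) \<le> len (u n) + len (inverse (u n) * v n)" using len_mult[of "u n" "inverse (u n) * v n"] by (simp add: gsimps)
    moreover have "real (len (u n)) \<le> C * d n" using C[of n] dpos[of n] by (simp add: divide_le_eq)
    ultimately have "real (len (v n)) \<le> (C + K) * d n" using assms(2)[of n] by (simp add: algebra_simps)
    then show ?thesis using dpos[of n] by (simp add: divide_le_eq)
  qed
  then show ?thesis unfolding bounded_seq_def by (intro bdd_aboveI2)
qed

lemma close_zero:
  assumes "\<And>n. n \<ge> N \<Longrightarrow> real n > 0 \<Longrightarrow> \<bar>f n\<bar> \<le> K / real n" shows "(f \<longlongrightarrow> 0) \<omega>"
proof (rule Lim_null_comparison[OF _ one_over_n[of K]])
  show "eventually (\<lambda>n. norm (f n) \<le> K / real n) \<omega>"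
    by (rule seq) (use eventually_ge_at_top[of "max N 1"] in eventually_elim, use assms in auto)
qed

lemma geodesic: "geodesic_space X"
  unfolding geodesic_space_def
proof (intro ballI)
  fix x y assume "x \<in> mspace X" "y \<in> mspace X"
  then obtain u v where u: "bounded_seq len d u" "x = pt u" and v: "bounded_seq len d v" "y = pt v" using pts by metis
  define D where "D n = len (inverse (u n) * v n)" for n
  have "\<exists>\<gamma>. \<gamma> 0 = u n \<and> dd (\<gamma> (D n)) (v n) = 0 \<and> isgeo \<gamma> (D n)" for n
    using ex_geo[of "u n" "v n"] by (auto simp: dd_def D_def)
  then obtain \<gamma> where \<gamma>: "\<And>n. \<gamma> n 0 = u n" "\<And>n. dd (\<gamma> n (D n)) (v n) = 0" "\<And>n. isgeo (\<gamma> n) (D n)" by metis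
  define k where "k s n = min (nat \<lfloor>s * d n\<rfloor>) (D n)" for s n
  define c where "c s = pt (\<lambda>n. \<gamma> n (k s n))" for s
  define L where "L = mdist X x y"
  have L: "((\<lambda>n. real (D n) / d n) \<longlongrightarrow> L) \<omega>" unfolding L_def D_def u v by (rule lim[OF u(1) v(1)])
  have dist: "real (len (inverse (\<gamma> n i) * \<gamma> n j)) = \<bar>real i - real j\<bar>" if "i \<le> D n" "j \<le> D n" for n i j
  proof -
    have "int (len (inverse (\<gamma> n i) * \<gamma> n j)) = \<bar>int i - int j\<bar>" using \<gamma>(3)[of n] that unfolding isgeo_def dd_def by blast
    then show ?thesis by linarith
  qed
  have kD: "k s n \<le> D n" for s n by (simp add: k_def)
  have kle: "real (k s n) \<le> s * d n" if "0 \<le> s" for s n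
  proof -
    have "real (nat \<lfloor>s * d n\<rfloor>) \<le> s * d n" using that dpos[of n] by simp
    then show ?thesis unfolding k_def by linarith
  qed
  have bdc: "bounded_seq len d (\<lambda>n. \<gamma> n (k s n))" if "0 \<le> s" for s
    using bd_close[OF u(1), of "\<lambda>n. \<gamma> n (k s n)" s] dist[of 0 _ "k s _"] kD kle[OF that] by (simp add: \<gamma>(1))
  have klim: "((\<lambda>n. real (k s n) / d n) \<longlongrightarrow> s) \<omega>" if s: "s \<in> {0..L}" for s
  proof -
    have "((\<lambda>n. real (nat \<lfloor>s * d n\<rfloor>) / d n - s) \<longlongrightarrow> 0) \<omega>"
    proof (rule Lim_null_comparison[OF _ one_over_d[of 1]], intro always_eventually allI)
      fix n
      have "\<bar>real (nat \<lfloor>s * d n\<rfloor>) - s * d n\<bar> \<le> 1" using s dpos[of n] by (simp add: zero_le_mult_iff) linarith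
      moreover have "real (nat \<lfloor>s * d n\<rfloor>) / d n - s = (real (nat \<lfloor>s * d n\<rfloor>) - s * d n) / d n"
        using dpos[of n] by (simp add: field_simps)
      ultimately show "norm (real (nat \<lfloor>s * d n\<rfloor>) / d n - s) \<le> 1 / d n" using dpos[of n] by (simp add: divide_right_mono)
    qed
    then have "((\<lambda>n. min (real (nat \<lfloor>s * d n\<rfloor>) / d n) (real (D n) / d n)) \<longlongrightarrow> min s L) \<omega>"
      by (intro tendsto_min L) (simp add: LIM_zero_iff)
    moreover have "min (real (nat \<lfloor>s * d n\<rfloor>) / d n) (real (D n) / d n) = real (k s n) / d n" for n
      using dpos[of n] by (simp add: k_def min_def divide_le_cancel)
    ultimately show ?thesis using s by simp
  qed
  show "\<exists>c. c \<in> {0..mdist X x y} \<rightarrow> mspace X \<and> c 0 = x \<and> c (mdist X x y) = y \<and>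
        (\<forall>s\<in>{0..mdist X x y}. \<forall>t\<in>{0..mdist X x y}. mdist X (c s) (c t) = \<bar>s - t\<bar>)"
    unfolding L_def[symmetric]
  proof (intro exI[of _ c] conjI ballI)
    show "c \<in> {0..L} \<rightarrow> mspace X" unfolding c_def using bdc pt_in by auto
    show "c 0 = x" unfolding c_def u by (simp add: k_def \<gamma>(1))
    have L0: "0 \<le> L" by (simp add: L_def)
    show "c L = y" unfolding c_def v
    proof (rule pt_eq[OF bdc[OF L0] v(1)])
      have "len (inverse (\<gamma> n (k L n)) * v n) = D n - k L n" for n
      proof -
        have "dd (\<gamma> n (k L n)) (v n) = dd (\<gamma> n (k L n)) (\<gamma> n (D n))"
          using dd_tri[of "\<gamma> n (k L n)" "v n" "\<gamma> n (D n)"] dd_tri[of "\<gamma> n (k L n)" "\<gamma> n (D n)" "v n"] \<gamma>(2)[of n]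
            dd_sym[of "v n" "\<gamma> n (D n)"] by simp
        also have "\<dots> = int (D n) - int (k L n)" using isgeoD[OF \<gamma>(3) kD order_refl] .
        finally show ?thesis using kD[of L n] by (simp add: dd_def)
      qed
      then have "real (len (inverse (\<gamma> n (k L n)) * v n)) / d n = real (D n) / d n - real (k L n) / d n" for n
        using kD[of L n] by (simp add: of_nat_diff diff_divide_distrib)
      moreover have "((\<lambda>n. real (D n) / d n - real (k L n) / d n) \<longlongrightarrow> L - L) \<omega>"
        by (intro tendsto_diff L klim) (use L0 in auto)
      ultimately show "((\<lambda>n. real (len (inverse (\<gamma> n (k L n)) * v n)) / d n) \<longlongrightarrow> 0) \<omega>" by simp
    qed
    fix s t assume st: "s \<in> {0..L}" "t \<in> {0..L}"
    have "((\<lambda>n. \<bar>real (k s n) / d n - real (k t n) / d n\<bar>) \<longlongrightarrow> \<bar>s - t\<bar>) \<omega>"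
      by (intro tendsto_intros klim st)
    moreover have "\<bar>real (k s n) / d n - real (k t n) / d n\<bar> = real (len (inverse (\<gamma> n (k s n)) * \<gamma> n (k t n))) / d n" for n
      using dist[OF kD[of s n] kD[of t n]] dpos[of n] by (simp flip: diff_divide_distrib)
    ultimately show "mdist X (c s) (c t) = \<bar>s - t\<bar>"
      unfolding c_def using tendsto_unique[OF ntriv lim[OF bdc bdc]] st by simp
  qed
qed

text \<open>After left multiplication moves the base point to 1, the representatives lie in the ball
  of radius \<open>n * d n\<close> for almost all \<open>n\<close>, and the error
  \<open>\<delta> n / d n\<close> tends to 0.\<close>

lemma tree:
  assumes b4: "\<And>n x y z. real (len x) \<le> n * d n \<Longrightarrow> real (len y) \<le> n * d n \<Longrightarrow> real (len z) \<le> n * d n \<Longrightarrow>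
      min (real (len x) + real (len y) - real (len (inverse x * y))) (real (len y) + real (len z) - real (len (inverse y * z))) - \<delta> n
      \<le> real (len x) + real (len z) - real (len (inverse x * z))"
    and \<delta>: "\<And>n. 0 \<le> \<delta> n \<and> real n * \<delta> n \<le> d n"
  shows "real_tree X"
proof (rule ms.real_tree_of_four_point[OF geodesic])
  fix w x y z assume "w \<in> mspace X" "x \<in> mspace X" "y \<in> mspace X" "z \<in> mspace X"
  then obtain p q r s where bds: "bounded_seq len d p" "bounded_seq len d q" "bounded_seq len d r" "bounded_seq len d s"
    and eq: "w = pt p" "x = pt q" "y = pt r" "z = pt s" using pts by metis
  let ?l = "\<lambda>u v n. real (len (inverse (u n) * v n)) / d n"
  have \<delta>0: "((\<lambda>n. \<delta> n / d n) \<longlongrightarrow> 0) \<omega>"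
  proof (rule close_zero[of 0 _ 1])
    fix n assume "real n > 0"
    then show "\<bar>\<delta> n / d n\<bar> \<le> 1 / real n" using \<delta>[of n] dpos[of n] by (simp add: field_simps)
  qed
  have small: "eventually (\<lambda>n. real (len (inverse (p n) * v n)) \<le> n * d n) \<omega>" if v: "bounded_seq len d v" for v
  proof -
    have "eventually (\<lambda>n. ?l p v n < mdist X (pt p) (pt v) + 1) \<omega>"
      using lim[OF bds(1) v] by (rule order_tendstoD) simp
    moreover have "eventually (\<lambda>n. mdist X (pt p) (pt v) + 1 \<le> real n) \<omega>" by (rule ev_ge)
    ultimately show ?thesis
    proof eventually_elim
      case (elim n)
      then have "?l p v n \<le> real n" by linarith
      then show ?case using dpos[of n] by (simp add: divide_le_eq)
    qed
  qed
  have "eventually (\<lambda>n. min (?l p q n + ?l p r n - ?l q r n) (?l p r n + ?l p s n - ?l r s n) - \<delta> n / d n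
     \<le> ?l p q n + ?l p s n - ?l q s n) \<omega>"
    using small[OF bds(2)] small[OF bds(3)] small[OF bds(4)]
  proof eventually_elim
    case (elim n)
    have sh: "inverse (inverse (p n) * u) * (inverse (p n) * v) = inverse u * v" for u v by (simp add: gsimps)
    have mi: "min (a / d n) (b / d n) = min a b / d n" for a b using dpos[of n] by (simp add: min_def divide_le_cancel)
    show ?case using divide_right_mono[OF b4[OF elim] less_imp_le[OF dpos[of n]]]
      unfolding sh by (simp add: add_divide_distrib diff_divide_distrib mi[symmetric])
  qed
  moreover have "((\<lambda>n. min (?l p q n + ?l p r n - ?l q r n) (?l p r n + ?l p s n - ?l r s n) - \<delta> n / d n) \<longlongrightarrow>
    min (ms.prd w x y) (ms.prd w y z) - 0) \<omega>"
    unfolding ms.prd_def eq by (intro tendsto_diff tendsto_min tendsto_add lim bds \<delta>0)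
  moreover have "((\<lambda>n. ?l p q n + ?l p s n - ?l q s n) \<longlongrightarrow> ms.prd w x z) \<omega>"
    unfolding ms.prd_def eq by (intro tendsto_diff tendsto_add lim bds)
  ultimately have "min (ms.prd w x y) (ms.prd w y z) - 0 \<le> ms.prd w x z" by (intro tendsto_le[OF ntriv])
  then show "min (ms.prd w x y) (ms.prd w y z) \<le> ms.prd w x z" by simp
qed

text \<open>Left multiplication by the power of \<open>z n\<close> with exponent about
  \<open>s * d n / \<tau> n\<close> converges to the translation by \<open>s\<close>. The estimate
  is required for all conjugates because conjugates measure the displacement of arbitrary
  points.\<close>

lemma no_cut:
  assumes \<tau>: "\<And>n. 0 < \<tau> n" "\<And>n. 0 \<le> c n" and sm: "\<And>n. real n * (\<tau> n + c n + 1) \<le> d n"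
    and J: "\<And>n. real n * d n \<le> \<tau> n * real (J n)"
    and est: "\<And>n g i. \<bar>i\<bar> \<le> int (J n) \<Longrightarrow> \<tau> n * \<bar>real_of_int i\<bar> - c n \<le> real (len (inverse g * z n powi i * g)) \<and>
      real (len (inverse g * z n powi i * g)) \<le> 2 * \<tau> n * \<bar>real_of_int i\<bar> + c n"
    and off: "\<And>n. \<exists>t. real (len t) \<le> d n \<and> (\<forall>g i. d n \<le> real (len (inverse t * (inverse g * z n powi i * g))))"
  shows "\<not> cut_point (mtopology_of X) p"
proof -
  \<comment> \<open>The guard replaces the exponent by 0 for finitely many \<open>n\<close>, where
    it could exceed \<open>J n\<close>; the sequences are then bounded for every \<open>n\<close>,
    and the limit is unaffected.\<close>
  define e where "e n s = (if \<bar>s\<bar> + 1 \<le> real n then \<lfloor>s * d n / \<tau> n\<rfloor> else 0)" for n s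
  have sm': "\<tau> n + c n \<le> d n / real n" if "real n > 0" for n
  proof -
    have "(\<tau> n + c n) * real n \<le> d n" using sm[of n] that by (simp add: algebra_simps)
    then show ?thesis using that by (simp add: le_divide_eq)
  qed
  have sm1: "\<tau> n + c n \<le> d n" if "real n > 0" for n
  proof -
    have "1 * (\<tau> n + c n + 1) \<le> real n * (\<tau> n + c n + 1)" using that \<tau>[of n] by (intro mult_right_mono) auto
    then show ?thesis using sm[of n] by simp
  qed
  have te: "\<bar>\<tau> n * \<bar>real_of_int (e n s)\<bar> - \<bar>s\<bar> * d n\<bar> \<le> \<tau> n" if "\<bar>s\<bar> + 1 \<le> real n" for n s
  proof -
    have "\<bar>\<bar>real_of_int (e n s)\<bar> - \<bar>s * d n / \<tau> n\<bar>\<bar> \<le> 1" 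
    proof -
      have "\<bar>real_of_int \<lfloor>y\<rfloor> - y\<bar> \<le> 1" for y :: real by linarith
      then have "\<bar>\<bar>real_of_int \<lfloor>y\<rfloor>\<bar> - \<bar>y\<bar>\<bar> \<le> 1" for y :: real by (meson abs_triangle_ineq3 order_trans)
      then show ?thesis using that unfolding e_def by (simp only: if_True)
    qed
    then have "\<tau> n * \<bar>\<bar>real_of_int (e n s)\<bar> - \<bar>s * d n / \<tau> n\<bar>\<bar> \<le> \<tau> n" using \<tau>(1)[of n] by (intro mult_left_le) auto
    moreover have "\<tau> n * \<bar>s * d n / \<tau> n\<bar> = \<bar>s\<bar> * d n" using \<tau>(1)[of n] dpos[of n] by (simp add: abs_mult)
    ultimately show ?thesis using \<tau>(1)[of n] by (metis abs_mult abs_of_pos right_diff_distrib)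
  qed
  have eJ: "\<bar>e n s\<bar> \<le> int (J n)" for n s
  proof (cases "\<bar>s\<bar> + 1 \<le> real n")
    case True
    then have n: "real n > 0" by linarith
    have "(\<bar>s\<bar> + 1) * d n \<le> real n * d n" using True dpos[of n] by (intro mult_right_mono) auto
    then have "\<tau> n * \<bar>real_of_int (e n s)\<bar> \<le> \<tau> n * real (J n)"
      using te[OF True] J[of n] sm1[OF n] \<tau>(2)[of n] by (simp add: algebra_simps)
    then show ?thesis using \<tau>(1)[of n] by simp
  qed (simp add: e_def)
  have lu: "\<bar>s\<bar> * d n - \<tau> n - c n \<le> real (len (inverse g * z n powi e n s * g))"
    "real (len (inverse g * z n powi e n s * g)) \<le> 2 * (\<bar>s\<bar> * d n) + 2 * \<tau> n + 2 * c n" if "\<bar>s\<bar> + 1 \<le> real n" for g n s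
  proof -
    define T where "T = \<tau> n * \<bar>real_of_int (e n s)\<bar>"
    have "2 * \<tau> n * \<bar>real_of_int (e n s)\<bar> = 2 * T" by (simp add: T_def)
    then have "T - c n \<le> real (len (inverse g * z n powi e n s * g))" "real (len (inverse g * z n powi e n s * g)) \<le> 2 * T + c n"
      using est[OF eJ[of n s], of g] unfolding T_def by linarith+
    moreover have "\<bar>T - \<bar>s\<bar> * d n\<bar> \<le> \<tau> n" unfolding T_def by (rule te[OF that])
    ultimately show "\<bar>s\<bar> * d n - \<tau> n - c n \<le> real (len (inverse g * z n powi e n s * g))"
      "real (len (inverse g * z n powi e n s * g)) \<le> 2 * (\<bar>s\<bar> * d n) + 2 * \<tau> n + 2 * c n"
      using \<tau>(2)[of n] by linarith+
  qed
  have upper: "real (len (inverse g * z n powi e n s * g)) \<le> (2 * \<bar>s\<bar> + 3) * d n" for g n s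
  proof (cases "\<bar>s\<bar> + 1 \<le> real n")
    case True
    then have n: "real n > 0" by linarith
    then show ?thesis using lu(2)[OF True, of g] sm1[OF n] dpos[of n] by (simp add: algebra_simps)
  next
    case False
    then show ?thesis using dpos[of n] by (simp add: e_def gsimps)
  qed
  define rep where "rep x = (SOME u. bounded_seq len d u \<and> x = pt u)" for x
  have rep: "bounded_seq len d (rep x)" "x = pt (rep x)" if "x \<in> mspace X" for x
    using someI_ex[of "\<lambda>u. bounded_seq len d u \<and> x = pt u"] that pts unfolding rep_def by blast+
  define a where "a s x = pt (\<lambda>n. z n powi e n s * rep x n)" for s x
  have bda: "bounded_seq len d (\<lambda>n. z n powi e n s * u n)" if "bounded_seq len d u" for s u
    using that by (rule bd_close) (use upper in \<open>simp add: mult.assoc\<close>)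
  have sh: "inverse (g * x) * (g * y) = inverse x * y" for g x y :: 'a by (simp add: gsimps)
  have aiso: "mdist X (pt (\<lambda>n. z n powi e n s * u n)) (pt (\<lambda>n. z n powi e n s * v n)) = mdist X (pt u) (pt v)"
    if "bounded_seq len d u" "bounded_seq len d v" for s u v
    using tendsto_unique[OF ntriv lim[OF bda[OF that(1)] bda[OF that(2)]]] lim[OF that] by (simp add: sh)
  have apt: "a s (pt u) = pt (\<lambda>n. z n powi e n s * u n)" if u: "bounded_seq len d u" for s u
  proof -
    note r = rep[OF pt_in[OF u]]
    have "mdist X (a s (pt u)) (pt (\<lambda>n. z n powi e n s * u n)) = mdist X (pt u) (pt u)"
      unfolding a_def using aiso[OF r(1) u] r(2) by simp
    then show ?thesis unfolding a_def using pt_in bda r(1) u by simp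
  qed
  show ?thesis
  proof (rule ms.no_cut_point[OF geodesic, of a])
    show "a s x \<in> mspace X" if "x \<in> mspace X" for s x unfolding a_def using pt_in bda rep that by blast
    show "mdist X (a s x) (a s y) = mdist X x y" if "x \<in> mspace X" "y \<in> mspace X" for s x y
      unfolding a_def using aiso rep that by simp
    show "a s (a t x) = a (s + t) x" if "x \<in> mspace X" for s t x
    proof -
      note u = rep[OF that]
      let ?u = "rep x"
      have "a s (a t x) = a s (pt (\<lambda>n. z n powi e n t * ?u n))" unfolding a_def[of t] ..
      also have "\<dots> = pt (\<lambda>n. z n powi e n s * (z n powi e n t * ?u n))" by (rule apt[OF bda[OF u(1)]])
      also have "\<dots> = pt (\<lambda>n. z n powi e n (s + t) * ?u n)"
      proof (rule pt_eq[OF bda[OF bda[OF u(1)]] bda[OF u(1)]], rule close_zero)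
        fix n assume n: "nat \<lceil>\<bar>s\<bar> + \<bar>t\<bar> + 1\<rceil> \<le> n" "real n > 0"
        \<comment> \<open>Rounding is additive up to one, and one power of \<open>z n\<close> moves
          a point by at most \<open>2 * d n / n\<close>, which vanishes at scale
          \<open>d n\<close>.\<close>
        define k where "k = e n (s + t) - e n s - e n t"
        have ple: "z n powi e n t * (z n powi e n s * y) = z n powi e n s * (z n powi e n t * y)" for y
          by (metis powi_add add.commute mult.assoc)
        have big: "\<bar>s\<bar> + \<bar>t\<bar> + 1 \<le> real n" using n by linarith
        have "s * d n / \<tau> n + t * d n / \<tau> n = (s + t) * d n / \<tau> n" by (simp add: add_divide_distrib distrib_right)
        moreover have "e n s = \<lfloor>s * d n / \<tau> n\<rfloor>" "e n t = \<lfloor>t * d n / \<tau> n\<rfloor>" "e n (s + t) = \<lfloor>(s + t) * d n / \<tau> n\<rfloor>"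
          using big unfolding e_def by auto
        ultimately have "\<bar>k\<bar> \<le> 1" unfolding k_def by linarith
        note k = this
        have "0 < real n * d n" using n(2) dpos[of n] by simp
        then have "0 < \<tau> n * real (J n)" using J[of n] by linarith
        then have "J n \<noteq> 0" by (intro notI) simp
        then have kJ: "\<bar>k\<bar> \<le> int (J n)" using k by linarith
        have "e n (s + t) = e n t + e n s + k" by (simp add: k_def)
        then have pw: "z n powi e n (s + t) = z n powi e n s * z n powi e n t * z n powi k"
          by (metis powi_add add.commute)
        have "inverse (z n powi e n s * (z n powi e n t * ?u n)) * (z n powi e n (s + t) * ?u n) = inverse (?u n) * z n powi k * ?u n"
          unfolding pw by (simp add: gsimps)
        moreover have "real (len (inverse (?u n) * z n powi k * ?u n)) \<le> 2 * (d n / real n)"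
        proof -
          have "\<tau> n * \<bar>real_of_int k\<bar> \<le> \<tau> n * 1" using k \<tau>(1)[of n] by (intro mult_left_mono) auto
          then show ?thesis using est[OF kJ, of "?u n"] sm'[OF n(2)] \<tau>(2)[of n] by linarith
        qed
        then have "real (len (inverse (?u n) * z n powi k * ?u n)) / d n \<le> 2 / real n"
          using dpos[of n] n(2) by (simp add: field_simps)
        ultimately show "\<bar>real (len (inverse (z n powi e n s * (z n powi e n t * ?u n)) * (z n powi e n (s + t) * ?u n))) / d n\<bar> \<le> 2 / real n"
          using dpos[of n] by simp
      qed
      also have "\<dots> = a (s + t) x" unfolding a_def ..
      finally show ?thesis .
    qed
    show "\<bar>s\<bar> \<le> mdist X (a s x) x \<and> mdist X (a s x) x \<le> 2 * \<bar>s\<bar>" if "x \<in> mspace X" for s x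
    proof -
      note u = rep[OF that]
      let ?u = "rep x"
      let ?f = "\<lambda>n. real (len (inverse (z n powi e n s * ?u n) * ?u n)) / d n"
      have l: "(?f \<longlongrightarrow> mdist X (a s x) x) \<omega>" using lim[OF bda[OF u(1)] u(1), of s] u(2) by (simp add: a_def)
      have fe: "?f n = real (len (inverse (?u n) * z n powi e n s * ?u n)) / d n" for n
        using len_inv[of "inverse (?u n) * z n powi e n s * ?u n"] by (simp add: gsimps)
      have ev: "eventually (\<lambda>n. \<bar>s\<bar> - 1 / real n \<le> ?f n \<and> ?f n \<le> 2 * \<bar>s\<bar> + 2 / real n) \<omega>"
        using ev_ge[of "\<bar>s\<bar> + 1"]
      proof eventually_elim
        case (elim n)
        then have n: "real n > 0" by linarith
        have "(\<bar>s\<bar> - 1 / real n) * d n \<le> real (len (inverse (?u n) * z n powi e n s * ?u n))"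
          using lu(1)[OF elim, of "?u n"] sm'[OF n] by (simp add: algebra_simps)
        moreover have "real (len (inverse (?u n) * z n powi e n s * ?u n)) \<le> (2 * \<bar>s\<bar> + 2 / real n) * d n"
        proof -
          have "(2 * \<bar>s\<bar> + 2 / real n) * d n = 2 * (\<bar>s\<bar> * d n) + 2 * (d n / real n)" by (simp add: algebra_simps)
          then show ?thesis using lu(2)[OF elim, of "?u n"] sm'[OF n] by linarith
        qed
        ultimately show ?case unfolding fe using dpos[of n] by (simp add: pos_le_divide_eq pos_divide_le_eq)
      qed
      have "((\<lambda>n. \<bar>s\<bar> - 1 / real n) \<longlongrightarrow> \<bar>s\<bar> - 0) \<omega>" by (intro tendsto_diff tendsto_const one_over_n)
      moreover have "((\<lambda>n. 2 * \<bar>s\<bar> + 2 / real n) \<longlongrightarrow> 2 * \<bar>s\<bar> + 0) \<omega>" by (intro tendsto_add tendsto_const one_over_n)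
      moreover have "eventually (\<lambda>n. \<bar>s\<bar> - 1 / real n \<le> ?f n) \<omega>" "eventually (\<lambda>n. ?f n \<le> 2 * \<bar>s\<bar> + 2 / real n) \<omega>"
        using ev by (auto elim: eventually_mono)
      ultimately show ?thesis using tendsto_le[OF ntriv l, of "\<lambda>n. \<bar>s\<bar> - 1 / real n" "\<bar>s\<bar>"]
        tendsto_le[OF ntriv _ l, of "\<lambda>n. 2 * \<bar>s\<bar> + 2 / real n" "2 * \<bar>s\<bar>"] by simp
    qed
    show "\<exists>y\<in>mspace X. \<forall>s. a s x \<noteq> y" if "x \<in> mspace X" for x
    proof -
      note u = rep[OF that]
      let ?u = "rep x"
      obtain t where t: "\<And>n. real (len (t n)) \<le> d n" "\<And>n g i. d n \<le> real (len (inverse (t n) * (inverse g * z n powi i * g)))"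
        using off by metis
      \<comment> \<open>Right multiplication by \<open>t n\<close> moves the representative of
        \<open>x\<close> by at most \<open>d n\<close>, while \<open>off\<close> keeps the result at
        distance at least \<open>d n\<close> from every translate.\<close>
      have b: "bounded_seq len d (\<lambda>n. ?u n * t n)"
        using u(1) by (rule bd_close[of _ _ 1]) (use t(1) in \<open>simp add: inv_cancel_left\<close>)
      have "a s x \<noteq> pt (\<lambda>n. ?u n * t n)" for s
      proof
        assume eq: "a s x = pt (\<lambda>n. ?u n * t n)"
        have "((\<lambda>n. real (len (inverse (z n powi e n s * ?u n) * (?u n * t n))) / d n) \<longlongrightarrow> mdist X (a s x) (pt (\<lambda>n. ?u n * t n))) \<omega>"
          using lim[OF bda[OF u(1)] b, of s] by (simp add: a_def)
        moreover have "1 \<le> real (len (inverse (z n powi e n s * ?u n) * (?u n * t n))) / d n" for n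
        proof -
          have "len (inverse (z n powi e n s * ?u n) * (?u n * t n)) = len (inverse (t n) * (inverse (?u n) * z n powi e n s * ?u n))"
            using len_inv[of "inverse (t n) * (inverse (?u n) * z n powi e n s * ?u n)"] by (simp add: gsimps)
          then show ?thesis using t(2)[of n "?u n" "e n s"] dpos[of n] by simp
        qed
        ultimately have "1 \<le> mdist X (a s x) (pt (\<lambda>n. ?u n * t n))"
          by (intro tendsto_lowerbound[OF _ _ ntriv]) (auto intro: always_eventually)
        moreover have "mdist X (a s x) (pt (\<lambda>n. ?u n * t n)) = 0" unfolding eq using pt_in[OF b] by simp
        ultimately show False by simp
      qed
      then show ?thesis using pt_in[OF b] by blast
    qed
  qed
qed

end

section \<open>The quotient as a group on the natural numbers\<close>

locale coded = fixes A :: "fg set" assumes nA: "nsub A"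
begin

text \<open>Each coset is named by the number of a chosen representative. The choice depends on the
  coset only, so the quotient becomes a group on natural numbers.\<close>

definition code :: "fg \<Rightarrow> nat" where "code x = to_nat (SOME y. inverse x * y \<in> A)"

definition dec :: "nat \<Rightarrow> fg" where "dec = from_nat"

lemma dec_code: "inverse x * dec (code x) \<in> A"
proof -
  have "inverse x * (SOME y. inverse x * y \<in> A) \<in> A"
    by (rule someI[of _ x]) (simp add: left_inv nsubD(1)[OF nA])
  then show ?thesis by (simp add: dec_def code_def)
qed

lemma code_eq: "code x = code y \<longleftrightarrow> inverse x * y \<in> A"
proof
  assume "code x = code y"
  then have "inverse y * dec (code x) \<in> A" using dec_code[of y] by simp
  then have "inverse x * dec (code x) * inverse (inverse y * dec (code x)) \<in> A" using dec_code nsubD(2,3)[OF nA] by blast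
  then show "inverse x * y \<in> A" by (simp add: gsimps)
next
  assume a: "inverse x * y \<in> A"
  have "inverse x * z \<in> A \<longleftrightarrow> inverse y * z \<in> A" for z
    using subgr_mult_left[OF nsub_subgr[OF nA] a, of "inverse y * z"] by (simp add: gsimps)
  then show "code x = code y" by (simp add: code_def)
qed

definition Q :: "nat monoid" where
  "Q = \<lparr>carrier = range code, mult = (\<lambda>a b. code (dec a * dec b)), one = code 1\<rparr>"

definition Qgens :: "nat set" where "Qgens = code ` gens"

lemma Q_simps [simp]: "carrier Q = range code" "\<one>\<^bsub>Q\<^esub> = code 1" by (simp_all add: Q_def)

lemma Q_mult [simp]: "code x \<otimes>\<^bsub>Q\<^esub> code y = code (x * y)"
proof -
  have "inverse (x * y) * (dec (code x) * dec (code y)) = inverse y * (inverse x * dec (code x)) * y * (inverse y * dec (code y))"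
    by (simp add: gsimps)
  also have "\<dots> \<in> A" using dec_code nsubD(2,5)[OF nA] by blast
  finally have "code (x * y) = code (dec (code x) * dec (code y))" by (simp only: code_eq)
  then show ?thesis by (simp add: Q_def)
qed

lemma group_Q: "group Q"
proof (rule groupI)
  fix a assume "a \<in> carrier Q"
  then obtain x where x: "a = code x" by auto
  show "\<exists>b\<in>carrier Q. b \<otimes>\<^bsub>Q\<^esub> a = \<one>\<^bsub>Q\<^esub>" by (intro bexI[of _ "code (inverse x)"]) (auto simp: x left_inv)
qed (auto simp: mult.assoc)

lemma Q_inv [simp]: "inv\<^bsub>Q\<^esub> code x = code (inverse x)"
  by (rule group.inv_equality[OF group_Q]) (auto simp: left_inv)

lemma Q_foldr: "foldr (\<lambda>x y. x \<otimes>\<^bsub>Q\<^esub> y) (map code ts) \<one>\<^bsub>Q\<^esub> = code (prod_list ts)"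
  by (induction ts) auto

lemma Q_pow: "code x [^]\<^bsub>Q\<^esub> (n::nat) = code (x ^ n)"
proof (induction n)
  case 0
  interpret group Q by (rule group_Q)
  show ?case by simp
next
  case (Suc n)
  interpret group Q by (rule group_Q)
  show ?case by (simp only: nat_pow_Suc Suc Q_mult power_Suc2)
qed

lemma letters_Q: "Qgens \<union> (\<lambda>s. inv\<^bsub>Q\<^esub> s) ` Qgens = code ` gens"
proof -
  have "inverse t \<in> gens" if "t \<in> gens" for t using genset_gens that by (simp add: genset_def)
  then show ?thesis by (auto simp: Qgens_def)
qed

lemma represents_Q: "represents Q Qgens w (code x) \<longleftrightarrow> (\<exists>ts. w = map code ts \<and> set ts \<subseteq> gens \<and> inverse x * prod_list ts \<in> A)"
proof
  assume a: "represents Q Qgens w (code x)"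
  then have "w \<in> lists (code ` gens)" unfolding represents_def letters_Q by auto
  then obtain ts where ts: "set ts \<subseteq> gens" "w = map code ts" unfolding lists_image by auto
  then have "code x = code (prod_list ts)" using a unfolding represents_def ts(2) Q_foldr by simp
  then show "\<exists>ts. w = map code ts \<and> set ts \<subseteq> gens \<and> inverse x * prod_list ts \<in> A" using ts code_eq by blast
next
  assume "\<exists>ts. w = map code ts \<and> set ts \<subseteq> gens \<and> inverse x * prod_list ts \<in> A"
  then obtain ts where ts: "w = map code ts" "set ts \<subseteq> gens" "code x = code (prod_list ts)" using code_eq by blast
  show "represents Q Qgens w (code x)" unfolding represents_def letters_Q ts(1,3) Q_foldr using ts(2) by auto
qed

lemma word_length_Q: "word_length Q Qgens (code x) = W A x"
proof -
  have "(\<exists>w. length w = n \<and> represents Q Qgens w (code x)) \<longleftrightarrow> (\<exists>y\<in>prods gens n. inverse x * y \<in> A)" (is "?L \<longleftrightarrow> ?R") for n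
  proof
    assume ?L
    then obtain ts where "length ts = n" "set ts \<subseteq> gens" "inverse x * prod_list ts \<in> A" unfolding represents_Q by auto
    then show ?R by (intro bexI[of _ "prod_list ts"]) (auto simp: prods_def)
  next
    assume ?R
    then obtain ts where "length ts = n" "set ts \<subseteq> gens" "inverse x * prod_list ts \<in> A" by (auto simp: prods_def)
    then show ?L unfolding represents_Q by (intro exI[of _ "map code ts"]) auto
  qed
  then show ?thesis by (simp add: word_length_def wl_def)
qed

lemma word_dist_Q: "word_dist Q Qgens (code x) (code y) = real (W A (inverse x * y))"
  by (simp add: word_dist_def word_length_Q)

lemma generating_Q: "generating_set Q Qgens"
proof -
  interpret group Q by (rule group_Q)
  have sub: "Qgens \<subseteq> carrier Q" by (auto simp: Qgens_def)
  have "code (prod_list ts) \<in> generate Q Qgens" if "set ts \<subseteq> gens" for ts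
    using that
  proof (induction ts)
    case Nil
    have "\<one>\<^bsub>Q\<^esub> \<in> generate Q Qgens" by (rule generate.one)
    then show ?case by simp
  next
    case (Cons t ts)
    then have "code t \<otimes>\<^bsub>Q\<^esub> code (prod_list ts) \<in> generate Q Qgens"
      by (intro generate.eng[OF generate.incl]) (auto simp: Qgens_def)
    then show ?case by simp
  qed
  moreover have "\<exists>ts. set ts \<subseteq> gens \<and> x = prod_list ts" for x
    using fg_prod[of x] by (intro exI[of _ "map gen (word x)"]) (auto simp: gens_def)
  ultimately have "code x \<in> generate Q Qgens" for x by metis
  then have "carrier Q \<subseteq> generate Q Qgens" by auto
  then show ?thesis using sub generate_in_carrier[OF sub] by (auto simp: generating_set_def)
qed

sublocale fg_group Q Qgens
  by (rule fg_group.intro[OF group_Q]) (unfold_locales, rule generating_Q)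

lemma torsion_Q: assumes "\<And>w. \<exists>k>0. w ^ k \<in> A" shows "torsion_group Q"
  unfolding torsion_group_def
proof (intro conjI group_Q ballI)
  fix a assume "a \<in> carrier Q"
  then obtain x where x: "a = code x" by auto
  obtain k where k: "k > 0" "x ^ k \<in> A" using assms by blast
  have "code 1 = code (x ^ k)" using k(2) by (simp add: code_eq gsimps)
  then show "\<exists>n>0. a [^]\<^bsub>Q\<^esub> (n::nat) = \<one>\<^bsub>Q\<^esub>" using k(1) Q_pow[of x k] x by auto
qed

lemma infinite_Q: assumes "\<And>n. \<exists>x. n \<le> W A x" shows "infinite (carrier Q)"
proof
  assume "finite (carrier Q)"
  then have "finite (word_length Q Qgens ` carrier Q)" by simp
  then obtain n where n: "\<And>a. a \<in> carrier Q \<Longrightarrow> word_length Q Qgens a < n"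
    using finite_nat_set_iff_bounded by auto
  obtain x where "n \<le> W A x" using assms by blast
  then show False using n[of "code x"] by (simp add: word_length_Q)
qed

lemma cone_Q:
  assumes "nonprincipal_ultrafilter \<omega>" "scaling_sequence d"
  shows "ucone (wl gens A) \<omega> d (asymptotic_cone \<omega> Q Qgens d) (\<lambda>u. cone_rel \<omega> Q Qgens d `` {\<lambda>n. code (u n)})"
proof -
  interpret cone_data Q Qgens \<omega> d by unfold_locales (use assms in auto)
  interpret lenspace "wl gens A" by (rule W_lenspace[OF nA])
  have dist1: "word_dist Q Qgens \<one>\<^bsub>Q\<^esub> (code x) = real (W A x)" for x
    using word_dist_Q[of 1 x] by (simp add: gsimps)
  have seq: "(\<lambda>n. code (u n)) \<in> cone_sequences Q Qgens d \<longleftrightarrow> bounded_seq (wl gens A) d u" for u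
    unfolding cone_sequences_def bounded_seq_def using dist1 by simp
  have ex: "\<exists>u. bounded_seq (wl gens A) d u \<and> g = (\<lambda>n. code (u n))" if g: "g \<in> cone_sequences Q Qgens d" for g
  proof -
    have "\<forall>n. \<exists>x. g n = code x" using g by (auto simp: cone_sequences_def)
    then obtain u where "g = (\<lambda>n. code (u n))" by metis
    then show ?thesis using seq g by blast
  qed
  show ?thesis
  proof
    show "x \<in> mspace (asymptotic_cone \<omega> Q Qgens d) \<longleftrightarrow> (\<exists>u. bounded_seq (wl gens A) d u \<and> x = cone_rel \<omega> Q Qgens d `` {\<lambda>n. code (u n)})" for x
      unfolding mspace_cone using cone_points_cases[of x] ex seq class_in_cone_points by metis
    fix u v assume "bounded_seq (wl gens A) d u" "bounded_seq (wl gens A) d v"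
    then show "((\<lambda>n. real (W A (inverse (u n) * v n)) / d n) \<longlongrightarrow>
      mdist (asymptotic_cone \<omega> Q Qgens d) (cone_rel \<omega> Q Qgens d `` {\<lambda>n. code (u n)}) (cone_rel \<omega> Q Qgens d `` {\<lambda>n. code (v n)})) \<omega>"
      using cone_dist_class[of "\<lambda>n. code (u n)" "\<lambda>n. code (v n)"] unfolding mdist_cone seq word_dist_Q by blast
  qed (use assms in auto)
qed

end

text \<open>The index is shifted by one because \<open>d 0\<close> may be 0.\<close>

lemma scaling_between:
  assumes b: "\<And>n. b n \<le> (b (Suc n) :: nat)" and d: "\<And>n. b n \<le> d n \<and> d n \<le> b (Suc n) \<and> n \<le> d n"
  shows "scaling_sequence (\<lambda>n. real (d (Suc n)))"
proof -
  have "d n \<le> d (Suc n)" for n using d[of n] d[of "Suc n"] by linarith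
  then have "mono (\<lambda>n. real (d (Suc n)))" by (intro monoI) (simp add: lift_Suc_mono_le)
  moreover have "\<not> bdd_above (range (\<lambda>n. real (d (Suc n))))"
  proof
    assume "bdd_above (range (\<lambda>n. real (d (Suc n))))"
    then obtain C where C: "\<And>n. real (d (Suc n)) \<le> C" by (auto simp: bdd_above_def)
    show False using C[of "nat \<lceil>C\<rceil>"] d[of "Suc (nat \<lceil>C\<rceil>)"] by linarith
  qed
  moreover have "0 < real (d (Suc n))" for n using d[of "Suc n"] by linarith
  ultimately show ?thesis by (simp add: scaling_sequence_def)
qed

theorem theorem1p14:
  shows "\<exists>(G :: nat monoid) S.
           group G \<and> infinite (carrier G) \<and> finite S \<and> generating_set G S \<and>
           torsion_group G \<and> lacunary_hyperbolic G S \<and>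
           (\<exists>X. is_asymptotic_cone_of X G S \<and> (\<nexists>p. cut_point (mtopology_of X) p))"
proof -
  obtain A P b where nA: "nsub A" and nP: "nsub P" and AP: "A \<subseteq> P" and tor: "\<And>w. \<exists>k>0. w ^ k \<in> A" and unb: "\<And>n. \<exists>x. W P x = n"
    and b: "\<And>n. b n < b (Suc n)" and tr: "\<And>n. tree_scale A n (b n) (b (Suc n))" and cu: "\<And>n. cut_scale A P n (b n) (b (Suc n))"
    using limit_group by blast
  interpret coded A by unfold_locales (rule nA)
  obtain \<omega> where \<omega>: "nonprincipal_ultrafilter \<omega>" using ex_ultrafilter by blast
  have WP: "W P x \<le> W A x" for x by (rule wl_mono[OF genset_gens nA AP])
  have "\<exists>X. is_asymptotic_cone_of X Q Qgens \<and> real_tree X"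
  proof -
    have "\<forall>n. \<exists>d \<delta>. b n \<le> d \<and> d \<le> b (Suc n) \<and> n \<le> d \<and> n * \<delta> \<le> d \<and> ball4 A (n * d) (int \<delta>)"
      using tr unfolding tree_scale_def by meson
    then obtain d \<delta> where d: "\<And>n. b n \<le> d n \<and> d n \<le> b (Suc n) \<and> n \<le> d n" "\<And>n. n * \<delta> n \<le> d n" "\<And>n. ball4 A (n * d n) (int (\<delta> n))"
      by metis
    have sc: "scaling_sequence (\<lambda>n. real (d (Suc n)))" by (rule scaling_between[OF less_imp_le[OF b] d(1)])
    interpret c: ucone "wl gens A" \<omega> "\<lambda>n. real (d (Suc n))" "asymptotic_cone \<omega> Q Qgens (\<lambda>n. real (d (Suc n)))"
      "\<lambda>u. cone_rel \<omega> Q Qgens (\<lambda>n. real (d (Suc n))) `` {\<lambda>n. code (u n)}" by (rule cone_Q[OF \<omega> sc])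
    have "real_tree (asymptotic_cone \<omega> Q Qgens (\<lambda>n. real (d (Suc n))))"
    proof (rule c.tree[where \<delta> = "\<lambda>n. real (\<delta> (Suc n))"])
      fix n x y z
      have le: "W A x \<le> Suc n * d (Suc n)" if "real (W A x) \<le> real n * real (d (Suc n))" for x
      proof -
        have "W A x \<le> n * d (Suc n)" using that by (metis of_nat_le_iff of_nat_mult)
        then show ?thesis by simp
      qed
      assume "real (W A x) \<le> real n * real (d (Suc n))" "real (W A y) \<le> real n * real (d (Suc n))" "real (W A z) \<le> real n * real (d (Suc n))"
      then have "min (int (W A x) + int (W A y) - int (W A (inverse x * y))) (int (W A y) + int (W A z) - int (W A (inverse y * z))) - int (\<delta> (Suc n))
        \<le> int (W A x) + int (W A z) - int (W A (inverse x * z))" using d(3)[of "Suc n"] le unfolding ball4_def by blast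
      then show "min (real (W A x) + real (W A y) - real (W A (inverse x * y))) (real (W A y) + real (W A z) - real (W A (inverse y * z))) - real (\<delta> (Suc n))
        \<le> real (W A x) + real (W A z) - real (W A (inverse x * z))" by linarith
    next
      fix n
      have "n * \<delta> (Suc n) \<le> Suc n * \<delta> (Suc n)" by simp
      then have "n * \<delta> (Suc n) \<le> d (Suc n)" using d(2)[of "Suc n"] by (rule order_trans)
      then show "0 \<le> real (\<delta> (Suc n)) \<and> real n * real (\<delta> (Suc n)) \<le> real (d (Suc n))" by (metis of_nat_0_le_iff of_nat_le_iff of_nat_mult)
    qed
    then show ?thesis using \<omega> sc unfolding is_asymptotic_cone_of_def by blast
  qed
  moreover have "\<exists>X. is_asymptotic_cone_of X Q Qgens \<and> (\<nexists>p. cut_point (mtopology_of X) p)"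
  proof -
    have "\<forall>n. \<exists>d z \<tau> c J. b n \<le> d \<and> d \<le> b (Suc n) \<and> n \<le> d \<and> z \<in> P \<and> 0 < \<tau> \<and> 0 \<le> c \<and>
      real n * (\<tau> + c + 1) \<le> real d \<and> real (n * d) \<le> \<tau> * real J \<and> translates A z \<tau> c J"
      using cu unfolding cut_scale_def by meson
    then obtain d z \<tau> c J where d: "\<And>n. b n \<le> d n \<and> d n \<le> b (Suc n) \<and> n \<le> d n" and z: "\<And>n. z n \<in> P"
      and \<tau>: "\<And>n. 0 < \<tau> n" "\<And>n. 0 \<le> c n" and sm: "\<And>n. real n * (\<tau> n + c n + 1) \<le> real (d n)"
      and J: "\<And>n. real (n * d n) \<le> \<tau> n * real (J n)" and ta: "\<And>n. translates A (z n) (\<tau> n) (c n) (J n)"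
      by metis
    have sc: "scaling_sequence (\<lambda>n. real (d (Suc n)))" by (rule scaling_between[OF less_imp_le[OF b] d])
    interpret c: ucone "wl gens A" \<omega> "\<lambda>n. real (d (Suc n))" "asymptotic_cone \<omega> Q Qgens (\<lambda>n. real (d (Suc n)))"
      "\<lambda>u. cone_rel \<omega> Q Qgens (\<lambda>n. real (d (Suc n))) `` {\<lambda>n. code (u n)}" by (rule cone_Q[OF \<omega> sc])
    have "\<not> cut_point (mtopology_of (asymptotic_cone \<omega> Q Qgens (\<lambda>n. real (d (Suc n))))) p" for p
    proof (rule c.no_cut[where \<tau> = "\<lambda>n. \<tau> (Suc n)" and c = "\<lambda>n. c (Suc n)" and J = "\<lambda>n. J (Suc n)" and z = "\<lambda>n. z (Suc n)"])
      fix n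
      have "real n * (\<tau> (Suc n) + c (Suc n) + 1) \<le> real (Suc n) * (\<tau> (Suc n) + c (Suc n) + 1)"
        using \<tau>[of "Suc n"] by (intro mult_right_mono) auto
      then show "real n * (\<tau> (Suc n) + c (Suc n) + 1) \<le> real (d (Suc n))" using sm[of "Suc n"] by linarith
      have "real n * real (d (Suc n)) \<le> real (Suc n * d (Suc n))" by (simp add: algebra_simps)
      then show "real n * real (d (Suc n)) \<le> \<tau> (Suc n) * real (J (Suc n))" using J[of "Suc n"] by linarith
      show "\<exists>t. real (W A t) \<le> real (d (Suc n)) \<and> (\<forall>g i. real (d (Suc n)) \<le> real (W A (inverse t * (inverse g * z (Suc n) powi i * g))))"
      proof -
        \<comment> \<open>Conjugates of powers of \<open>z (Suc n)\<close> are trivial modulo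
          \<open>P\<close>, so a word \<open>t\<close> of length \<open>d (Suc n)\<close> modulo
          \<open>P\<close> keeps that distance from all of them.\<close>
        obtain x where x: "W P x = d (Suc n)" using unb by blast
        obtain t where t: "length (word t) = W P x" "inverse x * t \<in> P" using W_rep[OF nP] .
        have Pt: "W P t = d (Suc n)" using wl_cong[OF nP t(2)] x by simp
        have "W P (inverse t * (inverse g * z (Suc n) powi i * g)) = d (Suc n)" for g i
        proof -
          have "inverse g * z (Suc n) powi i * g \<in> P" using subgr_powi[OF nsub_subgr[OF nP] z] nsubD(5)[OF nP] by blast
          then have "W P (inverse t) = W P (inverse t * (inverse g * z (Suc n) powi i * g))"
            by (intro wl_cong[OF nP]) (simp add: gsimps)
          then show ?thesis using Pt lenspace.len_inv[OF W_lenspace[OF nP]] by simp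
        qed
        then have "d (Suc n) \<le> W A (inverse t * (inverse g * z (Suc n) powi i * g))" for g i using WP by metis
        moreover have "W A t \<le> d (Suc n)" using W_le_length[OF nA, of t] t(1) x by simp
        ultimately show ?thesis by (intro exI[of _ t]) simp
      qed
    next
      fix n g i assume "\<bar>i\<bar> \<le> int (J (Suc n))"
      then show "\<tau> (Suc n) * \<bar>real_of_int i\<bar> - c (Suc n) \<le> real (W A (inverse g * z (Suc n) powi i * g)) \<and>
        real (W A (inverse g * z (Suc n) powi i * g)) \<le> 2 * \<tau> (Suc n) * \<bar>real_of_int i\<bar> + c (Suc n)"
        using ta[of "Suc n"] unfolding translates_def by blast
    qed (rule \<tau>)+
    then show ?thesis using \<omega> sc unfolding is_asymptotic_cone_of_def by blast
  qed
  moreover have "infinite (carrier Q)"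
  proof (rule infinite_Q)
    fix n show "\<exists>x. n \<le> W A x" using unb[of n] WP by metis
  qed
  moreover have "finite Qgens" by (simp add: Qgens_def finite_gens)
  ultimately show ?thesis
    using group_Q generating_Q torsion_Q[OF tor] unfolding lacunary_hyperbolic_def
    by (intro exI[of _ Q] exI[of _ Qgens]) blast
qed

end
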